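(* Let $f\colon[0,1]\to[0,1]$ be a topologically transitive $S$-unimodal map with a flat critical point $c$ satisfying the Misiurewicz condition, such that there is a positive $C^3$ function $v$ on $[0,1]$ with $v(c)\in(0,1)$ and $\ell(x)=|x-c|^{-v(x)}$ for all $x$ near $c$. Then there exist $\phi\in L^\infty$, a H\"older continuous $\psi$ and $C(\phi,\psi)>0$ such that, with correlations taken with respect to $\mu_{\rm ac}$, $\mathrm{Cor}(\phi\circ f^n,\psi)\geq C(\phi,\psi)n^{1-\frac1{v(c)}}$ for every $n\geq1$.
   Context: $X=[0,1]$. A unimodal map is a $C^1$ map $f\colon X\to X$ whose critical set is a single point $c\in(0,1)$ which is an extremum; $S$-unimodal means additionally $C^3$ on $X\setminus\{c\}$ with negative Schwarzian derivative. Misiurewicz condition: $c\notin\omega(c)$, and every periodic point $x$ with $f^n(x)=x$ has $|Df^n(x)|>1$. Flat critical point: there is a $C^3$ function $\ell$ on $X\setminus\{c\}$ with $\ell(x)\to+\infty$, $|D\ell(x)|\to+\infty$ as $x\to c$, and $C^1$ diffeomorphisms $\xi,\eta$ of $\mathbb R$ with $\xi(c)=0=\eta(f(c))$, $|\eta\circ f(x)|=|\xi(x)|^{\ell(x)}$ near $c$. $\mu_{\rm ac}$ is the normalized absolutely continuous invariant probability measure of $f$. $\mathrm{Cor}(\phi\circ f^n,\psi)=\int(\phi\circ f^n)\psi\,d\mu_{\rm ac}-\int\phi\,d\mu_{\rm ac}\int\psi\,d\mu_{\rm ac}$. *)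

theory Defs
  imports "HOL-Probability.Probability"
begin

definition has_deriv_on :: "(real \<Rightarrow> real) \<Rightarrow> (real \<Rightarrow> real) \<Rightarrow> real set \<Rightarrow> bool" where
  "has_deriv_on g g' S \<longleftrightarrow> (\<forall>x\<in>S. (g has_real_derivative g' x) (at x within S))"

definition C1_on :: "real set \<Rightarrow> (real \<Rightarrow> real) \<Rightarrow> bool" where
  "C1_on S g \<longleftrightarrow> (\<exists>g1. has_deriv_on g g1 S \<and> continuous_on S g1)"

definition C3_on :: "real set \<Rightarrow> (real \<Rightarrow> real) \<Rightarrow> bool" where
  "C3_on S g \<longleftrightarrow> (\<exists>g1 g2 g3. has_deriv_on g g1 S \<and> has_deriv_on g1 g2 S \<and>
      has_deriv_on g2 g3 S \<and> continuous_on S g3)"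

definition D01 :: "(real \<Rightarrow> real) \<Rightarrow> real \<Rightarrow> real" where
  "D01 g x = (THE d. (g has_real_derivative d) (at x within {0..1}))"

definition unimodal :: "(real \<Rightarrow> real) \<Rightarrow> real \<Rightarrow> bool" where
  "unimodal f c \<longleftrightarrow> c \<in> {0<..<1} \<and> f ` {0..1} \<subseteq> {0..1} \<and>
     (\<exists>f'. has_deriv_on f f' {0..1} \<and> continuous_on {0..1} f' \<and>
           {x \<in> {0..1}. f' x = 0} = {c}) \<and>
     (\<exists>e>0. (\<forall>x\<in>{0..1}. \<bar>x - c\<bar> < e \<longrightarrow> f x \<le> f c) \<or>
            (\<forall>x\<in>{0..1}. \<bar>x - c\<bar> < e \<longrightarrow> f x \<ge> f c))"

definition S_unimodal :: "(real \<Rightarrow> real) \<Rightarrow> real \<Rightarrow> bool" where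
  "S_unimodal f c \<longleftrightarrow> unimodal f c \<and>
     (\<exists>f1 f2 f3. has_deriv_on f f1 ({0..1} - {c}) \<and> has_deriv_on f1 f2 ({0..1} - {c}) \<and>
        has_deriv_on f2 f3 ({0..1} - {c}) \<and> continuous_on ({0..1} - {c}) f3 \<and>
        (\<forall>x \<in> {0..1} - {c}. f3 x / f1 x - 3 / 2 * (f2 x / f1 x)\<^sup>2 < 0))"

definition omega_limit :: "(real \<Rightarrow> real) \<Rightarrow> real \<Rightarrow> real set" where
  "omega_limit f x = {y. \<forall>e>0. \<forall>N. \<exists>n\<ge>N. dist ((f ^^ n) x) y < e}"

definition misiurewicz :: "(real \<Rightarrow> real) \<Rightarrow> real \<Rightarrow> bool" where
  "misiurewicz f c \<longleftrightarrow> c \<notin> omega_limit f c \<and>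
     (\<forall>x\<in>{0..1}. \<forall>n\<ge>1. (f ^^ n) x = x \<longrightarrow> \<bar>D01 (f ^^ n) x\<bar> > 1)"

definition C1_diffeo :: "(real \<Rightarrow> real) \<Rightarrow> bool" where
  "C1_diffeo g \<longleftrightarrow> bij g \<and> C1_on UNIV g \<and> C1_on UNIV (inv g)"

definition flat_critical :: "(real \<Rightarrow> real) \<Rightarrow> real \<Rightarrow> (real \<Rightarrow> real) \<Rightarrow> bool" where
  "flat_critical f c l \<longleftrightarrow> C3_on ({0..1} - {c}) l \<and>
     filterlim l at_top (at c within {0..1}) \<and>
     (\<exists>l1. has_deriv_on l l1 ({0..1} - {c}) \<and>
           filterlim (\<lambda>x. \<bar>l1 x\<bar>) at_top (at c within {0..1})) \<and>
     (\<exists>\<xi> \<eta>. C1_diffeo \<xi> \<and> C1_diffeo \<eta> \<and> \<xi> c = 0 \<and> \<eta> (f c) = 0 \<and>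
        (\<forall>\<^sub>F x in at c within {0..1}. \<bar>\<eta> (f x)\<bar> = \<bar>\<xi> x\<bar> powr l x))"

definition top_transitive :: "(real \<Rightarrow> real) \<Rightarrow> bool" where
  "top_transitive f \<longleftrightarrow> (\<forall>U V. openin (top_of_set {0..1}) U \<and> U \<noteq> {} \<and>
      openin (top_of_set {0..1}) V \<and> V \<noteq> {} \<longrightarrow> (\<exists>n\<ge>1. (f ^^ n) ` U \<inter> V \<noteq> {}))"

definition is_acip :: "(real \<Rightarrow> real) \<Rightarrow> real measure \<Rightarrow> bool" where
  "is_acip f \<mu> \<longleftrightarrow> prob_space \<mu> \<and> sets \<mu> = sets (restrict_space borel {0..1}) \<and>
     space \<mu> = {0..1} \<and> absolutely_continuous (restrict_space lborel {0..1}) \<mu> \<and>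
     f \<in> measurable \<mu> \<mu> \<and> distr \<mu> \<mu> f = \<mu>"

definition holder_on :: "real set \<Rightarrow> (real \<Rightarrow> real) \<Rightarrow> bool" where
  "holder_on S g \<longleftrightarrow> (\<exists>\<alpha> K. 0 < \<alpha> \<and> \<alpha> \<le> 1 \<and>
      (\<forall>x\<in>S. \<forall>y\<in>S. \<bar>g x - g y\<bar> \<le> K * \<bar>x - y\<bar> powr \<alpha>))"

definition Linfty_01 :: "(real \<Rightarrow> real) \<Rightarrow> bool" where
  "Linfty_01 g \<longleftrightarrow> g \<in> borel_measurable borel \<and>
      (\<exists>B. AE x in lborel. x \<in> {0..1} \<longrightarrow> \<bar>g x\<bar> \<le> B)"

definition Cor :: "real measure \<Rightarrow> (real \<Rightarrow> real) \<Rightarrow> (real \<Rightarrow> real) \<Rightarrow> (real \<Rightarrow> real) \<Rightarrow> nat \<Rightarrow> real" where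
  "Cor \<mu> f \<phi> \<psi> n = (\<integral>x. \<phi> ((f ^^ n) x) * \<psi> x \<partial>\<mu>) - (\<integral>x. \<phi> x \<partial>\<mu>) * (\<integral>x. \<psi> x \<partial>\<mu>)"

end

theory Submission
 imports Defs "HOL-Real_Asymp.Real_Asymp"
begin

text \<open>The Misiurewicz condition provides an interval \<open>J\<close> around \<open>c\<close> such that the orbits of \<open>c\<close> and of the end
 points of \<open>J\<close> never enter a larger interval \<open>J'\<close>. With negative Schwarzian derivative this gives bounded
 distortion for all inverse branches over \<open>J\<close>, and the set of points that avoid \<open>J\<close> up to time \<open>k\<close> is
 exponentially small. Flatness, in the form of two-sided bounds \<open>exp (- C |x-c|\<^sup>-\<^sup>v log (1/|x-c|))\<close> for
 \<open>|f x - f c|\<close>, then makes the tail of the return time to \<open>J\<close> comparable to \<open>(log k / k)\<^sup>1\<^sup>/\<^sup>v\<close>.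

 The transfer operators \<open>G\<^sub>n\<close> between visits to \<open>J\<close> satisfy a renewal equation. Splitting off multiples of the
 invariant density \<open>\<rho>\<close> yields \<open>G\<^sub>n b \<le> m(b) (\<rho> + K t\<^sub>n)\<close>, where \<open>t\<^sub>n\<close> is the summed tail.

 Take for \<open>\<phi>\<close> the indicator of the points that do not visit \<open>J\<close> at the times \<open>1, \<dots>, M\<close> and for \<open>\<psi>\<close> minus
 a bump on \<open>J\<close>. Decomposing according to the last visit to \<open>J\<close>, the term with \<open>\<rho>\<close> in the renewal bound
 contributes the tail of Kac's formula beyond time \<open>n\<close>, which is at least of order \<open>n\<^sup>1\<^sup>-\<^sup>1\<^sup>/\<^sup>v\<close>, and
 the term with \<open>K t\<^sub>n\<close> is a small fraction of it once \<open>M\<close> and \<open>n\<close> are large. Small \<open>n\<close> are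
 handled by replacing \<open>\<phi>\<close> with \<open>\<phi> \<circ> f\<^sup>k\<close>.\<close>

subsection \<open>Tails with logarithms\<close>

text \<open>The Hoelder observable is minus a nonnegative bump, so the correlation is a constant
  minus a sum of terms linear in \<open>G\<close>, and a one-sided bound on \<open>G\<close>
  suffices. That bound is proved by induction on time: each round couples a fixed fraction of the
  mass with the stationary process, and the fraction gained pays for errors of order
  \<open>t\<close>, provided the leftover density stays in the class on which the induction runs. So
  the class must tolerate subtracting a small multiple of the invariant density. Log-Lipschitz
  functions do, and they need Koebe space around \<open>J\<close>. A transitive map may still
  permute intervals cyclically, so return times can have a common divisor \<open>dd\<close>; the
  renewal argument runs in the time unit \<open>dd\<close>, while the estimate is claimed for every
  n. The tail (log k / k)^(1/v) comes from solving d^(-v) log (1/d) ~ k for d. Its logarithm is kept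
  as long as main term and error are compared, since both carry it, and is dropped only at the very
  end, in the favourable direction.\<close>

definition Qf :: "real => real => real" where "Qf s x = (ln x / x) powr s"
text \<open>With \<open>s = 1/v\<close>, \<open>Qf\<close> is the order of the return time tail and
  \<open>tf\<close>, up to constants, the sum of \<open>Qf\<close> over all later times.\<close>

definition tf :: "real => real => real" where "tf s x = x * Qf s x"
text \<open>Beyond this threshold \<open>s / ln x\<close> is at most \<open>(s - 1) / 2\<close>, so
  the slope of \<open>tf\<close> lies between \<open>-(s - 1) * Qf\<close> and half of it. The
  summand 2 also gives \<open>ln x > 1\<close>.\<close>

definition Bs :: "real => real" where "Bs s = exp (2 * s / (s - 1) + 2)"

lemma Bs_props:
 assumes s: "s > 1" and x: "x >= Bs s"
 shows "x > 1" "ln x >= 2 * s / (s - 1) + 2" "ln x > 1" "s / ln x <= (s - 1) / 2"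
proof -
 have e: "2 * s / (s - 1) + 2 > 2" using s by simp
 have B: "Bs s > 1" unfolding Bs_def using e by simp
 thus "x > 1" using x by simp
 hence "ln x >= ln (Bs s)" using x B by simp
 thus l: "ln x >= 2 * s / (s - 1) + 2" by (simp add: Bs_def)
 thus "ln x > 1" using e by simp
 have "2 * s / (s - 1) <= ln x" using l by simp
 hence "2 * s <= ln x * (s - 1)" using s by (simp add: field_simps)
 thus "s / ln x <= (s - 1) / 2" using \<open>ln x > 1\<close> by (simp add: field_simps)
qed

lemma Qf_pos: "x > 1 ==> Qf s x > 0" by (simp add: Qf_def)

lemma tf_pos: "x > 1 ==> tf s x > 0" by (simp add: tf_def Qf_pos)

lemma tf_deriv:
 assumes "x > 1"
 shows "(tf s has_real_derivative Qf s x * (1 - s + s / ln x)) (at x)"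
proof -
 have l: "ln x > 0" "ln x / x > 0" using assms by auto
 have "((\<lambda>x. ln x / x) has_real_derivative (1 - ln x) / x\<^sup>2) (at x)"
  using assms by (auto intro!: derivative_eq_intros simp: field_simps power2_eq_square)
 hence "((\<lambda>x. (ln x / x) powr s) has_real_derivative s * (ln x / x) powr (s - 1) * ((1 - ln x) / x\<^sup>2)) (at x)"
  using DERIV_fun_powr[of "\<lambda>x. ln x / x" "(1 - ln x) / x\<^sup>2" x s] l(2) by simp
 hence "((\<lambda>x. x * (ln x / x) powr s) has_real_derivative 1 * (ln x / x) powr s + s * (ln x / x) powr (s - 1) * ((1 - ln x) / x\<^sup>2) * x) (at x)"
  by (rule DERIV_mult[OF DERIV_ident])
 moreover have "(ln x / x) powr (s - 1) = (ln x / x) powr s * (x / ln x)"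
  using assms by (simp add: powr_diff)
 ultimately show ?thesis unfolding tf_def[abs_def] Qf_def
  by (elim DERIV_cong) (use l assms in \<open>simp add: field_simps power2_eq_square\<close>)
qed

lemma Qf_dec:
 assumes s: "s > 1" and xy: "Bs s <= x" "x <= y"
 shows "Qf s y <= Qf s x"
proof -
 have "ln y / y <= ln x / x"
 proof (rule DERIV_nonpos_imp_nonincreasing[OF xy(2)])
  fix z assume z: "x <= z" "z <= y"
  have zb: "z > 1" "ln z > 1" using Bs_props[OF s, of z] z xy by auto
  have "((\<lambda>x. ln x / x) has_real_derivative (1 - ln z) / z\<^sup>2) (at z)"
   using zb by (auto intro!: derivative_eq_intros simp: field_simps power2_eq_square)
  moreover have "(1 - ln z) / z\<^sup>2 <= 0" using zb by (simp add: divide_le_0_iff)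
  ultimately show "\<exists>u. ((\<lambda>x. ln x / x) has_real_derivative u) (at z) \<and> u <= 0" by blast
 qed
 moreover have "0 <= ln y / y" using Bs_props[OF s, of y] xy by simp
 ultimately show ?thesis unfolding Qf_def using s by (intro powr_mono2) auto
qed

lemma tf_step:
 assumes s: "s > 1" and x: "Bs s <= x"
 shows "(s - 1) / 2 * Qf s (x + 1) <= tf s x - tf s (x + 1)" "tf s x - tf s (x + 1) <= (s - 1) * Qf s x"
proof -
 have "\<exists>z. x < z \<and> z < x + 1 \<and> tf s (x + 1) - tf s x = (x + 1 - x) * (Qf s z * (1 - s + s / ln z))"
  by (rule MVT2) (use tf_deriv Bs_props(1)[OF s] x in auto)
 then obtain z where z: "x < z" "z < x + 1" "tf s x - tf s (x + 1) = Qf s z * (s - 1 - s / ln z)" by (auto simp: algebra_simps)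
 have zb: "z > 1" "ln z > 1" "s / ln z <= (s - 1) / 2" using Bs_props[OF s, of z] z x by auto
 have q: "Qf s z > 0" using Qf_pos[OF zb(1)] .
 have "(s - 1) / 2 * Qf s (x + 1) <= (s - 1) / 2 * Qf s z" using Qf_dec[OF s, of z "x + 1"] z x s by (intro mult_left_mono) auto
 also have "... <= Qf s z * (s - 1 - s / ln z)" using zb q by (subst mult.commute, intro mult_left_mono) auto
 finally show "(s - 1) / 2 * Qf s (x + 1) <= tf s x - tf s (x + 1)" using z by simp
 have "Qf s z * (s - 1 - s / ln z) <= Qf s z * (s - 1)" using q zb s by (intro mult_left_mono) auto
 also have "... <= (s - 1) * Qf s x" using Qf_dec[OF s, of x z] z x s by (simp add: mult.commute)
 finally show "tf s x - tf s (x + 1) <= (s - 1) * Qf s x" using z by simp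
qed

lemma tf_dec:
 assumes s: "s > 1" and xy: "Bs s <= x" "x <= y"
 shows "tf s y <= tf s x"
proof (rule DERIV_nonpos_imp_nonincreasing[OF xy(2)])
 fix z assume z: "x <= z" "z <= y"
 have zb: "z > 1" "ln z > 1" "s / ln z <= (s - 1) / 2" using Bs_props[OF s, of z] z xy by auto
 have "1 - s + w <= 0" if "w <= (s - 1) / 2" for w using that s by (simp add: field_simps)
 from this[OF zb(3)] have "1 - s + s / ln z <= 0" .
 hence "Qf s z * (1 - s + s / ln z) <= 0" using Qf_pos[OF zb(1), of s] by (intro mult_nonneg_nonpos) auto
 thus "\<exists>u. (tf s has_real_derivative u) (at z) \<and> u <= 0" using tf_deriv[OF zb(1), of s] by blast
qed

text \<open>For \<open>y < x\<close> the logarithms compare in the favourable direction, so only the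
  power \<open>(x / y) powr (s - 1)\<close> is lost. The constant tends to 1 as \<open>d\<close>
  does, which is what \<open>tf_slow\<close> exploits.\<close>

lemma tf_ratio:
 assumes s: "s > 1" and xy: "Bs s <= y" "Bs s <= x" and d: "0 < d" "d <= 1" "d * x <= y"
 shows "tf s y <= d powr (1 - s) * tf s x"
proof (cases "x <= y")
 case True
 have "1 * tf s x <= d powr (1 - s) * tf s x"
 proof (rule mult_right_mono)
  have "1 powr (1 - s) <= d powr (1 - s)" using d s by (intro powr_mono2') auto
  thus "1 <= d powr (1 - s)" by simp
 qed (use tf_pos[of x s] Bs_props(1)[OF s xy(2)] in simp)
 thus ?thesis using tf_dec[OF s xy(2) True] by simp
next
 case False
 have b: "x > 1" "y > 1" "ln x > 1" "ln y > 1" using Bs_props[OF s] xy by auto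
 have "ln y / y <= ln x / y" using False b by (intro divide_right_mono) auto
 hence "(ln y / y) powr s <= (ln x / y) powr s" using b s by (intro powr_mono2) auto
 also have "... = (ln x / x * (x / y)) powr s" by simp
 also have "... = (ln x / x) powr s * (x / y) powr s" using b by (subst powr_mult) auto
 finally have "tf s y <= y * ((ln x / x) powr s * (x / y) powr s)" unfolding tf_def Qf_def using b by (intro mult_left_mono) auto
 also have "... = (x / y) powr (s - 1) * tf s x" using b by (simp add: tf_def Qf_def powr_diff)
 also have "... <= (1 / d) powr (s - 1) * tf s x"
 proof (rule mult_right_mono)
  have "x / y <= 1 / d" using d b by (simp add: field_simps)
  thus "(x / y) powr (s - 1) <= (1 / d) powr (s - 1)" using b s by (intro powr_mono2) auto
 qed (use tf_pos[of x s] b in simp)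
 also have "(1 / d) powr (s - 1) = d powr (1 - s)" by (simp add: powr_divide powr_minus_divide[symmetric])
 finally show ?thesis .
qed

lemma tf_lim:
 assumes s: "s > 1" shows "(tf s \<longlongrightarrow> 0) at_top"
proof -
 \<comment> \<open>Bounding \<open>ln x\<close> by \<open>x powr a / a\<close> leaves the exponent
   \<open>1 + (a - 1) * s\<close>, which this choice makes equal to
   \<open>-(s - 1) / 2\<close>.\<close>
 define a where "a = (s - 1) / (2 * s)"
 have a: "a > 0" using s by (simp add: a_def)
 have up: "tf s x <= (1 / a) powr s * x powr (- (s - 1) / 2)" if x: "x > 1" for x
 proof -
  have "ln x <= x powr a / a" by (rule ln_powr_bound) (use x a in auto)
  hence "ln x / x <= x powr a / a / x" using x by (intro divide_right_mono) auto
  hence "Qf s x <= (x powr a / a / x) powr s" unfolding Qf_def using x s by (intro powr_mono2) auto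
  also have "x powr a / a / x = (1 / a) * x powr (a - 1)" using x by (simp add: powr_diff)
  also have "((1 / a) * x powr (a - 1)) powr s = (1 / a) powr s * x powr ((a - 1) * s)"
   using powr_mult[of "1 / a" "x powr (a - 1)" s] by (simp add: powr_powr)
  finally have "tf s x <= x * ((1 / a) powr s * x powr ((a - 1) * s))" unfolding tf_def using x by (intro mult_left_mono) auto
  also have "... = (1 / a) powr s * (x powr 1 * x powr ((a - 1) * s))" using x by simp
  also have "... = (1 / a) powr s * x powr (1 + (a - 1) * s)" by (simp only: powr_add)
  also have "1 + (a - 1) * s = - (s - 1) / 2" using s by (simp add: a_def field_simps)
  finally show ?thesis .
 qed
 have "((\<lambda>x. (1 / a) powr s * x powr (- (s - 1) / 2)) \<longlongrightarrow> (1 / a) powr s * 0) at_top"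
  using s by (intro tendsto_intros tendsto_neg_powr filterlim_ident) auto
 hence lim: "((\<lambda>x. (1 / a) powr s * x powr (- (s - 1) / 2)) \<longlongrightarrow> 0) at_top" by simp
 show ?thesis
 proof (rule tendsto_sandwich[OF _ _ tendsto_const lim])
  show "\<forall>\<^sub>F x in at_top. 0 <= tf s x" using eventually_gt_at_top[of 1] by eventually_elim (simp add: tf_pos less_imp_le)
  show "\<forall>\<^sub>F x in at_top. tf s x <= (1 / a) powr s * x powr (- (s - 1) / 2)" using eventually_gt_at_top[of 1] by (rule eventually_mono) (rule up)
 qed
qed

text \<open>The lower bound in \<open>tf_step\<close> telescopes but is shifted by one, so the first
  term is estimated separately, by \<open>Qf s x <= tf s x\<close>.\<close>

lemma Qf_sum_upper:
 assumes s: "s > 1" and x: "Bs s <= x"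
 shows "(\<Sum>k<n. Qf s (x + real k)) <= (1 + 2 / (s - 1)) * tf s x"
proof -
 have A: "(\<Sum>k<n. Qf s (x + real k + 1)) <= 2 / (s - 1) * (tf s x - tf s (x + real n))" for n
 proof (induct n)
  case (Suc n)
  have "Qf s (x + real n + 1) <= 2 / (s - 1) * (tf s (x + real n) - tf s (x + real n + 1))"
   using tf_step(1)[OF s, of "x + real n"] x s by (simp add: field_simps)
  moreover have "2 / (s - 1) * (tf s x - tf s (x + real (Suc n))) = 2 / (s - 1) * (tf s x - tf s (x + real n)) + 2 / (s - 1) * (tf s (x + real n) - tf s (x + real n + 1))"
   unfolding distrib_left[symmetric] by (simp add: add_ac)
  ultimately show ?case using Suc by simp
 qed simp
 have p: "tf s (x + real n) >= 0" "tf s x >= 0" for n using tf_pos[of "x + real n" s] tf_pos[of x s] Bs_props(1)[OF s x] by (auto simp: less_imp_le)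
 show ?thesis
 proof (cases n)
  case 0 thus ?thesis using p(2) s by simp
 next
  case (Suc m)
  have "(\<Sum>k<n. Qf s (x + real k)) = Qf s x + (\<Sum>k<m. Qf s (x + real k + 1))" unfolding Suc by (subst sum.lessThan_Suc_shift) (simp add: add_ac)
  also have "... <= tf s x + 2 / (s - 1) * tf s x"
  proof (rule add_mono)
   have "1 * Qf s x <= x * Qf s x" using Bs_props(1)[OF s x] Qf_pos[of x s] by (intro mult_right_mono) auto
   thus "Qf s x <= tf s x" by (simp add: tf_def)
   have "2 / (s - 1) * (tf s x - tf s (x + real m)) <= 2 / (s - 1) * tf s x" using p(1)[of m] s by (intro mult_left_mono) auto
   thus "(\<Sum>k<m. Qf s (x + real k + 1)) <= 2 / (s - 1) * tf s x" using A[of m] by linarith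
  qed
  finally show ?thesis by (simp add: algebra_simps)
 qed
qed

lemma Qf_sum_lower:
 assumes s: "s > 1" and x: "Bs s <= x"
 shows "(tf s x - tf s (x + real n)) / (s - 1) <= (\<Sum>k<n. Qf s (x + real k))"
proof (induct n)
 case (Suc n)
 have "tf s (x + real n) - tf s (x + real n + 1) <= (s - 1) * Qf s (x + real n)" using tf_step(2)[OF s, of "x + real n"] x by simp
 hence "(tf s (x + real n) - tf s (x + real n + 1)) / (s - 1) <= Qf s (x + real n)" using s by (simp add: field_simps)
 moreover have "(tf s x - tf s (x + real (Suc n))) / (s - 1) = (tf s x - tf s (x + real n)) / (s - 1) + (tf s (x + real n) - tf s (x + real n + 1)) / (s - 1)"
  by (simp add: add_divide_distrib[symmetric] add_ac)
 ultimately show ?case using Suc by simp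
qed simp

text \<open>The factor 3 fits the renewal induction, where a burn-in and two windows of length about
  \<open>\<epsilon> * n\<close> are cut off.\<close>

lemma tf_slow:
 assumes s: "s > 1" and eta: "\<eta> > 0" and B: "B >= Bs s"
 shows "\<exists>\<epsilon>>0. \<epsilon> < 1/4 \<and> (\<forall>n k. real k <= 3 * \<epsilon> * real n --> tf s (B + real (n - k)) <= (1 + \<eta>) * tf s (B + real n))"
proof -
 \<comment> \<open>The second entry solves \<open>d powr (1 - s) = 1 + \<eta>\<close>; the first
   keeps \<open>\<epsilon>\<close> below 1/4.\<close>
 define d where "d = max (1/2) ((1 + \<eta>) powr (- (1 / (s - 1))))"
 have "(1 + \<eta>) powr (- (1 / (s - 1))) < 1 powr (- (1 / (s - 1)))" using s eta by (intro powr_less_mono2_neg) auto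
 hence d: "1/2 <= d" "d < 1" by (auto simp: d_def)
 have dp: "d powr (1 - s) <= 1 + \<eta>"
 proof -
  have "d powr (1 - s) <= ((1 + \<eta>) powr (- (1 / (s - 1)))) powr (1 - s)" using s eta d by (intro powr_mono2') (auto simp: d_def)
  also have "... = (1 + \<eta>) powr (- (1 / (s - 1)) * (1 - s))" by (rule powr_powr)
  also have "- (1 / (s - 1)) * (1 - s) = 1" using s by (simp add: field_simps)
  finally show ?thesis using eta by simp
 qed
 define \<epsilon> where "\<epsilon> = (1 - d) / 3"
 have e: "\<epsilon> > 0" "\<epsilon> < 1/4" "3 * \<epsilon> = 1 - d" using d by (auto simp: \<epsilon>_def)
 have "tf s (B + real (n - k)) <= (1 + \<eta>) * tf s (B + real n)" if k: "real k <= 3 * \<epsilon> * real n" for n k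
 proof -
  have Bp: "B > 1" using Bs_props(1)[OF s B] .
  have "real k <= real n"
  proof -
   have "3 * \<epsilon> * real n <= 1 * real n" using e d by (intro mult_right_mono) auto
   thus ?thesis using k by simp
  qed
  hence r: "real (n - k) = real n - real k" by simp
  have "d * B <= B" using d Bp by simp
  hence "d * (B + real n) <= B + real (n - k)" using k unfolding r e(3) by (simp add: algebra_simps)
  hence "tf s (B + real (n - k)) <= d powr (1 - s) * tf s (B + real n)" using B d by (intro tf_ratio[OF s]) auto
  also have "... <= (1 + \<eta>) * tf s (B + real n)" using dp tf_pos[of "B + real n" s] Bp by (intro mult_right_mono) auto
  finally show ?thesis .
 qed
 thus ?thesis using e by blast
qed

text \<open>The \<open>k + 1\<close> allows \<open>k\<close> to be the floor of
  \<open>\<epsilon> * n\<close>; halving in the definition of \<open>d\<close> absorbs this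
  rounding.\<close>

lemma tf_doub:
 assumes s: "s > 1" and eps: "\<epsilon> > 0" and B: "B >= Bs s"
 shows "\<exists>C>0. \<forall>n k. \<epsilon> * real n <= real k + 1 --> Qf s (B + real k) * real n <= C * tf s (B + real n) \<and> tf s (B + real k) <= C * tf s (B + real n)"
proof -
 define d where "d = min 1 \<epsilon> / 2"
 have d: "0 < d" "d <= 1" "d <= \<epsilon> / 2" "d <= 1/2" using eps by (auto simp: d_def)
 have Bp: "B > 1" using Bs_props(1)[OF s B] .
 define C where "C = (1 / d) * d powr (1 - s)"
 have dp: "d powr (1 - s) > 0" using d by simp
 have "Qf s (B + real k) * real n <= C * tf s (B + real n) \<and> tf s (B + real k) <= C * tf s (B + real n)" if k: "\<epsilon> * real n <= real k + 1" for n k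
 proof -
  have 1: "d * real n <= \<epsilon> / 2 * real n" by (rule mult_right_mono[OF d(3)]) simp
  have 2: "d * B <= 1/2 * B" by (rule mult_right_mono[OF d(4)]) (use Bp in simp)
  have dx: "d * (B + real n) <= B + real k" unfolding distrib_left using 1 2 k Bp by linarith
  have R: "tf s (B + real k) <= d powr (1 - s) * tf s (B + real n)" using B d dx by (intro tf_ratio[OF s]) auto
  have tp: "tf s (B + real n) > 0" using tf_pos[of "B + real n" s] Bp by simp
  have "1 * (d powr (1 - s)) <= C" unfolding C_def using d dp by (intro mult_right_mono) auto
  hence 2: "tf s (B + real k) <= C * tf s (B + real n)"
   by (intro order_trans[OF R] mult_right_mono) (use tp in auto)
  have "real n <= (B + real k) / d" using dx d Bp by (simp add: field_simps) (smt (verit) mult_nonneg_nonneg)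
  hence "Qf s (B + real k) * real n <= Qf s (B + real k) * ((B + real k) / d)" using Qf_pos[of "B + real k" s] Bp by (intro mult_left_mono) auto
  also have "... = (1 / d) * tf s (B + real k)" by (simp add: tf_def)
  also have "... <= (1 / d) * (d powr (1 - s) * tf s (B + real n))" using R d by (intro mult_left_mono) auto
  finally show ?thesis using 2 by (simp add: C_def)
 qed
 moreover have "C > 0" using d by (simp add: C_def)
 ultimately show ?thesis by blast
qed

subsection \<open>Operator renewal\<close>

text \<open>An operator renewal equation \<open>G\<^sub>n = \<Sum>\<^sub>r L\<^sub>r G\<^sub>n\<^sub>-\<^sub>r\<close> on densities. The functional \<open>m\<close> is the mass,
 \<open>S\<close> a class of regular densities, \<open>\<rho>\<close> the invariant density, \<open>\<kappa> r\<close> the weight of the return time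
 \<open>r\<close>, with tail \<open>T\<close>, and \<open>t\<close> is comparable to the summed tail of \<open>T\<close>.\<close>

locale operator_renewal =
 fixes J :: "'a set" and L G :: "nat => ('a => real) => 'a => real" and S :: "('a => real) set"
  and m :: "('a => real) => real" and \<rho> :: "'a => real" and \<kappa> T t :: "nat => real" and A :: real and N0 :: nat
 assumes A1: "A >= 1"
  and L_diff: "\<And>r u v k y. y \<in> J ==> L r (\<lambda>y. u y - k * v y) y = L r u y - k * L r v y"
  and L_sum: "\<And>r (I :: nat set) u y. finite I ==> y \<in> J ==> L r (\<lambda>y. \<Sum>i\<in>I. u i y) y = (\<Sum>i\<in>I. L r (u i) y)"
  and L_mono: "\<And>r u v y. (\<And>y. y \<in> J ==> u y <= v y) ==> y \<in> J ==> L r u y <= L r v y"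
  and G_0: "\<And>u y. y \<in> J ==> G 0 u y = u y"
  and G_ren: "\<And>n u y. 1 <= n ==> y \<in> J ==> G n u y = (\<Sum>r\<in>{1..n}. L r (G (n - r) u) y)"
  and G_semi: "\<And>b s j y. b \<in> S ==> y \<in> J ==> G s (G j b) y <= G (j + s) b y"
  and S_nonneg: "\<And>b y. b \<in> S ==> y \<in> J ==> 0 <= b y"
  and S_L: "\<And>b r. b \<in> S ==> 1 <= r ==> L r b \<in> S"
  and S_G: "\<And>b n. b \<in> S ==> G n b \<in> S"
  and S_sub: "\<And>b n k. b \<in> S ==> N0 <= n ==> 0 <= k ==> (\<And>y. y \<in> J ==> 2 * k * \<rho> y <= G n b y) ==> (\<lambda>y. G n b y - k * \<rho> y) \<in> S"
  and m_nonneg: "\<And>b. b \<in> S ==> 0 <= m b"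
  and m_cong: "\<And>u v. (\<And>y. y \<in> J ==> u y = v y) ==> m u = m v"
  and m_diff: "\<And>u v k. u \<in> S ==> v \<in> S ==> m (\<lambda>y. u y - k * v y) = m u - k * m v"
  and m_sum: "\<And>(I :: nat set) u. finite I ==> (\<And>i. i \<in> I ==> u i \<in> S) ==> m (\<lambda>y. \<Sum>i\<in>I. u i y) = (\<Sum>i\<in>I. m (u i))"
  and m_L: "\<And>b. b \<in> S ==> (\<lambda>r. m (L (Suc r) b)) sums m b"
  and kap_nonneg: "\<And>r. 0 <= \<kappa> r"
  and m_kap: "\<And>b r. b \<in> S ==> 1 <= r ==> m (L r b) <= A * \<kappa> r * m b"
  and S_up: "\<And>b y. b \<in> S ==> y \<in> J ==> b y <= A * m b"
  and aper: "\<exists>s0. \<forall>s\<ge>s0. \<exists>c>0. \<forall>b\<in>S. \<forall>y\<in>J. c * m b <= G s b y"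
  and rho_S: "\<rho> \<in> S"
  and rho_sub: "\<And>n y. y \<in> J ==> (\<Sum>r\<in>{1..n}. L r \<rho> y) <= \<rho> y"
  and T_tail: "\<And>k n. (\<Sum>r\<in>{k<..n}. \<kappa> r) <= T k"
  and T_dec: "\<And>k l. k <= l ==> T l <= T k"
  and T_summable: "summable T"
  and tau_tail: "\<And>N. 1 - (\<Sum>k<N. m \<rho> - (\<Sum>r\<in>{1..k}. m (L r \<rho>))) <= A * t N"
  and tau_le: "\<And>N. (\<Sum>k<N. m \<rho> - (\<Sum>r\<in>{1..k}. m (L r \<rho>))) <= 1"
  and t_pos: "\<And>n. 0 < t n"
  and t_dec: "\<And>k l. k <= l ==> t l <= t k"
  and t_lim: "t \<longlonglongrightarrow> 0"
  and t_slow: "\<And>\<eta>. \<eta> > 0 ==> \<exists>\<epsilon>>0. \<epsilon> < 1/4 \<and> (\<forall>\<^sub>F n in sequentially. \<forall>k. real k <= 3 * \<epsilon> * real n --> t (n - k) <= (1 + \<eta>) * t n)"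
  and t_doub: "\<And>\<epsilon>. \<epsilon> > 0 ==> \<exists>C>0. \<forall>\<^sub>F n in sequentially. \<forall>k. \<epsilon> * real n <= real k + 1 --> T k * real n <= C * t n \<and> t k <= C * t n"
begin

text \<open>The mass of \<open>b\<close> whose first return takes longer than
  \<open>k\<close>.\<close>

definition tl :: "nat => ('a => real) => real" where "tl k b = m b - (\<Sum>r\<in>{1..k}. m (L r b))"

lemma sum_shift: "(\<Sum>r\<in>{1..k::nat}. g r) = (\<Sum>r<k. g (Suc r))" for g :: "nat => real"
proof -
 have "{1..k} = Suc ` {..<k}" by (auto simp: image_iff) (metis Suc_le_D le_less_Suc_eq not_less_eq Suc_le_lessD lessThan_iff less_eq_Suc_le)
 thus ?thesis by (simp add: sum.reindex)
qed

lemma sum_split: "k <= n ==> (\<Sum>r\<in>{1..n::nat}. g r) = (\<Sum>r\<in>{1..k}. g r) + (\<Sum>r\<in>{k<..n}. g r)" for g :: "nat => real"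
 by (subst sum.union_disjoint[symmetric]) (auto intro!: sum.cong)

lemma sum_triangle: "(\<Sum>q\<in>{n1<..<n::nat}. \<Sum>i\<in>{n1<..q}. h q i) = (\<Sum>i\<in>{n1<..<n}. \<Sum>q\<in>{i..<n}. h q i)" for h :: "nat => nat => real"
proof -
 have "(\<Sum>q\<in>{n1<..<n}. \<Sum>i\<in>{n1<..q}. h q i) = (\<Sum>(q, i)\<in>Sigma {n1<..<n} (\<lambda>q. {n1<..q}). h q i)" by (rule sum.Sigma) auto
 also have "... = (\<Sum>(i, q)\<in>Sigma {n1<..<n} (\<lambda>i. {i..<n}). h q i)"
  by (rule sum.reindex_bij_witness[of _ "\<lambda>(i, q). (q, i)" "\<lambda>(q, i). (i, q)"]) auto
 also have "... = (\<Sum>i\<in>{n1<..<n}. \<Sum>q\<in>{i..<n}. h q i)" by (rule sum.Sigma[symmetric]) auto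
 finally show ?thesis .
qed

lemma mL_nonneg: "b \<in> S ==> 1 <= r ==> 0 <= m (L r b)" using m_nonneg S_L by blast

lemma tl_bound:
 assumes b: "b \<in> S" and k: "k <= n"
 shows "(\<Sum>r\<in>{k<..n}. m (L r b)) <= tl k b"
proof -
 have "(\<Sum>r\<in>{1..n}. m (L r b)) <= m b"
  unfolding sum_shift using m_L[OF b] mL_nonneg[OF b] by (metis sum_le_suminf sums_iff finite_lessThan le_add1 plus_1_eq_Suc)
 moreover have "(\<Sum>r\<in>{1..n}. m (L r b)) = (\<Sum>r\<in>{1..k}. m (L r b)) + (\<Sum>r\<in>{k<..n}. m (L r b))" by (rule sum_split[OF k])
 ultimately show ?thesis by (simp add: tl_def)
qed

lemma tl_nonneg: "b \<in> S ==> 0 <= tl k b" using tl_bound[of b k k] by simp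

lemma tl_T:
 assumes b: "b \<in> S" shows "tl k b <= A * T k * m b"
proof -
 have "(\<lambda>n. \<Sum>r\<in>{1..n}. m (L r b)) \<longlonglongrightarrow> m b" unfolding sum_shift using m_L[OF b] by (simp add: sums_def)
 hence lim: "(\<lambda>n. (\<Sum>r\<in>{1..n}. m (L r b)) - (\<Sum>r\<in>{1..k}. m (L r b))) \<longlonglongrightarrow> tl k b"
  unfolding tl_def by (intro tendsto_diff) auto
 have ev: "(\<Sum>r\<in>{1..n}. m (L r b)) - (\<Sum>r\<in>{1..k}. m (L r b)) <= A * T k * m b" if n: "n >= k" for n
 proof -
  have "(\<Sum>r\<in>{1..n}. m (L r b)) - (\<Sum>r\<in>{1..k}. m (L r b)) = (\<Sum>r\<in>{k<..n}. m (L r b))" using sum_split[OF n, of "\<lambda>r. m (L r b)"] by simp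
  also have "... <= (\<Sum>r\<in>{k<..n}. A * \<kappa> r * m b)" using m_kap[OF b] by (intro sum_mono) auto
  also have "... = A * (\<Sum>r\<in>{k<..n}. \<kappa> r) * m b" by (simp add: sum_distrib_left sum_distrib_right)
  also have "... <= A * T k * m b" using T_tail[of k n] A1 m_nonneg[OF b] by (intro mult_right_mono mult_left_mono) auto
  finally show ?thesis .
 qed
 show ?thesis by (rule tendsto_upperbound[OF lim]) (use ev in \<open>auto simp: eventually_sequentially\<close>)
qed

lemma m_G: "b \<in> S ==> 1 <= n ==> m (G n b) = (\<Sum>r\<in>{1..n}. m (L r (G (n - r) b)))"
proof -
 assume b: "b \<in> S" "1 <= n"
 have "m (G n b) = m (\<lambda>y. \<Sum>r\<in>{1..n}. L r (G (n - r) b) y)" by (rule m_cong) (rule G_ren[OF b(2)])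
 also have "... = (\<Sum>r\<in>{1..n}. m (L r (G (n - r) b)))" by (rule m_sum[where u = "\<lambda>r. L r (G (n - r) b)"]) (use S_L S_G b in auto)
 finally show ?thesis .
qed

text \<open>The mass is split by its last visit up to time \<open>n\<close>: the term
  \<open>j\<close> is the mass that visits at time \<open>j\<close> and then stays away. From
  \<open>n\<close> to \<open>Suc n\<close> these terms lose exactly what returns at
  \<open>Suc n\<close>, and that is the new term.\<close>

lemma conservation: "b \<in> S ==> (\<Sum>j\<le>n. tl (n - j) (G j b)) = m b"
proof (induct n)
 case 0
 have "m (G 0 b) = m b" by (rule m_cong) (rule G_0)
 thus ?case by (simp add: tl_def)
next
 case (Suc n)
 have "(\<Sum>j\<le>n. tl (Suc n - j) (G j b)) = (\<Sum>j\<le>n. tl (n - j) (G j b) - m (L (Suc n - j) (G j b)))"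
 proof (rule sum.cong[OF refl])
  fix j assume "j \<in> {..n}"
  hence "Suc n - j = Suc (n - j)" by auto
  thus "tl (Suc n - j) (G j b) = tl (n - j) (G j b) - m (L (Suc n - j) (G j b))" by (simp add: tl_def)
 qed
 also have "... = m b - (\<Sum>j\<le>n. m (L (Suc n - j) (G j b)))" using Suc by (simp add: sum_subtractf)
 also have "(\<Sum>j\<le>n. m (L (Suc n - j) (G j b))) = (\<Sum>r\<in>{1..Suc n}. m (L r (G (Suc n - r) b)))"
  by (rule sum.reindex_bij_witness[of _ "\<lambda>r. Suc n - r" "\<lambda>j. Suc n - j"]) auto
 also have "... = m (G (Suc n) b)" using m_G[of b "Suc n"] Suc by simp
 finally show ?case by (simp add: tl_def)
qed

lemma m_G_le: "b \<in> S ==> m (G n b) <= m b"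
proof -
 assume b: "b \<in> S"
 have "tl (n - n) (G n b) <= (\<Sum>j\<le>n. tl (n - j) (G j b))" by (rule member_le_sum) (use tl_nonneg S_G b in auto)
 thus ?thesis using conservation[OF b, of n] by (simp add: tl_def)
qed

lemma rho_le: "y \<in> J ==> \<rho> y <= A" "m \<rho> <= 1"
proof -
 show 1: "m \<rho> <= 1" using tau_le[of 1] by simp
 show "y \<in> J ==> \<rho> y <= A"
 proof -
  assume "y \<in> J"
  hence "\<rho> y <= A * m \<rho>" by (rule S_up[OF rho_S])
  also have "... <= A * 1" using 1 A1 by (intro mult_left_mono) auto
  finally show "\<rho> y <= A" by simp
 qed
qed

lemma T_nonneg: "0 <= T k" using T_tail[of k k] by simp

text \<open>By \<open>conservation\<close> and summability of \<open>T\<close>, at least half of the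
  mass made its last visit within the last \<open>W\<close> steps, so one of boundedly many times
  carries a fixed fraction of it. From there \<open>aper\<close> spreads it over \<open>J\<close> in
  a time taken from a finite set, hence with a uniform constant.\<close>

lemma doeblin: "\<exists>n0 c. 0 < c \<and> N0 <= n0 \<and> (\<forall>n\<ge>n0. \<forall>b\<in>S. \<forall>y\<in>J. c * m b <= G n b y)"
proof -
 obtain W where W: "\<And>N. (\<Sum>k\<in>{W<..N}. A * T k) <= 1 / 2"
 proof -
  have s: "summable (\<lambda>k. A * T k)" using T_summable by (rule summable_mult)
  obtain N where N: "\<And>m n. m >= N ==> norm (\<Sum>k\<in>{m..<n}. A * T k) < 1 / 2"
   using s unfolding summable_Cauchy by (metis half_gt_zero zero_less_one)
  have "(\<Sum>k\<in>{N<..M}. A * T k) <= 1 / 2" for M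
  proof -
   have "{N<..M} = {Suc N..<Suc M}" by auto
   thus ?thesis using N[of "Suc N" "Suc M"] by (simp add: abs_less_iff less_imp_le)
  qed
  thus ?thesis using that by blast
 qed
 obtain s0 where s0: "\<And>s. s >= s0 ==> \<exists>c>0. \<forall>b\<in>S. \<forall>y\<in>J. c * m b <= G s b y" using aper by blast
 then obtain cf where cf: "\<And>s. s >= s0 ==> cf s > 0 \<and> (\<forall>b\<in>S. \<forall>y\<in>J. cf s * m b <= G s b y)" by metis
 define c where "c = Min (cf ` {s0..s0 + W})"
 have c: "c > 0" using cf unfolding c_def by (subst Min_gr_iff) auto
 have c_le: "c <= cf s" if "s \<in> {s0..s0 + W}" for s unfolding c_def using that by auto
 define c' where "c' = c / (2 * (real W + 1))"
 have "c' * m b <= G (n + s0) b y" if b: "b \<in> S" and y: "y \<in> J" for n b y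
 proof -
  have "m b = (\<Sum>j\<le>n. tl (n - j) (G j b))" using conservation[OF b] by simp
  also have "... = (\<Sum>j\<in>{j. j <= n \<and> n - j <= W}. tl (n - j) (G j b)) + (\<Sum>j\<in>{j. j <= n \<and> W < n - j}. tl (n - j) (G j b))"
   by (subst sum.union_disjoint[symmetric]) (auto intro!: sum.cong)
  also have "(\<Sum>j\<in>{j. j <= n \<and> W < n - j}. tl (n - j) (G j b)) <= (\<Sum>j\<in>{j. j <= n \<and> W < n - j}. A * T (n - j) * m b)"
  proof (rule sum_mono)
   fix j
   have "tl (n - j) (G j b) <= A * T (n - j) * m (G j b)" by (rule tl_T[OF S_G[OF b]])
   also have "... <= A * T (n - j) * m b" using m_G_le[OF b] A1 T_nonneg by (intro mult_left_mono) auto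
   finally show "tl (n - j) (G j b) <= A * T (n - j) * m b" .
  qed
  also have "... = (\<Sum>k\<in>{W<..n}. A * T k * m b)"
   by (rule sum.reindex_bij_witness[of _ "\<lambda>k. n - k" "\<lambda>j. n - j"]) auto
  also have "... <= 1 / 2 * m b" using mult_right_mono[OF W[of n] m_nonneg[OF b]] by (simp add: sum_distrib_right)
  finally have big: "m b / 2 <= (\<Sum>j\<in>{j. j <= n \<and> n - j <= W}. tl (n - j) (G j b))" by simp
  have fin: "finite {j. j <= n \<and> n - j <= W}" by (rule finite_subset[of _ "{..n}"]) auto
  have cardle: "card {j. j <= n \<and> n - j <= W} <= W + 1"
  proof -
   have "{j. j <= n \<and> n - j <= W} \<subseteq> {n - W..n}" by auto
   hence "card {j. j <= n \<and> n - j <= W} <= card {n - W..n}" by (intro card_mono) auto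
   also have "... <= W + 1" by simp
   finally show ?thesis .
  qed
  have "\<exists>j. j <= n \<and> n - j <= W \<and> m b / (2 * (real W + 1)) <= m (G j b)"
  proof (rule ccontr)
   assume n: "\<not> ?thesis"
   have le: "tl (n - j) (G j b) <= m (G j b)" for j unfolding tl_def using sum_nonneg[of "{1..n - j}" "\<lambda>r. m (L r (G j b))"] mL_nonneg[OF S_G[OF b]] by simp
   have "(\<Sum>j\<in>{j. j <= n \<and> n - j <= W}. tl (n - j) (G j b)) < (\<Sum>j\<in>{j. j <= n \<and> n - j <= W}. m b / (2 * (real W + 1)))"
   proof (rule sum_strict_mono[OF fin])
    show "{j. j <= n \<and> n - j <= W} ~= {}" by (auto intro: exI[of _ n])
    show "tl (n - j) (G j b) < m b / (2 * (real W + 1))" if "j \<in> {j. j <= n \<and> n - j <= W}" for j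
    proof -
     have "\<not> m b / (2 * (real W + 1)) <= m (G j b)" using n that by blast
     thus ?thesis using le[of j] by linarith
    qed
   qed
   also have "... = real (card {j. j <= n \<and> n - j <= W}) * (m b / (2 * (real W + 1)))" by simp
   also have "... <= real (W + 1) * (m b / (2 * (real W + 1)))" using cardle m_nonneg[OF b] by (intro mult_right_mono) (auto simp del: of_nat_add)
   also have "... = m b / 2" by (simp add: field_simps)
   finally show False using big by simp
  qed
  then obtain j where j: "j <= n" "n - j <= W" "m b / (2 * (real W + 1)) <= m (G j b)" by blast
  define s where "s = n + s0 - j"
  have s: "s \<in> {s0..s0 + W}" "j + s = n + s0" using j by (auto simp: s_def)
  have "c' * m b = c * (m b / (2 * (real W + 1)))" by (simp add: c'_def)
  also have "... <= cf s * m (G j b)" using j c c_le[OF s(1)] m_nonneg[OF b] by (intro mult_mono) auto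
  also have "... <= G s (G j b) y" using cf[of s] s(1) S_G[OF b] y by auto
  also have "... <= G (n + s0) b y" using G_semi[OF b y, of s j] s(2) by simp
  finally show ?thesis .
 qed
 hence "\<forall>n\<ge>N0 + s0. \<forall>b\<in>S. \<forall>y\<in>J. c' * m b <= G n b y" by (metis add.commute add_leD2 le_add_diff_inverse2)
 moreover have "c' > 0" using c by (simp add: c'_def)
 ultimately show ?thesis by (intro exI[of _ "N0 + s0"] exI[of _ c']) auto
qed

text \<open>The part \<open>k \<rho>\<close> split off at the times \<open>n0 < j \<le> n1\<close> stays below \<open>k \<rho>\<close> for ever, being dominated by the
 stationary process; the rest is restarted at its first return after time \<open>n1\<close>.\<close>

lemma split_bound:
 assumes b: "b \<in> S" and n01: "n0 <= n1" and k: "0 <= k"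
  and z: "\<And>j. z j = (if n0 < j then (\<lambda>y. G j b y - k * \<rho> y) else G j b)"
  and n: "n1 < n" and y: "y \<in> J"
 shows "G n b y <= k * \<rho> y + (\<Sum>i\<in>{n1<..n}. \<Sum>j\<le>n1. G (n - i) (L (i - j) (z j)) y)"
 using n y
proof (induct n arbitrary: y rule: less_induct)
 case (less n)
 let ?Sol = "\<lambda>q y. \<Sum>i\<in>{n1<..q}. \<Sum>j\<le>n1. G (q - i) (L (i - j) (z j)) y"
 have y: "y \<in> J" and n: "n1 < n" using less by auto
 have "G n b y = (\<Sum>r\<in>{1..n}. L r (G (n - r) b) y)" using G_ren[of n y b] n y by simp
 also have "... = (\<Sum>q<n. L (n - q) (G q b) y)"
  by (rule sum.reindex_bij_witness[of _ "\<lambda>q. n - q" "\<lambda>r. n - r"]) (use n in auto)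
 also have "{..<n} = {..n1} \<union> {n1<..<n}" using n by auto
 also have "(\<Sum>q\<in>{..n1} \<union> {n1<..<n}. L (n - q) (G q b) y) = (\<Sum>q\<le>n1. L (n - q) (G q b) y) + (\<Sum>q\<in>{n1<..<n}. L (n - q) (G q b) y)"
  by (rule sum.union_disjoint) auto
 also have "(\<Sum>q\<le>n1. L (n - q) (G q b) y) = (\<Sum>q\<le>n1. L (n - q) (z q) y + (if n0 < q then k * L (n - q) \<rho> y else 0))"
  by (intro sum.cong refl) (auto simp: z L_diff[OF y])
 also have "... = (\<Sum>q\<le>n1. L (n - q) (z q) y) + (\<Sum>q\<in>{n0<..n1}. k * L (n - q) \<rho> y)"
 proof -
  have "(\<Sum>q\<le>n1. (if n0 < q then k * L (n - q) \<rho> y else 0)) = (\<Sum>q\<in>{n0<..n1}. k * L (n - q) \<rho> y)"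
   by (intro sum.mono_neutral_cong_right) auto
  thus ?thesis by (simp add: sum.distrib)
 qed
 also have "(\<Sum>q\<in>{n1<..<n}. L (n - q) (G q b) y) <= (\<Sum>q\<in>{n1<..<n}. k * L (n - q) \<rho> y + L (n - q) (?Sol q) y)"
 proof (rule sum_mono)
  fix q assume q: "q \<in> {n1<..<n}"
  have "L (n - q) (G q b) y <= L (n - q) (\<lambda>y. ?Sol q y - (- k) * \<rho> y) y"
  proof (rule L_mono[OF _ y])
   fix y' assume "y' \<in> J"
   hence "G q b y' <= k * \<rho> y' + ?Sol q y'" using less(1)[of q y'] q by simp
   thus "G q b y' <= ?Sol q y' - (- k) * \<rho> y'" by linarith
  qed
  also have "... = L (n - q) (?Sol q) y - (- k) * L (n - q) \<rho> y" by (rule L_diff[OF y])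
  finally show "L (n - q) (G q b) y <= k * L (n - q) \<rho> y + L (n - q) (?Sol q) y" by simp
 qed
 also have "... = (\<Sum>q\<in>{n1<..<n}. k * L (n - q) \<rho> y) + (\<Sum>q\<in>{n1<..<n}. L (n - q) (?Sol q) y)" by (simp add: sum.distrib)
 finally have 1: "G n b y <= (\<Sum>q\<le>n1. L (n - q) (z q) y) + (\<Sum>q\<in>{n1<..<n}. L (n - q) (?Sol q) y) +
  ((\<Sum>q\<in>{n0<..n1}. k * L (n - q) \<rho> y) + (\<Sum>q\<in>{n1<..<n}. k * L (n - q) \<rho> y))" by (simp add: algebra_simps)
 \<comment> \<open>All contributions of \<open>\<rho>\<close> after time \<open>n0\<close>, from the
   splitting as well as from the induction hypothesis, merge into one sum over first returns, which
   \<open>rho_sub\<close> bounds by \<open>\<rho>\<close>.\<close>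
 have "(\<Sum>q\<in>{n0<..n1}. k * L (n - q) \<rho> y) + (\<Sum>q\<in>{n1<..<n}. k * L (n - q) \<rho> y) = (\<Sum>q\<in>{n0<..<n}. k * L (n - q) \<rho> y)"
 proof -
  have "{n0<..<n} = {n0<..n1} \<union> {n1<..<n}" using n01 n by auto
  moreover have "(\<Sum>q\<in>{n0<..n1} \<union> {n1<..<n}. k * L (n - q) \<rho> y) = (\<Sum>q\<in>{n0<..n1}. k * L (n - q) \<rho> y) + (\<Sum>q\<in>{n1<..<n}. k * L (n - q) \<rho> y)"
   by (rule sum.union_disjoint) auto
  ultimately show ?thesis by simp
 qed
 also have "... = (\<Sum>r\<in>{1..n - Suc n0}. k * L r \<rho> y)"
  by (rule sum.reindex_bij_witness[of _ "\<lambda>r. n - r" "\<lambda>q. n - q"]) (use n n01 in auto)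
 also have "... = k * (\<Sum>r\<in>{1..n - Suc n0}. L r \<rho> y)" by (simp add: sum_distrib_left)
 also have "... <= k * \<rho> y" using rho_sub[OF y] k by (intro mult_left_mono) auto
 finally have 2: "(\<Sum>q\<in>{n0<..n1}. k * L (n - q) \<rho> y) + (\<Sum>q\<in>{n1<..<n}. k * L (n - q) \<rho> y) <= k * \<rho> y" .
 have "(\<Sum>q\<in>{n1<..<n}. L (n - q) (?Sol q) y) = (\<Sum>q\<in>{n1<..<n}. \<Sum>i\<in>{n1<..q}. \<Sum>j\<le>n1. L (n - q) (G (q - i) (L (i - j) (z j))) y)"
 proof (rule sum.cong[OF refl])
  fix q
  have "L (n - q) (?Sol q) y = (\<Sum>i\<in>{n1<..q}. L (n - q) (\<lambda>y. \<Sum>j\<le>n1. G (q - i) (L (i - j) (z j)) y) y)"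
   by (rule L_sum[OF _ y, where u = "\<lambda>i y. \<Sum>j\<le>n1. G (q - i) (L (i - j) (z j)) y"]) simp
  also have "... = (\<Sum>i\<in>{n1<..q}. \<Sum>j\<le>n1. L (n - q) (G (q - i) (L (i - j) (z j))) y)"
   by (intro sum.cong refl L_sum[OF _ y]) simp
  finally show "L (n - q) (?Sol q) y = (\<Sum>i\<in>{n1<..q}. \<Sum>j\<le>n1. L (n - q) (G (q - i) (L (i - j) (z j))) y)" .
 qed
 \<comment> \<open>After exchanging the sums, the renewal equation read backwards reassembles the
   operators \<open>G (n - i)\<close> of the restarted parts.\<close>
 also have "... = (\<Sum>i\<in>{n1<..<n}. \<Sum>q\<in>{i..<n}. \<Sum>j\<le>n1. L (n - q) (G (q - i) (L (i - j) (z j))) y)"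
  by (rule sum_triangle)
 also have "... = (\<Sum>i\<in>{n1<..<n}. \<Sum>j\<le>n1. G (n - i) (L (i - j) (z j)) y)"
 proof (rule sum.cong[OF refl])
  fix i assume i: "i \<in> {n1<..<n}"
  have "(\<Sum>q\<in>{i..<n}. \<Sum>j\<le>n1. L (n - q) (G (q - i) (L (i - j) (z j))) y) = (\<Sum>j\<le>n1. \<Sum>q\<in>{i..<n}. L (n - q) (G (q - i) (L (i - j) (z j))) y)"
   by (rule sum.swap)
  also have "... = (\<Sum>j\<le>n1. G (n - i) (L (i - j) (z j)) y)"
  proof (rule sum.cong[OF refl])
   fix j
   have "(\<Sum>q\<in>{i..<n}. L (n - q) (G (q - i) (L (i - j) (z j))) y) = (\<Sum>r\<in>{1..n - i}. L r (G (n - i - r) (L (i - j) (z j))) y)"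
    by (rule sum.reindex_bij_witness[of _ "\<lambda>r. n - r" "\<lambda>q. n - q"]) (use i in auto)
   also have "... = G (n - i) (L (i - j) (z j)) y" by (rule G_ren[symmetric]) (use i y in auto)
   finally show "(\<Sum>q\<in>{i..<n}. L (n - q) (G (q - i) (L (i - j) (z j))) y) = G (n - i) (L (i - j) (z j)) y" .
  qed
  finally show "(\<Sum>q\<in>{i..<n}. \<Sum>j\<le>n1. L (n - q) (G (q - i) (L (i - j) (z j))) y) = (\<Sum>j\<le>n1. G (n - i) (L (i - j) (z j)) y)" .
 qed
 finally have 3: "(\<Sum>q\<in>{n1<..<n}. L (n - q) (?Sol q) y) = (\<Sum>i\<in>{n1<..<n}. \<Sum>j\<le>n1. G (n - i) (L (i - j) (z j)) y)" .
 have "{n1<..n} = insert n {n1<..<n}" using n by auto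
 hence "?Sol n y = (\<Sum>q\<le>n1. L (n - q) (z q) y) + (\<Sum>i\<in>{n1<..<n}. \<Sum>j\<le>n1. G (n - i) (L (i - j) (z j)) y)"
  by (simp add: G_0[OF y])
 thus ?case using 1 2 3 by linarith
qed

text \<open>Induction on \<open>n\<close> through \<open>split_bound\<close>. The splitting removes
  nearly the fraction \<open>c\<close> from the mass that is restarted, so the coefficient of
  \<open>K * t n\<close> contracts to \<open>1 - c/8\<close>. The coefficient of
  \<open>\<rho>\<close> exceeds \<open>m b\<close> only by \<open>k\<close> times the defect
  \<open>EN\<close> of Kac's sum, which is of order \<open>t n\<close>. For \<open>K\<close> large
  the contraction pays for this excess.\<close>

theorem renewal_upper: "\<exists>K>0. \<forall>n. \<forall>b\<in>S. \<forall>y\<in>J. G n b y <= m b * (\<rho> y + K * t n)"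
proof -
 obtain n0 c0 where c0: "0 < c0" "N0 <= n0" and D: "\<And>n b y. n >= n0 ==> b \<in> S ==> y \<in> J ==> c0 * m b <= G n b y"
  using doeblin by metis
 \<comment> \<open>With \<open>\<rho> <= A\<close>, this gives
   \<open>2 * k * \<rho> <= G j b\<close> for \<open>j > n0\<close>, the margin that
   \<open>S_sub\<close> asks for.\<close>
 define c where "c = min 1 (c0 / (2 * A))"
 have c: "0 < c" "c <= 1" "2 * c * A <= c0" using c0 A1 by (auto simp: c_def min_def field_simps)
 obtain e where e: "e > 0" "e < 1/4" and slow: "\<forall>\<^sub>F n in sequentially. \<forall>k. real k <= 3 * e * real n --> t (n - k) <= (1 + c/4) * t n"
  using t_slow[of "c/4"] c by auto
 obtain C where C: "C > 0" and doub: "\<forall>\<^sub>F n in sequentially. \<forall>k. e * real n <= real k + 1 --> T k * real n <= C * t n \<and> t k <= C * t n"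
  using t_doub[OF e(1)] by blast
 \<comment> \<open>Calibrated so that late restarts contribute at most \<open>c/8 * t n\<close> per
   unit of mass.\<close>
 define d where "d = c / (8 * A * C)"
 have d: "d > 0" using c A1 C by (simp add: d_def)
 have ces: "\<forall>\<^sub>F n in sequentially. (\<Sum>l<n. t l) <= d * real n"
 proof -
  obtain M where M: "\<And>n. n >= M ==> t n < d / 2" using t_lim d unfolding LIMSEQ_iff by (metis diff_zero half_gt_zero real_norm_def abs_of_pos t_pos)
  obtain M2 :: nat where M2: "(\<Sum>l<M. t l) / (d / 2) < real M2" using reals_Archimedean2 by blast
  have "(\<Sum>l<n. t l) <= d * real n" if n: "n >= M + M2" for n
  proof -
   have "{..<n} = {..<M} \<union> {M..<n}" using n by auto
   hence "(\<Sum>l<n. t l) = (\<Sum>l<M. t l) + (\<Sum>l\<in>{M..<n}. t l)" by (simp add: sum.union_disjoint ivl_disj_int)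
   also have "(\<Sum>l\<in>{M..<n}. t l) <= (\<Sum>l\<in>{M..<n}. d / 2)" using M by (intro sum_mono less_imp_le) auto
   also have "... <= real n * (d / 2)" using d by simp
   also have "(\<Sum>l<M. t l) <= real n * (d / 2)"
   proof -
    have "(\<Sum>l<M. t l) <= real M2 * (d / 2)" using M2 d by (simp add: field_simps)
    also have "... <= real n * (d / 2)" using n d by (intro mult_right_mono) auto
    finally show ?thesis .
   qed
   finally show ?thesis by (simp add: mult.commute)
  qed
  thus ?thesis by (auto simp: eventually_sequentially)
 qed
 have half: "\<forall>\<^sub>F n in sequentially. A * (C * t n) <= 1 / 2 \<and> real n0 <= e * real n \<and> n >= 1"
 proof -
  have "(\<lambda>n. A * (C * t n)) \<longlonglongrightarrow> A * (C * 0)" by (intro tendsto_intros t_lim)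
  hence "\<forall>\<^sub>F n in sequentially. A * (C * t n) < 1 / 2" by (intro order_tendstoD) auto
  moreover have "\<forall>\<^sub>F n in sequentially. real n0 <= e * real n"
   using e(1) by (intro eventually_sequentiallyI[of "nat \<lceil>real n0 / e\<rceil>"]) (simp add: field_simps nat_le_iff ceiling_le_iff)
  moreover have "\<forall>\<^sub>F n in sequentially. n >= (1::nat)" by (rule eventually_ge_at_top)
  ultimately show ?thesis by eventually_elim auto
 qed
 obtain ns where ns: "\<And>n. n >= ns ==> (\<forall>k. real k <= 3 * e * real n --> t (n - k) <= (1 + c/4) * t n) \<and>
  (\<forall>k. e * real n <= real k + 1 --> T k * real n <= C * t n \<and> t k <= C * t n) \<and> (\<Sum>l<n. t l) <= d * real n \<and>
  A * (C * t n) <= 1 / 2 \<and> real n0 <= e * real n \<and> n >= 1"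
  using eventually_conj[OF slow eventually_conj[OF doub eventually_conj[OF ces half]]] unfolding eventually_sequentially by blast
 \<comment> \<open>The first entry lets the trivial bound \<open>A * m b\<close> settle all
   \<open>n <= ns\<close>; the second makes \<open>c/8 * K\<close> dominate the excess caused by
   \<open>EN\<close>.\<close>
 define K where "K = max (A / t ns) (8 * A\<^sup>2 * C)"
 have K: "K > 0" "A / t ns <= K" "8 * A\<^sup>2 * C <= K" using A1 C by (auto simp: K_def intro: less_max_iff_disj[THEN iffD2])
 have main: "G n b y <= m b * (\<rho> y + K * t n)" if by': "b \<in> S" "y \<in> J" for n b y
  using by'
 proof (induct n arbitrary: b y rule: less_induct)
  case (less n)
  note b = less(2) and y = less(3)
  have mb: "0 <= m b" by (rule m_nonneg[OF b])
  have rho: "0 <= \<rho> y" "\<rho> y <= A" using S_nonneg[OF rho_S y] rho_le(1)[OF y] by auto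
  show ?case
  proof (cases "n <= ns")
   case True
   have "G n b y <= A * m (G n b)" by (rule S_up[OF S_G[OF b] y])
   also have "... <= A * m b" using m_G_le[OF b] A1 by (intro mult_left_mono) auto
   also have "... <= (K * t n) * m b"
   proof (rule mult_right_mono[OF _ mb])
    have "A <= K * t ns" using K t_pos[of ns] by (simp add: field_simps)
    also have "... <= K * t n" using t_dec[OF True] K by (intro mult_left_mono) auto
    finally show "A <= K * t n" .
   qed
   also have "... <= m b * (\<rho> y + K * t n)" using rho mb by (simp add: algebra_simps)
   finally show ?thesis .
  next
   case False
   hence nn: "n >= ns" by simp
   note P = ns[OF nn]
   define N where "N = nat \<lfloor>e * real n\<rfloor>"
   have N: "real N <= e * real n" "e * real n <= real N + 1"
   using e by (auto simp: N_def)
   define n1 where "n1 = n0 + N"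
   have n1n: "real (n1 + N) <= 3 * e * real n" using N P by (simp add: n1_def)
   also have "3 * e * real n < 1 * real n" using e P by (intro mult_strict_right_mono) auto
   finally have "real (n1 + N) < real n" by simp
   hence n1: "n1 + N < n" by linarith
   define k where "k = c * m b"
   have k: "0 <= k" using c mb by (simp add: k_def)
   define z where "z j = (if n0 < j then (\<lambda>y. G j b y - k * \<rho> y) else G j b)" for j
   have zS: "z j \<in> S" for j
   proof (cases "n0 < j")
    case True
    have "2 * k * \<rho> y' <= G j b y'" if y': "y' \<in> J" for y'
    proof -
     have "2 * k * \<rho> y' <= 2 * k * A" using rho_le(1)[OF y'] k by (intro mult_left_mono) auto
     also have "... = (2 * c * A) * m b" by (simp add: k_def)
     also have "... <= c0 * m b" using c mb by (intro mult_right_mono) auto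
     also have "... <= G j b y'" using D[OF _ b y', of j] True by simp
     finally show ?thesis .
    qed
    thus ?thesis using S_sub[OF b, of j k] True c0 k by (simp add: z_def)
   qed (simp add: z_def S_G[OF b])
   have LzS: "L r (z j) \<in> S" if "1 <= r" for r j using S_L[OF zS that] .
   \<comment> \<open>The mass of the leftover whose first return after time \<open>n1\<close>
     happens at time \<open>i\<close>.\<close>
   define om where "om i = (\<Sum>j\<le>n1. m (L (i - j) (z j)))" for i
   have om_nn: "0 <= om i" if "n1 < i" for i unfolding om_def using that by (intro sum_nonneg m_nonneg LzS) auto
   have "G n b y <= k * \<rho> y + (\<Sum>i\<in>{n1<..n}. \<Sum>j\<le>n1. G (n - i) (L (i - j) (z j)) y)"
    by (rule split_bound[OF b _ k z_def _ y]) (use n1 in \<open>auto simp: n1_def\<close>)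
   also have "(\<Sum>i\<in>{n1<..n}. \<Sum>j\<le>n1. G (n - i) (L (i - j) (z j)) y) <= (\<Sum>i\<in>{n1<..n}. om i * (\<rho> y + K * t (n - i)))"
   proof (rule sum_mono)
    fix i assume i: "i \<in> {n1<..n}"
    have "(\<Sum>j\<le>n1. G (n - i) (L (i - j) (z j)) y) <= (\<Sum>j\<le>n1. m (L (i - j) (z j)) * (\<rho> y + K * t (n - i)))"
     by (intro sum_mono less(1) LzS y) (use i in auto)
    thus "(\<Sum>j\<le>n1. G (n - i) (L (i - j) (z j)) y) <= om i * (\<rho> y + K * t (n - i))" by (simp add: om_def sum_distrib_right)
   qed
   also have "... = (\<Sum>i\<in>{n1<..n}. om i) * \<rho> y + K * (\<Sum>i\<in>{n1<..n}. om i * t (n - i))"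
    by (simp add: algebra_simps sum.distrib sum_distrib_left sum_distrib_right)
   finally have step: "G n b y <= k * \<rho> y + ((\<Sum>i\<in>{n1<..n}. om i) * \<rho> y + K * (\<Sum>i\<in>{n1<..n}. om i * t (n - i)))" by simp
   \<comment> \<open>What Kac's sum for \<open>\<rho>\<close> still lacks after \<open>N\<close>
     terms.\<close>
   define EN where "EN = 1 - (\<Sum>q<N. m \<rho> - (\<Sum>r\<in>{1..q}. m (L r \<rho>)))"
   have EN: "0 <= EN" "EN <= A * (C * t n)"
   proof -
    show "0 <= EN" using tau_le[of N] by (simp add: EN_def)
    have "EN <= A * t N" using tau_tail[of N] by (simp add: EN_def)
    also have "... <= A * (C * t n)" using P N A1 by (intro mult_left_mono) auto
    finally show "EN <= A * (C * t n)" .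
   qed
   have omsum: "(\<Sum>i\<in>{n1<..n}. om i) <= m b - k * (1 - EN)"
   proof -
    have "(\<Sum>i\<in>{n1<..n}. om i) = (\<Sum>j\<le>n1. \<Sum>i\<in>{n1<..n}. m (L (i - j) (z j)))" unfolding om_def by (rule sum.swap)
    also have "... <= (\<Sum>j\<le>n1. tl (n1 - j) (z j))"
    proof (rule sum_mono)
     fix j assume j: "j \<in> {..n1}"
     have "(\<Sum>i\<in>{n1<..n}. m (L (i - j) (z j))) = (\<Sum>r\<in>{n1 - j<..n - j}. m (L r (z j)))"
      by (rule sum.reindex_bij_witness[of _ "\<lambda>r. r + j" "\<lambda>i. i - j"]) (use j in auto)
     also have "... <= tl (n1 - j) (z j)" by (rule tl_bound[OF zS]) (use n1 in auto)
     finally show "(\<Sum>i\<in>{n1<..n}. m (L (i - j) (z j))) <= tl (n1 - j) (z j)" .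
    qed
    also have "... = (\<Sum>j\<le>n1. tl (n1 - j) (G j b) - (if n0 < j then k * tl (n1 - j) \<rho> else 0))"
    proof (rule sum.cong[OF refl])
     fix j
     have "tl (n1 - j) (\<lambda>y. G j b y - k * \<rho> y) = tl (n1 - j) (G j b) - k * tl (n1 - j) \<rho>"
     proof -
      have "m (L r (\<lambda>y. G j b y - k * \<rho> y)) = m (L r (G j b)) - k * m (L r \<rho>)" if "r \<in> {1..n1 - j}" for r
      proof -
       have "m (L r (\<lambda>y. G j b y - k * \<rho> y)) = m (\<lambda>y. L r (G j b) y - k * L r \<rho> y)" by (rule m_cong) (rule L_diff)
       also have "... = m (L r (G j b)) - k * m (L r \<rho>)" by (rule m_diff) (use S_L S_G b rho_S that in auto)
       finally show ?thesis .
      qed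
      hence "(\<Sum>r\<in>{1..n1 - j}. m (L r (\<lambda>y. G j b y - k * \<rho> y))) = (\<Sum>r\<in>{1..n1 - j}. m (L r (G j b)) - k * m (L r \<rho>))" by (intro sum.cong) auto
      moreover have "m (\<lambda>y. G j b y - k * \<rho> y) = m (G j b) - k * m \<rho>" by (rule m_diff[OF S_G[OF b] rho_S])
      ultimately show ?thesis by (simp add: tl_def sum_subtractf sum_distrib_left algebra_simps)
     qed
     thus "tl (n1 - j) (z j) = tl (n1 - j) (G j b) - (if n0 < j then k * tl (n1 - j) \<rho> else 0)" by (simp add: z_def)
    qed
    also have "... = m b - (\<Sum>j\<in>{n0<..n1}. k * tl (n1 - j) \<rho>)"
    proof -
     have "(\<Sum>j\<le>n1. (if n0 < j then k * tl (n1 - j) \<rho> else 0)) = (\<Sum>j\<in>{n0<..n1}. k * tl (n1 - j) \<rho>)"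
      by (intro sum.mono_neutral_cong_right) auto
     thus ?thesis using conservation[OF b, of n1] by (simp add: sum_subtractf)
    qed
    also have "(\<Sum>j\<in>{n0<..n1}. k * tl (n1 - j) \<rho>) = (\<Sum>q<N. k * tl q \<rho>)"
     by (rule sum.reindex_bij_witness[of _ "\<lambda>q. n1 - q" "\<lambda>j. n1 - j"]) (auto simp: n1_def)
    also have "... = k * (1 - EN)" by (simp add: EN_def tl_def sum_distrib_left)
    finally show ?thesis .
   qed
   have om_le: "om i <= A * T (i - n1 - 1) * m b" if i: "n1 < i" for i
   proof -
    have "om i <= (\<Sum>j\<le>n1. A * \<kappa> (i - j) * m b)" unfolding om_def
    proof (rule sum_mono)
     fix j assume j: "j \<in> {..n1}"
     have r: "1 <= i - j" using i j by auto
     have "m (z j) <= m b"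
     proof (cases "n0 < j")
      case True
      have "m (\<lambda>y. G j b y - k * \<rho> y) = m (G j b) - k * m \<rho>" by (rule m_diff[OF S_G[OF b] rho_S])
      moreover have "0 <= k * m \<rho>" using k m_nonneg[OF rho_S] by simp
      ultimately show ?thesis using m_G_le[OF b, of j] by (simp add: z_def)
     qed (use m_G_le[OF b] in \<open>simp add: z_def\<close>)
     have "m (L (i - j) (z j)) <= A * \<kappa> (i - j) * m (z j)" by (rule m_kap[OF zS r])
     also have "... <= A * \<kappa> (i - j) * m b" using \<open>m (z j) \<le> m b\<close> A1 kap_nonneg by (intro mult_left_mono) auto
     finally show "m (L (i - j) (z j)) <= A * \<kappa> (i - j) * m b" .
    qed
    also have "... = A * (\<Sum>j\<le>n1. \<kappa> (i - j)) * m b" by (simp add: sum_distrib_left sum_distrib_right)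
    also have "(\<Sum>j\<le>n1. \<kappa> (i - j)) = (\<Sum>r\<in>{i - n1 - 1<..i}. \<kappa> r)"
     by (rule sum.reindex_bij_witness[of _ "\<lambda>r. i - r" "\<lambda>j. i - j"]) (use i in auto)
    also have "A * ... * m b <= A * T (i - n1 - 1) * m b" using T_tail A1 mb by (intro mult_right_mono mult_left_mono) auto
    finally show ?thesis .
   qed
   \<comment> \<open>Restarts within \<open>N\<close> steps after \<open>n1\<close> see an almost
     constant \<open>t\<close> and have total mass at most \<open>m b * (1 - c/2)\<close>. Later
     ones are individually small through \<open>T N\<close>, and over them the Cesaro mean of
     \<open>t\<close> is small.\<close>
   have "(\<Sum>i\<in>{n1<..n}. om i * t (n - i)) = (\<Sum>i\<in>{n1<..n1 + N}. om i * t (n - i)) + (\<Sum>i\<in>{n1 + N<..n}. om i * t (n - i))"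
    by (subst sum.union_disjoint[symmetric]) (use n1 in \<open>auto intro!: sum.cong\<close>)
   also have "(\<Sum>i\<in>{n1<..n1 + N}. om i * t (n - i)) <= (\<Sum>i\<in>{n1<..n1 + N}. om i * ((1 + c/4) * t n))"
   proof (intro sum_mono mult_left_mono)
    fix i assume i: "i \<in> {n1<..n1 + N}"
    hence "real i <= 3 * e * real n" using n1n by (auto intro: order_trans[OF of_nat_mono])
    thus "t (n - i) <= (1 + c/4) * t n" using P by blast
   qed (use om_nn in auto)
   also have "... = (\<Sum>i\<in>{n1<..n1 + N}. om i) * ((1 + c/4) * t n)" by (simp add: sum_distrib_right)
   also have "... <= (m b * (1 - c/2)) * ((1 + c/4) * t n)"
   proof (rule mult_right_mono)
    have "(\<Sum>i\<in>{n1<..n1 + N}. om i) <= (\<Sum>i\<in>{n1<..n}. om i)" using om_nn n1 by (intro sum_mono2) auto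
    also have "... <= m b - k * (1 - EN)" by (rule omsum)
    also have "... <= m b - k * (1/2)" using k EN P by (intro diff_mono mult_left_mono) auto
    also have "... = m b * (1 - c/2)" by (simp add: k_def algebra_simps)
    finally show "(\<Sum>i\<in>{n1<..n1 + N}. om i) <= m b * (1 - c/2)" .
    show "0 <= (1 + c/4) * t n" using c t_pos[of n] by simp
   qed
   also have "... <= m b * ((1 - c/4) * t n)"
   proof -
    have "(1 - c/2) * (1 + c/4) <= 1 - c/4" by (simp add: algebra_simps)
    hence "(1 - c/2) * (1 + c/4) * t n <= (1 - c/4) * t n" using t_pos[of n] by (intro mult_right_mono) auto
    thus ?thesis using mb mult_left_mono[of "(1 - c/2) * (1 + c/4) * t n" "(1 - c/4) * t n" "m b"] by (simp add: mult.assoc)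
   qed
   also have "(\<Sum>i\<in>{n1 + N<..n}. om i * t (n - i)) <= (\<Sum>i\<in>{n1 + N<..n}. (A * T N * m b) * t (n - i))"
   proof (intro sum_mono mult_right_mono)
    fix i assume i: "i \<in> {n1 + N<..n}"
    have "om i <= A * T (i - n1 - 1) * m b" using om_le[of i] i by simp
    also have "... <= A * T N * m b" using i A1 mb by (intro mult_right_mono mult_left_mono T_dec) auto
    finally show "om i <= A * T N * m b" .
   qed (use t_pos less_imp_le in blast)
   also have "... = (A * T N * m b) * (\<Sum>i\<in>{n1 + N<..n}. t (n - i))" by (simp add: sum_distrib_left)
   also have "(\<Sum>i\<in>{n1 + N<..n}. t (n - i)) = (\<Sum>l\<in>{..<n - (n1 + N)}. t l)"
    by (rule sum.reindex_bij_witness[of _ "\<lambda>l. n - l" "\<lambda>i. n - i"]) (use n1 in auto)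
   also have "(A * T N * m b) * (\<Sum>l\<in>{..<n - (n1 + N)}. t l) <= (A * T N * m b) * (d * real n)"
   proof (rule mult_left_mono)
    have "(\<Sum>l\<in>{..<n - (n1 + N)}. t l) <= (\<Sum>l<n. t l)" using t_pos by (intro sum_mono2) (auto simp: less_imp_le)
    thus "(\<Sum>l\<in>{..<n - (n1 + N)}. t l) <= d * real n" using P by linarith
    show "0 <= A * T N * m b" using A1 T_nonneg mb by simp
   qed
   also have "... = (A * d * m b) * (T N * real n)" by simp
   also have "... <= (A * d * m b) * (C * t n)" using P N A1 d mb by (intro mult_left_mono) auto
   also have "... = m b * (c / 8 * t n)" using A1 C by (simp add: d_def)
   finally have conv: "(\<Sum>i\<in>{n1<..n}. om i * t (n - i)) <= m b * ((1 - c/8) * t n)" by (simp add: algebra_simps)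
   have "G n b y <= k * \<rho> y + ((m b - k * (1 - EN)) * \<rho> y + K * (m b * ((1 - c/8) * t n)))"
    using step mult_right_mono[OF omsum rho(1)] mult_left_mono[OF conv, of K] K by linarith
   also have "... = m b * \<rho> y + m b * (c * (EN * \<rho> y)) + m b * (K * (1 - c/8) * t n)" by (simp add: k_def algebra_simps)
   also have "... <= m b * \<rho> y + m b * (c / 8 * K * t n) + m b * (K * (1 - c/8) * t n)"
   proof -
    have "EN * \<rho> y <= (A * (C * t n)) * A" using EN rho by (intro mult_mono) auto
    also have "... = (8 * A\<^sup>2 * C) / 8 * t n" by (simp add: power2_eq_square)
    also have "... <= K / 8 * t n" using K t_pos[of n] by (intro mult_right_mono) auto
    finally have "c * (EN * \<rho> y) <= c * (K / 8 * t n)" using c by (intro mult_left_mono) auto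
    hence "m b * (c * (EN * \<rho> y)) <= m b * (c * (K / 8 * t n))" by (rule mult_left_mono[OF _ mb])
    thus ?thesis by (simp add: algebra_simps)
   qed
   also have "... = m b * (\<rho> y + K * t n)" by (simp add: algebra_simps)
   finally show ?thesis .
  qed
 qed
 thus ?thesis using K by blast
qed

end

subsection \<open>Transitive unimodal maps\<close>

lemmas abs_int_imp_int = set_lebesgue_integral_eq_integral(1)

lemma iter_add: "(f ^^ (m + n)) x = (f ^^ m) ((f ^^ n) x)"
 by (simp add: funpow_add)

lemma iter_comm: "(f ^^ m) ((f ^^ n) x) = (f ^^ n) ((f ^^ m) x)"
 by (metis iter_add add.commute)

lemma periodic_iter_mult: "(f ^^ n) x = x ==> (f ^^ (n * k)) x = x"
 by (induct k) (simp_all add: funpow_add)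

lemma inj_interval_image_dist:
 fixes g :: "real => real"
 assumes "continuous_on {a..b} g" "inj_on g {a..b}" "a <= b" "x \<in> {a..b}" "y \<in> {a..b}"
 shows "\<bar>g x - g y\<bar> <= \<bar>g a - g b\<bar>"
proof -
 have "(g a <= g z \<and> g z <= g b) \<or> (g b <= g z \<and> g z <= g a)" if "z \<in> {a..b}" for z
 proof (cases "z = a \<or> z = b")
  case False
  thus ?thesis using continuous_inj_imp_mono[of a z b g] that assms by auto
 qed auto
 from this[OF assms(4)] this[OF assms(5)] show ?thesis by linarith
qed

lemma iterate_in_01:
 fixes f :: "real => real"
 assumes "f ` {0..1} \<subseteq> {0..1}" "x \<in> {0..1}"
 shows "(f ^^ n) x \<in> {0..1}"
proof (induct n)
 case (Suc n)
 hence "f ((f ^^ n) x) \<in> f ` {0..1}" by (rule imageI)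
 thus ?case using assms(1) by auto
qed (use assms in simp)

lemma iterate_has_derivative:
 fixes f f1 :: "real => real"
 assumes der: "\<And>x. x \<in> {0..1} ==> (f has_real_derivative f1 x) (at x within {0..1})" and im: "f ` {0..1} \<subseteq> {0..1}" and x: "x \<in> {0..1}"
 shows "((f ^^ n) has_real_derivative (\<Prod>j<n. f1 ((f ^^ j) x))) (at x within {0..1})"
proof (induct n)
 case (Suc n)
 have "(f ^^ n) ` {0..1} \<subseteq> {0..1}" using iterate_in_01[OF im] by blast
 hence "(f has_real_derivative f1 ((f ^^ n) x)) (at ((f ^^ n) x) within (f ^^ n) ` {0..1})"
  by (rule DERIV_subset[OF der[OF iterate_in_01[OF im x]]])
 from DERIV_image_chain[OF this Suc] show ?case by (simp add: o_def mult.commute)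
qed (simp add: id_def)

text \<open>Continuity is assumed on the whole line so that preimages under iterates are open or
  closed without domain conditions; the final theorem provides it by clamping the argument to the
  unit interval.\<close>

locale transitive_unimodal =
 fixes f f1 :: "real => real" and c :: real
 assumes c01: "0 < c" "c < 1"
  and f_cont: "continuous_on UNIV f"
  and f_rng: "\<And>x. 0 <= f x" "\<And>x. f x <= 1"
  and f_der: "\<And>x. x \<in> {0..1} ==> (f has_real_derivative f1 x) (at x within {0..1})"
  and f1_cont: "continuous_on {0..1} f1"
  and f1_zero: "\<And>x. x \<in> {0..1} ==> f1 x = 0 \<longleftrightarrow> x = c"
  and f_ext: "(\<forall>x\<in>{0..1}. f x <= f c) \<or> (\<forall>x\<in>{0..1}. f c <= f x)"
  and trans: "\<And>a b a' b'. [|0 <= a; a < b; b <= 1; 0 <= a'; a' < b'; b' <= 1|]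
    ==> \<exists>n\<ge>1. \<exists>x\<in>{a<..<b}. (f ^^ n) x \<in> {a'<..<b'}"
  and repelling: "\<And>x n. [|x \<in> {0..1}; 1 <= n; (f ^^ n) x = x|] ==> \<bar>\<Prod>j<n. f1 ((f ^^ j) x)\<bar> > 1"
  and crit_nonrec: "\<exists>d>0. \<forall>k\<ge>1. d <= \<bar>(f ^^ k) c - c\<bar>"
begin

definition Df :: "nat => real => real" where "Df n x = (\<Prod>j<n. f1 ((f ^^ j) x))"

lemma fn_cont: "continuous_on S (f ^^ n)"
proof -
 have "continuous_on UNIV (f ^^ n)"
  by (induct n) (auto intro!: continuous_on_compose2[OF f_cont] continuous_on_id simp: o_def)
 thus ?thesis using continuous_on_subset by blast
qed

lemma fn_rng: "x \<in> {0..1} ==> (f ^^ n) x \<in> {0..1}"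
 using f_rng by (cases n) auto

lemma Df_0 [simp]: "Df 0 x = 1" by (simp add: Df_def)

lemma Df_Suc: "Df (Suc n) x = f1 ((f ^^ n) x) * Df n x" by (simp add: Df_def)

lemma Df_add: "Df (m + n) x = Df m ((f ^^ n) x) * Df n x"
 by (induct m) (simp_all add: Df_Suc funpow_add)

lemma fn_der: "x \<in> {0..1} ==> ((f ^^ n) has_real_derivative Df n x) (at x within {0..1})"
 unfolding Df_def using f_rng by (intro iterate_has_derivative f_der) auto

lemma fn_der_at: "0 < x ==> x < 1 ==> ((f ^^ n) has_real_derivative Df n x) (at x)"
 using fn_der[of x n] at_within_interior[of x "{0..1}"] by auto

lemma fn_mvt:
 assumes "0 <= x" "x < y" "y <= 1"
 shows "\<exists>z. x < z \<and> z < y \<and> (f ^^ n) y - (f ^^ n) x = (y - x) * Df n z"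
proof -
 have "\<exists>l z. x < z \<and> z < y \<and> ((f ^^ n) has_real_derivative l) (at z) \<and> (f ^^ n) y - (f ^^ n) x = (y - x) * l"
  using assms by (intro MVT fn_cont) (auto simp: real_differentiable_def intro!: exI fn_der_at)
 then obtain l z where lz: "x < z" "z < y" "((f ^^ n) has_real_derivative l) (at z)"
  "(f ^^ n) y - (f ^^ n) x = (y - x) * l" by blast
 have "l = Df n z" using lz fn_der_at[of z n] assms DERIV_unique by fastforce
 thus ?thesis using lz by blast
qed

text \<open>The image is compact, so around a missed point there would be a gap that no orbit ever
  enters, against transitivity.\<close>

lemma f_surj: "y \<in> {0..1} ==> \<exists>x\<in>{0..1}. f x = y"
proof (rule ccontr)
 assume y: "y \<in> {0..1}" and n: "\<not> (\<exists>x\<in>{0..1}. f x = y)"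
 have "compact (f ` {0..1})" using f_cont by (intro compact_continuous_image) (auto intro: continuous_on_subset)
 hence "open (- f ` {0..1})" by (simp add: compact_imp_closed open_Compl)
 moreover have "y \<in> - f ` {0..1}" using n by auto
 ultimately obtain e where e: "e > 0" "ball y e \<subseteq> - f ` {0..1}" using openE by blast
 define a b where "a = max 0 (y - e/2)" "b = min 1 (y + e/2)"
 have ab: "0 <= a" "a < b" "b <= 1" "{a<..<b} \<subseteq> ball y e" using e y by (auto simp: a_b_def dist_real_def)
 from trans[of 0 1 a b] ab obtain n x where n: "n >= 1" "x \<in> {0<..<1}" "(f ^^ n) x \<in> {a<..<b}" by auto
 then obtain k where "n = Suc k" by (cases n) auto
 hence "(f ^^ n) x = f ((f ^^ k) x)" "(f ^^ k) x \<in> {0..1}" using n fn_rng[of x k] by auto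
 thus False using n ab e by blast
qed

lemma fn_surj: "y \<in> {0..1} ==> \<exists>x\<in>{0..1}. (f ^^ n) x = y"
proof (induct n arbitrary: y)
 case (Suc n)
 then obtain z where "z \<in> {0..1}" "f z = y" using f_surj by blast
 thus ?case using Suc(1)[of z] by auto
qed simp

text \<open>Transitivity is applied to a small interval that \<open>f ^^ k\<close> maps into the
  target, instead of the target itself.\<close>

lemma trans_large:
 assumes "0 <= a" "a < b" "b <= 1" "0 <= a'" "a' < b'" "b' <= 1"
 shows "\<exists>n>k. \<exists>x\<in>{a<..<b}. (f ^^ n) x \<in> {a'<..<b'}"
proof -
 obtain z where z: "z \<in> {0..1}" "(f ^^ k) z = (a' + b') / 2" using fn_surj[of "(a'+b')/2" k] assms by auto
 have "open ((f ^^ k) -` {a'<..<b'})"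
  using fn_cont[of UNIV k] by (intro continuous_open_vimage) (auto simp: continuous_on_eq_continuous_at)
 moreover have "z \<in> (f ^^ k) -` {a'<..<b'}" using z assms by auto
 ultimately obtain e where e: "e > 0" "ball z e \<subseteq> (f ^^ k) -` {a'<..<b'}" using openE by blast
 define u v where "u = max 0 (z - e/2)" "v = min 1 (z + e/2)"
 have uv: "0 <= u" "u < v" "v <= 1" "{u<..<v} \<subseteq> ball z e" using e z by (auto simp: u_v_def dist_real_def)
 from trans[OF assms(1-3) uv(1-3)] obtain n x where n: "n >= 1" "x \<in> {a<..<b}" "(f ^^ n) x \<in> {u<..<v}" by auto
 hence "(f ^^ (k + n)) x \<in> {a'<..<b'}" using e uv unfolding iter_add by blast
 thus ?thesis using n by (intro exI[of _ "k + n"]) auto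
qed

lemma f_inj_L: "inj_on f {0..c}" and f_inj_R: "inj_on f {c..1}"
proof -
 have A: False if xy: "x < y" "0 <= x" "y <= 1" "f x = f y" "y <= c \<or> c <= x" for x y
 proof -
  obtain z where "x < z" "z < y" "f y - f x = (y - x) * Df 1 z" using fn_mvt[of x y 1] xy by auto
  thus False using xy f1_zero[of z] by (auto simp: Df_def)
 qed
 show "inj_on f {0..c}" by (rule linorder_inj_onI) (use A c01 in \<open>auto, fastforce\<close>)
 show "inj_on f {c..1}" by (rule linorder_inj_onI) (use A c01 in \<open>auto, fastforce\<close>)
qed

lemma fn_interval: "is_interval ((f ^^ n) ` I)" if "is_interval I" for I
 using that is_interval_connected_1 connected_continuous_image[OF fn_cont] by blast

lemma inj_iter:
 assumes "is_interval I" "I \<subseteq> {0..1}" "\<And>j. j < n ==> c \<notin> (f ^^ j) ` I"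
 shows "inj_on (f ^^ n) I"
 using assms(3)
proof (induct n)
 case (Suc n)
 let ?S = "(f ^^ n) ` I"
 have s: "?S \<subseteq> {0..1}" using fn_rng assms(2) by blast
 have i: "is_interval ?S" by (rule fn_interval[OF assms(1)])
 have "c \<notin> ?S" using Suc(2)[of n] by simp
 hence "?S \<subseteq> {0..c} \<or> ?S \<subseteq> {c..1}"
  using i s unfolding is_interval_1 by (smt (verit) atLeastAtMost_iff subset_iff)
 hence "inj_on f ?S" using f_inj_L f_inj_R inj_on_subset by blast
 moreover have "inj_on (f ^^ n) I" using Suc by simp
 ultimately show ?case using comp_inj_on[of "f ^^ n" I f] by (simp add: o_def)
qed simp

text \<open>If \<open>f ^^ (m * i)\<close> moves \<open>z\<close> up but
  \<open>f ^^ (m * Suc i)\<close> does not, then \<open>f ^^ (m * i)\<close> moves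
  \<open>(f ^^ m) z\<close> down, and the intermediate value theorem yields a fixed point of it
  between the two.\<close>

lemma no_periodic_push:
 assumes I: "0 <= a" "b <= 1" and np: "\<And>x n. x \<in> {a<..<b} ==> n >= 1 ==> (f ^^ n) x ~= x"
  and m: "m >= 1" and z: "z \<in> {a<..<b}" and w: "(f ^^ m) z \<in> {a<..<b}"
 shows "z < (f ^^ m) z ==> i >= 1 ==> z < (f ^^ (m * i)) z"
  and "z > (f ^^ m) z ==> i >= 1 ==> z > (f ^^ (m * i)) z"
proof -
 have mi: "m * k >= 1" if "k >= 1" for k using m that by simp
 show "z < (f ^^ (m * i)) z" if zz: "z < (f ^^ m) z" "i >= 1"
  using that(2)
 proof (induct i rule: nat_induct_at_least)
  case base show ?case using zz by simp
 next
  case (Suc i)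
  show ?case
  proof (rule ccontr)
   assume n: "\<not> z < (f ^^ (m * Suc i)) z"
   let ?h = "\<lambda>x. (f ^^ (m * i)) x - x"
   have "?h ((f ^^ m) z) <= 0" using n zz by (simp add: iter_add[symmetric] add.commute)
   moreover have "0 <= ?h z" using Suc by simp
   ultimately have "\<exists>x\<ge>z. x <= (f ^^ m) z \<and> ?h x = 0"
    using zz by (intro IVT2' continuous_intros fn_cont) auto
   thus False using np[OF _ mi[of i]] z w Suc by (metis eq_iff_diff_eq_0 greaterThanLessThan_iff le_less_trans less_le_trans)
  qed
 qed
 show "z > (f ^^ (m * i)) z" if zz: "z > (f ^^ m) z" "i >= 1"
  using that(2)
 proof (induct i rule: nat_induct_at_least)
  case base show ?case using zz by simp
 next
  case (Suc i)
  show ?case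
  proof (rule ccontr)
   assume n: "\<not> z > (f ^^ (m * Suc i)) z"
   let ?h = "\<lambda>x. (f ^^ (m * i)) x - x"
   have "?h ((f ^^ m) z) >= 0" using n zz by (simp add: iter_add[symmetric] add.commute)
   moreover have "0 >= ?h z" using Suc by simp
   ultimately have "\<exists>x\<ge>(f ^^ m) z. x <= z \<and> ?h x = 0"
    using zz by (intro IVT2' continuous_intros fn_cont) auto
   thus False using np[OF _ mi[of i]] z w Suc by (metis eq_iff_diff_eq_0 greaterThanLessThan_iff le_less_trans less_le_trans)
  qed
 qed
qed

text \<open>If \<open>(a, b)\<close> contains no periodic point, then the visits of an orbit to \<open>(a, b)\<close> form a monotone
 sequence, which transitivity forbids.\<close>

lemma periodic_dense:
 assumes I: "0 <= a" "a < b" "b <= 1"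
 shows "\<exists>x n. x \<in> {a<..<b} \<and> n >= 1 \<and> (f ^^ n) x = x"
proof (rule ccontr)
 assume "\<not> ?thesis"
 hence np: "\<And>x n. x \<in> {a<..<b} ==> n >= 1 ==> (f ^^ n) x ~= x" by blast
 from trans[OF I I] obtain m x where m: "m >= 1" "x \<in> {a<..<b}" "(f ^^ m) x \<in> {a<..<b}" by auto
 let ?y = "(f ^^ m) x"
 have ne: "x ~= ?y" using np m by metis
 define e where "e = Min {\<bar>?y - x\<bar> / 4, x - a, b - x, ?y - a, b - ?y}"
 have e: "e > 0" "e <= \<bar>?y - x\<bar> / 4" "e <= x - a" "e <= b - x" "e <= ?y - a" "e <= b - ?y"
 proof -
  have "e \<in> {\<bar>?y - x\<bar> / 4, x - a, b - x, ?y - a, b - ?y}" unfolding e_def by (rule Min_in) auto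
  thus "e > 0" using m ne by auto
  show "e <= \<bar>?y - x\<bar> / 4" "e <= x - a" "e <= b - x" "e <= ?y - a" "e <= b - ?y"
   unfolding e_def by (rule Min_le; simp)+
 qed
 have "continuous (at x) (f ^^ m)" using fn_cont[of UNIV m] by (simp add: continuous_on_eq_continuous_at)
 then obtain d where d: "d > 0" "\<And>x'. \<bar>x' - x\<bar> < d ==> \<bar>(f ^^ m) x' - ?y\<bar> < e"
  using e(1) unfolding continuous_at_eps_delta by (auto simp: dist_real_def)
 define d' where "d' = min d e"
 \<comment> \<open>The target lies strictly between \<open>x\<close> and its return
   \<open>?y\<close>. A point near \<open>x\<close> first jumps across the target to the vicinity of
   \<open>?y\<close> and later comes back into the target, so two iterates push in opposite
   directions.\<close>
 define g h where "g = min x ?y + e" and "h = max x ?y - e"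
 have gh: "0 <= g" "g < h" "h <= 1" using e I by (auto simp: g_def h_def min_def max_def split: if_splits)
 obtain n y where n: "n > m" "y \<in> {x - d'<..<x + d'}" "(f ^^ n) y \<in> {g<..<h}"
  using trans_large[of "x - d'" "x + d'" g h m] gh e d I m unfolding d'_def by fastforce
 let ?w = "(f ^^ m) y"
 have w: "\<bar>?w - ?y\<bar> < e" using d n by (auto simp: d'_def)
 have yx: "\<bar>y - x\<bar> < e" using n by (auto simp: d'_def)
 have yI: "y \<in> {a<..<b}" "?w \<in> {a<..<b}" "(f ^^ n) y \<in> {a<..<b}"
  using w yx e n(3) m(2,3) by (auto simp: g_def h_def)
 define k where "k = n - m"
 have k: "k >= 1" "(f ^^ k) ?w = (f ^^ n) y" using n by (auto simp: k_def iter_add[symmetric])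
 have eq: "(f ^^ (k * m)) ?w - ?w = 0 ==> False" "(f ^^ (m * k)) y - y = 0 ==> False"
  using np yI m k by auto
 have km: "k * m >= 1" using k m by simp
 \<comment> \<open>\<open>f ^^ (m * k)\<close> is an iterate of \<open>f ^^ m\<close> and of
   \<open>f ^^ k\<close>, so it inherits the direction of the first at \<open>y\<close> and that of
   the second at \<open>?w\<close>; these are opposite.\<close>
 let ?H = "\<lambda>x. (f ^^ (m * k)) x - x"
 show False
 proof (cases "x < ?y")
  case True
  have "y < ?w" using w yx e(1,2) True by (auto simp: abs_real_def split: if_splits)
  hence A: "?H y > 0" using no_periodic_push(1)[OF I(1,3) np m(1) yI(1,2) _ k(1)] by simp
  have "(f ^^ k) ?w < ?w" using k(2) n(3) w True unfolding h_def by auto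
  hence B: "?H ?w < 0" using no_periodic_push(2)[OF I(1,3) np k(1) yI(2) _ _ m(1)] k yI by (simp add: mult.commute)
  have "\<exists>x\<ge>y. x <= ?w \<and> ?H x = 0" using A B \<open>y < ?w\<close> by (intro IVT2' continuous_intros fn_cont) auto
  thus False using np[of _ "m * k"] km yI by (auto simp: mult.commute)
 next
  case False
  have "?w < y" using w yx e(1,2) False by (auto simp: abs_real_def split: if_splits)
  hence A: "?H y < 0" using no_periodic_push(2)[OF I(1,3) np m(1) yI(1,2) _ k(1)] by simp
  have "(f ^^ k) ?w > ?w" using k(2) n(3) w False unfolding g_def by auto
  hence B: "?H ?w > 0" using no_periodic_push(1)[OF I(1,3) np k(1) yI(2) _ _ m(1)] k yI by (simp add: mult.commute)
  have "\<exists>x\<ge>?w. x <= y \<and> ?H x = 0" using A B \<open>?w < y\<close> by (intro IVT2' continuous_intros fn_cont) auto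
  thus False using np[of _ "m * k"] km yI by (auto simp: mult.commute)
 qed
qed

end

text \<open>Makes constants found for finitely many grid cells valid for all intervals of a given
  length.\<close>

lemma grid_cell:
 assumes "0 <= a" "b <= 1" "2 / real k < b - a" "0 < k"
 shows "\<exists>i<k. a <= real i / real k \<and> real (Suc i) / real k <= b"
proof -
 define i where "i = nat \<lceil>a * real k\<rceil>"
 have i: "a * real k <= real i" "real i < a * real k + 1"
  using assms unfolding i_def by (auto simp: of_nat_ceiling real_nat_ceiling_ge) linarith
 have "2 < (b - a) * real k" using assms by (simp add: field_simps)
 hence b: "real (Suc i) < b * real k" using i by (simp add: algebra_simps)
 moreover have "b * real k <= real k" using assms by simp
 ultimately have "i < k" by simp
 thus ?thesis using i b assms by (intro exI[of _ i]) (auto simp: field_simps)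
qed

context transitive_unimodal
begin

text \<open>Otherwise every iterate is injective on the interval. Between two periodic points with
  common period \<open>K\<close>, \<open>f ^^ K\<close> is increasing, so its only periodic points
  there are fixed points. As periodic points are dense it is the identity, with derivative 1,
  against \<open>repelling\<close>.\<close>

lemma no_homterval:
 assumes I: "0 <= a" "a < b" "b <= 1"
 shows "\<exists>n. c \<in> (f ^^ n) ` {a<..<b}"
proof (rule ccontr)
 assume "\<not> ?thesis"
 hence nc: "\<And>n. c \<notin> (f ^^ n) ` {a<..<b}" by blast
 have inj: "inj_on (f ^^ n) {a<..<b}" for n
  by (rule inj_iter) (use I nc in \<open>auto simp: is_interval_oo\<close>)
 obtain u p where u: "u \<in> {a<..<(a+b)/2}" "p >= 1" "(f ^^ p) u = u"
  using periodic_dense[of a "(a+b)/2"] I by auto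
 obtain v q where v: "v \<in> {(a+b)/2<..<b}" "q >= 1" "(f ^^ q) v = v"
  using periodic_dense[of "(a+b)/2" b] I by auto
 define K where "K = p * q"
 let ?H = "f ^^ K"
 have K: "K >= 1" using u v by (simp add: K_def)
 have Hu: "?H u = u" using periodic_iter_mult[OF u(3)] by (simp add: K_def)
 have Hv: "?H v = v" using periodic_iter_mult[OF v(3), of p] by (simp add: K_def mult.commute)
 have uv: "a < u" "u < v" "v < b" using u v by auto
 have sub: "inj_on ?H {s..t}" if "u <= s" "t <= v" for s t
  by (rule inj_on_subset[OF inj[of K]]) (use uv that in auto)
 have between: "u < ?H x \<and> ?H x < v" if "u < x" "x < v" for x
  using continuous_inj_imp_mono[OF that fn_cont sub] Hu Hv uv by auto
 have mono: "?H s < ?H t" if "u < s" "s < t" "t < v" for s t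
  using continuous_inj_imp_mono[OF that(1,2) fn_cont sub] Hu between[of t] that by auto
 have fixed: "?H x = x" if x: "u < x" "x < v" and k: "k >= 1" "(f ^^ k) x = x" for x k
 proof -
  have kk: "(f ^^ (K * k)) x = x" using periodic_iter_mult[OF k(2), of K] by (simp add: mult.commute)
  have A: "u < (f ^^ (K * i)) x \<and> (f ^^ (K * i)) x < v" for i
  proof (induct i)
   case (Suc i) thus ?case using between[of "(f ^^ (K * i)) x"] by (simp add: iter_add)
  qed (use x in simp)
  have B: "x < (f ^^ (K * i)) x" if "x < ?H x" "i >= 1" for i
   using that(2)
  proof (induct i rule: nat_induct_at_least)
   case (Suc i)
   have "?H x < ?H ((f ^^ (K * i)) x)" using mono A[of i] Suc x by auto
   thus ?case using that by (simp add: iter_add)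
  qed (use that in simp)
  have C: "(f ^^ (K * i)) x < x" if "?H x < x" "i >= 1" for i
   using that(2)
  proof (induct i rule: nat_induct_at_least)
   case (Suc i)
   have "?H ((f ^^ (K * i)) x) < ?H x" using mono A[of i] Suc x by auto
   thus ?case using that by (simp add: iter_add)
  qed (use that in simp)
  show ?thesis using B[of k] C[of k] kk k by (metis less_irrefl linorder_neqE)
 qed
 have id: "?H x = x" if x: "u < x" "x < v" for x
 proof (rule ccontr)
  assume ne: "?H x ~= x"
  have "open {y. ?H y ~= y}" using fn_cont[of UNIV K] by (intro open_Collect_neq continuous_intros)
  hence "open ({y. ?H y ~= y} \<inter> {u<..<v})" by auto
  moreover have "x \<in> {y. ?H y ~= y} \<inter> {u<..<v}" using ne x by auto
  ultimately obtain e where e: "e > 0" "ball x e \<subseteq> {y. ?H y ~= y} \<inter> {u<..<v}" by (meson openE)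
  have "x - e/2 \<in> ball x e" "x + e/2 \<in> ball x e" using e by (auto simp: dist_real_def)
  hence "x - e/2 \<in> {u<..<v}" "x + e/2 \<in> {u<..<v}" using e(2) by blast+
  hence "u < x - e/2" "x + e/2 < v" by auto
  then obtain y k where y: "y \<in> {x - e/2<..<x + e/2}" "k >= 1" "(f ^^ k) y = y"
   using periodic_dense[of "x - e/2" "x + e/2"] e uv I by auto
  hence "y \<in> ball x e" by (auto simp: dist_real_def)
  hence "y \<in> {y. ?H y ~= y} \<inter> {u<..<v}" using e(2) by blast
  thus False using fixed[of y k] y by simp
 qed
 define x where "x = (u + v) / 2"
 have x: "u < x" "x < v" using uv by (auto simp: x_def)
 have x01: "0 < x" "x < 1" using uv x I by auto
 have "(?H has_real_derivative 1) (at x)"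
  by (rule has_field_derivative_transform_within_open[of "\<lambda>x. x" 1 x "{u<..<v}"]) (use x id in auto)
 hence "Df K x = 1" using fn_der_at[OF x01, of K] DERIV_unique by blast
 thus False using repelling[of x K] K id[OF x] x01 by (simp add: Df_def)
qed

text \<open>A long interval contains one of finitely many grid cells, and by
  \<open>no_homterval\<close> each cell covers \<open>c\<close> after some number of steps.\<close>

lemma shrink:
 assumes "e > 0"
 shows "\<exists>n. \<forall>a b. 0 <= a \<and> a < b \<and> b <= 1 \<and> (\<forall>j<n. c \<notin> (f ^^ j) ` {a<..<b}) --> b - a <= e"
proof -
 obtain k :: nat where k: "k > 0" "2 / real k < e"
  using reals_Archimedean2[of "2 / e"] assms by (metis divide_less_eq gr0I mult.commute not_numeral_less_zero of_nat_0 of_nat_0_less_iff pos_divide_less_eq divide_pos_pos zero_less_numeral less_trans)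
 have "\<forall>i<k. \<exists>n. c \<in> (f ^^ n) ` {real i / k<..<real (Suc i) / k}"
 proof (intro allI impI no_homterval)
  fix i assume "i < k"
  thus "0 <= real i / k" "real i / k < real (Suc i) / k" "real (Suc i) / k <= 1"
   by (auto simp: field_simps)
 qed
 then obtain N where N: "\<And>i. i < k ==> c \<in> (f ^^ N i) ` {real i / k<..<real (Suc i) / k}" by metis
 show ?thesis
 proof (intro exI[of _ "Suc (\<Sum>i<k. N i)"] allI impI)
  fix a b assume H: "0 <= a \<and> a < b \<and> b <= 1 \<and> (\<forall>j<Suc (\<Sum>i<k. N i). c \<notin> (f ^^ j) ` {a<..<b})"
  show "b - a <= e"
  proof (rule ccontr)
   assume "\<not> b - a <= e"
   then obtain i where i: "i < k" "a <= real i / real k" "real (Suc i) / real k <= b"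
    using grid_cell[of a b k] H k by auto
   hence "c \<in> (f ^^ N i) ` {a<..<b}" using N[of i] by fastforce
   moreover have "N i < Suc (\<Sum>i<k. N i)" using i member_le_sum[of i "{..<k}" N] by auto
   ultimately show False using H by blast
  qed
 qed
qed

text \<open>Each grid cell contains two distinct periodic points. Their orbits never merge, and the
  distance between them runs through finitely many positive values.\<close>

lemma no_shrink:
 assumes "d > 0"
 shows "\<exists>h>0. \<forall>a b n. 0 <= a \<and> b <= 1 \<and> d <= b - a -->
  (\<exists>x\<in>{a..b}. \<exists>y\<in>{a..b}. h <= \<bar>(f ^^ n) x - (f ^^ n) y\<bar>)"
proof -
 obtain k :: nat where k: "k > 0" "2 / real k < d"
  using reals_Archimedean2[of "2 / d"] assms by (metis divide_less_eq gr0I mult.commute not_numeral_less_zero of_nat_0 of_nat_0_less_iff pos_divide_less_eq divide_pos_pos zero_less_numeral less_trans)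
 have "\<forall>i<k. \<exists>h>0. \<exists>u\<in>{real i / k..real (Suc i) / k}. \<exists>v\<in>{real i / k..real (Suc i) / k}. \<forall>n. h <= \<bar>(f ^^ n) u - (f ^^ n) v\<bar>"
 proof (intro allI impI)
  fix i assume i: "i < k"
  define a b where "a = real i / k" and "b = real (Suc i) / k"
  have I: "0 <= a" "a < b" "b <= 1" using i by (auto simp: field_simps a_def b_def)
  obtain u p where u: "u \<in> {a<..<(a+b)/2}" "p >= 1" "(f ^^ p) u = u"
   using periodic_dense[of a "(a+b)/2"] I by auto
  obtain v q where v: "v \<in> {(a+b)/2<..<b}" "q >= 1" "(f ^^ q) v = v"
   using periodic_dense[of "(a+b)/2" b] I by auto
  define K where "K = p * q"
  have K: "K >= 1" using u v by (simp add: K_def)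
  have Hu: "(f ^^ K) u = u" using periodic_iter_mult[OF u(3)] by (simp add: K_def)
  have Hv: "(f ^^ K) v = v" using periodic_iter_mult[OF v(3), of p] by (simp add: K_def mult.commute)
  define h where "h = Min ((\<lambda>j. \<bar>(f ^^ j) u - (f ^^ j) v\<bar>) ` {..<K})"
  have "(f ^^ j) u ~= (f ^^ j) v" if "j < K" for j
  proof
   assume "(f ^^ j) u = (f ^^ j) v"
   hence "(f ^^ (K - j + j)) u = (f ^^ (K - j + j)) v" by (simp only: iter_add)
   hence "u = v" using Hu Hv that by simp
   thus False using u v by auto
  qed
  hence "h > 0" using K unfolding h_def by (subst Min_gr_iff) (auto simp: lessThan_empty_iff)
  moreover have "h <= \<bar>(f ^^ n) u - (f ^^ n) v\<bar>" for n
  proof -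
   have "h <= \<bar>(f ^^ (n mod K)) u - (f ^^ (n mod K)) v\<bar>" unfolding h_def using K by (intro Min_le) auto
   thus ?thesis using funpow_mod_eq[OF Hu, of n] funpow_mod_eq[OF Hv, of n] by simp
  qed
  moreover have "u \<in> {a..b}" "v \<in> {a..b}" using u v by auto
  ultimately show "\<exists>h>0. \<exists>u\<in>{real i / k..real (Suc i) / k}. \<exists>v\<in>{real i / k..real (Suc i) / k}. \<forall>n. h <= \<bar>(f ^^ n) u - (f ^^ n) v\<bar>"
   unfolding a_def b_def by blast
 qed
 then obtain h where h: "\<And>i. i < k ==> h i > 0 \<and> (\<exists>u\<in>{real i / k..real (Suc i) / k}. \<exists>v\<in>{real i / k..real (Suc i) / k}. \<forall>n. h i <= \<bar>(f ^^ n) u - (f ^^ n) v\<bar>)"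
  by metis
 define m where "m = Min (h ` {..<k})"
 have "m > 0" using h k unfolding m_def by (subst Min_gr_iff) (auto simp: lessThan_empty_iff)
 moreover have "\<exists>x\<in>{a..b}. \<exists>y\<in>{a..b}. m <= \<bar>(f ^^ n) x - (f ^^ n) y\<bar>" if ab: "0 <= a" "b <= 1" "d <= b - a" for a b n
 proof -
  obtain i where i: "i < k" "a <= real i / real k" "real (Suc i) / real k <= b"
   using grid_cell[of a b k] ab k by auto
  have "m <= h i" unfolding m_def using i by auto
  thus ?thesis using h[OF i(1)] i by (smt (verit, best) atLeastAtMost_iff)
 qed
 ultimately show ?thesis by blast
qed

section \<open>The critical value and the orbits of the end points\<close>

lemma fc_01: "f c \<in> {0, 1}"
 using f_ext f_surj[of 0] f_surj[of 1] f_rng[of c] by (metis antisym atLeastAtMost_iff insertCI zero_le_one order_refl)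

text \<open>The end point of the unit interval that is not the critical value.\<close>

definition e2 :: real where "e2 = 1 - f c"

lemma f_eq_fc: "x \<in> {0..1} ==> f x = f c \<longleftrightarrow> x = c"
 using f_inj_L f_inj_R c01 unfolding inj_on_def by (metis atLeastAtMost_iff linear order_refl order.strict_implies_order)

text \<open>\<open>e2\<close> is an extreme value of \<open>f\<close>, so an interior preimage would
  be a critical point, hence \<open>c\<close>, whose value is the other end point.\<close>

lemma preimage_e2: "x \<in> {0..1} ==> f x = e2 ==> x \<in> {0, 1}"
proof (rule ccontr)
 assume x: "x \<in> {0..1}" "f x = e2" "x \<notin> {0, 1}"
 hence i: "0 < x" "x < 1" by auto
 have d: "(f has_real_derivative f1 x) (at x)" using f_der[OF x(1)] at_within_interior[of x "{0..1}"] i by auto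
 have "(\<forall>y. \<bar>x - y\<bar> < 1 --> f y <= f x) \<or> (\<forall>y. \<bar>x - y\<bar> < 1 --> f x <= f y)"
  using x(2) fc_01 f_rng by (auto simp: e2_def)
 hence "f1 x = 0" using DERIV_local_max[OF d, of 1] DERIV_local_min[OF d, of 1] by auto
 hence "x = c" using f1_zero x by blast
 thus False using x fc_01 by (auto simp: e2_def)
qed

lemma e2_fixed_or: "f e2 = e2 \<or> f (f c) = e2"
proof -
 have "e2 \<in> {0..1}" using fc_01 by (auto simp: e2_def)
 then obtain x where "x \<in> {0..1}" "f x = e2" using f_surj by blast
 thus ?thesis using preimage_e2[of x] fc_01 by (auto simp: e2_def)
qed

lemma f_end_ne: "x \<in> {0, 1} ==> f x ~= f c"
 using f_eq_fc[of x] c01 by auto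

lemma end_cases: "x \<in> {0, 1} ==> f x = e2 \<or> (0 < f x \<and> f x < 1)"
 using f_end_ne[of x] fc_01 f_rng[of x] by (auto simp: e2_def)

text \<open>One end point is \<open>f c\<close>; the other is fixed or equals
  \<open>f (f c)\<close>. So whatever the critical orbit avoids inside the interval is avoided by
  the end points as well.\<close>

lemma end_orbit: "x \<in> {0, 1} ==> (f ^^ k) x \<in> {0, 1} \<or> (\<exists>j\<ge>1. (f ^^ k) x = (f ^^ j) c)"
proof -
 assume x: "x \<in> {0, 1}"
 have A: "(f ^^ k) (f c) = (f ^^ Suc k) c" for k by (simp add: funpow_swap1)
 show ?thesis
 proof (cases "x = f c")
  case True thus ?thesis using A[of k] by (metis Suc_leI zero_less_Suc One_nat_def)
 next
  case False
  hence xe: "x = e2" using x fc_01 by (auto simp: e2_def)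
  show ?thesis
  proof (cases "f e2 = e2")
   case True
   hence "(f ^^ k) e2 = e2" by (induct k) auto
   thus ?thesis using xe x by auto
  next
   case False
   hence "e2 = (f ^^ 2) c" using e2_fixed_or by (simp add: numeral_2_eq_2)
   hence "(f ^^ k) x = (f ^^ (k + 2)) c" using xe by (simp only: iter_add)
   thus ?thesis by (metis One_nat_def Suc_leI add_2_eq_Suc' zero_less_Suc)
  qed
 qed
qed

subsection \<open>Nice intervals\<close>

text \<open>A height that identifies the two sides of \<open>c\<close>: equal height means equal
  image, so both ends of a sublevel interval have the same future orbit.\<close>

definition kap :: "real => real" where "kap x = \<bar>f x - f c\<bar>"

lemma kap_cont: "continuous_on S kap"
 unfolding kap_def using f_cont by (intro continuous_intros) (auto intro: continuous_on_subset)

lemma kap_c [simp]: "kap c = 0" by (simp add: kap_def)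

lemma kap_pos: "x \<in> {0..1} ==> x ~= c ==> 0 < kap x"
 using f_eq_fc[of x] by (simp add: kap_def)

lemma f_cont_on: "continuous_on S f" using f_cont continuous_on_subset by blast

lemma kap_L: assumes "0 <= x" "x < y" "y <= c" shows "kap y < kap x"
proof (cases "y = c")
 case True thus ?thesis using kap_pos[of x] assms c01 by simp
next
 case False
 have "inj_on f {x..c}" by (rule inj_on_subset[OF f_inj_L]) (use assms in auto)
 thus ?thesis using continuous_inj_imp_mono[of x y c f] f_cont_on assms False by (auto simp: kap_def)
qed

lemma kap_R: assumes "c <= x" "x < y" "y <= 1" shows "kap x < kap y"
proof (cases "x = c")
 case True thus ?thesis using kap_pos[of y] assms c01 by simp
next
 case False
 have "inj_on f {c..y}" by (rule inj_on_subset[OF f_inj_R]) (use assms in auto)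
 thus ?thesis using continuous_inj_imp_mono[of c x y f] f_cont_on assms False by (auto simp: kap_def)
qed

lemma kap_eq: "kap x = kap y \<longleftrightarrow> f x = f y"
 using fc_01 f_rng[of x] f_rng[of y] by (auto simp: kap_def)

lemma kap_interval:
 assumes r: "0 < r" "r < kap 0" "r < kap 1"
 shows "\<exists>a b. 0 < a \<and> a < c \<and> c < b \<and> b < 1 \<and> kap a = r \<and> kap b = r \<and> (\<forall>x\<in>{0..1}. kap x < r \<longleftrightarrow> a < x \<and> x < b)"
proof -
 obtain a where a: "0 <= a" "a <= c" "kap a = r"
  using IVT2'[of kap c r 0] r c01 kap_cont by auto
 obtain b where b: "c <= b" "b <= 1" "kap b = r"
  using IVT'[of kap c r 1] r c01 kap_cont by auto
 have ne: "a ~= 0" "a ~= c" "b ~= c" "b ~= 1" using a b r by auto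
 have "kap x < r \<longleftrightarrow> a < x \<and> x < b" if x: "x \<in> {0..1}" for x
 proof (cases "x <= c")
  case True
  thus ?thesis using kap_L[of x a] kap_L[of a x] x a b ne by (cases x a rule: linorder_cases) auto
 next
  case False
  thus ?thesis using kap_R[of x b] kap_R[of b x] x a b ne by (cases x b rule: linorder_cases) auto
 qed
 thus ?thesis using a b ne by (intro exI[of _ a] exI[of _ b]) auto
qed

lemma same_image_iter: "f x = f y ==> k >= 1 ==> (f ^^ k) x = (f ^^ k) y"
 by (cases k) (auto simp: funpow_swap1)

text \<open>Take a periodic orbit passing close to \<open>c\<close> and let \<open>r0\<close> be its
  minimal height. The ends of the sublevel interval at \<open>r0\<close> have the same image as a
  point of that orbit, all of whose iterates have height at least \<open>r0\<close>. Closeness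
  \<open>\<delta>\<close> below the distance \<open>d\<close> from \<open>c\<close> to its forward
  orbit keeps that orbit out of the closed interval.\<close>

lemma nice_outer:
 "\<exists>a' b'. 0 < a' \<and> a' < c \<and> c < b' \<and> b' < 1 \<and> kap a' = kap b' \<and>
  (\<forall>x\<in>{0..1}. kap x < kap a' \<longleftrightarrow> a' < x \<and> x < b') \<and>
  (\<forall>k\<ge>1. (f ^^ k) c \<notin> {a'..b'}) \<and> (\<forall>k\<ge>1. (f ^^ k) a' \<notin> {a'<..<b'} \<and> (f ^^ k) b' \<notin> {a'<..<b'})"
proof -
 obtain d where d: "d > 0" "\<And>k. k >= 1 ==> d <= \<bar>(f ^^ k) c - c\<bar>" using crit_nonrec by blast
 define \<delta> where "\<delta> = min (d / 2) (min (c / 2) ((1 - c) / 2))"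
 have dl: "\<delta> > 0" "\<delta> < d" "0 < c - \<delta>" "c + \<delta> < 1" using d c01 by (auto simp: \<delta>_def min_def field_simps)
 define r where "r = min (kap (c - \<delta>)) (kap (c + \<delta>)) / 2"
 have k: "kap (c - \<delta>) > 0" "kap (c + \<delta>) > 0" using kap_pos[of "c - \<delta>"] kap_pos[of "c + \<delta>"] dl by simp_all
 have k': "kap (c - \<delta>) < kap 0" "kap (c + \<delta>) < kap 1" using kap_L[of 0 "c - \<delta>"] kap_R[of "c + \<delta>" 1] dl by auto
 have rb: "0 < r" "r < kap (c - \<delta>)" "r < kap (c + \<delta>)" using k by (auto simp: r_def min_def)
 then obtain a b where ab: "0 < a" "a < c" "c < b" "b < 1" "kap a = r" "kap b = r"
  "\<forall>x\<in>{0..1}. kap x < r \<longleftrightarrow> a < x \<and> x < b"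
  using kap_interval[of r] k' by auto
 obtain z n where z: "z \<in> {a<..<c}" "n >= 1" "(f ^^ n) z = z" using periodic_dense[of a c] ab by auto
 have z01: "z \<in> {0..1}" using z ab by auto
 have nc: "(f ^^ j) z ~= c" for j
 using z iter_comm[of n f j z] d by force
 define r0 where "r0 = Min ((\<lambda>j. kap ((f ^^ j) z)) ` {..<n})"
 have ne: "{..<n} ~= {}" using z by (auto simp: lessThan_empty_iff)
 have "r0 > 0" unfolding r0_def using ne nc fn_rng[OF z01] by (subst Min_gr_iff) (auto intro!: kap_pos)
 moreover have r0_le: "r0 <= kap ((f ^^ j) z)" for j
 proof -
  have "r0 <= kap ((f ^^ (j mod n)) z)" unfolding r0_def using z by (intro Min_le) auto
  thus ?thesis using funpow_mod_eq[OF z(3), of j] by simp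
 qed
 moreover have "kap z < r" using ab z by auto
 ultimately have r0: "0 < r0" "r0 < r" using r0_le[of 0] by auto
 obtain a' b' where ab': "0 < a'" "a' < c" "c < b'" "b' < 1" "kap a' = r0" "kap b' = r0"
  "\<forall>x\<in>{0..1}. kap x < r0 \<longleftrightarrow> a' < x \<and> x < b'"
  using kap_interval[of r0] r0 rb k' by auto
 have "r0 \<in> (\<lambda>j. kap ((f ^^ j) z)) ` {..<n}" unfolding r0_def by (rule Min_in) (use ne in auto)
 then obtain j where j: "kap ((f ^^ j) z) = r0" by (elim imageE) simp
 have A: "(f ^^ k) x \<notin> {a'<..<b'}" if "kap x = r0" "k >= 1" "x \<in> {0..1}" for x k
 proof -
  have "f x = f ((f ^^ j) z)" using that j by (simp add: kap_eq[symmetric])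
  hence "(f ^^ k) x = (f ^^ k) ((f ^^ j) z)" using same_image_iter that by blast
  hence "r0 <= kap ((f ^^ k) x)" using r0_le[of "k + j"] by (simp add: iter_add)
  thus ?thesis using bspec[OF ab'(7) fn_rng[OF that(3), of k]] by auto
 qed
 have l: "c - \<delta> < a'"
 by (smt (verit) kap_L[of a' "c - \<delta>"] ab'(1) dl(1) r0(2) rb(2) ab'(5) ccontr)
 have u: "b' < c + \<delta>"
 by (smt (verit) kap_R[of "c + \<delta>" b'] ab'(4) dl(1) r0(2) rb(3) ab'(6) ccontr)
 have "(f ^^ k) c \<notin> {a'..b'}" if "k >= 1" for k using d(2)[OF that] l u dl by auto
 thus ?thesis using ab' A[of a'] A[of b'] c01 by (intro exI[of _ a'] exI[of _ b']) auto
qed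

text \<open>The inner interval is a sublevel interval through a point \<open>p\<close> that never
  returns to \<open>J'\<close>. Such a point exists: otherwise the first return time is locally
  constant on the connected interval from \<open>a'\<close> to \<open>c\<close>, hence constant, and
  by closure \<open>c\<close> itself would return.\<close>

lemma nice_pair:
 "\<exists>a' a b b'. 0 < a' \<and> a' < a \<and> a < c \<and> c < b \<and> b < b' \<and> b' < 1 \<and>
  (\<forall>k\<ge>1. (f ^^ k) c \<notin> {a'..b'}) \<and> (\<forall>k\<ge>1. (f ^^ k) a \<notin> {a'<..<b'} \<and> (f ^^ k) b \<notin> {a'<..<b'})"
proof -
 obtain a' b' where ab': "0 < a'" "a' < c" "c < b'" "b' < 1" "kap a' = kap b'"
  "\<And>x. x\<in>{0..1} ==> kap x < kap a' \<longleftrightarrow> a' < x \<and> x < b'"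
  "\<And>k. k>=1 ==> (f ^^ k) c \<notin> {a'..b'}" "\<And>k. k>=1 ==> (f ^^ k) a' \<notin> {a'<..<b'} \<and> (f ^^ k) b' \<notin> {a'<..<b'}"
  using nice_outer by blast
 have "\<exists>p\<in>{a'<..<c}. \<forall>k\<ge>1. (f ^^ k) p \<notin> {a'<..<b'}"
 proof (rule ccontr)
  assume "\<not> ?thesis"
  hence ret: "\<exists>k\<ge>1. (f ^^ k) p \<in> {a'<..<b'}" if "p \<in> {a'<..<c}" for p using that by blast
  define V where "V n = {x \<in> {a'<..<c}. (f ^^ n) x \<in> {a'<..<b'} \<and> (\<forall>j\<in>{1..<n}. (f ^^ j) x \<notin> {a'<..<b'})}" for n
  \<comment> \<open>Since the ends of the interval never enter its interior later, a point that
    returns at time \<open>n\<close> cannot pass through them before; so avoiding the open interval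
    means avoiding the closed one, which is an open condition.\<close>
  have V': "V n = {a'<..<c} \<inter> (f ^^ n) -` {a'<..<b'} \<inter> (\<Inter>j\<in>{1..<n}. (f ^^ j) -` (- {a'..b'}))" for n
  proof -
   have "(f ^^ j) x \<notin> {a'..b'}" if "j \<in> {1..<n}" "(f ^^ j) x \<notin> {a'<..<b'}" "(f ^^ n) x \<in> {a'<..<b'}" for j x
   proof
    assume "(f ^^ j) x \<in> {a'..b'}"
    hence "(f ^^ j) x = a' \<or> (f ^^ j) x = b'" using that by auto
    moreover have "(f ^^ n) x = (f ^^ (n - j)) ((f ^^ j) x)" using that by (simp add: iter_add[symmetric])
    ultimately show False using ab'(8)[of "n - j"] that(1,3) by (auto simp: Suc_le_eq)
   qed
   hence "x \<in> V n \<longleftrightarrow> x \<in> {a'<..<c} \<and> (f ^^ n) x \<in> {a'<..<b'} \<and> (\<forall>j\<in>{1..<n}. (f ^^ j) x \<notin> {a'..b'})" for x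
    unfolding V_def mem_Collect_eq by (meson greaterThanLessThan_subseteq_atLeastAtMost_iff order_refl subsetD)
   thus ?thesis by (intro set_eqI) (simp only: Int_iff vimage_eq INT_iff Compl_iff, blast)
  qed
  have ov: "open ((f ^^ j) -` S)" if "open S" for j S
   using that fn_cont[of UNIV j] by (intro continuous_open_vimage) (auto simp: continuous_on_eq_continuous_at)
  have "open (\<Inter>j\<in>{1..<n}. (f ^^ j) -` (- {a'..b'}))" for n
   by (intro open_INT ballI ov) (simp_all add: open_Compl)
  hence Vo: "open (V n)" for n unfolding V' by (intro open_Int ov) simp_all
  have cov: "x \<in> (\<Union>n\<in>{1..}. V n)" if x: "x \<in> {a'<..<c}" for x
  proof -
   define n where "n = (LEAST k. k >= 1 \<and> (f ^^ k) x \<in> {a'<..<b'})"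
   have "n >= 1 \<and> (f ^^ n) x \<in> {a'<..<b'}" unfolding n_def by (rule LeastI_ex[OF ret[OF x]])
   moreover have "(f ^^ j) x \<notin> {a'<..<b'}" if "j \<in> {1..<n}" for j
   proof -
    have "\<not> (j >= 1 \<and> (f ^^ j) x \<in> {a'<..<b'})" using that unfolding n_def by (intro not_less_Least) simp
    thus ?thesis using that by simp
   qed
   ultimately have "x \<in> V n" "n \<in> {1..}" using x unfolding V_def by simp_all
   thus ?thesis by blast
  qed
  have disj: "V n \<inter> V m = {}" if "n ~= m" "n >= 1" "m >= 1" for n m
   using that unfolding V_def by (cases n m rule: linorder_cases) auto
  define x0 where "x0 = (a' + c) / 2"
  have x0: "x0 \<in> {a'<..<c}" using ab' by (auto simp: x0_def)
  then obtain n where n: "n >= 1" "x0 \<in> V n" using cov by auto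
  let ?W = "\<Union>m\<in>{1..}-{n}. V m"
  have "open ?W" using Vo by auto
  moreover have "{a'<..<c} \<subseteq> V n \<union> ?W" using cov by blast
  moreover have "V n \<inter> ?W \<inter> {a'<..<c} = {}"
  proof -
   have "V n \<inter> V m = {}" if "m \<in> {1..} - {n}" for m using disj[of n m] that n(1) by auto
   thus ?thesis by blast
  qed
  moreover have "V n \<inter> {a'<..<c} ~= {}" using n x0 by auto
  ultimately have "?W \<inter> {a'<..<c} = {}" using connectedD[of "{a'<..<c}" "V n" ?W] Vo[of n] connected_Ioo by blast
  hence all: "(f ^^ n) x \<in> {a'<..<b'}" if "x \<in> {a'<..<c}" for x
  proof -
   have "x \<in> V n" using cov[OF that] that \<open>?W \<inter> {a'<..<c} = {}\<close> by blast
   thus ?thesis by (simp add: V_def)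
  qed
  have "closed ((f ^^ n) -` {a'..b'})"
   using fn_cont[of UNIV n] by (intro continuous_closed_vimage) (auto simp: continuous_on_eq_continuous_at)
  moreover have "{a'<..<c} \<subseteq> (f ^^ n) -` {a'..b'}" using all by fastforce
  ultimately have "closure {a'<..<c} \<subseteq> (f ^^ n) -` {a'..b'}" by (rule closure_minimal[rotated])
  moreover have "c \<in> closure {a'<..<c}" using ab' by simp
  ultimately have "(f ^^ n) c \<in> {a'..b'}" by blast
  thus False using ab'(7)[OF n(1)] by simp
 qed
 then obtain p where p: "p \<in> {a'<..<c}" "\<And>k. k >= 1 ==> (f ^^ k) p \<notin> {a'<..<b'}" by blast
 have "kap p < kap a'" using p ab' by auto
 moreover have "kap a' < kap 0" "kap b' < kap 1" using kap_L[of 0 a'] kap_R[of b' 1] ab' by auto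
 moreover have "0 < kap p" using p ab' c01 by (intro kap_pos) auto
 ultimately obtain a b where ab: "0 < a" "a < c" "c < b" "b < 1" "kap a = kap p" "kap b = kap p"
  using kap_interval[of "kap p"] ab' by auto
 have "a' < a" "b < b'" using ab'(6)[of a] ab'(6)[of b] ab \<open>kap p < kap a'\<close> by auto
 moreover have "(f ^^ k) a \<notin> {a'<..<b'} \<and> (f ^^ k) b \<notin> {a'<..<b'}" if "k >= 1" for k
 by (metis ab same_image_iter[OF _ that] p(2)[OF that] kap_eq _)
 ultimately show ?thesis using ab(2,3) ab'(1,4,7) by blast
qed

end

subsection \<open>Negative Schwarzian derivative\<close>

text \<open>\<open>N\<close> plays the role of the nonlinearity \<open>D'/D\<close> of a map with derivative \<open>D\<close>; the hypothesis
 \<open>N' \<le> N\<^sup>2/2\<close> says that its Schwarzian derivative is nonpositive, i.e. that \<open>|D|\<^sup>-\<^sup>1\<^sup>/\<^sup>2\<close> is convex.\<close>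

lemma schwarzian_minimum_principle:
 fixes D N N' :: "real => real"
 assumes D: "\<And>x. s < x ==> x < t ==> (D has_real_derivative D x * N x) (at x)"
  and N: "\<And>x. s < x ==> x < t ==> (N has_real_derivative N' x) (at x)"
  and S: "\<And>x. s < x ==> x < t ==> N' x <= (N x)\<^sup>2 / 2"
  and nz: "\<And>x. s < x ==> x < t ==> D x ~= 0"
  and o: "s < y" "y < x" "x < z" "z < t"
 shows "min \<bar>D y\<bar> \<bar>D z\<bar> <= \<bar>D x\<bar>"
proof (rule ccontr)
 assume "\<not> ?thesis"
 hence less: "\<bar>D x\<bar> < \<bar>D y\<bar>" "\<bar>D x\<bar> < \<bar>D z\<bar>" by auto
 \<comment> \<open>This is \<open>|D|\<close> to the power -1/2, and \<open>w\<close> is its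
   derivative. A violation would make \<open>u\<close> larger at \<open>x\<close> than at
   \<open>y\<close> and \<open>z\<close>, so \<open>w\<close> would change from positive to
   negative, although it is nondecreasing.\<close>
 define u where "u = (\<lambda>x. exp (- ln ((D x)\<^sup>2) / 4))"
 define w where "w = (\<lambda>x. - u x * N x / 2)"
 have u_pos: "u x > 0" for x by (simp add: u_def)
 have du: "(u has_real_derivative w x) (at x)" if "s < x" "x < t" for x
 proof -
  have "0 < D x * D x" using nz[OF that] by (metis not_real_square_gt_zero)
  thus ?thesis unfolding u_def w_def
   by (auto intro!: derivative_eq_intros D[OF that] simp: field_simps power2_eq_square)
 qed
 have dw: "(w has_real_derivative (u x * ((N x)\<^sup>2 / 4 - N' x / 2))) (at x)" if "s < x" "x < t" for x
 proof -
  have "((\<lambda>x. - u x * N x / 2) has_real_derivative (- w x * N x + N' x * - u x) / 2) (at x)"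
   by (rule DERIV_cdivide) (rule derivative_eq_intros du[OF that] N[OF that] refl)+
  moreover have "(- w x * N x + N' x * - u x) / 2 = u x * ((N x)\<^sup>2 / 4 - N' x / 2)"
   unfolding w_def power2_eq_square by (simp add: field_simps)
  ultimately show ?thesis unfolding w_def by metis
 qed
 have mono: "w p <= w q" if "s < p" "p <= q" "q < t" for p q
 proof (rule DERIV_nonneg_imp_nondecreasing[OF that(2)])
  fix x assume x: "p <= x" "x <= q"
  hence "u x * ((N x)\<^sup>2 / 4 - N' x / 2) >= 0" using S[of x] u_pos[of x] that by (intro mult_nonneg_nonneg) auto
  thus "\<exists>y. (w has_real_derivative y) (at x) \<and> 0 <= y" using dw[of x] x that by auto
 qed
 have u_less: "u p < u q" if "\<bar>D q\<bar> < \<bar>D p\<bar>" "D q ~= 0" for p q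
 proof -
  have "(D q)\<^sup>2 < (D p)\<^sup>2" using that by (simp add: abs_le_square_iff[symmetric] not_le[symmetric])
  thus ?thesis using that by (simp add: u_def)
 qed
 obtain p where p: "y < p" "p < x" "u x - u y = (x - y) * w p"
  using MVT2[of y x u w] du o by (meson less_trans order.strict_trans1 order.strict_trans2)
 obtain q where q: "x < q" "q < z" "u z - u x = (z - x) * w q"
  using MVT2[of x z u w] du o by (meson less_trans order.strict_trans1 order.strict_trans2)
 have "u y < u x" "u z < u x" using u_less less nz[of x] o by auto
 hence "0 < w p" "w q < 0" using p q by (smt (verit) mult_le_0_iff, smt (verit) mult_nonneg_nonneg)
 thus False using mono[of p q] p q o by simp
qed

text \<open>While \<open>N\<close> is positive, \<open>-1 / N\<close> grows at rate at least 1/2, so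
  a value above \<open>2 / (t - x)\<close> would blow up before \<open>t\<close>. The inequality for
  \<open>N'\<close> is the one satisfied by inverse branches.\<close>

lemma koebe_nonlinearity_upper:
 fixes N N' :: "real => real"
 assumes N: "\<And>x. s < x ==> x < t ==> (N has_real_derivative N' x) (at x)"
  and S: "\<And>x. s < x ==> x < t ==> (N x)\<^sup>2 / 2 <= N' x"
  and x: "s < x" "x < t"
 shows "N x <= 2 / (t - x)"
proof (rule ccontr)
 assume "\<not> ?thesis"
 hence big: "2 / (t - x) < N x" by simp
 hence pos: "N x > 0" using x by (smt (verit) divide_pos_pos)
 have mono: "N x <= N y" if "x <= y" "y < t" for y
 proof (rule DERIV_nonneg_imp_nondecreasing[OF that(1)])
  fix z assume z: "x <= z" "z <= y"
  have "0 <= N' z" using S[of z] z x that by (smt (verit) divide_nonneg_nonneg zero_le_power2)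
  thus "\<exists>y. (N has_real_derivative y) (at z) \<and> 0 <= y" using N[of z] z x that by auto
 qed
 define y where "y = x + 2 / N x"
 have y: "x < y" "y < t" using pos big x by (auto simp: y_def field_simps)
 have npos: "N z > 0" if "x <= z" "z <= y" for z using mono[of z] pos that y by auto
 have "\<exists>z. x < z \<and> z < y \<and> (- 1 / N y) - (- 1 / N x) = (y - x) * (N' z / (N z)\<^sup>2)"
 proof (rule MVT2[OF y(1)])
  fix z assume z: "x <= z" "z <= y"
  show "((\<lambda>x. - 1 / N x) has_real_derivative N' z / (N z)\<^sup>2) (at z)"
   using npos[OF z] z x y by (auto intro!: derivative_eq_intros N simp: field_simps power2_eq_square)
 qed
 then obtain z where z: "x < z" "z < y" "(- 1 / N y) - (- 1 / N x) = (y - x) * (N' z / (N z)\<^sup>2)" by blast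
 have "1 / 2 <= N' z / (N z)\<^sup>2" using S[of z] npos[of z] z x y by (simp add: field_simps)
 hence "(y - x) * (1/2) <= (y - x) * (N' z / (N z)\<^sup>2)" using y by (intro mult_left_mono) auto
 hence "0 <= - 1 / N y" using z by (simp add: y_def field_simps)
 thus False using npos[of y] y by (simp add: divide_le_0_iff)
qed

lemma koebe_nonlinearity_lower:
 fixes N N' :: "real => real"
 assumes N: "\<And>x. s < x ==> x < t ==> (N has_real_derivative N' x) (at x)"
  and S: "\<And>x. s < x ==> x < t ==> (N x)\<^sup>2 / 2 <= N' x"
  and x: "s < x" "x < t"
 shows "- (2 / (x - s)) <= N x"
proof -
 have "- N (- (- x)) <= 2 / (- s - (- x))"
 proof (rule koebe_nonlinearity_upper[of "- t" "- s" "\<lambda>x. - N (- x)" "\<lambda>x. N' (- x)"])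
  fix y assume y: "- t < y" "y < - s"
  have "((\<lambda>y. N (- y)) has_real_derivative N' (- y) * (- 1)) (at y)"
   by (rule DERIV_chain2[where f = N]) (use N[of "- y"] y in \<open>auto intro!: derivative_eq_intros\<close>)
  thus "((\<lambda>x. - N (- x)) has_real_derivative N' (- y)) (at y)" using DERIV_minus by fastforce
  show "(- N (- y))\<^sup>2 / 2 <= N' (- y)" using S[of "- y"] y by simp
 qed (use x in auto)
 thus ?thesis by simp
qed

locale nice_unimodal = transitive_unimodal +
 fixes f2 f3 :: "real => real" and a' a b b' :: real
 assumes f1_der: "\<And>x. x \<in> {0..1} - {c} ==> (f1 has_real_derivative f2 x) (at x within {0..1} - {c})"
  and f2_der: "\<And>x. x \<in> {0..1} - {c} ==> (f2 has_real_derivative f3 x) (at x within {0..1} - {c})"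
  and schwarz: "\<And>x. x \<in> {0..1} - {c} ==> f3 x / f1 x - 3 / 2 * (f2 x / f1 x)\<^sup>2 < 0"
  and ab: "0 < a'" "a' < a" "a < c" "c < b" "b < b'" "b' < 1"
  and crit_avoid: "\<And>k. k >= 1 ==> (f ^^ k) c \<notin> {a'..b'}"
  and bd_avoid: "\<And>k. k >= 1 ==> (f ^^ k) a \<notin> {a'<..<b'} \<and> (f ^^ k) b \<notin> {a'<..<b'}"
begin

definition J :: "real set" where "J = {a<..<b}"
definition J' :: "real set" where "J' = {a'<..<b'}"

lemma J_sub: "J \<subseteq> J'" "J' \<subseteq> {0<..<1}" "c \<in> J" using ab by (auto simp: J_def J'_def)

lemma end_avoid: "x \<in> {0, 1} ==> (f ^^ k) x \<notin> J'"
proof -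
 assume "x \<in> {0, 1}"
 then consider "(f ^^ k) x \<in> {0, 1}" | j where "j >= 1" "(f ^^ k) x = (f ^^ j) c" using end_orbit[of x k] by blast
 thus ?thesis
 proof cases
  case 1 thus ?thesis using ab by (auto simp: J'_def)
 next
  case 2 thus ?thesis using crit_avoid[of j] by (auto simp: J'_def)
 qed
qed

text \<open>The end points are the extreme values of \<open>f\<close>, attained in the interior at
  most at \<open>c\<close>. Hence orbits off \<open>c\<close> stay where \<open>f1\<close> and
  \<open>f2\<close> have two-sided derivatives.\<close>

lemma interior_iter:
 assumes "0 < x" "x < 1" "\<And>j. j < n ==> (f ^^ j) x ~= c"
 shows "0 < (f ^^ n) x \<and> (f ^^ n) x < 1"
 using assms(3)
proof (induct n)
 case (Suc n)
 let ?y = "(f ^^ n) x"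
 have y: "0 < ?y \<and> ?y < 1" "?y ~= c" using Suc by auto
 hence "f ?y ~= f c" "f ?y ~= e2" using f_eq_fc[of ?y] preimage_e2[of ?y] by auto
 thus ?case using fc_01 f_rng[of ?y] by (auto simp: e2_def)
qed (use assms in simp)

text \<open>The nonlinearity of \<open>f\<close>; in terms of it, negative Schwarzian derivative
  means that \<open>Nf'\<close> is below half the square of \<open>Nf\<close>.\<close>

definition Nf :: "real => real" where "Nf x = f2 x / f1 x"
definition Nf' :: "real => real" where "Nf' x = f3 x / f1 x - (f2 x / f1 x)\<^sup>2"

lemma der_int:
 assumes "0 < x" "x < 1" "x ~= c"
 shows "(f has_real_derivative f1 x) (at x)" "(f1 has_real_derivative f2 x) (at x)"
  "(f2 has_real_derivative f3 x) (at x)" "f1 x ~= 0"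
  "(f1 has_real_derivative f1 x * Nf x) (at x)"
  "(Nf has_real_derivative Nf' x) (at x)" "Nf' x <= (Nf x)\<^sup>2 / 2"
proof -
 have "x \<in> {0<..<1} - {c}" "open ({0<..<1} - {c})" "{0<..<1} - {c} \<subseteq> {0..1} - {c}" using assms by auto
 hence "x \<in> interior ({0..1} - {c})" by (meson interior_maximal subsetD)
 hence w: "at x within ({0..1} - {c}) = at x" by (rule at_within_interior)
 show fd: "(f has_real_derivative f1 x) (at x)"
  using f_der[of x] at_within_interior[of x "{0..1}"] assms by auto
 show d1: "(f1 has_real_derivative f2 x) (at x)" and d2: "(f2 has_real_derivative f3 x) (at x)"
  using f1_der[of x] f2_der[of x] assms w by auto
 show nz: "f1 x ~= 0" using f1_zero[of x] assms by auto
 thus "(f1 has_real_derivative f1 x * Nf x) (at x)" using d1 by (simp add: Nf_def)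
 show "(Nf has_real_derivative Nf' x) (at x)" unfolding Nf_def Nf'_def
  using nz by (auto intro!: derivative_eq_intros d1 d2 simp: field_simps power2_eq_square)
 show "Nf' x <= (Nf x)\<^sup>2 / 2" using schwarz[of x] assms by (simp add: Nf_def Nf'_def)
qed

lemma Df_nonzero: "x \<in> {0..1} ==> (\<And>j. j < n ==> (f ^^ j) x ~= c) ==> Df n x ~= 0"
 unfolding Df_def using f1_zero fn_rng by (auto simp: prod_zero_iff)

text \<open>Nonlinearities add along a composition, the outer one weighted by the inner derivative.
  The inequality survives because the cross term in the square equals the one produced by
  differentiating the weight.\<close>

lemma Df_nonlinearity:
 assumes st: "0 <= s" "t <= 1" and nc: "\<And>j x. j < n ==> s < x ==> x < t ==> (f ^^ j) x ~= c"
 shows "\<exists>N N'. \<forall>x. s < x \<and> x < t --> (Df n has_real_derivative Df n x * N x) (at x) \<and>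
  (N has_real_derivative N' x) (at x) \<and> N' x <= (N x)\<^sup>2 / 2"
 using nc
proof (induct n)
 case 0
 show ?case by (rule exI[of _ "\<lambda>_. 0"], rule exI[of _ "\<lambda>_. 0"]) (simp add: Df_def)
next
 case (Suc n)
 then obtain N N' where N: "\<And>x. s < x \<and> x < t ==> (Df n has_real_derivative Df n x * N x) (at x) \<and>
  (N has_real_derivative N' x) (at x) \<and> N' x <= (N x)\<^sup>2 / 2" by (metis less_Suc_eq)
 let ?F = "f ^^ n"
 let ?M = "\<lambda>x. N x + Nf (?F x) * Df n x"
 let ?M' = "\<lambda>x. N' x + (Nf' (?F x) * (Df n x)\<^sup>2 + Nf (?F x) * (Df n x * N x))"
 show ?case
 proof (rule exI[of _ ?M], rule exI[of _ ?M'], intro allI impI)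
  fix x assume x: "s < x \<and> x < t"
  have x01: "0 < x" "x < 1" using x st by auto
  have y: "0 < ?F x" "?F x < 1" "?F x ~= c"
   using interior_iter[OF x01, of n] Suc(2) x by auto
  have dF: "(?F has_real_derivative Df n x) (at x)" by (rule fn_der_at[OF x01])
  note dn = N[OF x, THEN conjunct1] and dN = N[OF x, THEN conjunct2, THEN conjunct1]
  have d1: "((\<lambda>x. f1 (?F x)) has_real_derivative (f1 (?F x) * Nf (?F x)) * Df n x) (at x)"
   by (rule DERIV_chain2[OF der_int(5)[OF y] dF])
  have d2: "((\<lambda>x. Nf (?F x)) has_real_derivative Nf' (?F x) * Df n x) (at x)"
   by (rule DERIV_chain2[OF der_int(6)[OF y] dF])
  have A: "(Df (Suc n) has_real_derivative Df (Suc n) x * ?M x) (at x)"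
   unfolding Df_Suc[abs_def] by (rule derivative_eq_intros d1 dn refl)+ (simp add: algebra_simps)
  have B: "(?M has_real_derivative ?M' x) (at x)"
   by (rule derivative_eq_intros d2 dn dN refl)+ (simp add: algebra_simps power2_eq_square)
  have "Nf' (?F x) * (Df n x)\<^sup>2 <= (Nf (?F x))\<^sup>2 / 2 * (Df n x)\<^sup>2"
   using der_int(7)[OF y] by (intro mult_right_mono) auto
  hence C: "?M' x <= (?M x)\<^sup>2 / 2" using N[OF x] by (simp add: power2_eq_square algebra_simps)
  show "(Df (Suc n) has_real_derivative Df (Suc n) x * ?M x) (at x) \<and> (?M has_real_derivative ?M' x) (at x) \<and> ?M' x <= (?M x)\<^sup>2 / 2"
   using A B C by blast
 qed
qed

lemma Df_min_principle:
 assumes st: "0 <= s" "t <= 1" and nc: "\<And>j x. j < n ==> s < x ==> x < t ==> (f ^^ j) x ~= c"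
  and o: "s < y" "y < x" "x < z" "z < t"
 shows "min \<bar>Df n y\<bar> \<bar>Df n z\<bar> <= \<bar>Df n x\<bar>"
proof -
 obtain N N' where N: "\<And>x. s < x ==> x < t ==> (Df n has_real_derivative Df n x * N x) (at x)"
  "\<And>x. s < x ==> x < t ==> (N has_real_derivative N' x) (at x)"
  "\<And>x. s < x ==> x < t ==> N' x <= (N x)\<^sup>2 / 2"
  using Df_nonlinearity[OF st nc] by metis
 show ?thesis
 proof (rule schwarzian_minimum_principle[OF N _ o])
  fix x assume "s < x" "x < t"
  thus "Df n x ~= 0" using Df_nonzero[of x n] nc st by auto
 qed
qed

end

lemma iter_diff: "j <= n ==> (f ^^ (n - j)) ((f ^^ j) x) = (f ^^ n) x"
 by (simp add: iter_add[symmetric])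

lemma iter_Suc_swap: "(f ^^ n) (f x) = (f ^^ Suc n) x"
 by (simp add: funpow_swap1)

context nice_unimodal
begin

section \<open>Uniform expansion along orbits that avoid the nice interval\<close>

lemma f1_lower_off_J: "\<exists>m>0. m <= 1 \<and> (\<forall>x\<in>{0..1} - J. m <= \<bar>f1 x\<bar>)"
proof -
 let ?K = "{0..1} - J"
 have cK: "compact ?K" unfolding J_def by (intro compact_diff) auto
 moreover have "0 \<in> ?K" using ab by (auto simp: J_def)
 moreover have "continuous_on ?K (\<lambda>x. \<bar>f1 x\<bar>)" using f1_cont by (intro continuous_intros) (auto intro: continuous_on_subset)
 ultimately obtain x where x: "x \<in> ?K" "\<And>y. y \<in> ?K ==> \<bar>f1 x\<bar> <= \<bar>f1 y\<bar>"
  using continuous_attains_inf[of ?K "\<lambda>x. \<bar>f1 x\<bar>"] by blast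
 have "\<bar>f1 x\<bar> > 0" using f1_zero[of x] x J_sub by auto
 thus ?thesis using x by (intro exI[of _ "min 1 \<bar>f1 x\<bar>"]) force
qed

definition mJ :: real where "mJ = (SOME m. m > 0 \<and> m <= 1 \<and> (\<forall>x\<in>{0..1} - J. m <= \<bar>f1 x\<bar>))"

lemma mJ: "mJ > 0" "mJ <= 1" "\<And>x. x \<in> {0..1} ==> x \<notin> J ==> mJ <= \<bar>f1 x\<bar>"
proof -
 have "mJ > 0 \<and> mJ <= 1 \<and> (\<forall>x\<in>{0..1} - J. mJ <= \<bar>f1 x\<bar>)"
  unfolding mJ_def by (rule someI_ex[OF f1_lower_off_J])
 thus "mJ > 0" "mJ <= 1" "\<And>x. x \<in> {0..1} ==> x \<notin> J ==> mJ <= \<bar>f1 x\<bar>" by auto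
qed

lemma Df_lower_pow:
 assumes "x \<in> {0..1}" "\<And>j. j < n ==> (f ^^ j) x \<notin> J"
 shows "mJ ^ n <= \<bar>Df n x\<bar>"
 using assms(2)
proof (induct n)
 case (Suc n)
 have "mJ * mJ ^ n <= \<bar>f1 ((f ^^ n) x)\<bar> * \<bar>Df n x\<bar>"
  using Suc mJ fn_rng[OF assms(1)] by (intro mult_mono) auto
 thus ?case by (simp add: Df_Suc abs_mult)
qed simp

lemma between_image:
 assumes "x <= y" "z \<in> {min (g x) (g y)..max (g x) (g y)}" "continuous_on {x..y} (g :: real => real)"
 shows "\<exists>t\<in>{x..y}. g t = z"
proof (cases "g x <= g y")
 case True thus ?thesis using IVT'[of g x z y] assms by auto
next
 case False thus ?thesis using IVT2'[of g y z x] assms by auto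
qed

text \<open>A point whose one-sided monotonicity interval is bounded by a preimage of \<open>c\<close> sees a large
 derivative nearby: that interval is short by \<open>shrink\<close> but its image is long by \<open>no_shrink\<close>.\<close>

lemma large_derivative_beside:
 assumes "B > 0"
 shows "\<exists>N. \<forall>n\<ge>N. \<forall>x y. 0 <= x \<and> x < y \<and> y <= 1 \<and>
  (\<forall>j<n. \<forall>t. x < t \<and> t < y --> (f ^^ j) t ~= c) \<and>
  (\<exists>j<n. ((f ^^ j) x = c \<and> (f ^^ j) y \<notin> J) \<or> ((f ^^ j) y = c \<and> (f ^^ j) x \<notin> J)) -->
  (\<exists>t. x < t \<and> t < y \<and> B <= \<bar>Df n t\<bar>)"
proof -
 define d where "d = min (c - a) (b - c)"
 have d: "d > 0" using ab by (simp add: d_def)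
 obtain h where h: "h > 0" "\<And>u v n. 0 <= u ==> v <= 1 ==> d <= v - u ==>
  (\<exists>x\<in>{u..v}. \<exists>y\<in>{u..v}. h <= \<bar>(f ^^ n) x - (f ^^ n) y\<bar>)" using no_shrink[OF d] by blast
 have hB: "h / B > 0" using h assms by simp
 obtain N where N: "\<And>u v. 0 <= u ==> u < v ==> v <= 1 ==> (\<forall>j<N. c \<notin> (f ^^ j) ` {u<..<v}) ==> v - u <= h / B"
  using shrink[OF hB] by blast
 show ?thesis
 proof (intro exI[of _ N] allI impI, elim conjE exE)
  fix n x y j assume n: "N <= n" and xy: "0 <= x" "x < y" "y <= 1"
   and nc: "\<forall>j<n. \<forall>t. x < t \<and> t < y --> (f ^^ j) t ~= c"
   and j: "j < n" "((f ^^ j) x = c \<and> (f ^^ j) y \<notin> J) \<or> ((f ^^ j) y = c \<and> (f ^^ j) x \<notin> J)"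
  let ?g = "f ^^ j"
  define u v where "u = min (?g x) (?g y)" and "v = max (?g x) (?g y)"
  have "d <= v - u" using j(2) unfolding u_def v_def d_def J_def by auto
  moreover have "0 <= u" "v <= 1" using fn_rng[of x j] fn_rng[of y j] xy by (auto simp: u_def v_def)
  ultimately obtain p q where pq: "p \<in> {u..v}" "q \<in> {u..v}" "h <= \<bar>(f ^^ (n - j)) p - (f ^^ (n - j)) q\<bar>"
   using h(2) by metis
  obtain p' where p': "p' \<in> {x..y}" "?g p' = p" using between_image[of x y p ?g] pq xy fn_cont by (auto simp: u_def v_def)
  obtain q' where q': "q' \<in> {x..y}" "?g q' = q" using between_image[of x y q ?g] pq xy fn_cont by (auto simp: u_def v_def)
  have big: "h <= \<bar>(f ^^ n) p' - (f ^^ n) q'\<bar>"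
   using pq(3) p'(2) q'(2) iter_diff[of j n f p'] iter_diff[of j n f q'] j(1) by auto
  have "y - x <= h / B"
  proof (rule N[OF xy], intro allI impI notI, elim imageE)
   fix i t assume "i < N" "c = (f ^^ i) t" "t \<in> {x<..<y}"
   thus False using nc n by (metis greaterThanLessThan_iff less_le_trans)
  qed
  obtain s t where st: "s \<in> {x..y}" "t \<in> {x..y}" "s < t" "h <= \<bar>(f ^^ n) t - (f ^^ n) s\<bar>"
  by (smt (verit) big p' q' h abs_minus_commute)
  obtain z where z: "s < z" "z < t" "(f ^^ n) t - (f ^^ n) s = (t - s) * Df n z" using fn_mvt[of s t n] st xy by auto
  have "h <= (t - s) * \<bar>Df n z\<bar>" using st z by (simp add: abs_mult)
  also have "... <= h / B * \<bar>Df n z\<bar>" using st \<open>y - x \<le> h / B\<close> by (intro mult_right_mono) auto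
  finally have "B <= \<bar>Df n z\<bar>" using h assms by (simp add: field_simps)
  thus "\<exists>t. x < t \<and> t < y \<and> B <= \<bar>Df n t\<bar>" using z st by (intro exI[of _ z]) auto
 qed
qed

lemma first_hit_right:
 assumes "x \<in> {0..1}" "\<And>j. j < n ==> (f ^^ j) x ~= c" "\<exists>t\<in>{x..1}. \<exists>j<n. (f ^^ j) t = c"
 shows "\<exists>t j. x < t \<and> t <= 1 \<and> j < n \<and> (f ^^ j) t = c \<and> (\<forall>i<n. \<forall>s. x < s \<and> s < t --> (f ^^ i) s ~= c)"
proof -
 define A where "A = {x..1} \<inter> (\<Union>j\<in>{..<n}. (f ^^ j) -` {c})"
 have "closed ((f ^^ j) -` {c})" for j
  using fn_cont[of UNIV j] by (intro continuous_closed_vimage) (auto simp: continuous_on_eq_continuous_at)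
 hence "compact A" unfolding A_def by (intro compact_Int_closed compact_Icc closed_UN) auto
 moreover have "A ~= {}" using assms(3) by (auto simp: A_def)
 ultimately obtain t where t: "t \<in> A" "\<And>s. s \<in> A ==> t <= s" using compact_attains_inf[of A] by metis
 then obtain j where j: "j < n" "(f ^^ j) t = c" unfolding A_def by blast
 have "x ~= t" using assms(2) j by auto
 moreover have "t \<in> {x..1}" using t(1) by (simp add: A_def)
 moreover have "(f ^^ i) s ~= c" if "i < n" "x < s" "s < t" for i s
 proof
  assume "(f ^^ i) s = c"
  hence "s \<in> A" using that \<open>t \<in> {x..1}\<close> unfolding A_def by auto
  thus False using t(2)[of s] that by simp
 qed
 ultimately show ?thesis using j by (intro exI[of _ t] exI[of _ j]) auto
qed

lemma first_hit_left:
 assumes "x \<in> {0..1}" "\<And>j. j < n ==> (f ^^ j) x ~= c" "\<exists>t\<in>{0..x}. \<exists>j<n. (f ^^ j) t = c"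
 shows "\<exists>t j. t < x \<and> 0 <= t \<and> j < n \<and> (f ^^ j) t = c \<and> (\<forall>i<n. \<forall>s. t < s \<and> s < x --> (f ^^ i) s ~= c)"
proof -
 define A where "A = {0..x} \<inter> (\<Union>j\<in>{..<n}. (f ^^ j) -` {c})"
 have "closed ((f ^^ j) -` {c})" for j
  using fn_cont[of UNIV j] by (intro continuous_closed_vimage) (auto simp: continuous_on_eq_continuous_at)
 hence "compact A" unfolding A_def by (intro compact_Int_closed compact_Icc closed_UN) auto
 moreover have "A ~= {}" using assms(3) by (auto simp: A_def)
 ultimately obtain t where t: "t \<in> A" "\<And>s. s \<in> A ==> s <= t" using compact_attains_sup[of A] by metis
 then obtain j where j: "j < n" "(f ^^ j) t = c" unfolding A_def by blast
 have "x ~= t" using assms(2) j by auto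
 moreover have "t \<in> {0..x}" using t(1) by (simp add: A_def)
 moreover have "(f ^^ i) s ~= c" if "i < n" "t < s" "s < x" for i s
 proof
  assume "(f ^^ i) s = c"
  hence "s \<in> A" using that \<open>t \<in> {0..x}\<close> unfolding A_def by auto
  thus False using t(2)[of s] that by simp
 qed
 ultimately show ?thesis using j by (intro exI[of _ t] exI[of _ j]) auto
qed

text \<open>The monotonicity interval at \<open>x\<close> ends on both sides at preimages of
  \<open>c\<close>; \<open>large_derivative_beside\<close> gives a large derivative on each side,
  and the minimum principle carries it to \<open>x\<close>.\<close>

lemma expand_interior:
 assumes "B > 0"
 shows "\<exists>N. \<forall>n\<ge>N. \<forall>x\<in>{0..1}. (\<forall>j<n. (f ^^ j) x \<notin> J) \<and> (\<exists>t\<in>{x..1}. \<exists>j<n. (f ^^ j) t = c) \<and>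
  (\<exists>t\<in>{0..x}. \<exists>j<n. (f ^^ j) t = c) --> B <= \<bar>Df n x\<bar>"
proof -
 obtain N where N': "\<forall>n\<ge>N. \<forall>x y. 0 <= x \<and> x < y \<and> y <= 1 \<and>
  (\<forall>j<n. \<forall>t. x < t \<and> t < y --> (f ^^ j) t ~= c) \<and>
  (\<exists>j<n. ((f ^^ j) x = c \<and> (f ^^ j) y \<notin> J) \<or> ((f ^^ j) y = c \<and> (f ^^ j) x \<notin> J)) -->
  (\<exists>t. x < t \<and> t < y \<and> B <= \<bar>Df n t\<bar>)" using large_derivative_beside[OF assms] by (elim exE)
 note N = N'[rule_format]
 show ?thesis
 proof (intro exI[of _ N] allI impI ballI, elim conjE)
  fix n x assume n: "N <= n" and x: "x \<in> {0..1}" and av: "\<forall>j<n. (f ^^ j) x \<notin> J"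
   and r: "\<exists>t\<in>{x..1}. \<exists>j<n. (f ^^ j) t = c" and l: "\<exists>t\<in>{0..x}. \<exists>j<n. (f ^^ j) t = c"
  have nc: "(f ^^ j) x ~= c" if "j < n" for j using av that J_sub by auto
  obtain t i where t: "x < t" "t <= 1" "i < n" "(f ^^ i) t = c" "\<forall>i<n. \<forall>s. x < s \<and> s < t --> (f ^^ i) s ~= c"
   using first_hit_right[OF x nc r] by blast
  obtain s k where s: "s < x" "0 <= s" "k < n" "(f ^^ k) s = c" "\<forall>i<n. \<forall>u. s < u \<and> u < x --> (f ^^ i) u ~= c"
   using first_hit_left[OF x nc l] by blast
  obtain z where z: "x < z" "z < t" "B <= \<bar>Df n z\<bar>"
  using t(3,4) av x N[OF n, of x t] t(1,2,5) by auto
  obtain y where y: "s < y" "y < x" "B <= \<bar>Df n y\<bar>"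
  using s(3,4) av x N[OF n, of s x] s(1,2,5) by auto
  have "(f ^^ j) u ~= c" if "j < n" "s < u" "u < t" for j u
   using t(5) s(5) nc that by (metis linorder_neqE)
  hence "min \<bar>Df n y\<bar> \<bar>Df n z\<bar> <= \<bar>Df n x\<bar>"
   by (intro Df_min_principle[of s t n y x z]) (use s t y z in auto)
  thus "B <= \<bar>Df n x\<bar>" using y z by auto
 qed
qed

text \<open>Used mostly with an end point \<open>e\<close>: the monotonicity interval at
  \<open>x\<close> then reaches the boundary on that side, where
  \<open>large_derivative_beside\<close> gives nothing and a separate argument is required.\<close>

definition clear :: "nat => real => real => bool" where
 "clear n x e \<longleftrightarrow> (\<forall>j<n. \<forall>t\<in>{min x e..max x e}. (f ^^ j) t ~= c)"

lemma clear_step: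
 assumes "clear (i + n) x e"
 shows "clear n ((f ^^ i) x) ((f ^^ i) e)"
 unfolding clear_def
proof (intro allI impI ballI)
 fix j t assume j: "j < n" and t: "t \<in> {min ((f ^^ i) x) ((f ^^ i) e)..max ((f ^^ i) x) ((f ^^ i) e)}"
 have "\<exists>u\<in>{min x e..max x e}. (f ^^ i) u = t"
  using between_image[of "min x e" "max x e" t "f ^^ i"] t fn_cont by (auto simp: min_def max_def split: if_splits)
 then obtain u where u: "u \<in> {min x e..max x e}" "(f ^^ i) u = t" by blast
 have "(f ^^ (j + i)) u ~= c" using assms u(1) j unfolding clear_def by auto
 thus "(f ^^ j) t ~= c" using u by (simp add: iter_add)
qed

lemma clear_close:
 assumes "r > 0"
 shows "\<exists>N. \<forall>x\<in>{0..1}. \<forall>e\<in>{0..1}. \<forall>n\<ge>N. clear n x e --> \<bar>x - e\<bar> <= r"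
proof -
 obtain N where N: "\<And>u v. 0 <= u ==> u < v ==> v <= 1 ==> (\<forall>j<N. c \<notin> (f ^^ j) ` {u<..<v}) ==> v - u <= r"
  using shrink[OF assms] by blast
 have "\<bar>x - e\<bar> <= r" if "x \<in> {0..1}" "e \<in> {0..1}" "n >= N" "clear n x e" for x e n
 proof (cases "x = e")
  case False
  have "max x e - min x e <= r"
  proof (rule N, goal_cases)
   case 4
   show ?case
   proof (intro allI impI notI, elim imageE)
    fix i t assume "i < N" "c = (f ^^ i) t" "t \<in> {min x e<..<max x e}"
    thus False using that(3,4) unfolding clear_def by (metis atLeastAtMost_iff greaterThanLessThan_iff less_imp_le less_le_trans)
   qed
  qed (use that False in auto)
  thus ?thesis by auto
 qed (use assms in auto)
 thus ?thesis by blast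
qed

definition expand_at :: "real => bool" where
 "expand_at e \<longleftrightarrow> (\<forall>B>0. \<exists>N. \<forall>n\<ge>N. \<forall>x\<in>{0..1}. (\<forall>j<n. (f ^^ j) x \<notin> J) \<and> clear n x e --> B <= \<bar>Df n x\<bar>)"

text \<open>While at least \<open>N2\<close> steps remain, the stretch between the orbit and
  \<open>e\<close> is still clear, hence short, and the orbit feels the repelling derivative at
  \<open>e\<close>. The last \<open>N2\<close> steps lose at most the factor
  \<open>mJ ^ N2\<close>.\<close>

lemma expand_at_fixed:
 assumes e: "e \<in> {0, 1}" "f e = e"
 shows "expand_at e"
 unfolding expand_at_def
proof (intro allI impI)
 fix B :: real assume B: "B > 0"
 have e01: "e \<in> {0..1}" using e by auto
 have "\<bar>f1 e\<bar> > 1" using repelling[of e 1] e by auto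
 define l where "l = (1 + \<bar>f1 e\<bar>) / 2"
 have l: "1 < l" "l < \<bar>f1 e\<bar>" using \<open>\<bar>f1 e\<bar> > 1\<close> by (auto simp: l_def)
 have "continuous_on {0..1} (\<lambda>x. \<bar>f1 x\<bar>)" using f1_cont by (intro continuous_intros)
 then obtain r where r: "r > 0" "\<And>y. y \<in> {0..1} ==> \<bar>y - e\<bar> < r ==> \<bar>\<bar>f1 y\<bar> - \<bar>f1 e\<bar>\<bar> < \<bar>f1 e\<bar> - l"
  using e01 l unfolding continuous_on_iff dist_real_def by (meson diff_gt_0_iff_gt)
 obtain N2 where N2: "\<And>x n. x \<in> {0..1} ==> n >= N2 ==> clear n x e ==> \<bar>x - e\<bar> <= r / 2"
  using clear_close[of "r / 2"] r e01 by (metis half_gt_zero)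
 have fe: "(f ^^ i) e = e" for i using e by (induct i) auto
 obtain k where k: "B / mJ ^ N2 < l ^ k" using real_arch_pow[OF l(1)] by blast
 show "\<exists>N. \<forall>n\<ge>N. \<forall>x\<in>{0..1}. (\<forall>j<n. (f ^^ j) x \<notin> J) \<and> clear n x e --> B <= \<bar>Df n x\<bar>"
 proof (intro exI[of _ "N2 + k"] allI impI ballI, elim conjE)
  fix n x assume n: "N2 + k <= n" and x: "x \<in> {0..1}" and av: "\<forall>j<n. (f ^^ j) x \<notin> J" and cl: "clear n x e"
  define m where "m = n - N2"
  have m: "n = N2 + m" "k <= m" using n by (auto simp: m_def)
  have f1big: "l <= \<bar>f1 ((f ^^ i) x)\<bar>" if "i < m" for i
  proof -
   have "clear (n - i) ((f ^^ i) x) e" using clear_step[of i "n - i" x e] cl that m fe by auto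
   hence "\<bar>(f ^^ i) x - e\<bar> <= r / 2" using N2[OF fn_rng[OF x], of "n - i" i] that m by simp
   thus ?thesis using r(2)[OF fn_rng[OF x, of i]] r(1) by auto
  qed
  have "l ^ i <= \<bar>Df i x\<bar>" if "i <= m" for i
   using that
  proof (induct i)
   case (Suc i)
   have "l * l ^ i <= \<bar>f1 ((f ^^ i) x)\<bar> * \<bar>Df i x\<bar>" using Suc f1big[of i] l by (intro mult_mono) auto
   thus ?case by (simp add: Df_Suc abs_mult)
  qed simp
  hence A: "l ^ m <= \<bar>Df m x\<bar>" by simp
  have "(f ^^ j) ((f ^^ m) x) \<notin> J" if "j < N2" for j
   using av m that by (metis add_less_cancel_right iter_add)
  hence Bd: "mJ ^ N2 <= \<bar>Df N2 ((f ^^ m) x)\<bar>" using Df_lower_pow[OF fn_rng[OF x], of N2 m] by blast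
  have "B <= mJ ^ N2 * l ^ k" using k mJ(1) by (simp add: field_simps)
  also have "... <= mJ ^ N2 * l ^ m" using m l mJ by (intro mult_left_mono power_increasing) auto
  also have "... <= \<bar>Df N2 ((f ^^ m) x)\<bar> * \<bar>Df m x\<bar>" using A Bd l mJ by (intro mult_mono) auto
  also have "... = \<bar>Df n x\<bar>" using m Df_add[of N2 m x] by (simp add: abs_mult)
  finally show "B <= \<bar>Df n x\<bar>" .
 qed
qed

lemma expand_step:
 assumes x: "x \<in> {0..1}" "\<forall>j<Suc n. (f ^^ j) x \<notin> J" and B: "B / mJ <= \<bar>Df n (f x)\<bar>"
 shows "B <= \<bar>Df (Suc n) x\<bar>"
proof -
 have "B = B / mJ * mJ" using mJ by simp
 also have "... <= \<bar>Df n (f x)\<bar> * \<bar>f1 x\<bar>" using B mJ(1) mJ(3)[of x] x by (intro mult_mono) auto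
 also have "... = \<bar>Df (Suc n) x\<bar>" using Df_add[of n 1 x] by (simp add: Df_def abs_mult)
 finally show ?thesis .
qed

text \<open>After one step the point is close to the interior point \<open>f e\<close>. A clear
  stretch up to 0 or 1 would be too long, so preimages of \<open>c\<close> lie on both sides and
  \<open>expand_interior\<close> applies to \<open>f x\<close>.\<close>

lemma expand_at_interior:
 assumes e: "e \<in> {0, 1}" "0 < f e" "f e < 1"
 shows "expand_at e"
 unfolding expand_at_def
proof (intro allI impI)
 fix B :: real assume B: "B > 0"
 have e01: "e \<in> {0..1}" using e by auto
 define r where "r = min (f e) (1 - f e) / 3"
 have r: "r > 0" "3 * r <= f e" "3 * r <= 1 - f e" using e by (auto simp: r_def)
 have Bm: "B / mJ > 0" using B mJ by simp
 obtain N1 where N1: "\<And>n x. n >= N1 ==> x \<in> {0..1} ==> (\<forall>j<n. (f ^^ j) x \<notin> J) ==> (\<exists>t\<in>{x..1}. \<exists>j<n. (f ^^ j) t = c) ==>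
  (\<exists>t\<in>{0..x}. \<exists>j<n. (f ^^ j) t = c) ==> B / mJ <= \<bar>Df n x\<bar>" using expand_interior[OF Bm] by (elim exE) blast
 obtain N2 where N2: "\<And>x y n. x \<in> {0..1} ==> y \<in> {0..1} ==> n >= N2 ==> clear n x y ==> \<bar>x - y\<bar> <= r"
  using clear_close[OF r(1)] by metis
 have f01: "f y \<in> {0..1}" for y using f_rng by auto
 show "\<exists>N. \<forall>n\<ge>N. \<forall>x\<in>{0..1}. (\<forall>j<n. (f ^^ j) x \<notin> J) \<and> clear n x e --> B <= \<bar>Df n x\<bar>"
 proof (intro exI[of _ "Suc (N1 + N2)"] allI impI ballI, elim conjE)
  fix n x assume n: "Suc (N1 + N2) <= n" and x: "x \<in> {0..1}" and av: "\<forall>j<n. (f ^^ j) x \<notin> J" and cl: "clear n x e"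
  obtain m where m: "n = Suc m" "m >= N1" "m >= N2" using n by (cases n) auto
  have "clear m (f x) (f e)" using clear_step[of 1 m x e] cl m by simp
  hence close: "\<bar>f x - f e\<bar> <= r" using N2[OF f01 f01 m(3)] by blast
  have av': "\<forall>j<m. (f ^^ j) (f x) \<notin> J" using av m unfolding iter_Suc_swap by blast
  have R: "\<exists>t\<in>{f x..1}. \<exists>j<m. (f ^^ j) t = c"
  proof (rule ccontr)
   assume "\<not> ?thesis"
   hence "clear m (f x) 1" using f01[of x] by (auto simp: clear_def)
   hence "\<bar>f x - 1\<bar> <= r" using N2[OF f01 _ m(3), of 1] by auto
   thus False using close r by auto
  qed
  have L: "\<exists>t\<in>{0..f x}. \<exists>j<m. (f ^^ j) t = c"
  proof (rule ccontr)
   assume "\<not> ?thesis"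
   hence "clear m (f x) 0" using f01[of x] by (auto simp: clear_def)
   hence "\<bar>f x - 0\<bar> <= r" using N2[OF f01 _ m(3), of 0] by auto
   thus False using close r by auto
  qed
  have "B / mJ <= \<bar>Df m (f x)\<bar>" by (rule N1[OF m(2) f01 av' R L])
  thus "B <= \<bar>Df n x\<bar>" using expand_step[of x m B] x av m by auto
 qed
qed

text \<open>In the remaining case \<open>f e = e2\<close>, one step reduces the claim to
  \<open>e2\<close>, which is fixed or has an interior image.\<close>

lemma expand_at_end: "e \<in> {0, 1} ==> expand_at e"
proof -
 assume e: "e \<in> {0, 1}"
 have e2: "e2 \<in> {0, 1}" using fc_01 by (auto simp: e2_def)
 have E2: "expand_at e2" using end_cases[OF e2] expand_at_fixed[OF e2] expand_at_interior[OF e2] by blast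
 show ?thesis
 proof (cases "0 < f e \<and> f e < 1")
  case True thus ?thesis using expand_at_interior[OF e] by blast
 next
  case False
  hence fe: "f e = e2" using end_cases[OF e] by blast
  show ?thesis unfolding expand_at_def
  proof (intro allI impI)
   fix B :: real assume B: "B > 0"
   hence "B / mJ > 0" using mJ by simp
   then obtain N where N: "\<And>n x. n >= N ==> x \<in> {0..1} ==> (\<forall>j<n. (f ^^ j) x \<notin> J) ==> clear n x e2 ==> B / mJ <= \<bar>Df n x\<bar>"
    using E2 unfolding expand_at_def by metis
   show "\<exists>N. \<forall>n\<ge>N. \<forall>x\<in>{0..1}. (\<forall>j<n. (f ^^ j) x \<notin> J) \<and> clear n x e --> B <= \<bar>Df n x\<bar>"
   proof (intro exI[of _ "Suc N"] allI impI ballI, elim conjE)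
    fix n x assume n: "Suc N <= n" and x: "x \<in> {0..1}" and av: "\<forall>j<n. (f ^^ j) x \<notin> J" and cl: "clear n x e"
    obtain m where m: "n = Suc m" "m >= N" using n by (cases n) auto
    have "clear m (f x) e2" using clear_step[of 1 m x e] cl m fe by simp
    moreover have "\<forall>j<m. (f ^^ j) (f x) \<notin> J" using av m unfolding iter_Suc_swap by blast
    moreover have "f x \<in> {0..1}" using f_rng by auto
    ultimately have "B / mJ <= \<bar>Df m (f x)\<bar>" using N m by blast
    thus "B <= \<bar>Df n x\<bar>" using expand_step[of x m B] x av m by auto
   qed
  qed
 qed
qed

text \<open>A form of Mane's theorem on hyperbolicity away from the critical point. The cases are
  whether the monotonicity interval at \<open>x\<close> is bounded by preimages of \<open>c\<close>
  on both sides, reaches 0, or reaches 1.\<close>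

theorem expand_off_J:
 assumes B: "B > 0"
 shows "\<exists>N. \<forall>n\<ge>N. \<forall>x\<in>{0..1}. (\<forall>j<n. (f ^^ j) x \<notin> J) --> B <= \<bar>Df n x\<bar>"
proof -
 obtain N0 where N0: "\<And>n x. n >= N0 ==> x \<in> {0..1} ==> (\<forall>j<n. (f ^^ j) x \<notin> J) ==> (\<exists>t\<in>{x..1}. \<exists>j<n. (f ^^ j) t = c) ==>
  (\<exists>t\<in>{0..x}. \<exists>j<n. (f ^^ j) t = c) ==> B <= \<bar>Df n x\<bar>" using expand_interior[OF B] by (elim exE) blast
 obtain N1 where N1: "\<And>n x. n >= N1 ==> x \<in> {0..1} ==> (\<forall>j<n. (f ^^ j) x \<notin> J) ==> clear n x 0 ==> B <= \<bar>Df n x\<bar>"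
  using expand_at_end[of 0] B unfolding expand_at_def by (metis insertI1)
 obtain N2 where N2: "\<And>n x. n >= N2 ==> x \<in> {0..1} ==> (\<forall>j<n. (f ^^ j) x \<notin> J) ==> clear n x 1 ==> B <= \<bar>Df n x\<bar>"
  using expand_at_end[of 1] B unfolding expand_at_def by (metis insertI1 insert_commute)
 show ?thesis
 proof (intro exI[of _ "N0 + N1 + N2"] allI impI ballI)
  fix n x assume n: "N0 + N1 + N2 <= n" and x: "x \<in> {0..1}" and av: "\<forall>j<n. (f ^^ j) x \<notin> J"
  have "clear n x 1" if "\<not> (\<exists>t\<in>{x..1}. \<exists>j<n. (f ^^ j) t = c)" using that x by (auto simp: clear_def)
  moreover have "clear n x 0" if "\<not> (\<exists>t\<in>{0..x}. \<exists>j<n. (f ^^ j) t = c)" using that x by (auto simp: clear_def)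
  ultimately show "B <= \<bar>Df n x\<bar>" using N0[of n x] N1[of n x] N2[of n x] n x av by (metis add_leE)
 qed
qed

end

lemma power_div_le:
 fixes q :: real assumes q: "0 < q" "q < 1" and m: "m >= 1"
 shows "q ^ (k div m) <= (1 / q) * (q powr (1 / real m)) ^ k"
proof -
 have "real k = real m * real (k div m) + real (k mod m)" by (metis mult_div_mod_eq of_nat_add of_nat_mult)
 moreover have "real (k mod m) <= real m" using m by simp
 ultimately have "real k / real m <= real (k div m) + 1" using m by (simp add: field_simps)
 hence "q powr (real (k div m) + 1) <= q powr (real k / real m)" using q by (intro powr_mono') auto
 moreover have "q powr (real (k div m) + 1) = q ^ (k div m) * q" using q by (simp add: powr_add powr_realpow)
 moreover have "q powr (real k / real m) = (q powr (1 / real m)) powr real k" by (simp add: powr_powr)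
 moreover have "(q powr (1 / real m)) powr real k = (q powr (1 / real m)) ^ k" using q by (intro powr_realpow) simp
 ultimately have "q ^ (k div m) * q <= (q powr (1 / real m)) ^ k" by simp
 thus ?thesis using q by (simp add: field_simps)
qed

lemma block_decay:
 fixes z :: "nat => real"
 assumes dec: "\<And>k. z (Suc k) <= z k" and blk: "\<And>k. z (k + m) <= q * z k" and q: "0 < q" "q < 1" and m: "m >= 1" and z0: "z 0 <= 1"
  and nn: "\<And>k. 0 <= z k"
 shows "\<exists>C \<gamma>. C > 0 \<and> 0 < \<gamma> \<and> \<gamma> < 1 \<and> (\<forall>k. z k <= C * \<gamma> ^ k)"
proof -
 have A: "z (m * i) <= q ^ i" for i
 proof (induct i)
  case (Suc i)
  have "z (m * Suc i) <= q * z (m * i)" using blk[of "m * i"] by (simp add: add.commute)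
  also have "... <= q * q ^ i" using Suc q by (intro mult_left_mono) auto
  finally show ?case by simp
 qed (use z0 in simp)
 have "z k <= (1 / q) * (q powr (1 / real m)) ^ k" for k
 proof -
  have "z k <= z (m * (k div m))" using decseqD[OF decseq_SucI[of z, OF dec], of "m * (k div m)" k] by simp
  also have "... <= q ^ (k div m)" by (rule A)
  also have "... <= (1 / q) * (q powr (1 / real m)) ^ k" by (rule power_div_le[OF q m])
  finally show ?thesis .
 qed
 moreover have "q powr (1 / real m) < 1" using powr_less_mono2[of "1 / real m" q 1] q m by simp
 ultimately show ?thesis using q by (intro exI[of _ "1 / q"] exI[of _ "q powr (1 / real m)"]) auto
qed

context nice_unimodal
begin

subsection \<open>Points avoiding the nice interval\<close>

definition Z :: "nat => real set" where "Z k = {x \<in> {0..1}. \<forall>j<k. (f ^^ j) x \<notin> J}"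

definition Sd :: "bool => real set" where "Sd s = (if s then {0..a} else {b..1})"

definition Wd :: "bool list => real set" where "Wd w = {x \<in> {0..1}. \<forall>j<length w. (f ^^ j) x \<in> Sd (w ! j)}"

text \<open>The property that ends of pieces acquire when they are cut at \<open>a\<close> or
  \<open>b\<close> and keep under iteration.\<close>

definition clean :: "real => bool" where "clean y \<longleftrightarrow> (\<forall>i. (f ^^ i) y \<notin> J')"

lemma Sd_sub: "Sd s \<subseteq> {0..1}" "x \<in> Sd s ==> x \<notin> J" using ab by (auto simp: Sd_def J_def split: if_splits)

lemma Sd_cover: "x \<in> {0..1} ==> x \<notin> J \<longleftrightarrow> x \<in> Sd True \<or> x \<in> Sd False"
 by (auto simp: Sd_def J_def)

lemma Sd_disj: "Sd True \<inter> Sd False = {}" using ab by (auto simp: Sd_def)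

lemma clean_f: "clean y ==> clean (f y)"
 unfolding clean_def iter_Suc_swap by blast

lemma clean_bd: "clean (f a)" "clean (f b)" "clean 0" "clean 1"
proof -
 show "clean (f a)" "clean (f b)" unfolding clean_def iter_Suc_swap
  using bd_avoid[of "Suc _"] by (simp_all only: J'_def) simp_all
 show "clean 0" "clean 1" unfolding clean_def using end_avoid by simp_all
qed

lemma Wd_snoc: "Wd (w @ [s]) = {x \<in> Wd w. (f ^^ length w) x \<in> Sd s}"
 by (auto simp: Wd_def nth_append less_Suc_eq)

lemma Z_Suc: "Z (Suc k) \<subseteq> Z k" by (auto simp: Z_def)

lemma Z_Wd: "Z k = (\<Union>w\<in>{w. length w = k}. Wd w)"
proof (induct k)
 case 0 show ?case by (auto simp: Z_def Wd_def)
next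
 case (Suc k)
 have "Z (Suc k) = {x \<in> Z k. (f ^^ k) x \<notin> J}" by (auto simp: Z_def less_Suc_eq)
 also have "... = {x \<in> Z k. (f ^^ k) x \<in> Sd True \<or> (f ^^ k) x \<in> Sd False}"
  using Sd_cover fn_rng by (auto simp: Z_def)
 also have "... = (\<Union>w\<in>{w. length w = k}. Wd (w @ [True]) \<union> Wd (w @ [False]))"
  unfolding Suc by (auto simp: Wd_snoc)
 also have "... = (\<Union>w\<in>{w. length w = Suc k}. Wd w)"
 proof (intro equalityI subsetI)
  fix x assume "x \<in> (\<Union>w\<in>{w. length w = Suc k}. Wd w)"
  then obtain w where w: "length w = Suc k" "x \<in> Wd w" by auto
  then obtain v s where "w = v @ [s]" "length v = k" by (metis length_Suc_conv_rev)
  thus "x \<in> (\<Union>w\<in>{w. length w = k}. Wd (w @ [True]) \<union> Wd (w @ [False]))" using w by (cases s) auto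
 next
  fix x assume "x \<in> (\<Union>w\<in>{w. length w = k}. Wd (w @ [True]) \<union> Wd (w @ [False]))"
  then obtain w s where "length w = k" "x \<in> Wd (w @ [s])" by blast
  thus "x \<in> (\<Union>w\<in>{w. length w = Suc k}. Wd w)" by (intro UN_I[of "w @ [s]"]) auto
 qed
 finally show ?case .
qed

lemma Wd_disj: "length w = length v ==> w ~= v ==> Wd w \<inter> Wd v = {}"
proof (rule ccontr)
 assume l: "length w = length v" "w ~= v" "Wd w \<inter> Wd v ~= {}"
 then obtain x where x: "x \<in> Wd w" "x \<in> Wd v" by blast
 obtain j where j: "j < length w" "w ! j ~= v ! j" using l nth_equalityI by blast
 hence "(f ^^ j) x \<in> Sd (w ! j)" "(f ^^ j) x \<in> Sd (v ! j)" using x l by (auto simp: Wd_def)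
 thus False using j Sd_disj by (cases "w ! j"; cases "v ! j") auto
qed

definition dcut :: real where "dcut = min (a - a') (b' - b)"

lemma dcut_pos: "dcut > 0" using ab by (simp add: dcut_def)

text \<open>Together with \<open>no_shrink\<close> it bounds the length of the image from below
  uniformly, and unlike such a bound it passes to later times at once.\<close>

definition long :: "nat => real => real => bool" where
 "long k s t \<longleftrightarrow> (\<exists>i u v. 0 <= u \<and> v <= 1 \<and> dcut <= v - u \<and> (f ^^ i) ` {u..v} \<subseteq> (f ^^ k) ` {s..t})"

lemma long_Suc: "long k s t ==> long (Suc k) s t"
proof -
 assume "long k s t"
 then obtain i u v where iuv: "0 <= u" "v <= 1" "dcut <= v - u" "(f ^^ i) ` {u..v} \<subseteq> (f ^^ k) ` {s..t}" unfolding long_def by blast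
 have "(f ^^ Suc i) ` {u..v} = f ` ((f ^^ i) ` {u..v})" by (auto simp: image_image)
 also have "... \<subseteq> f ` ((f ^^ k) ` {s..t})" using iuv by blast
 also have "... = (f ^^ Suc k) ` {s..t}" by (auto simp: image_image)
 finally show ?thesis unfolding long_def using iuv by blast
qed

lemma long_cut:
 assumes "0 <= u" "v <= 1" "dcut <= v - u" "{u..v} \<subseteq> (f ^^ k) ` {s..t}"
 shows "long (Suc k) s t"
proof -
 have "(f ^^ 0) ` {u..v} \<subseteq> (f ^^ k) ` {s..t}" using assms by auto
 hence "long k s t" unfolding long_def using assms by blast
 thus ?thesis by (rule long_Suc)
qed

definition good_piece :: "nat => real => real => bool" where
 "good_piece k s t \<longleftrightarrow> 0 <= s \<and> s < t \<and> t <= 1 \<and> (\<forall>x\<in>{s..t}. \<forall>j<k. (f ^^ j) x \<notin> J) \<and>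
  clean ((f ^^ k) s) \<and> clean ((f ^^ k) t) \<and> long k s t"

lemma good_inj: "good_piece k s t ==> inj_on (f ^^ k) {s..t}"
 by (rule inj_iter) (use J_sub in \<open>auto simp: good_piece_def is_interval_cc\<close>)

lemma good_mono:
 assumes "good_piece k s t"
 shows "(\<forall>x\<in>{s..t}. \<forall>y\<in>{s..t}. x < y --> (f ^^ k) x < (f ^^ k) y) \<or>
    (\<forall>x\<in>{s..t}. \<forall>y\<in>{s..t}. x < y --> (f ^^ k) y < (f ^^ k) x)"
using injective_eq_monotone_map[of "{s..t}" "f ^^ k"] good_inj[OF assms] fn_cont is_interval_cc by (auto simp: monotone_on_def)

text \<open>When the image of a piece meets \<open>J\<close> it crosses \<open>J'\<close> completely, since the orbits of its end points
 avoid \<open>J'\<close>; so freshly cut pieces have length at least \<open>dcut\<close>.\<close>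

lemma good_split:
 assumes g: "good_piece k s t"
 shows "{x\<in>{s..t}. (f ^^ k) x \<in> Sd sd} = {} \<or> (\<exists>s' t'. {x\<in>{s..t}. (f ^^ k) x \<in> Sd sd} = {s'..t'} \<and> good_piece (Suc k) s' t')"
proof -
 let ?g = "f ^^ k"
 have st: "0 <= s" "s < t" "t <= 1" using g by (auto simp: good_piece_def)
 have cl: "clean (?g s)" "clean (?g t)" using g by (auto simp: good_piece_def)
 have nJ: "?g s \<notin> J'" "?g t \<notin> J'" using cl unfolding clean_def by (metis funpow_0)+
 have rng: "?g x \<in> {0..1}" if "x \<in> {s..t}" for x using fn_rng[of x k] that st by auto
 have clS: "clean ((f ^^ Suc k) s)" "clean ((f ^^ Suc k) t)" using clean_f cl by auto
 have av: "\<forall>x\<in>{s..t}. \<forall>j<k. (f ^^ j) x \<notin> J" using g by (auto simp: good_piece_def)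
 define I where "I = {min (?g s) (?g t)..max (?g s) (?g t)}"
 have img: "?g ` {s..t} = I"
 proof
  show "I \<subseteq> ?g ` {s..t}" using between_image[of s t _ ?g] fn_cont st unfolding I_def by (force simp: image_iff)
  show "?g ` {s..t} \<subseteq> I"
  proof
   fix y assume "y \<in> ?g ` {s..t}"
   then obtain x where x: "x \<in> {s..t}" "y = ?g x" by blast
   from good_mono[OF g] show "y \<in> I"
   proof
    assume m: "\<forall>x\<in>{s..t}. \<forall>y\<in>{s..t}. x < y --> ?g x < ?g y"
    have "s = x \<or> s < x" "x = t \<or> x < t" using x by auto
    hence "?g s <= ?g x" "?g x <= ?g t" using m[rule_format, of s x] m[rule_format, of x t] by auto
    thus ?thesis using x by (auto simp: I_def)
   next
    assume m: "\<forall>x\<in>{s..t}. \<forall>y\<in>{s..t}. x < y --> ?g y < ?g x"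
    have "s = x \<or> s < x" "x = t \<or> x < t" using x by auto
    hence "?g x <= ?g s" "?g t <= ?g x" using m[rule_format, of s x] m[rule_format, of x t] by auto
    thus ?thesis using x by (auto simp: I_def)
   qed
  qed
 qed
 show ?thesis
 proof (cases "I \<inter> J = {}")
  case True
  have "I \<subseteq> Sd True \<or> I \<subseteq> Sd False"
  proof -
   have "min (?g s) (?g t) \<in> I" "max (?g s) (?g t) \<in> I" by (auto simp: I_def min_def max_def)
   hence "min (?g s) (?g t) \<notin> J" "max (?g s) (?g t) \<notin> J" using True by blast+
   moreover have "\<not> (min (?g s) (?g t) <= a \<and> b <= max (?g s) (?g t))"
   proof
    assume "min (?g s) (?g t) <= a \<and> b <= max (?g s) (?g t)"
    hence "c \<in> I" using ab by (auto simp: I_def)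
    thus False using True J_sub by auto
   qed
   ultimately have "max (?g s) (?g t) <= a \<or> b <= min (?g s) (?g t)" unfolding J_def by auto
   thus ?thesis using rng[of s] rng[of t] st unfolding I_def Sd_def by (auto simp: min_def max_def split: if_splits)
  qed
  hence "I \<subseteq> Sd sd \<or> I \<inter> Sd sd = {}" using Sd_disj by (cases sd) auto
  hence "{x\<in>{s..t}. ?g x \<in> Sd sd} = {s..t} \<or> {x\<in>{s..t}. ?g x \<in> Sd sd} = {}" using img by blast
  moreover have "\<forall>x\<in>{s..t}. \<forall>j<Suc k. (f ^^ j) x \<notin> J" using av img True by (auto simp: less_Suc_eq)
  hence "good_piece (Suc k) s t" using st clS g long_Suc unfolding good_piece_def by blast
  ultimately show ?thesis by blast
 next
  case False
  hence cross: "min (?g s) (?g t) <= a'" "b' <= max (?g s) (?g t)"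
   using nJ ab unfolding I_def J_def J'_def by (auto simp: min_def max_def split: if_splits)
  define q u v where "q = (if sd then a else b)" and "u = (if sd then min (?g s) (?g t) else b)" and "v = (if sd then a else max (?g s) (?g t))"
  have qI: "q \<in> I" using cross ab by (auto simp: q_def I_def)
  then obtain x0 where x0: "x0 \<in> {s..t}" "?g x0 = q" using img by blast
  have clq: "clean (f q)" using clean_bd by (simp add: q_def)
  have uv: "0 <= u" "v <= 1" "dcut <= v - u" using cross rng[of s] rng[of t] ab st by (auto simp: u_def v_def dcut_def min_def max_def)
  have Sde: "?g x \<in> Sd sd \<longleftrightarrow> u <= ?g x \<and> ?g x <= v" if "x \<in> {s..t}" for x
  proof -
   have "?g x \<in> I" using img that by blast
   hence "min (?g s) (?g t) <= ?g x" "?g x <= max (?g s) (?g t)" unfolding I_def atLeastAtMost_iff by blast+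
   thus ?thesis using rng[OF that] by (cases sd) (simp_all add: Sd_def u_def v_def)
  qed
  have uvI: "{u..v} \<subseteq> I" using cross ab by (auto simp: u_def v_def I_def)
  have fin: ?thesis if "{x\<in>{s..t}. u <= ?g x \<and> ?g x <= v} = {s'..t'}" "s' < t'" "s' = s \<and> t' = x0 \<or> s' = x0 \<and> t' = t" for s' t'
  proof -
   have sub: "{s'..t'} \<subseteq> {s..t}" using that(1) by blast
   have e: "{x\<in>{s..t}. ?g x \<in> Sd sd} = {s'..t'}" using that(1) Sde by auto
   have "{u..v} \<subseteq> ?g ` {s'..t'}"
   proof
    fix y assume y: "y \<in> {u..v}"
    then obtain x where x: "x \<in> {s..t}" "?g x = y" using uvI img by blast
    hence "x \<in> {x\<in>{s..t}. u <= ?g x \<and> ?g x <= v}" using y by simp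
    hence "x \<in> {s'..t'}" unfolding that(1) .
    thus "y \<in> ?g ` {s'..t'}" using x(2) by blast
   qed
   hence "long (Suc k) s' t'" by (rule long_cut[OF uv])
   moreover have "\<forall>x\<in>{s'..t'}. \<forall>j<Suc k. (f ^^ j) x \<notin> J"
   proof (intro ballI allI impI)
    fix x j assume x: "x \<in> {s'..t'}" "j < Suc k"
    show "(f ^^ j) x \<notin> J"
    proof (cases "j = k")
     case True thus ?thesis using x e Sd_sub(2) by blast
    next
     case False thus ?thesis using av x sub by auto
    qed
   qed
   moreover have "clean ((f ^^ Suc k) s')" "clean ((f ^^ Suc k) t')" using that(3) clS clq x0 by auto
   moreover have "0 <= s'" "t' <= 1" using sub that(2) st by auto
   ultimately have "good_piece (Suc k) s' t'" using that(2) unfolding good_piece_def by blast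
   thus ?thesis using e by blast
  qed
  have ns: "x0 ~= s" "x0 ~= t" using x0(2) nJ ab by (cases sd; auto simp: q_def J'_def)+
  from good_mono[OF g] show ?thesis
  proof
   assume m: "\<forall>x\<in>{s..t}. \<forall>y\<in>{s..t}. x < y --> ?g x < ?g y"
   have le: "?g x <= ?g y \<longleftrightarrow> x <= y" if "x \<in> {s..t}" "y \<in> {s..t}" for x y
    using m that by (metis leD le_less linorder_le_less_linear)
   have mm: "min (?g s) (?g t) = ?g s" "max (?g s) (?g t) = ?g t" using m[rule_format, of s t] st by auto
   show ?thesis
   proof (cases sd)
    case True
    have "{x\<in>{s..t}. u <= ?g x \<and> ?g x <= v} = {s..x0}"
     using le x0 True by (auto simp: u_def v_def q_def)
    thus ?thesis using fin[of s x0] x0 ns by auto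
   next
    case False
    have "{x\<in>{s..t}. u <= ?g x \<and> ?g x <= v} = {x0..t}"
     using le x0 False by (auto simp: u_def v_def q_def)
    thus ?thesis using fin[of x0 t] x0 ns by auto
   qed
  next
   assume m: "\<forall>x\<in>{s..t}. \<forall>y\<in>{s..t}. x < y --> ?g y < ?g x"
   have le: "?g x <= ?g y \<longleftrightarrow> y <= x" if "x \<in> {s..t}" "y \<in> {s..t}" for x y
    using m that by (metis leD le_less linorder_le_less_linear)
   have mm: "min (?g s) (?g t) = ?g t" "max (?g s) (?g t) = ?g s" using m[rule_format, of s t] st by auto
   show ?thesis
   proof (cases sd)
    case True
    have "{x\<in>{s..t}. u <= ?g x \<and> ?g x <= v} = {x0..t}"
     using le x0 True by (auto simp: u_def v_def q_def)
    thus ?thesis using fin[of x0 t] x0 ns by auto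
   next
    case False
    have "{x\<in>{s..t}. u <= ?g x \<and> ?g x <= v} = {s..x0}"
     using le x0 False by (auto simp: u_def v_def q_def)
    thus ?thesis using fin[of s x0] x0 ns by auto
   qed
  qed
 qed
qed

lemma Wd_good: "Wd w = {} \<or> (\<exists>s t. Wd w = {s..t} \<and> good_piece (length w) s t)"
proof (induct w rule: rev_induct)
 case Nil
 have "long 0 0 1" unfolding long_def using ab by (intro exI[of _ 0] exI[of _ 0] exI[of _ 1]) (auto simp: dcut_def)
 hence "good_piece 0 0 1" using clean_bd by (simp add: good_piece_def)
 moreover have "Wd [] = {0..1}" by (auto simp: Wd_def)
 ultimately show ?case by auto
next
 case (snoc sd w)
 thus ?case
 proof
  assume "\<exists>s t. Wd w = {s..t} \<and> good_piece (length w) s t"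
  then obtain s t where st: "Wd w = {s..t}" "good_piece (length w) s t" by blast
  show ?thesis unfolding Wd_snoc st(1) using good_split[OF st(2), of sd] by auto
 qed (simp add: Wd_snoc)
qed

end

lemma measure_finite_UN_lborel:
 assumes "finite I" "\<And>i. i \<in> I ==> A i \<in> sets borel" "\<And>i. i \<in> I ==> A i \<subseteq> {0..1::real}" "disjoint_family_on A I"
 shows "measure lborel (\<Union>i\<in>I. A i) = (\<Sum>i\<in>I. measure lborel (A i))"
proof (rule measure_finite_Union[OF assms(1) _ assms(4)])
 show "A ` I \<subseteq> sets lborel" using assms(2) by auto
 show "emeasure lborel (A i) ~= \<infinity>" if "i \<in> I" for i
 proof -
  have "emeasure lborel (A i) <= emeasure lborel {0..1::real}" using assms(3)[OF that] by (intro emeasure_mono) auto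
  thus ?thesis by (auto simp: top_unique)
 qed
qed

lemma lmeasurable_01: "B \<in> sets borel ==> B \<subseteq> {0..1::real} ==> B \<in> lmeasurable"
 using bounded_subset[OF compact_imp_bounded[OF compact_Icc]] by (intro bounded_set_imp_lmeasurable) auto

lemma measure_mono_01:
 assumes "A \<subseteq> B" "A \<in> sets borel" "B \<in> sets borel" "B \<subseteq> {0..1::real}"
 shows "measure lborel A <= measure lborel B"
proof (rule measure_mono_fmeasurable)
 have "emeasure lborel B <= emeasure lborel {0..1::real}" using assms by (intro emeasure_mono) auto
 thus "B \<in> fmeasurable lborel" using assms by (intro fmeasurableI) (auto simp: less_top[symmetric] top_unique)
qed (use assms in auto)

context nice_unimodal
begin

section \<open>Exponential growth, distortion, and decay of the avoiding set\<close>

lemma exp_growth: "\<exists>C0 \<theta>. C0 > 0 \<and> 0 < \<theta> \<and> \<theta> < 1 \<and>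
 (\<forall>n. \<forall>x\<in>{0..1}. (\<forall>j<n. (f ^^ j) x \<notin> J) --> C0 <= \<bar>Df n x\<bar> * \<theta> ^ n)"
proof -
 obtain N0 where N0: "\<forall>n\<ge>N0. \<forall>x\<in>{0..1}. (\<forall>j<n. (f ^^ j) x \<notin> J) --> 2 <= \<bar>Df n x\<bar>" using expand_off_J[of 2] by auto
 define N where "N = Suc N0"
 have N: "N >= 1" "\<And>x. x \<in> {0..1} ==> (\<forall>j<N. (f ^^ j) x \<notin> J) ==> 2 <= \<bar>Df N x\<bar>" using N0 by (auto simp: N_def)
 have blk: "2 ^ q <= \<bar>Df (N * q) x\<bar>" if x: "x \<in> {0..1}" "\<forall>j<N * q. (f ^^ j) x \<notin> J" for q x
  using that(2)
 proof (induct q)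
  case (Suc q)
  let ?y = "(f ^^ (N * q)) x"
  have "\<forall>j<N. (f ^^ j) ?y \<notin> J"
  proof (intro allI impI)
   fix j assume "j < N"
   hence "j + N * q < N * Suc q" by simp
   thus "(f ^^ j) ?y \<notin> J" using Suc(2) iter_add[of j "N * q" f x] by metis
  qed
  hence "2 <= \<bar>Df N ?y\<bar>" using N(2)[OF fn_rng[OF x(1)]] by blast
  moreover have "2 ^ q <= \<bar>Df (N * q) x\<bar>" using Suc by simp
  ultimately have "2 * 2 ^ q <= \<bar>Df N ?y\<bar> * \<bar>Df (N * q) x\<bar>" by (intro mult_mono) auto
  thus ?case using Df_add[of N "N * q" x] by (simp add: abs_mult)
 qed simp
 define \<theta> :: real where "\<theta> = (1/2) powr (1 / real N)"
 have th: "0 < \<theta>" "\<theta> < 1" using powr_less_mono2[of "1 / real N" "1/2" 1] N by (auto simp: \<theta>_def)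
 have "mJ ^ N / 2 <= \<bar>Df n x\<bar> * \<theta> ^ n" if x: "x \<in> {0..1}" "\<forall>j<n. (f ^^ j) x \<notin> J" for n x
 proof -
  define q r where "q = n div N" and "r = n mod N"
  have n: "n = r + N * q" "r <= N" using N(1) by (auto simp: q_def r_def less_imp_le)
  have A: "2 ^ q <= \<bar>Df (N * q) x\<bar>" using blk[OF x(1), of q] x(2) n by auto
  have "(f ^^ j) ((f ^^ (N * q)) x) \<notin> J" if "j < r" for j
   using x(2) n that iter_add[of j "N * q" f x] by (metis add_less_cancel_right)
  hence "mJ ^ r <= \<bar>Df r ((f ^^ (N * q)) x)\<bar>" using Df_lower_pow[OF fn_rng[OF x(1)], of r "N * q"] by blast
  moreover have "mJ ^ N <= mJ ^ r" using mJ n by (intro power_decreasing) auto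
  ultimately have B: "mJ ^ N * 2 ^ q <= \<bar>Df n x\<bar>"
   using mult_mono[of "mJ ^ N" "\<bar>Df r ((f ^^ (N * q)) x)\<bar>" "2 ^ q" "\<bar>Df (N * q) x\<bar>"] A Df_add[of r "N * q" x] n by (simp add: abs_mult)
  have "(1/2::real) ^ q <= 2 * \<theta> ^ n" using power_div_le[of "1/2" N n] N(1) by (simp add: q_def \<theta>_def)
  hence "1 / 2 <= 2 ^ q * \<theta> ^ n" by (simp add: power_one_over field_simps)
  hence "mJ ^ N * (1 / 2) <= mJ ^ N * (2 ^ q * \<theta> ^ n)" using mJ(1) by (intro mult_left_mono) auto
  also have "... <= \<bar>Df n x\<bar> * \<theta> ^ n" using mult_right_mono[OF B, of "\<theta> ^ n"] th by (simp add: mult.assoc)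
  finally show ?thesis by simp
 qed
 thus ?thesis using th mJ(1) by (intro exI[of _ "mJ ^ N / 2"] exI[of _ \<theta>]) auto
qed

text \<open>Each side of \<open>J\<close> is compact and away from \<open>c\<close>, so
  \<open>f2\<close> is bounded there and \<open>f1\<close> is at least \<open>mJ\<close> in
  modulus.\<close>

lemma f1_log_lip: "\<exists>L\<ge>0. \<forall>sd. \<forall>x\<in>Sd sd. \<forall>y\<in>Sd sd. \<bar>f1 x\<bar> <= \<bar>f1 y\<bar> * exp (L * \<bar>x - y\<bar>)"
proof -
 have S: "Sd sd \<subseteq> {0..1} - {c}" for sd using ab by (auto simp: Sd_def split: if_splits)
 have "\<exists>B\<ge>0. \<forall>x\<in>Sd sd. \<bar>f2 x\<bar> <= B" for sd
 proof -
  have "continuous_on ({0..1} - {c}) f2" using f2_der by (rule DERIV_continuous_on)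
  hence "continuous_on (Sd sd) f2" using S continuous_on_subset by blast
  moreover have "compact (Sd sd)" by (simp add: Sd_def)
  ultimately have "bounded (f2 ` Sd sd)" using compact_continuous_image compact_imp_bounded by blast
  thus ?thesis unfolding bounded_pos by (metis imageI less_imp_le real_norm_def)
 qed
 then obtain B where B: "\<And>sd. B sd >= 0" "\<And>sd x. x \<in> Sd sd ==> \<bar>f2 x\<bar> <= B sd" by metis
 have "\<bar>f1 x\<bar> <= \<bar>f1 y\<bar> * exp ((B True + B False) / mJ * \<bar>x - y\<bar>)" if xy: "x \<in> Sd sd" "y \<in> Sd sd" for sd x y
 proof -
  have "norm (f1 x - f1 y) <= B sd * norm (x - y)"
  proof (rule field_differentiable_bound[of "Sd sd" f1 f2])
   show "convex (Sd sd)" by (simp add: Sd_def)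
   fix z assume z: "z \<in> Sd sd"
   show "(f1 has_field_derivative f2 z) (at z within Sd sd)" using f1_der[of z] S z DERIV_subset by blast
   show "norm (f2 z) <= B sd" using B(2)[OF z] by simp
  qed (use xy in auto)
  hence "\<bar>f1 x\<bar> <= \<bar>f1 y\<bar> + B sd * \<bar>x - y\<bar>" by simp
  also have "B sd * \<bar>x - y\<bar> <= (B True + B False) * \<bar>x - y\<bar>" using B(1)[of True] B(1)[of False] by (intro mult_right_mono) (cases sd; auto)+
  also have "\<bar>f1 y\<bar> + (B True + B False) * \<bar>x - y\<bar> <= \<bar>f1 y\<bar> + \<bar>f1 y\<bar> * ((B True + B False) / mJ * \<bar>x - y\<bar>)"
  proof -
   have "mJ * ((B True + B False) / mJ * \<bar>x - y\<bar>) <= \<bar>f1 y\<bar> * ((B True + B False) / mJ * \<bar>x - y\<bar>)"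
   proof (rule mult_right_mono)
    show "mJ <= \<bar>f1 y\<bar>" using mJ(3)[of y] Sd_sub(1)[of sd] Sd_sub(2)[of y sd] xy(2) by blast
   qed (use mJ(1) B(1)[of True] B(1)[of False] in auto)
   thus ?thesis using mJ(1) by simp
  qed
  also have "... = \<bar>f1 y\<bar> * (1 + (B True + B False) / mJ * \<bar>x - y\<bar>)" by (simp add: algebra_simps)
  also have "... <= \<bar>f1 y\<bar> * exp ((B True + B False) / mJ * \<bar>x - y\<bar>)" by (intro mult_left_mono exp_ge_add_one_self) auto
  finally show ?thesis by simp
 qed
 moreover have "(B True + B False) / mJ >= 0" using B(1)[of True] B(1)[of False] mJ(1) by simp
 ultimately show ?thesis by blast
qed

lemma piece_same_side:
 assumes "\<And>x. x \<in> {s..t} ==> (f ^^ j) x \<notin> J" "0 <= s" "t <= 1" "x \<in> {s..t}" "y \<in> {s..t}"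
 shows "\<exists>sd. (f ^^ j) x \<in> Sd sd \<and> (f ^^ j) y \<in> Sd sd"
proof (rule ccontr)
 assume n: "\<not> ?thesis"
 have r: "(f ^^ j) x \<in> {0..1}" "(f ^^ j) y \<in> {0..1}" using fn_rng[of x j] fn_rng[of y j] assms by auto
 have sides: "((f ^^ j) x <= a \<and> b <= (f ^^ j) y) \<or> ((f ^^ j) y <= a \<and> b <= (f ^^ j) x)"
 proof -
  have "\<not> ((f ^^ j) x <= a \<and> (f ^^ j) y <= a)" "\<not> (b <= (f ^^ j) x \<and> b <= (f ^^ j) y)"
   using n r unfolding Sd_def by (metis atLeastAtMost_iff)+
  moreover have "(f ^^ j) x <= a \<or> b <= (f ^^ j) x" "(f ^^ j) y <= a \<or> b <= (f ^^ j) y"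
   using assms(1)[OF assms(4)] assms(1)[OF assms(5)] unfolding J_def by auto
  ultimately show ?thesis by blast
 qed
 have "is_interval ((f ^^ j) ` {s..t})" by (rule fn_interval) (simp add: is_interval_cc)
 hence conv: "w \<in> (f ^^ j) ` {s..t}" if "u \<in> (f ^^ j) ` {s..t}" "v \<in> (f ^^ j) ` {s..t}" "u <= w" "w <= v" for u v w
  using that unfolding is_interval_1 by blast
 have im: "(f ^^ j) x \<in> (f ^^ j) ` {s..t}" "(f ^^ j) y \<in> (f ^^ j) ` {s..t}" using assms(4,5) by blast+
 have "c \<in> (f ^^ j) ` {s..t}"
  using sides conv[OF im, of c] conv[OF im(2,1), of c] ab by auto
 thus False using assms(1) J_sub by auto
qed

text \<open>By \<open>exp_growth\<close> from time \<open>j\<close> to time \<open>k\<close>, the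
  images at time \<open>j\<close> are exponentially short in \<open>k - j\<close>, so the errors
  from \<open>f1_log_lip\<close> form a geometric sum.\<close>

lemma distortion: "\<exists>Cd\<ge>1. \<forall>k s t. 0 <= s \<and> s <= t \<and> t <= 1 \<and> (\<forall>x\<in>{s..t}. \<forall>j<k. (f ^^ j) x \<notin> J) -->
 (\<forall>x\<in>{s..t}. \<forall>y\<in>{s..t}. \<bar>Df k x\<bar> <= Cd * \<bar>Df k y\<bar>)"
proof -
 obtain C0 \<theta> where C0: "C0 > 0" "0 < \<theta>" "\<theta> < 1" "\<And>n x. x\<in>{0..1} ==> (\<forall>j<n. (f ^^ j) x \<notin> J) ==> C0 <= \<bar>Df n x\<bar> * \<theta> ^ n"
  using exp_growth by metis
 obtain L where L: "L >= 0" "\<And>sd x y. x \<in> Sd sd ==> y \<in> Sd sd ==> \<bar>f1 x\<bar> <= \<bar>f1 y\<bar> * exp (L * \<bar>x - y\<bar>)"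
  using f1_log_lip by metis
 define Cd where "Cd = exp (L * (1 / C0 / (1 - \<theta>)))"
 have "\<bar>Df k x\<bar> <= Cd * \<bar>Df k y\<bar>" if st: "0 <= s" "s <= t" "t <= 1" and av: "\<forall>x\<in>{s..t}. \<forall>j<k. (f ^^ j) x \<notin> J"
  and xy: "x \<in> {s..t}" "y \<in> {s..t}" for k s t x y
 proof -
  have close: "\<bar>(f ^^ j) x - (f ^^ j) y\<bar> <= \<theta> ^ (k - j) / C0" if j: "j < k" for j
  proof -
   have aux: "\<bar>(f ^^ j) u - (f ^^ j) v\<bar> <= \<theta> ^ (k - j) / C0"
    if uv: "u \<in> {s..t}" "v \<in> {s..t}" "(f ^^ j) u < (f ^^ j) v" for u v
   proof -
    let ?u = "(f ^^ j) u" let ?v = "(f ^^ j) v"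
    have r: "0 <= ?u" "?v <= 1" using fn_rng[of u j] fn_rng[of v j] uv st by auto
    obtain z where z: "?u < z" "z < ?v" "(f ^^ (k - j)) ?v - (f ^^ (k - j)) ?u = (?v - ?u) * Df (k - j) z"
     using fn_mvt[OF r(1) uv(3) r(2)] by blast
    have "is_interval ((f ^^ j) ` {s..t})" by (rule fn_interval) (simp add: is_interval_cc)
    hence "z \<in> (f ^^ j) ` {s..t}" using z uv unfolding is_interval_1 by (meson imageI less_imp_le)
    then obtain w where w: "w \<in> {s..t}" "z = (f ^^ j) w" by blast
    have "(f ^^ i) z \<notin> J" if "i < k - j" for i
     using av w that iter_add[of i j f w] by (metis less_diff_conv)
    hence "C0 <= \<bar>Df (k - j) z\<bar> * \<theta> ^ (k - j)" using C0(4)[of z "k - j"] z r by auto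
    hence "C0 * (?v - ?u) <= (\<bar>Df (k - j) z\<bar> * \<theta> ^ (k - j)) * (?v - ?u)" using uv by (intro mult_right_mono) auto
    also have "... = \<bar>(f ^^ (k - j)) ?v - (f ^^ (k - j)) ?u\<bar> * \<theta> ^ (k - j)" using z by (simp add: abs_mult)
    also have "... <= 1 * \<theta> ^ (k - j)"
     using fn_rng[of ?v "k - j"] fn_rng[of ?u "k - j"] fn_rng[of u j] fn_rng[of v j] uv st C0 by (intro mult_right_mono) auto
    finally have "?v - ?u <= \<theta> ^ (k - j) / C0" using C0(1) by (simp add: field_simps)
    thus ?thesis using uv by simp
   qed
   show ?thesis using aux[of x y] aux[of y x] xy C0 by (cases "(f ^^ j) x" "(f ^^ j) y" rule: linorder_cases) (auto simp: abs_minus_commute)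
  qed
  have sum: "(\<Sum>j<k. \<theta> ^ (k - j) / C0) <= 1 / C0 / (1 - \<theta>)"
  proof -
   have "(\<Sum>j<k. \<theta> ^ (k - j)) <= (\<Sum>j<k. \<theta> ^ (k - Suc j))" using C0 by (intro sum_mono power_decreasing) auto
   also have "... = (\<Sum>j<k. \<theta> ^ j)" by (rule sum.nat_diff_reindex)
   also have "... = (1 - \<theta> ^ k) / (1 - \<theta>)" using C0 by (simp add: sum_gp_strict)
   also have "... <= 1 / (1 - \<theta>)" using C0 by (intro divide_right_mono) auto
   finally have "(\<Sum>j<k. \<theta> ^ (k - j)) / C0 <= 1 / (1 - \<theta>) / C0" using C0 by (intro divide_right_mono) auto
   thus ?thesis by (simp add: sum_divide_distrib mult.commute)
  qed
  have "\<bar>Df k x\<bar> = (\<Prod>j<k. \<bar>f1 ((f ^^ j) x)\<bar>)" by (simp add: Df_def abs_prod)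
  also have "... <= (\<Prod>j<k. \<bar>f1 ((f ^^ j) y)\<bar> * exp (L * (\<theta> ^ (k - j) / C0)))"
  proof (rule prod_mono, intro conjI)
   fix j assume "j \<in> {..<k}"
   hence j: "j < k" by simp
   obtain sd where sd: "(f ^^ j) x \<in> Sd sd" "(f ^^ j) y \<in> Sd sd"
    using piece_same_side[of s t j x y] av j st xy by auto
   have "\<bar>f1 ((f ^^ j) x)\<bar> <= \<bar>f1 ((f ^^ j) y)\<bar> * exp (L * \<bar>(f ^^ j) x - (f ^^ j) y\<bar>)" by (rule L(2)[OF sd])
   also have "... <= \<bar>f1 ((f ^^ j) y)\<bar> * exp (L * (\<theta> ^ (k - j) / C0))"
   by (metis close[OF j] L(1) j mult_left_mono exp_le_cancel_iff abs_ge_zero)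
   finally show "\<bar>f1 ((f ^^ j) x)\<bar> <= \<bar>f1 ((f ^^ j) y)\<bar> * exp (L * (\<theta> ^ (k - j) / C0))" .
  qed simp
  also have "... = \<bar>Df k y\<bar> * exp (L * (\<Sum>j<k. \<theta> ^ (k - j) / C0))"
   by (simp add: prod.distrib Df_def abs_prod exp_sum sum_distrib_left)
  also have "... <= \<bar>Df k y\<bar> * Cd"
  by (metis sum L(1) mult_left_mono Cd_def exp_le_cancel_iff abs_ge_zero)
  finally show ?thesis by (simp add: mult.commute)
 qed
 moreover have "Cd >= 1" unfolding Cd_def using L C0 by (simp)
 ultimately show ?thesis by blast
qed

text \<open>Transitivity brings a small subinterval of each grid cell into \<open>J\<close>;
  finitely many cells give a uniform size and a uniform time.\<close>

lemma hole:
 assumes "h > 0"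
 shows "\<exists>m e. e > 0 \<and> (\<forall>u v. 0 <= u \<and> v <= 1 \<and> h <= v - u -->
  (\<exists>p q j. u <= p \<and> p + e <= q \<and> q <= v \<and> j < m \<and> (\<forall>x. p < x \<and> x < q --> (f ^^ j) x \<in> J)))"
proof -
 obtain k :: nat where k: "k > 0" "2 / real k < h"
  using reals_Archimedean2[of "2 / h"] assms by (metis divide_less_eq gr0I mult.commute not_numeral_less_zero of_nat_0 of_nat_0_less_iff pos_divide_less_eq divide_pos_pos zero_less_numeral less_trans)
 have "\<forall>i<k. \<exists>e j p q. e > 0 \<and> real i / k <= p \<and> p + e <= q \<and> q <= real (Suc i) / k \<and> (\<forall>x. p < x \<and> x < q --> (f ^^ j) x \<in> J)"
 proof (intro allI impI)
  fix i assume i: "i < k"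
  define u v where "u = real i / k" and "v = real (Suc i) / k"
  have uv: "0 <= u" "u < v" "v <= 1" using i by (auto simp: field_simps u_def v_def)
  obtain n x where x: "x \<in> {u<..<v}" "(f ^^ n) x \<in> {a<..<b}" using trans[OF uv, of a b] ab by auto
  have "open ((f ^^ n) -` {a<..<b} \<inter> {u<..<v})"
   using fn_cont[of UNIV n] by (intro open_Int continuous_open_vimage) (auto simp: continuous_on_eq_continuous_at)
  moreover have "x \<in> (f ^^ n) -` {a<..<b} \<inter> {u<..<v}" using x by auto
  ultimately obtain e where e: "e > 0" "ball x e \<subseteq> (f ^^ n) -` {a<..<b} \<inter> {u<..<v}" by (meson openE)
  have "x - e/2 \<in> ball x e" "x + e/2 \<in> ball x e" using e by (auto simp: dist_real_def)
  hence "x - e/2 \<in> {u<..<v}" "x + e/2 \<in> {u<..<v}" using e(2) by blast+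
  hence 1: "u <= x - e/2" "x + e/2 <= v" by auto
  have 2: "(f ^^ n) y \<in> J" if "x - e/2 < y \<and> y < x + e/2" for y
  proof -
   have "y \<in> ball x e" using that by (auto simp: dist_real_def)
   thus ?thesis using e(2) by (auto simp: J_def)
  qed
  show "\<exists>e j p q. e > 0 \<and> real i / k <= p \<and> p + e <= q \<and> q <= real (Suc i) / k \<and> (\<forall>x. p < x \<and> x < q --> (f ^^ j) x \<in> J)"
   using e(1) 1 2 unfolding u_def v_def by (intro exI[of _ e] exI[of _ n] exI[of _ "x - e/2"] exI[of _ "x + e/2"]) auto
 qed
 then obtain e j p q where H: "\<And>i. i < k ==> e i > 0 \<and> real i / k <= p i \<and> p i + e i <= q i \<and> q i <= real (Suc i) / k \<and> (\<forall>x. p i < x \<and> x < q i --> (f ^^ j i) x \<in> J)"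
  by metis
 define e0 where "e0 = Min (e ` {..<k})"
 have e0: "e0 > 0" using H k unfolding e0_def by (subst Min_gr_iff) (auto simp: lessThan_empty_iff)
 have e0_le: "e0 <= e i" if "i < k" for i unfolding e0_def using that by auto
 show ?thesis
 proof (rule exI[of _ "Suc (\<Sum>i<k. j i)"], rule exI[of _ e0], intro conjI allI impI, rule e0)
  fix u v assume uv: "0 <= u \<and> v <= 1 \<and> h <= v - u"
  then obtain i where i: "i < k" "u <= real i / real k" "real (Suc i) / real k <= v" using grid_cell[of u v k] k by auto
  have "j i < Suc (\<Sum>i<k. j i)" using i member_le_sum[of i "{..<k}" j] by auto
  moreover have "u <= p i" "p i + e0 <= q i" "q i <= v" using H[OF i(1)] e0_le[OF i(1)] i by auto
  ultimately show "\<exists>p q ja. u <= p \<and> p + e0 <= q \<and> q <= v \<and> ja < Suc (\<Sum>i<k. j i) \<and> (\<forall>x. p < x \<and> x < q --> (f ^^ ja) x \<in> J)"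
   using H[OF i(1)] by blast
 qed
qed

lemma Z_borel: "Z k \<in> sets borel"
proof -
 have "closed ((f ^^ j) -` (- J))" for j
  using fn_cont[of UNIV j] by (intro continuous_closed_vimage) (auto simp: continuous_on_eq_continuous_at J_def closed_Compl)
 hence "closed ({0..1} \<inter> (\<Inter>j\<in>{..<k}. (f ^^ j) -` (- J)))" by (intro closed_Int closed_INT) auto
 moreover have "Z k = {0..1} \<inter> (\<Inter>j\<in>{..<k}. (f ^^ j) -` (- J))" by (auto simp: Z_def)
 ultimately show ?thesis by simp
qed

lemma Z_sub: "Z k \<subseteq> {0..1}" by (auto simp: Z_def)

text \<open>The image of each piece has length at least \<open>h\<close>, so it contains an interval
  of length \<open>e0\<close> that enters \<open>J\<close> within \<open>m0\<close> steps. As the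
  whole image has length at most 1, bounded distortion pulls this hole back to a proportion at least
  \<open>e0 / Cd\<close> of the piece.\<close>

theorem Z_exp: "\<exists>C \<gamma>. C > 0 \<and> 0 < \<gamma> \<and> \<gamma> < 1 \<and> (\<forall>k. measure lborel (Z k) <= C * \<gamma> ^ k)"
proof -
 obtain h where h: "h > 0" "\<And>u v n. 0 <= u ==> v <= 1 ==> dcut <= v - u ==>
  (\<exists>x\<in>{u..v}. \<exists>y\<in>{u..v}. h <= \<bar>(f ^^ n) x - (f ^^ n) y\<bar>)" using no_shrink[OF dcut_pos] by blast
 obtain m0 e0 where e0: "e0 > 0" and hole: "\<And>u v. 0 <= u ==> v <= 1 ==> h <= v - u ==>
  (\<exists>p q j. u <= p \<and> p + e0 <= q \<and> q <= v \<and> j < m0 \<and> (\<forall>x. p < x \<and> x < q --> (f ^^ j) x \<in> J))"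
  using hole[OF h(1)] by metis
 obtain Cd where Cd: "Cd >= 1" "\<And>k s t x y. 0 <= s ==> s <= t ==> t <= 1 ==> (\<forall>x\<in>{s..t}. \<forall>j<k. (f ^^ j) x \<notin> J) ==>
  x\<in>{s..t} ==> y\<in>{s..t} ==> \<bar>Df k x\<bar> <= Cd * \<bar>Df k y\<bar>" using distortion by metis
 define m where "m = Suc m0"
 define \<epsilon> where "\<epsilon> = min (1/2) (e0 / Cd)"
 have eps: "0 < \<epsilon>" "\<epsilon> < 1" "\<epsilon> <= e0 / Cd" using e0 Cd by (auto simp: \<epsilon>_def)
 have loss: "measure lborel (Z (k + m) \<inter> {s..t}) <= (1 - \<epsilon>) * (t - s)" if g: "good_piece k s t" for k s t
 proof -
  let ?g = "f ^^ k"
  have st: "0 <= s" "s < t" "t <= 1" and av: "\<forall>x\<in>{s..t}. \<forall>j<k. (f ^^ j) x \<notin> J" using g by (auto simp: good_piece_def)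
  have lng: "h <= \<bar>?g s - ?g t\<bar>"
  proof -
   obtain i u v where iuv: "0 <= u" "v <= 1" "dcut <= v - u" "(f ^^ i) ` {u..v} \<subseteq> ?g ` {s..t}" using g unfolding good_piece_def long_def by blast
   obtain x y where xy: "x\<in>{u..v}" "y\<in>{u..v}" "h <= \<bar>(f ^^ i) x - (f ^^ i) y\<bar>" using h(2)[OF iuv(1-3)] by blast
   have "(f ^^ i) x \<in> ?g ` {s..t}" "(f ^^ i) y \<in> ?g ` {s..t}" using iuv(4) xy by blast+
   then obtain x' y' where "x' \<in> {s..t}" "y' \<in> {s..t}" "h <= \<bar>?g x' - ?g y'\<bar>" using xy(3) by (elim imageE) simp
   thus ?thesis using inj_interval_image_dist[of s t ?g x' y'] fn_cont good_inj[OF g] by force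
  qed
  define u v where "u = min (?g s) (?g t)" and "v = max (?g s) (?g t)"
  have uv: "0 <= u" "v <= 1" "h <= v - u" using fn_rng[of s k] fn_rng[of t k] st lng by (auto simp: u_def v_def)
  obtain p q j where pq: "u <= p" "p + e0 <= q" "q <= v" "j < m0" "\<And>x. p < x \<and> x < q ==> (f ^^ j) x \<in> J"
   using hole[OF uv] by blast
  obtain x1 where x1: "x1 \<in> {s..t}" "?g x1 = p" using between_image[of s t p ?g] fn_cont st pq e0 by (auto simp: u_def v_def)
  obtain x2 where x2: "x2 \<in> {s..t}" "?g x2 = q" using between_image[of s t q ?g] fn_cont st pq e0 by (auto simp: u_def v_def)
  define y1 y2 where "y1 = min x1 x2" and "y2 = max x1 x2"
  have "x1 ~= x2" using x1(2) x2(2) pq(2) e0 by auto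
  hence y: "s <= y1" "y1 < y2" "y2 <= t" using x1(1) x2(1) by (auto simp: y1_def y2_def min_def max_def)
  have gap: "x \<notin> Z (k + m)" if x: "y1 < x" "x < y2" for x
  proof -
   have inj: "inj_on ?g {y1..y2}" by (rule inj_on_subset[OF good_inj[OF g]]) (use y in auto)
   have "p < ?g x \<and> ?g x < q"
    using continuous_inj_imp_mono[OF x fn_cont inj] x1 x2 pq e0 by (auto simp: y1_def y2_def min_def max_def split: if_splits)
   hence "(f ^^ (j + k)) x \<in> J" using pq(5) by (simp add: iter_add)
   moreover have "j + k < k + m" using pq(4) by (simp add: m_def)
   ultimately show ?thesis unfolding Z_def mem_Collect_eq by blast
  qed
  obtain z where z: "y1 < z" "z < y2" "?g y2 - ?g y1 = (y2 - y1) * Df k z" using fn_mvt[of y1 y2 k] y st by auto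
  obtain z' where z': "s < z'" "z' < t" "?g t - ?g s = (t - s) * Df k z'" using fn_mvt[of s t k] st by auto
  have "e0 <= \<bar>?g y2 - ?g y1\<bar>" using x1 x2 pq by (auto simp: y1_def y2_def min_def max_def)
  hence a1: "e0 <= (y2 - y1) * \<bar>Df k z\<bar>" using z by (simp add: abs_mult)
  have "\<bar>?g t - ?g s\<bar> <= 1" using fn_rng[of s k] fn_rng[of t k] st by auto
  hence a2: "(t - s) * \<bar>Df k z'\<bar> <= 1" using z' by (simp add: abs_mult)
  have a3: "\<bar>Df k z\<bar> <= Cd * \<bar>Df k z'\<bar>" by (rule Cd(2)[OF st(1) _ st(3) av]) (use st y z z' in auto)
  have "e0 * (t - s) <= (y2 - y1) * \<bar>Df k z\<bar> * (t - s)" using a1 st by (intro mult_right_mono) auto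
  also have "... <= (y2 - y1) * (Cd * \<bar>Df k z'\<bar>) * (t - s)" using a3 y st by (intro mult_right_mono mult_left_mono) auto
  also have "... = (y2 - y1) * Cd * ((t - s) * \<bar>Df k z'\<bar>)" by simp
  also have "... <= (y2 - y1) * Cd * 1" using a2 y Cd by (intro mult_left_mono) auto
  finally have "e0 / Cd * (t - s) <= y2 - y1" using Cd by (simp add: field_simps)
  moreover have "\<epsilon> * (t - s) <= e0 / Cd * (t - s)" using eps st by (intro mult_right_mono) auto
  ultimately have len: "\<epsilon> * (t - s) <= y2 - y1" by linarith
  have "measure lborel (Z (k + m) \<inter> {s..t}) <= measure lborel ({s..y1} \<union> {y2..t})"
  proof (rule measure_mono_01)
   show "Z (k + m) \<inter> {s..t} \<subseteq> {s..y1} \<union> {y2..t}"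
   proof
    fix x assume "x \<in> Z (k + m) \<inter> {s..t}"
    thus "x \<in> {s..y1} \<union> {y2..t}" using gap[of x] by (cases "x <= y1"; cases "y2 <= x") auto
   qed
   show "{s..y1} \<union> {y2..t} \<subseteq> {0..1}" using st y by auto
  qed (use Z_borel in auto)
  also have "... <= measure lborel {s..y1} + measure lborel {y2..t}" by (rule measure_Un_le) auto
  also have "... = (t - s) - (y2 - y1)" using y by simp
  also have "... <= (1 - \<epsilon>) * (t - s)" using len by (simp add: algebra_simps)
  finally show ?thesis .
 qed
 have Wb: "Wd w \<in> sets borel" for w using Wd_good[of w] by (elim disjE exE conjE) simp_all
 have Ws: "Wd w \<subseteq> {0..1}" for w unfolding Wd_def by blast
 have fin: "finite {w :: bool list. length w = k}" for k using finite_lists_length_eq[of "UNIV :: bool set" k] by simp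
 have disj: "disjoint_family_on Wd {w. length w = k}" for k using Wd_disj by (auto simp: disjoint_family_on_def)
 have blk: "measure lborel (Z (k + m)) <= (1 - \<epsilon>) * measure lborel (Z k)" for k
 proof -
  have "Z (k + m) \<subseteq> Z k" by (auto simp: Z_def)
  hence e: "Z (k + m) = (\<Union>w\<in>{w. length w = k}. Z (k + m) \<inter> Wd w)" using Z_Wd[of k] by blast
  have "measure lborel (Z (k + m)) = (\<Sum>w\<in>{w. length w = k}. measure lborel (Z (k + m) \<inter> Wd w))"
  proof (subst e, rule measure_finite_UN_lborel[OF fin])
   show "disjoint_family_on (\<lambda>w. Z (k + m) \<inter> Wd w) {w. length w = k}"
    using disj[of k] unfolding disjoint_family_on_def by blast
   show "Z (k + m) \<inter> Wd w \<in> sets borel" for w using Z_borel Wb by blast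
   show "Z (k + m) \<inter> Wd w \<subseteq> {0..1}" for w using Ws by blast
  qed
  also have "... <= (\<Sum>w\<in>{w. length w = k}. (1 - \<epsilon>) * measure lborel (Wd w))"
  proof (rule sum_mono)
   fix w :: "bool list" assume w: "w \<in> {w. length w = k}"
   from Wd_good[of w] show "measure lborel (Z (k + m) \<inter> Wd w) <= (1 - \<epsilon>) * measure lborel (Wd w)"
   proof
    assume "\<exists>s t. Wd w = {s..t} \<and> good_piece (length w) s t"
    then obtain s t where "Wd w = {s..t}" "good_piece k s t" using w by auto
    thus ?thesis using loss[of k s t] by (simp add: good_piece_def)
   qed simp
  qed
  also have "... = (1 - \<epsilon>) * measure lborel (Z k)"
   unfolding Z_Wd by (subst measure_finite_UN_lborel[OF fin Wb Ws disj]) (simp add: sum_distrib_left)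
  finally show ?thesis .
 qed
 show ?thesis
 proof (rule block_decay[of "\<lambda>k. measure lborel (Z k)" m "1 - \<epsilon>"])
  show "measure lborel (Z (Suc k)) <= measure lborel (Z k)" for k by (rule measure_mono_01[OF Z_Suc Z_borel Z_borel Z_sub])
  have "measure lborel (Z 0) <= measure lborel {0..1::real}" by (rule measure_mono_01) (use Z_borel Z_sub in auto)
  thus "measure lborel (Z 0) <= 1" by simp
 qed (use blk eps in \<open>auto simp: m_def\<close>)
qed

subsection \<open>Inverse branches\<close>

definition side :: "bool => real set" where "side s = (if s then {0..c} else {c..1})"
definition gi :: "bool => real => real" where "gi s = the_inv_into (side s) f"

text \<open>The branch of \<open>f\<^sup>-\<^sup>n\<close> with itinerary \<open>w\<close>, meaningful on \<open>J'\<close> when \<open>ok w\<close> holds: the images of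
 \<open>J'\<close> then avoid \<open>f 0\<close>, \<open>f 1\<close> and \<open>f c\<close>, so that every branch extends to all of \<open>J'\<close>.\<close>

primrec hw :: "bool list => real => real" where
 "hw [] y = y"
| "hw (s # w) y = gi s (hw w y)"

primrec ok :: "bool list => bool" where
 "ok [] = True"
| "ok (s # w) = (ok w \<and> hw w c \<in> f ` side s)"

definition dh :: "bool list => real => real" where "dh w y = 1 / Df (length w) (hw w y)"

lemma side_props: "side s \<subseteq> {0..1}" "compact (side s)" "inj_on f (side s)" "c \<in> side s"
 using f_inj_L f_inj_R c01 by (auto simp: side_def)

lemma side_inter: "x \<in> side s ==> x \<in> side s' ==> x ~= c ==> s = s'"
 by (cases s; cases s') (auto simp: side_def)

lemma side_cover: "x \<in> {0..1} ==> \<exists>s. x \<in> side s"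
 by (cases "x <= c") (auto simp: side_def intro: exI[of _ True] exI[of _ False])

lemma gi_f: "x \<in> side s ==> gi s (f x) = x"
 unfolding gi_def using side_props(3) by (rule the_inv_into_f_f)

lemma f_gi: "y \<in> f ` side s ==> f (gi s y) = y" "y \<in> f ` side s ==> gi s y \<in> side s"
 unfolding gi_def using f_the_inv_into_f[OF side_props(3)] the_inv_into_into[OF side_props(3) _ order_refl] by blast+

lemma side_image_interior:
 assumes "y \<in> f ` side s" "y ~= f 0" "y ~= f 1" "y ~= f c"
 shows "\<exists>u v. u < y \<and> y < v \<and> {u<..<v} \<subseteq> f ` side s"
proof -
 define e where "e = (if s then 0 else 1 :: real)"
 define u v where "u = min (f e) (f c)" and "v = max (f e) (f c)"
 have con: "continuous_on {min e c..max e c} f" using f_cont_on .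
 have sd: "side s = {min e c..max e c}" using c01 by (auto simp: side_def e_def)
 have inj: "inj_on f {min e c..max e c}" using side_props(3)[of s] sd by simp
 obtain x where x: "x \<in> side s" "f x = y" using assms(1) by blast
 have "min e c < x" "x < max e c" using x assms sd by (auto simp: e_def min_def max_def less_le split: if_splits)
 hence "u < y \<and> y < v"
  using continuous_inj_imp_mono[OF _ _ con inj, of x] x(2) by (auto simp: u_def v_def min_def max_def split: if_splits)
 moreover have "{u<..<v} \<subseteq> f ` side s"
 proof
  fix z assume z: "z \<in> {u<..<v}"
  have "z \<in> {min (f (min e c)) (f (max e c))..max (f (min e c)) (f (max e c))}"
   using z unfolding u_def v_def by (cases "e <= c") (auto simp: min_def max_def split: if_splits)
  hence "\<exists>t\<in>{min e c..max e c}. f t = z" by (intro between_image[OF _ _ con]) auto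
  thus "z \<in> f ` side s" unfolding sd by blast
 qed
 ultimately show ?thesis by blast
qed

lemma gi_der:
 assumes "y \<in> f ` side s" "y ~= f 0" "y ~= f 1" "y ~= f c"
 shows "(gi s has_real_derivative 1 / f1 (gi s y)) (at y)" "0 < gi s y" "gi s y < 1" "gi s y ~= c"
proof -
 obtain u v where uv: "u < y" "y < v" "{u<..<v} \<subseteq> f ` side s" using side_image_interior[OF assms] by blast
 have g: "gi s y \<in> {0..1}" "f (gi s y) = y" using f_gi[OF assms(1)] side_props(1) by blast+
 have "gi s y ~= 0" "gi s y ~= 1" using g(2) assms by metis+
 thus i: "0 < gi s y" "gi s y < 1" using g(1) by auto
 show nc: "gi s y ~= c" using g(2) assms by metis
 have "continuous_on (f ` side s) (gi s)" unfolding gi_def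
  by (rule continuous_on_inv_into[OF f_cont_on side_props(2,3)])
 hence "continuous_on {u<..<v} (gi s)" using uv(3) continuous_on_subset by blast
 hence "isCont (gi s) y" using uv(1,2) by (intro continuous_on_interior[of "{u<..<v}"]) auto
 hence "(gi s has_real_derivative inverse (f1 (gi s y))) (at y)"
  by (intro DERIV_inverse_function[where f = f and g = "gi s" and x = y and a = u and b = v, OF der_int(1)[OF i nc] der_int(4)[OF i nc] uv(1,2)])
   (use uv(3) f_gi(1) in \<open>auto simp: subset_iff\<close>)
 thus "(gi s has_real_derivative 1 / f1 (gi s y)) (at y)" by (simp add: inverse_eq_divide)
qed

lemma J'_int: "is_interval J'" "open J'" "connected J'" by (auto simp: J'_def is_interval_oo)

lemma cJ': "c \<in> J'" using J_sub by auto

text \<open>The image of \<open>J'\<close> under \<open>h\<close> is connected and misses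
  \<open>f 0\<close>, \<open>f 1\<close> and \<open>f c\<close>, because the orbits of 0, 1 and
  \<open>c\<close> avoid \<open>J'\<close>. So it cannot cross the boundary of the image of a
  side.\<close>

lemma branch_ext:
 assumes con: "continuous_on J' h" and fn: "\<And>y. y \<in> J' ==> (f ^^ n) (h y) = y"
  and y0: "y0 \<in> J'" "h y0 \<in> f ` side s" and y: "y \<in> J'"
 shows "h y \<in> f ` side s \<and> h y ~= f 0 \<and> h y ~= f 1 \<and> h y ~= f c"
proof -
 have ne: "h z ~= f x" if "z \<in> J'" "x \<in> {0, 1, c}" for z x
 proof
  assume "h z = f x"
  hence "(f ^^ n) (f x) = z" using fn[OF that(1)] by simp
  hence "(f ^^ Suc n) x = z" by (simp only: iter_Suc_swap)
  moreover have "(f ^^ Suc n) x \<notin> J'"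
  proof (cases "x = c")
   case True thus ?thesis using crit_avoid[of "Suc n"] by (auto simp: J'_def)
  next
   case False thus ?thesis using end_avoid[of x "Suc n"] that(2) by blast
  qed
  ultimately show False using that(1) by simp
 qed
 have cJ: "connected (h ` J')" using con J'_int(3) connected_continuous_image by blast
 have "h y \<in> f ` side s"
 proof (rule ccontr)
  assume nin: "h y \<notin> f ` side s"
  \<comment> \<open>The interior of the image of the side, in the form delivered by
    \<open>side_image_interior\<close>.\<close>
  define O' where "O' = {z. \<exists>u v. u < z \<and> z < v \<and> {u<..<v} \<subseteq> f ` side s}"
  have "open O'" unfolding open_dist
  proof (intro ballI)
   fix z assume "z \<in> O'"
   then obtain u v where uv: "u < z" "z < v" "{u<..<v} \<subseteq> f ` side s" unfolding O'_def by blast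
   have "x \<in> O'" if "dist x z < min (z - u) (v - z)" for x
   proof -
    have "u < x" "x < v" using that by (auto simp: dist_real_def)
    thus ?thesis unfolding O'_def using uv(3) by blast
   qed
   thus "\<exists>e>0. \<forall>x. dist x z < e --> x \<in> O'" using uv by (intro exI[of _ "min (z - u) (v - z)"]) auto
  qed
  have O'_sub: "z \<in> O' ==> z \<in> f ` side s" for z unfolding O'_def by auto
  have cl: "closed (f ` side s)" using side_props(2) f_cont_on compact_continuous_image compact_imp_closed by blast
  have A: "z \<in> O'" if zz: "z \<in> h ` J'" "z \<in> f ` side s" for z
  proof -
   obtain x where x: "x \<in> J'" "z = h x" using zz(1) by blast
   show ?thesis unfolding O'_def mem_Collect_eq
    by (rule side_image_interior[OF zz(2)]) (use ne[OF x(1)] x(2) in auto)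
  qed
  have "h ` J' \<subseteq> O' \<union> (- f ` side s)" using A by blast
  moreover have "O' \<inter> (- f ` side s) \<inter> h ` J' = {}" using O'_sub by blast
  ultimately have "O' \<inter> h ` J' = {} \<or> (- f ` side s) \<inter> h ` J' = {}"
   using connectedD[OF cJ \<open>open O'\<close> open_Compl[OF cl]] by blast
  moreover have "h y0 \<in> O'" using A y0 by blast
  ultimately show False using nin y0 y by blast
 qed
 thus ?thesis using ne[OF y] by simp
qed

lemma ok_branch:
 "ok w ==> continuous_on J' (hw w) \<and> (\<forall>y\<in>J'. 0 < hw w y \<and> hw w y < 1 \<and> (f ^^ length w) (hw w y) = y)"
proof (induct w)
 case Nil
 show ?case using J_sub by auto
next
 case (Cons s' w)
 hence okw: "ok w" and hc: "hw w c \<in> f ` side s'" by auto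
 note ih = Cons(1)[OF okw]
 have E: "hw w y \<in> f ` side s' \<and> hw w y ~= f 0 \<and> hw w y ~= f 1 \<and> hw w y ~= f c" if "y \<in> J'" for y
  by (rule branch_ext[of "hw w" "length w" c s' y]) (use ih hc cJ' that in auto)
 have "continuous_on J' (\<lambda>y. gi s' (hw w y))"
 proof (rule continuous_on_compose2[of "hw w ` J'" "gi s'" J' "hw w"])
  have "hw w ` J' \<subseteq> f ` side s'" using E by blast
  thus "continuous_on (hw w ` J') (gi s')"
   unfolding gi_def by (rule continuous_on_subset[OF continuous_on_inv_into[OF f_cont_on side_props(2,3)]])
 qed (use ih in auto)
 moreover have "0 < gi s' (hw w y) \<and> gi s' (hw w y) < 1 \<and> (f ^^ Suc (length w)) (gi s' (hw w y)) = y" if "y \<in> J'" for y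
 proof -
  have "f (gi s' (hw w y)) = hw w y" using E[OF that] f_gi(1) by blast
  hence "(f ^^ Suc (length w)) (gi s' (hw w y)) = y" using ih that by (simp only: iter_Suc_swap[symmetric])
  thus ?thesis using gi_der(2,3)[of "hw w y" s'] E[OF that] by blast
 qed
 ultimately show ?case by simp
qed

lemma ok_ext: "ok w ==> y0 \<in> J' ==> hw w y0 \<in> f ` side s ==> y \<in> J' ==>
  hw w y \<in> f ` side s \<and> hw w y ~= f 0 \<and> hw w y ~= f 1 \<and> hw w y ~= f c"
 using branch_ext[of "hw w" "length w" y0 s y] ok_branch[of w] by blast

lemma ok_cont: "ok w ==> continuous_on J' (hw w)"
 and ok_01: "ok w ==> y \<in> J' ==> 0 < hw w y \<and> hw w y < 1"
 and ok_fn: "ok w ==> y \<in> J' ==> (f ^^ length w) (hw w y) = y"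
 using ok_branch by blast+

lemma ok_drop: "ok w ==> ok (drop j w)"
proof (induct w arbitrary: j)
 case (Cons s w) thus ?case by (cases j) auto
qed simp

lemma ok_iter: "ok w ==> y \<in> J' ==> j <= length w ==> (f ^^ j) (hw w y) = hw (drop j w) y"
proof (induct w arbitrary: j)
 case (Cons s w)
 show ?case
 proof (cases j)
  case (Suc i)
  have "f (hw (s # w) y) = hw w y" using ok_ext[of w c s y] Cons cJ' f_gi(1) by auto
  hence "(f ^^ j) (hw (s # w) y) = (f ^^ i) (hw w y)" using Suc by (simp only: iter_Suc_swap[symmetric])
  thus ?thesis using Cons Suc by auto
 qed simp
qed simp

lemma ok_nc: "ok w ==> y \<in> J' ==> j < length w ==> (f ^^ j) (hw w y) ~= c"
using ok_fn iter_diff[of j "length w" f "hw w y"] crit_avoid[of "length w - j"] by (force simp: J'_def)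

lemma ok_side: "ok w ==> y \<in> J' ==> j < length w ==> (f ^^ j) (hw w y) \<in> side (w ! j)"
proof -
 assume w: "ok w" "y \<in> J'" "j < length w"
 have d: "drop j w = w ! j # drop (Suc j) w" using w(3) by (simp add: Cons_nth_drop_Suc)
 hence o: "ok (w ! j # drop (Suc j) w)" using ok_drop[OF w(1), of j] by simp
 have "hw (drop j w) y \<in> side (w ! j)"
  using ok_ext[of "drop (Suc j) w" c "w ! j" y] o w cJ' f_gi(2) d by auto
 thus ?thesis using ok_iter[OF w(1,2)] w(3) by simp
qed

lemma dh_nz: "ok w ==> y \<in> J' ==> dh w y ~= 0"
 unfolding dh_def using Df_nonzero[of "hw w y" "length w"] ok_nc ok_01[of w y] by auto

lemma dh_Cons: "ok (s # w) ==> y \<in> J' ==> dh (s # w) y = dh w y / f1 (hw (s # w) y)"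
proof -
 assume o: "ok (s # w)" "y \<in> J'"
 have "f (hw (s # w) y) = hw w y" using ok_iter[OF o, of 1] by simp
 hence "Df (Suc (length w)) (hw (s # w) y) = Df (length w) (hw w y) * f1 (hw (s # w) y)"
  using Df_add[of "length w" 1 "hw (s # w) y"] by (simp add: Df_def)
 thus ?thesis by (simp add: dh_def)
qed

lemma hw_der: "ok w ==> y \<in> J' ==> (hw w has_real_derivative dh w y) (at y)"
proof (induct w arbitrary: y)
 case Nil thus ?case by (simp add: dh_def)
next
 case (Cons s w)
 have E: "hw w y \<in> f ` side s \<and> hw w y ~= f 0 \<and> hw w y ~= f 1 \<and> hw w y ~= f c"
  using ok_ext[of w c s y] Cons cJ' by auto
 have "((\<lambda>y. gi s (hw w y)) has_real_derivative 1 / f1 (gi s (hw w y)) * dh w y) (at y)"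
  by (rule DERIV_chain2[OF gi_der(1)]) (use E Cons in auto)
 thus ?case using dh_Cons[OF Cons(2,3)] by simp
qed

text \<open>For inverse branches the sign of the Schwarzian is reversed: \<open>N'\<close> is
  bounded from below, which is the hypothesis of the two Koebe estimates on all of
  \<open>J'\<close>.\<close>

lemma hw_nonlinearity: "ok w ==> \<exists>N N'. \<forall>y\<in>J'. (dh w has_real_derivative dh w y * N y) (at y) \<and>
  (N has_real_derivative N' y) (at y) \<and> (N y)\<^sup>2 / 2 <= N' y"
proof (induct w)
 case Nil
 show ?case by (rule exI[of _ "\<lambda>_. 0"], rule exI[of _ "\<lambda>_. 0"]) (simp add: dh_def)
next
 case (Cons s w)
 obtain N N' where N: "\<And>y. y \<in> J' ==> (dh w has_real_derivative dh w y * N y) (at y)"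
  "\<And>y. y \<in> J' ==> (N has_real_derivative N' y) (at y)" "\<And>y. y \<in> J' ==> (N y)\<^sup>2 / 2 <= N' y" using Cons by fastforce
 let ?k = "hw (s # w)" let ?d = "dh (s # w)"
 define M where "M = (\<lambda>y. N y - Nf (?k y) * ?d y)"
 define M' where "M' = (\<lambda>y. N' y - (Nf' (?k y) * (?d y)\<^sup>2 + Nf (?k y) * (?d y * M y)))"
 have "(?d has_real_derivative ?d y * M y) (at y) \<and> (M has_real_derivative M' y) (at y) \<and> (M y)\<^sup>2 / 2 <= M' y" if y: "y \<in> J'" for y
 proof -
  have k: "0 < ?k y" "?k y < 1" "?k y ~= c" using ok_01[OF Cons(2) y] ok_nc[OF Cons(2) y, of 0] by auto
  have dk: "(?k has_real_derivative ?d y) (at y)" by (rule hw_der[OF Cons(2) y])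
  have c1: "((\<lambda>y. f1 (?k y)) has_real_derivative (f1 (?k y) * Nf (?k y)) * ?d y) (at y)"
   by (rule DERIV_chain2[OF der_int(5)[OF k] dk])
  have c2: "((\<lambda>y. Nf (?k y)) has_real_derivative Nf' (?k y) * ?d y) (at y)"
   by (rule DERIV_chain2[OF der_int(6)[OF k] dk])
  have nz: "f1 (?k y) ~= 0" by (rule der_int(4)[OF k])
  have de: "?d y = dh w y / f1 (?k y)" using dh_Cons[OF Cons(2) y] .
  have "((\<lambda>y. dh w y / f1 (?k y)) has_real_derivative
   ((dh w y * N y) * f1 (?k y) - dh w y * (f1 (?k y) * Nf (?k y) * ?d y)) / (f1 (?k y) * f1 (?k y))) (at y)"
   by (rule DERIV_divide[OF N(1)[OF y] c1 nz])
  moreover have "((dh w y * N y) * f1 (?k y) - dh w y * (f1 (?k y) * Nf (?k y) * ?d y)) / (f1 (?k y) * f1 (?k y)) = ?d y * M y"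
   unfolding M_def de by (simp add: field_simps)
  ultimately have "((\<lambda>y. dh w y / f1 (?k y)) has_real_derivative ?d y * M y) (at y)" by simp
  hence A: "(?d has_real_derivative ?d y * M y) (at y)"
   by (rule has_field_derivative_transform_within_open[OF _ J'_int(2) y]) (use dh_Cons[OF Cons(2)] in auto)
  have B: "(M has_real_derivative M' y) (at y)" unfolding M_def
   by (rule derivative_eq_intros N(2)[OF y] c2 A refl)+ (simp add: M'_def M_def algebra_simps power2_eq_square)
  have "Nf' (?k y) * (?d y)\<^sup>2 <= (Nf (?k y))\<^sup>2 / 2 * (?d y)\<^sup>2" using der_int(7)[OF k] by (intro mult_right_mono) auto
  hence "(M y)\<^sup>2 / 2 <= M' y" using N(3)[OF y] unfolding M'_def M_def by (simp add: power2_eq_square field_simps)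
  thus ?thesis using A B by blast
 qed
 thus ?case by blast
qed

text \<open>A margin around \<open>J\<close> inside \<open>J'\<close>: distortion is controlled up
  to \<open>a1\<close> and \<open>b1\<close>, and the room between them and \<open>J\<close> serves
  for the bump that vanishes at the boundary of \<open>J\<close>.\<close>

definition a1 :: real where "a1 = (a' + a) / 2"
definition b1 :: real where "b1 = (b + b') / 2"
text \<open>The Koebe bound for the nonlinearity at points whose distance from the boundary of
  \<open>J'\<close> is at least the margin.\<close>

definition K0 :: real where "K0 = 2 / min (a1 - a') (b' - b1)"

lemma a1b1: "a' < a1" "a1 < a" "b < b1" "b1 < b'" "K0 > 0" using ab by (auto simp: a1_def b1_def K0_def)

lemma koebe:
 assumes o: "ok w" and x: "x \<in> {a1..b1}" and y: "y \<in> {a1..b1}"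
 shows "\<bar>dh w x\<bar> <= \<bar>dh w y\<bar> * exp (K0 * \<bar>x - y\<bar>)"
proof -
 obtain N N' where N: "\<And>y. y \<in> J' ==> (dh w has_real_derivative dh w y * N y) (at y)"
  "\<And>y. y \<in> J' ==> (N has_real_derivative N' y) (at y)" "\<And>y. y \<in> J' ==> (N y)\<^sup>2 / 2 <= N' y"
  using hw_nonlinearity[OF o] by blast
 have sub: "{a1..b1} \<subseteq> J'" using a1b1 by (auto simp: J'_def)
 have Nb: "\<bar>N z\<bar> <= K0" if z: "z \<in> {a1..b1}" for z
 proof -
  have z': "a' < z" "z < b'" using z a1b1 by auto
  have "N z <= 2 / (b' - z)" by (rule koebe_nonlinearity_upper[of a' b' N N' z]) (use N z' in \<open>auto simp: J'_def\<close>)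
  also have "... <= K0" unfolding K0_def using z z' a1b1 by (intro divide_left_mono) auto
  finally have 1: "N z <= K0" .
  have "2 / (z - a') <= K0" unfolding K0_def using z z' a1b1 by (intro divide_left_mono) auto
  moreover have "- (2 / (z - a')) <= N z" by (rule koebe_nonlinearity_lower[of a' b' N N' z]) (use N z' in \<open>auto simp: J'_def\<close>)
  ultimately show ?thesis using 1 by linarith
 qed
 let ?l = "\<lambda>z. ln ((dh w z)\<^sup>2) / 2"
 have "norm (?l x - ?l y) <= K0 * norm (x - y)"
 proof (rule field_differentiable_bound[of "{a1..b1}" ?l N])
  fix z assume z: "z \<in> {a1..b1}"
  have nz: "dh w z ~= 0" using dh_nz[OF o] z sub by blast
  hence "0 < dh w z * dh w z" by (metis not_real_square_gt_zero)
  hence "(?l has_real_derivative N z) (at z)"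
   using z sub by (auto intro!: derivative_eq_intros N(1) simp: field_simps power2_eq_square)
  thus "(?l has_field_derivative N z) (at z within {a1..b1})" by (rule has_field_derivative_at_within)
  show "norm (N z) <= K0" using Nb[OF z] by simp
 qed (use x y in auto)
 hence "?l x <= ?l y + K0 * \<bar>x - y\<bar>" by simp
 moreover have L: "ln ((dh w z)\<^sup>2) / 2 = ln \<bar>dh w z\<bar>" "\<bar>dh w z\<bar> > 0" if "z \<in> {a1..b1}" for z
  using dh_nz[OF o, of z] that sub ln_realpow[of "\<bar>dh w z\<bar>" 2] by auto
 ultimately have "ln \<bar>dh w x\<bar> <= ln \<bar>dh w y\<bar> + K0 * \<bar>x - y\<bar>" using x y by simp
 hence "exp (ln \<bar>dh w x\<bar>) <= exp (ln \<bar>dh w y\<bar> + K0 * \<bar>x - y\<bar>)" by simp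
 thus ?thesis using L x y by (simp add: exp_add)
qed

subsection \<open>Return words\<close>

definition inJ :: "bool list => bool" where "inJ w \<longleftrightarrow> hw w c \<in> J"

lemma hw_append: "hw (w @ v) y = hw w (hw v y)"
 by (induct w) auto

lemma hw_ne_bd:
 assumes "ok w" "w ~= []" "y \<in> J'" shows "hw w y ~= a" "hw w y ~= b"
proof -
 have "length w >= 1" using assms by (cases w) auto
 thus "hw w y ~= a" "hw w y ~= b" using ok_fn[OF assms(1,3)] bd_avoid[of "length w"] assms(3) by (auto simp: J'_def)
qed

text \<open>The image of a nonempty branch is connected and misses \<open>a\<close> and
  \<open>b\<close>: its points are mapped into \<open>J'\<close>, whereas the orbits of
  \<open>a\<close> and \<open>b\<close> avoid \<open>J'\<close>.\<close>

lemma hw_dichotomy: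
 assumes "ok w" "w ~= []" "x \<in> J'" "y \<in> J'" "hw w x \<in> J"
 shows "hw w y \<in> J"
proof -
 have "connected (hw w ` J')" using ok_cont[OF assms(1)] J'_int(3) connected_continuous_image by blast
 hence iv: "\<And>p q r. p \<in> hw w ` J' ==> q \<in> hw w ` J' ==> p <= r ==> r <= q ==> r \<in> hw w ` J'"
  unfolding is_interval_connected_1[symmetric] is_interval_1 by blast
 have n: "a \<notin> hw w ` J'" "b \<notin> hw w ` J'" using hw_ne_bd[OF assms(1,2)] by force+
 have im: "hw w x \<in> hw w ` J'" "hw w y \<in> hw w ` J'" using assms by auto
 have "a < hw w y" using iv[OF im(2,1), of a] n assms(5) unfolding J_def by (metis greaterThanLessThan_iff less_imp_le not_le)
 moreover have "hw w y < b" using iv[OF im, of b] n assms(5) unfolding J_def by (metis greaterThanLessThan_iff less_imp_le not_le)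
 ultimately show ?thesis by (simp add: J_def)
qed

lemma inJ_iff: "ok w ==> w ~= [] ==> y \<in> J' ==> hw w y \<in> J \<longleftrightarrow> inJ w"
 unfolding inJ_def using hw_dichotomy cJ' by blast

lemma inJ_J: "ok w ==> inJ w ==> y \<in> J ==> hw w y \<in> J"
 using inJ_iff[of w y] J_sub(1) by (cases "w = []") auto

lemma inJ_J': "ok w ==> inJ w ==> y \<in> J' ==> hw w y \<in> J'"
 using inJ_iff[of w y] J_sub(1) by (cases "w = []") auto

lemma ok_appendI: "ok w ==> ok v ==> inJ v ==> ok (w @ v)"
proof (induct w)
 case (Cons s w)
 have "hw v c \<in> J'" using inJ_J'[OF Cons(3,4) cJ'] .
 thus ?case using Cons ok_ext[of w c s "hw v c"] cJ' by (auto simp: hw_append)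
qed simp

lemma ok_appendD: "ok (w @ v) ==> ok v" by (induct w) auto

lemma ok_appendD2: "ok (w @ v) ==> inJ v ==> ok w"
proof (induct w)
 case (Cons s w)
 have v: "ok v" using ok_appendD Cons(2) by blast
 have "hw v c \<in> J'" using inJ_J'[OF v Cons(3) cJ'] .
 thus ?case using Cons ok_ext[of w "hw v c" s c] cJ' by (auto simp: hw_append)
qed simp

text \<open>\<open>RW n\<close> labels the branches of \<open>f\<^sup>n\<close> from \<open>J\<close> to \<open>J\<close>, \<open>FR n\<close> those which are first returns.\<close>

definition RW :: "nat => bool list set" where "RW n = {w. length w = n \<and> ok w \<and> inJ w}"
definition FR :: "nat => bool list set" where "FR r = {w \<in> RW r. 1 <= r \<and> (\<forall>j. 0 < j \<and> j < r --> \<not> inJ (drop j w))}"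

lemma fin_RW: "finite (RW n)" "finite (FR n)"
using finite_lists_length_eq[of "UNIV :: bool set" n] by (auto simp: RW_def FR_def)

lemma RW_0: "RW 0 = {[]}" using J_sub by (auto simp: RW_def inJ_def)

lemma RW_append: "w \<in> RW m ==> v \<in> RW n ==> w @ v \<in> RW (m + n)"
 unfolding RW_def using ok_appendI inJ_J[of w "hw v c"] by (auto simp: hw_append inJ_def)

lemma RW_split: "u \<in> RW n ==> k <= n ==> inJ (drop k u) ==> take k u \<in> RW k \<and> drop k u \<in> RW (n - k)"
proof -
 assume u: "u \<in> RW n" "k <= n" "inJ (drop k u)"
 let ?w = "take k u" let ?v = "drop k u"
 have uw: "?w @ ?v = u" by simp
 have o: "ok ?v" "ok ?w" using ok_appendD[of ?w ?v] ok_appendD2[of ?w ?v] u by (auto simp: RW_def)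
 have "inJ ?w"
 proof (cases "?w = []")
  case True thus ?thesis using J_sub(3) unfolding inJ_def True by simp
 next
  case False
  have "hw ?w (hw ?v c) \<in> J" using u hw_append[of ?w ?v c] by (auto simp: RW_def inJ_def)
  thus ?thesis using inJ_iff[OF o(2) False, of "hw ?v c"] inJ_J'[OF o(1) u(3) cJ'] by blast
 qed
 thus ?thesis using o u by (auto simp: RW_def)
qed

text \<open>A return word is cut at its last visit to \<open>J\<close> before the end; the least
  \<open>r\<close> makes the final segment a first return. Cutting at the last visit is what puts
  \<open>LL\<close> outermost in the renewal equation.\<close>

lemma RW_decomp:
 assumes n: "n >= 1"
 shows "bij_betw (\<lambda>(r, w, v). w @ v) (SIGMA r:{1..n}. RW (n - r) \<times> FR r) (RW n)"
proof (rule bij_betwI')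
 fix x y assume x: "x \<in> (SIGMA r:{1..n}. RW (n - r) \<times> FR r)" and y: "y \<in> (SIGMA r:{1..n}. RW (n - r) \<times> FR r)"
 obtain r w v where xe: "x = (r, w, v)" by (cases x)
 obtain r' w' v' where ye: "y = (r', w', v')" by (cases y)
 have props: "r \<in> {1..n}" "r' \<in> {1..n}" "w \<in> RW (n - r)" "v \<in> FR r" "w' \<in> RW (n - r')" "v' \<in> FR r'" using x y xe ye by auto
 have len: "length w = n - r" "length w' = n - r'" "length v = r" "length v' = r'" using props by (auto simp: RW_def FR_def)
 show "((case x of (r, w, v) => w @ v) = (case y of (r, w, v) => w @ v)) = (x = y)"
 proof
  assume "(case x of (r, w, v) => w @ v) = (case y of (r, w, v) => w @ v)"
  hence eq: "w @ v = w' @ v'" using xe ye by simp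
  have A: False if "r1 < r2" "w1 @ v1 = w2 @ v2" "v1 \<in> FR r1" "v2 \<in> FR r2" "length w1 = n - r1" "length w2 = n - r2" "r1 \<in> {1..n}" "r2 \<in> {1..n}"
   for w1 w2 v1 v2 and r1 r2 :: nat
  proof -
   have "drop (n - r1) (w1 @ v1) = v1" using that(5) by simp
   moreover have "n - r1 - (n - r2) = r2 - r1" "n - r2 <= n - r1" using that(1,7,8) by auto
   hence "drop (n - r1) (w2 @ v2) = drop (r2 - r1) v2" using that(6) by simp
   ultimately have "v1 = drop (r2 - r1) v2" using that(2) by metis
   hence "inJ (drop (r2 - r1) v2)" using that(3) by (auto simp: FR_def RW_def)
   thus False using that by (auto simp: FR_def)
  qed
  have "r = r'" using A[of r r' w v w' v'] A[of r' r w' v' w v] eq props len by (metis linorder_neqE_nat)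
  thus "x = y" using eq len xe ye by auto
 qed simp
next
 fix x assume x: "x \<in> (SIGMA r:{1..n}. RW (n - r) \<times> FR r)"
 obtain r w v where xe: "x = (r, w, v)" by (cases x)
 thus "(case x of (r, w, v) => w @ v) \<in> RW n" using x RW_append[of w "n - r" v r] by (auto simp: FR_def)
next
 fix u assume u: "u \<in> RW n"
 define r where "r = (LEAST r. 1 <= r \<and> inJ (drop (n - r) u))"
 have ex: "1 <= n \<and> inJ (drop (n - n) u)" using u n by (simp add: RW_def)
 have r: "1 <= r" "inJ (drop (n - r) u)" using LeastI[of "\<lambda>r. 1 <= r \<and> inJ (drop (n - r) u)" n, OF ex] unfolding r_def by blast+
 have rn: "r <= n" unfolding r_def by (rule Least_le) (rule ex)
 have min: "\<not> inJ (drop (n - r') u)" if "1 <= r'" "r' < r" for r' using not_less_Least[of r' "\<lambda>r. 1 <= r \<and> inJ (drop (n - r) u)"] that unfolding r_def by blast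
 have sp: "take (n - r) u \<in> RW (n - r)" "drop (n - r) u \<in> RW r" using RW_split[OF u _ r(2)] rn by auto
 have "drop (n - r) u \<in> FR r" unfolding FR_def
 proof (intro CollectI conjI allI impI sp r(1))
  fix j assume j: "0 < j \<and> j < r"
  have "drop j (drop (n - r) u) = drop (n - (r - j)) u" using j rn by (simp add: add.commute)
  thus "\<not> inJ (drop j (drop (n - r) u))" using min[of "r - j"] j by (metis One_nat_def Suc_leI diff_less less_le_trans not_less_zero zero_less_diff linorder_not_le)
 qed
 hence "(r, take (n - r) u, drop (n - r) u) \<in> (SIGMA r:{1..n}. RW (n - r) \<times> FR r)" using sp r rn by auto
 thus "\<exists>x\<in>(SIGMA r:{1..n}. RW (n - r) \<times> FR r). u = (case x of (r, w, v) => w @ v)"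
  by (intro bexI[of _ "(r, take (n - r) u, drop (n - r) u)"]) simp_all
qed

text \<open>The transfer operators of \<open>f\<^sup>n\<close> restricted to orbits from \<open>J\<close> to \<open>J\<close>, and of the first returns at time \<open>r\<close>.\<close>

definition GG :: "nat => (real => real) => real => real" where
 "GG n u y = (\<Sum>w\<in>RW n. u (hw w y) * \<bar>dh w y\<bar>)"
definition LL :: "nat => (real => real) => real => real" where
 "LL r u y = (\<Sum>w\<in>FR r. u (hw w y) * \<bar>dh w y\<bar>)"

lemma dh_append: "ok w ==> ok v ==> inJ v ==> y \<in> J' ==> dh (w @ v) y = dh w (hw v y) * dh v y"
proof -
 assume v: "ok w" "ok v" "inJ v" "y \<in> J'"
 let ?x = "hw w (hw v y)"
 have "(f ^^ length w) ?x = hw v y" using ok_fn[OF v(1) inJ_J'[OF v(2-4)]] .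
 hence "Df (length w + length v) ?x = Df (length v) (hw v y) * Df (length w) ?x"
  using Df_add[of "length v" "length w" ?x] by (simp add: add.commute)
 thus ?thesis unfolding dh_def hw_append length_append by simp
qed

lemma renewal_identity:
 assumes n: "n >= 1" and y: "y \<in> J"
 shows "GG n u y = (\<Sum>r\<in>{1..n}. LL r (GG (n - r) u) y)"
proof -
 have y': "y \<in> J'" using y J_sub by auto
 have "GG n u y = (\<Sum>x\<in>(SIGMA r:{1..n}. RW (n - r) \<times> FR r). u (hw ((\<lambda>(r, w, v). w @ v) x) y) * \<bar>dh ((\<lambda>(r, w, v). w @ v) x) y\<bar>)"
  unfolding GG_def by (rule sum.reindex_bij_betw[OF RW_decomp[OF n], symmetric])
 also have "... = (\<Sum>r\<in>{1..n}. \<Sum>x\<in>RW (n - r) \<times> FR r. u (hw (fst x @ snd x) y) * \<bar>dh (fst x @ snd x) y\<bar>)"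
  by (subst sum.Sigma) (auto simp: fin_RW split_def)
 also have "... = (\<Sum>r\<in>{1..n}. LL r (GG (n - r) u) y)"
 proof (rule sum.cong[OF refl])
  fix r assume "r \<in> {1..n}"
  have "(\<Sum>x\<in>RW (n - r) \<times> FR r. u (hw (fst x @ snd x) y) * \<bar>dh (fst x @ snd x) y\<bar>) =
   (\<Sum>w\<in>RW (n - r). \<Sum>v\<in>FR r. u (hw (w @ v) y) * \<bar>dh (w @ v) y\<bar>)"
   by (simp add: sum.cartesian_product split_def)
  also have "... = (\<Sum>v\<in>FR r. \<Sum>w\<in>RW (n - r). u (hw (w @ v) y) * \<bar>dh (w @ v) y\<bar>)" by (rule sum.swap)
  also have "... = (\<Sum>v\<in>FR r. \<Sum>w\<in>RW (n - r). (u (hw w (hw v y)) * \<bar>dh w (hw v y)\<bar>) * \<bar>dh v y\<bar>)"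
   by (intro sum.cong refl) (auto simp: hw_append dh_append RW_def FR_def abs_mult y')
  also have "... = LL r (GG (n - r) u) y" unfolding LL_def GG_def by (simp add: sum_distrib_right)
  finally show "(\<Sum>x\<in>RW (n - r) \<times> FR r. u (hw (fst x @ snd x) y) * \<bar>dh (fst x @ snd x) y\<bar>) = LL r (GG (n - r) u) y" .
 qed
 finally show ?thesis .
qed

lemma branch_cover:
 "x \<in> {0..1} ==> (f ^^ n) x \<in> J' ==> \<exists>w. length w = n \<and> ok w \<and> x = hw w ((f ^^ n) x)"
proof (induct n arbitrary: x)
 case (Suc n)
 have fx: "(f ^^ n) (f x) \<in> J'" "f x \<in> {0..1}" using Suc(3) f_rng by (simp_all only: iter_Suc_swap) auto
 then obtain w where w: "length w = n" "ok w" "f x = hw w ((f ^^ n) (f x))" using Suc(1) by blast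
 obtain s where s: "x \<in> side s" using side_cover[OF Suc(2)] by blast
 have "hw w c \<in> f ` side s" using ok_ext[OF w(2) fx(1) _ cJ', of s] w(3) s by auto
 hence "ok (s # w)" using w(2) by simp
 moreover have "x = hw (s # w) ((f ^^ Suc n) x)" using gi_f[OF s] w(3) by (simp only: iter_Suc_swap hw.simps)
 ultimately show ?case using w(1) by (intro exI[of _ "s # w"]) auto
qed simp

text \<open>A description by itinerary; it makes branch images Borel without discussing images of
  measurable sets.\<close>

lemma hw_image:
 assumes "ok w" "A \<subseteq> J'"
 shows "hw w ` A = {x \<in> {0..1}. (f ^^ length w) x \<in> A \<and> (\<forall>j<length w. (f ^^ j) x \<in> side (w ! j))}"
proof (intro equalityI subsetI)
 fix x assume "x \<in> hw w ` A"
 then obtain y where y: "y \<in> A" "x = hw w y" by blast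
 hence "y \<in> J'" using assms by auto
 thus "x \<in> {x \<in> {0..1}. (f ^^ length w) x \<in> A \<and> (\<forall>j<length w. (f ^^ j) x \<in> side (w ! j))}"
  using ok_01[OF assms(1), of y] ok_fn[OF assms(1), of y] ok_side[OF assms(1), of y] y by auto
next
 fix x assume x: "x \<in> {x \<in> {0..1}. (f ^^ length w) x \<in> A \<and> (\<forall>j<length w. (f ^^ j) x \<in> side (w ! j))}"
 let ?y = "(f ^^ length w) x"
 have y: "?y \<in> J'" using x assms by auto
 obtain v where v: "length v = length w" "ok v" "x = hw v ?y" using branch_cover[of x "length w"] x y by auto
 have "v = w"
 proof (rule nth_equalityI[OF v(1)])
  fix j assume j: "j < length v"
  have "(f ^^ j) x \<in> side (v ! j)" "(f ^^ j) x ~= c" using ok_side[OF v(2) y j] ok_nc[OF v(2) y j] v(3) by auto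
  moreover have "(f ^^ j) x \<in> side (w ! j)" using x j v(1) by auto
  ultimately show "v ! j = w ! j" using side_inter by blast
 qed
 thus "x \<in> hw w ` A" using v(3) x by blast
qed

lemma hw_disjoint: "ok w ==> ok v ==> length w = length v ==> w ~= v ==> hw w ` J' \<inter> hw v ` J' = {}"
proof (rule ccontr)
 assume o: "ok w" "ok v" "length w = length v" "w ~= v" "hw w ` J' \<inter> hw v ` J' ~= {}"
 then obtain y z where yz: "y \<in> J'" "z \<in> J'" "hw w y = hw v z" by blast
 have "w = v"
 by (smt (verit) ok_side[OF o(1) yz(1)] ok_side[OF o(2) yz(2)] ok_nc[OF o(1) yz(1)] yz(3) o(3) side_inter nth_equalityI o(1) yz(1) o(2) yz(2))
 thus False using o by simp
qed

lemma RW_sets: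
 assumes "A \<subseteq> J"
 shows "{x \<in> J. (f ^^ n) x \<in> A} = (\<Union>w\<in>RW n. hw w ` A)"
proof (intro equalityI subsetI)
 fix x assume x: "x \<in> {x \<in> J. (f ^^ n) x \<in> A}"
 let ?y = "(f ^^ n) x"
 have yJ: "?y \<in> J" "?y \<in> J'" and xJ: "x \<in> J" "x \<in> {0..1}" using x assms J_sub by auto
 obtain w where w: "length w = n" "ok w" "x = hw w ?y" using branch_cover[of x n] xJ yJ by auto
 have "inJ w" using inJ_iff[OF w(2) _ yJ(2)] w(3) xJ J_sub by (cases "w = []") (auto simp: inJ_def)
 thus "x \<in> (\<Union>w\<in>RW n. hw w ` A)" using w x by (auto simp: RW_def)
next
 fix x assume "x \<in> (\<Union>w\<in>RW n. hw w ` A)"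
 then obtain w y where w: "w \<in> RW n" "y \<in> A" "x = hw w y" by blast
 hence "y \<in> J" "y \<in> J'" using assms J_sub by auto
 thus "x \<in> {x \<in> J. (f ^^ n) x \<in> A}" using w inJ_J[of w y] ok_fn[of w y] by (auto simp: RW_def)
qed

definition frset :: "nat => real set" where
 "frset r = {x \<in> J. 1 <= r \<and> (f ^^ r) x \<in> J \<and> (\<forall>j. 0 < j \<and> j < r --> (f ^^ j) x \<notin> J)}"

lemma FR_sets:
 assumes "A \<subseteq> J"
 shows "{x \<in> frset r. (f ^^ r) x \<in> A} = (\<Union>w\<in>FR r. hw w ` A)"
proof -
 have E: "(f ^^ j) (hw w y) \<in> J \<longleftrightarrow> inJ (drop j w)" if "w \<in> RW r" "y \<in> J'" "j < r" for w y j
 proof -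
  have w: "ok w" "length w = r" using that by (auto simp: RW_def)
  thus ?thesis using ok_iter[OF w(1) that(2), of j] inJ_iff[OF ok_drop[OF w(1)], of j y] that by auto
 qed
 have J': "A \<subseteq> J'" using assms J_sub by auto
 show ?thesis
 proof (intro equalityI subsetI)
  fix x assume x: "x \<in> {x \<in> frset r. (f ^^ r) x \<in> A}"
  hence "x \<in> {x \<in> J. (f ^^ r) x \<in> A}" by (auto simp: frset_def)
  then obtain w y where w: "w \<in> RW r" "y \<in> A" "x = hw w y" unfolding RW_sets[OF assms] by blast
  have "w \<in> FR r" unfolding FR_def using w x E[OF w(1), of y] J' by (auto simp: frset_def)
  thus "x \<in> (\<Union>w\<in>FR r. hw w ` A)" using w by blast
 next
  fix x assume "x \<in> (\<Union>w\<in>FR r. hw w ` A)"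
  then obtain w y where w: "w \<in> FR r" "y \<in> A" "x = hw w y" by blast
  hence wR: "w \<in> RW r" "1 <= r" by (auto simp: FR_def)
  hence "x \<in> {x \<in> J. (f ^^ r) x \<in> A}" unfolding RW_sets[OF assms] using w by blast
  moreover have "(f ^^ j) x \<notin> J" if "0 < j \<and> j < r" for j using E[OF wR(1), of y j] w J' that by (auto simp: FR_def)
  ultimately show "x \<in> {x \<in> frset r. (f ^^ r) x \<in> A}" using wR assms by (auto simp: frset_def)
 qed
qed

section \<open>Change of variables along branches\<close>

lemma fn_meas: "(f ^^ n) \<in> borel_measurable borel"
 using fn_cont by (rule borel_measurable_continuous_onI)

lemma hw_image_borel: "ok w ==> A \<subseteq> J' ==> A \<in> sets borel ==> hw w ` A \<in> sets borel"
proof -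
 assume w: "ok w" "A \<subseteq> J'" "A \<in> sets borel"
 have p: "(f ^^ n) -` B \<in> sets borel" if "B \<in> sets borel" for n B
  using measurable_sets[OF fn_meas that] by simp
 have s: "side s \<in> sets borel" for s by (simp add: side_def)
 have "hw w ` A = {0..1} \<inter> (f ^^ length w) -` A \<inter> {x. \<forall>j\<in>{..<length w}. x \<in> (f ^^ j) -` side (w ! j)}"
  unfolding hw_image[OF w(1,2)] by auto
 also have "... = {0..1} \<inter> (f ^^ length w) -` A \<inter> (\<Inter>j\<in>{..<length w}. (f ^^ j) -` side (w ! j)) \<inter> UNIV" by auto
 also have "... \<in> sets borel"
 using w p s by auto
 finally show ?thesis .
qed

lemma hw_inj: "ok w ==> inj_on (hw w) J'"
 using ok_fn by (metis inj_onI)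

lemma branch_integral:
 assumes w: "ok w" and A: "A \<subseteq> J'" "A \<in> sets borel" and F: "F absolutely_integrable_on (hw w ` A)"
 shows "(\<lambda>y. F (hw w y) * \<bar>dh w y\<bar>) absolutely_integrable_on A"
  "integral A (\<lambda>y. F (hw w y) * \<bar>dh w y\<bar>) = integral (hw w ` A) F"
proof -
 have "(\<lambda>x. \<bar>dh w x\<bar> * F (hw w x)) absolutely_integrable_on A \<and>
     integral A (\<lambda>x. \<bar>dh w x\<bar> * F (hw w x)) = integral (hw w ` A) F
  \<longleftrightarrow> F absolutely_integrable_on (hw w ` A) \<and> integral (hw w ` A) F = integral (hw w ` A) F"
 proof (rule has_absolute_integral_change_of_variables_1')
  show "A \<in> sets lebesgue" using A by simp
  show "inj_on (hw w) A" using hw_inj[OF w] A inj_on_subset by blast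
  show "(hw w has_real_derivative dh w x) (at x within A)" if "x \<in> A" for x
   using hw_der[OF w] that A has_field_derivative_at_within by blast
 qed
 thus "(\<lambda>y. F (hw w y) * \<bar>dh w y\<bar>) absolutely_integrable_on A"
  "integral A (\<lambda>y. F (hw w y) * \<bar>dh w y\<bar>) = integral (hw w ` A) F" using F by (auto simp: mult.commute)
qed

lemma words_integral:
 assumes Om: "finite \<Omega>" "\<And>w. w \<in> \<Omega> ==> ok w \<and> length w = n" and A: "A \<subseteq> J'" "A \<in> sets borel"
  and u: "u absolutely_integrable_on B" "(\<Union>w\<in>\<Omega>. hw w ` A) \<subseteq> B"
 shows "(\<lambda>y. \<Sum>w\<in>\<Omega>. u (hw w y) * \<bar>dh w y\<bar>) absolutely_integrable_on A"
  "integral A (\<lambda>y. \<Sum>w\<in>\<Omega>. u (hw w y) * \<bar>dh w y\<bar>) = integral (\<Union>w\<in>\<Omega>. hw w ` A) u"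
proof -
 have ai: "u absolutely_integrable_on (hw w ` A)" if "w \<in> \<Omega>" for w
 proof (rule set_integrable_subset[OF u(1)])
  show "hw w ` A \<in> sets lebesgue" using hw_image_borel[of w A] Om A that by simp
  show "hw w ` A \<subseteq> B" using u(2) that by blast
 qed
 show "(\<lambda>y. \<Sum>w\<in>\<Omega>. u (hw w y) * \<bar>dh w y\<bar>) absolutely_integrable_on A"
  by (rule absolutely_integrable_sum[OF Om(1)]) (use branch_integral(1)[OF _ A ai] Om in auto)
 have "integral A (\<lambda>y. \<Sum>w\<in>\<Omega>. u (hw w y) * \<bar>dh w y\<bar>) = (\<Sum>w\<in>\<Omega>. integral A (\<lambda>y. u (hw w y) * \<bar>dh w y\<bar>))"
  by (rule integral_sum[OF Om(1)]) (use branch_integral(1)[OF _ A ai] Om in \<open>auto intro: abs_int_imp_int\<close>)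
 also have "... = (\<Sum>w\<in>\<Omega>. integral (hw w ` A) u)" by (intro sum.cong refl branch_integral(2)[OF _ A ai]) (use Om in auto)
 also have "... = integral (\<Union>w\<in>\<Omega>. hw w ` A) u"
 proof (rule integral_unique[symmetric], rule has_integral_UN[OF Om(1)])
  show "(u has_integral integral (hw w ` A) u) (hw w ` A)" if "w \<in> \<Omega>" for w
   using ai[OF that] abs_int_imp_int by blast
  show "pairwise (\<lambda>i i'. negligible (hw i ` A \<inter> hw i' ` A)) \<Omega>"
  proof (rule pairwiseI)
   fix v w assume vw: "v \<in> \<Omega>" "w \<in> \<Omega>" "v ~= w"
   hence "hw v ` J' \<inter> hw w ` J' = {}" using hw_disjoint Om by metis
   hence "hw v ` A \<inter> hw w ` A = {}" using A by blast
   thus "negligible (hw v ` A \<inter> hw w ` A)" by simp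
  qed
 qed
 finally show "integral A (\<lambda>y. \<Sum>w\<in>\<Omega>. u (hw w y) * \<bar>dh w y\<bar>) = integral (\<Union>w\<in>\<Omega>. hw w ` A) u" .
qed

end

subsection \<open>Return time tails at a flat critical point\<close>

text \<open>The order of \<open>-ln |f x - f c|\<close> at distance \<open>d\<close> from
  \<open>c\<close>: the exponent \<open>d powr (- v)\<close> times the logarithm of the
  base.\<close>

definition Phi :: "real => real => real" where "Phi v d = d powr (- v) * ln (1 / d)"

text \<open>\<open>Qf (1 / v)\<close> inverts \<open>Phi v\<close> up to constants: at
  \<open>D\<close> the power yields \<open>k / ln k\<close>, and \<open>ln (1 / D)\<close> restores
  \<open>ln k / v\<close>. This is the source of the logarithm in the tail.\<close>

lemma Phi_at:
 assumes v: "0 < v" and k: "k >= 3" and L: "L > 0" and D: "D = L * Qf (1 / v) (real k)"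
 shows "D powr (- v) = L powr (- v) * (real k / ln (real k))"
  "L <= 1 ==> L powr (- v) * (real k / (2 * v)) <= Phi v D"
  "L >= 1 ==> D < 1 ==> Phi v D <= L powr (- v) * (real k / v)"
proof -
 have lk: "ln (real k) > 1"
 proof -
  have "exp 1 < (3::real)" using e_less_272 by simp
  hence "ln (exp 1) < ln (real k)" using k by (subst ln_less_cancel_iff) auto
  thus ?thesis by simp
 qed
 have q: "ln (real k) / real k > 0" using k by simp
 have Qp: "Qf (1 / v) (real k) > 0" using k by (intro Qf_pos) auto
 have Dp: "D > 0" using D L Qp by simp
 have "Qf (1 / v) (real k) powr (- v) = (ln (real k) / real k) powr (- 1)" unfolding Qf_def using v by (simp add: powr_powr)
 also have "... = real k / ln (real k)" using k by (simp add: powr_minus_divide)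
 finally have Qv: "Qf (1 / v) (real k) powr (- v) = real k / ln (real k)" .
 show e: "D powr (- v) = L powr (- v) * (real k / ln (real k))" unfolding D Qv[symmetric] by (intro powr_mult)
 have lnQ: "ln (Qf (1 / v) (real k)) = (1 / v) * (ln (ln (real k)) - ln (real k))"
  unfolding Qf_def by (simp add: ln_powr ln_div)
 have lnD: "ln (1 / D) = - ln L + (1 / v) * (ln (real k) - ln (ln (real k)))"
  using D L Qp by (simp add: ln_div ln_mult lnQ algebra_simps)
 have lp: "L powr (- v) > 0" using L by simp
 show "L powr (- v) * (real k / (2 * v)) <= Phi v D" if "L <= 1"
 proof -
  have "ln (ln (real k)) <= ln (real k) / 2"
  proof -
   have "ln (ln (real k) / 2) <= ln (real k) / 2 - 1" using lk by (intro ln_le_minus_one) auto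
   moreover have "ln (ln (real k) / 2) = ln (ln (real k)) - ln 2" using lk by (simp add: ln_div)
   moreover have "ln 2 <= (1::real)" using ln_2_less_1 by simp
   ultimately show ?thesis by linarith
  qed
  hence "(1 / v) * (ln (real k) / 2) <= (1 / v) * (ln (real k) - ln (ln (real k)))" using v by (intro mult_left_mono) auto
  moreover have "ln L <= 0" using that L by simp
  ultimately have "(1 / v) * (ln (real k) / 2) <= ln (1 / D)" using lnD by linarith
  hence "D powr (- v) * ((1 / v) * (ln (real k) / 2)) <= Phi v D" unfolding Phi_def by (intro mult_left_mono) auto
  thus ?thesis using lk by (simp add: e field_simps)
 qed
 show "Phi v D <= L powr (- v) * (real k / v)" if "L >= 1" "D < 1"
 proof -
  have "ln L >= 0" "ln (ln (real k)) >= 0" using that lk by auto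
  hence "(1 / v) * (ln (real k) - ln (ln (real k))) <= (1 / v) * ln (real k)" using v by (intro mult_left_mono) auto
  hence "ln (1 / D) <= (1 / v) * ln (real k)" using lnD \<open>ln L \<ge> 0\<close> by linarith
  hence "Phi v D <= D powr (- v) * ((1 / v) * ln (real k))" unfolding Phi_def by (intro mult_left_mono) auto
  thus ?thesis using lk by (simp add: e field_simps)
 qed
qed

lemma Qf_lim: "s > 1 ==> (\<lambda>k. Qf s (real k)) \<longlonglongrightarrow> 0"
proof -
 assume s: "s > 1"
 have "((\<lambda>k. tf s (real k)) \<longlongrightarrow> 0) sequentially" using tf_lim[OF s] filterlim_real_sequentially by (rule filterlim_compose)
 moreover have "\<forall>\<^sub>F k in sequentially. 0 <= Qf s (real k) \<and> Qf s (real k) <= tf s (real k)"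
  using eventually_gt_at_top[of 1]
 proof eventually_elim
  case (elim k)
  hence "Qf s (real k) > 0" by (intro Qf_pos) auto
  hence "1 * Qf s (real k) <= real k * Qf s (real k)" using elim by (intro mult_right_mono) auto
  thus ?case using \<open>Qf s (real k) > 0\<close> by (simp add: tf_def)
 qed
 ultimately show ?thesis by (intro tendsto_sandwich[of "\<lambda>_. 0" "\<lambda>k. Qf s (real k)" sequentially "\<lambda>k. tf s (real k)" 0]) (auto elim: eventually_mono)
qed

locale flat_unimodal = nice_unimodal +
 fixes v0 C1 C2 e0 :: real
 assumes v0: "0 < v0" "v0 < 1" and C12: "C1 > 0" "C2 > 0" and e0: "e0 > 0"
  and flat_lo: "\<And>x. x \<in> {0..1} ==> 0 < \<bar>x - c\<bar> ==> \<bar>x - c\<bar> < e0 ==> exp (- C1 * Phi v0 \<bar>x - c\<bar>) <= kap x"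
  and flat_hi: "\<And>x. x \<in> {0..1} ==> 0 < \<bar>x - c\<bar> ==> \<bar>x - c\<bar> < e0 ==> kap x <= exp (- C2 * Phi v0 \<bar>x - c\<bar>)"
begin

definition sR :: "nat => real set" where "sR k = {x \<in> J. \<forall>j. 1 <= j \<and> j <= k --> (f ^^ j) x \<notin> J}"
definition TT :: "nat => real" where "TT k = measure lborel (sR k)"
definition ss :: real where "ss = 1 / v0"

lemma ss: "ss > 1" using v0 by (simp add: ss_def field_simps)

lemma kap_le_dist:
 assumes "x \<in> {0..1}" "\<bar>x - c\<bar> <= D" "0 < D" "c - D >= 0" "c + D <= 1" "kap (c - D) <= B" "kap (c + D) <= B"
 shows "kap x <= B"
proof (cases "x <= c")
 case True
 thus ?thesis using kap_L[of "c - D" x] assms by (cases "x = c - D") auto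
next
 case False
 thus ?thesis using kap_R[of x "c + D"] assms by (cases "x = c + D") auto
qed

lemma kap_ge_dist:
 assumes "x \<in> {0..1}" "\<bar>x - c\<bar> >= D" "0 < D" "c - D >= 0" "c + D <= 1" "B <= kap (c - D)" "B <= kap (c + D)"
 shows "B <= kap x"
proof (cases "x <= c")
 case True
 thus ?thesis using kap_L[of x "c - D"] assms by (cases "x = c - D") auto
next
 case False
 thus ?thesis using kap_R[of "c + D" x] assms by (cases "x = c + D") auto
qed

lemma sR_borel: "sR k \<in> sets borel"
proof -
 have p: "(f ^^ n) -` B \<in> sets borel" if "B \<in> sets borel" for n B
  using measurable_sets[OF fn_meas that] by simp
 have "sR k = J - (\<Union>j\<in>{1..k}. (f ^^ j) -` J)" by (auto simp: sR_def)
 also have "... \<in> sets borel" using p by (intro sets.Diff sets.finite_UN) (auto simp: J_def)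
 finally show ?thesis .
qed

lemma sR_sub: "sR k \<subseteq> J" "sR k \<subseteq> {0..1}" using J_sub by (auto simp: sR_def)

lemma f1_bound: "\<exists>M>1. \<forall>x\<in>{0..1}. \<bar>f1 x\<bar> <= M"
proof -
 have "compact (f1 ` {0..1})" using f1_cont by (intro compact_continuous_image) auto
 then obtain B where "\<forall>x\<in>f1 ` {0..1}. norm x <= B" using compact_imp_bounded bounded_iff by blast
 thus ?thesis by (intro exI[of _ "max 2 B"]) (auto simp: le_max_iff_disj)
qed

text \<open>Points within \<open>D\<close> of \<open>c\<close> start, after one step, within
  \<open>exp (- C2 * Phi)\<close> of \<open>f c\<close> and separate from the critical orbit by at
  most the factor \<open>M\<close> per step. That orbit stays at distance at least
  \<open>dcut\<close> from \<open>J\<close>, so these points cannot return up to time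
  \<open>k\<close>.\<close>

lemma TT_lower: "\<exists>d>0. \<forall>\<^sub>F k in sequentially. d * Qf ss (real k) <= TT k"
proof -
 obtain M where M: "M > 1" "\<And>x. x \<in> {0..1} ==> \<bar>f1 x\<bar> <= M" using f1_bound by blast
 have lip: "\<bar>f x - f y\<bar> <= M * \<bar>x - y\<bar>" if "x \<in> {0..1}" "y \<in> {0..1}" for x y
  using field_differentiable_bound[of "{0..1}" f f1 M x y] f_der M that by auto
 have spread: "\<bar>(f ^^ Suc j) x - (f ^^ Suc j) c\<bar> <= M ^ j * kap x" if x: "x \<in> {0..1}" for x j
 proof (induct j)
  case (Suc j)
  have "\<bar>(f ^^ Suc (Suc j)) x - (f ^^ Suc (Suc j)) c\<bar> <= M * \<bar>(f ^^ Suc j) x - (f ^^ Suc j) c\<bar>"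
   using lip[OF fn_rng[OF x, of "Suc j"] fn_rng[of c "Suc j"]] c01 by simp
  also have "... <= M * (M ^ j * kap x)" using Suc M by (intro mult_left_mono) auto
  finally show ?case by simp
 qed (simp add: kap_def)
 have inR: "x \<in> sR k" if x: "x \<in> J" and k: "M ^ k * kap x < dcut" for x k
  unfolding sR_def
 proof (intro CollectI conjI allI impI x)
  fix j assume j: "1 <= j \<and> j <= k"
  then obtain i where i: "j = Suc i" by (cases j) auto
  have x01: "x \<in> {0..1}" using x J_sub by auto
  have "\<bar>(f ^^ j) x - (f ^^ j) c\<bar> <= M ^ i * kap x" unfolding i by (rule spread[OF x01])
  also have "... <= M ^ k * kap x" using j i M by (intro mult_right_mono power_increasing) (auto simp: kap_def)
  finally have "\<bar>(f ^^ j) x - (f ^^ j) c\<bar> < dcut" using k by simp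
  moreover have "(f ^^ j) c \<notin> {a'..b'}" using crit_avoid j by blast
  ultimately show "(f ^^ j) x \<notin> J" unfolding J_def dcut_def by auto
 qed
 \<comment> \<open>Makes \<open>C2 * Phi\<close> at \<open>D\<close> at least
   \<open>k * (ln M + 1)\<close>; the surplus \<open>k\<close> beats the constant
   \<open>dcut\<close>.\<close>
 define L where "L = min 1 ((C2 / (2 * v0 * (ln M + 1))) powr (1 / v0))"
 have lM: "ln M > 0" using M by simp
 have L: "0 < L" "L <= 1" using C12 v0 lM by (auto simp: L_def)
 have Lv: "ln M + 1 <= C2 * (L powr (- v0) / (2 * v0))"
 proof -
  have "L <= (C2 / (2 * v0 * (ln M + 1))) powr (1 / v0)" by (simp add: L_def)
  hence "L powr v0 <= ((C2 / (2 * v0 * (ln M + 1))) powr (1 / v0)) powr v0" using L v0 by (intro powr_mono2) auto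
  also have "... = C2 / (2 * v0 * (ln M + 1))" using v0 C12 lM by (simp add: powr_powr)
  finally have "L powr v0 <= C2 / (2 * v0 * (ln M + 1))" .
  moreover have "2 * v0 * (ln M + 1) > 0" using v0 lM by simp
  ultimately have "L powr v0 * (2 * v0 * (ln M + 1)) <= C2" by (simp only: pos_le_divide_eq)
  moreover have "L powr v0 > 0" using L by simp
  ultimately show ?thesis using v0 by (simp add: powr_minus field_simps)
 qed
 define D where "D k = L * Qf ss (real k)" for k :: nat
 have Dlim: "D \<longlonglongrightarrow> 0" unfolding D_def using tendsto_mult_right_zero[OF Qf_lim[OF ss]] by simp
 define r where "r = Min {e0, c - a, b - c}"
 have r: "r > 0" "r <= e0" "r <= c - a" "r <= b - c" using e0 ab by (auto simp: r_def)
 have evD: "\<forall>\<^sub>F k in sequentially. D k < r" using order_tendstoD(2)[OF Dlim r(1)] .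
 have evk: "\<forall>\<^sub>F k in sequentially. real k > - ln dcut" using filterlim_real_sequentially by (auto simp: filterlim_at_top_dense)
 have "\<forall>\<^sub>F k in sequentially. 1 * L * Qf ss (real k) <= TT k"
  using evD evk eventually_ge_at_top[of 3]
 proof eventually_elim
  case (elim k)
  let ?D = "D k"
  have Dp: "0 < ?D" unfolding D_def using L Qf_pos[of "real k" ss] elim by simp
  have Ph: "L powr (- v0) * (real k / (2 * v0)) <= Phi v0 ?D"
   by (rule Phi_at(2)) (use v0 elim L in \<open>auto simp: D_def ss_def\<close>)
  have small: "exp (- C2 * Phi v0 ?D) * M ^ k < dcut"
  proof -
   have "real k * (ln M + 1) <= real k * (C2 * (L powr (- v0) / (2 * v0)))" using Lv by (intro mult_left_mono) auto
   also have "... = C2 * (L powr (- v0) * (real k / (2 * v0)))" by simp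
   also have "... <= C2 * Phi v0 ?D" using Ph C12 by (intro mult_left_mono) auto
   finally have "- C2 * Phi v0 ?D + real k * ln M < ln dcut" using elim by (simp add: algebra_simps)
   hence "exp (- C2 * Phi v0 ?D + real k * ln M) < exp (ln dcut)" by simp
   moreover have "exp (real k * ln M) = M ^ k" using M by (simp add: exp_of_nat_mult)
   ultimately show ?thesis using dcut_pos exp_add[of "- C2 * Phi v0 ?D" "real k * ln M"] by (simp del: mult_minus_left)
  qed
  have sub: "{c - ?D<..<c + ?D} \<subseteq> sR k"
  proof
   fix x assume x: "x \<in> {c - ?D<..<c + ?D}"
   have xJ: "x \<in> J" using x elim r by (auto simp: J_def)
   have "kap x <= exp (- C2 * Phi v0 ?D)"
    by (rule kap_le_dist[of x ?D]) (use x xJ J_sub Dp elim r ab flat_hi[of "c - ?D"] flat_hi[of "c + ?D"] in auto)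
   hence "M ^ k * kap x <= M ^ k * exp (- C2 * Phi v0 ?D)" using M by (intro mult_left_mono) auto
   thus "x \<in> sR k" using inR[OF xJ, of k] small by (simp add: mult.commute)
  qed
  have "measure lborel {c - ?D<..<c + ?D} <= TT k" unfolding TT_def by (rule measure_mono_01[OF sub _ sR_borel sR_sub(2)]) simp
  thus ?case using Dp by (simp add: D_def)
 qed
 thus ?thesis using L by (intro exI[of _ L]) auto
qed

text \<open>Turns lower bounds for \<open>kap\<close> into lower bounds for \<open>f1\<close>. The
  mean value point between \<open>x\<close> and \<open>c\<close> has the smaller derivative, by the
  minimum principle against a reference point \<open>p\<close> or \<open>q\<close> whose derivative
  is larger.\<close>

lemma f1_near_c: "\<exists>e>0. \<forall>x. 0 < \<bar>x - c\<bar> \<and> \<bar>x - c\<bar> < e --> kap x <= \<bar>f1 x\<bar> * \<bar>x - c\<bar>"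
proof -
 have Df1: "Df 1 = f1" by (auto simp: Df_def fun_eq_iff)
 have con: "continuous_on {0..1} (\<lambda>x. \<bar>f1 x\<bar>)" using f1_cont by (intro continuous_intros)
 have f1c: "f1 c = 0" using f1_zero[of c] c01 by auto
 define p q where "p = c / 2" and "q = (1 + c) / 2"
 have pq: "0 < p" "p < c" "c < q" "q < 1" using c01 by (auto simp: p_def q_def)
 define \<eta> where "\<eta> = min \<bar>f1 p\<bar> \<bar>f1 q\<bar>"
 have eta: "\<eta> > 0" using f1_zero[of p] f1_zero[of q] pq by (auto simp: \<eta>_def)
 obtain d where d: "d > 0" "\<And>x. x \<in> {0..1} ==> \<bar>x - c\<bar> < d ==> \<bar>f1 x\<bar> < \<eta>"
  using con eta f1c c01 unfolding continuous_on_iff dist_real_def by (metis abs_abs atLeastAtMost_iff diff_zero less_imp_le abs_zero)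
 define e where "e = Min {d, c - p, q - c}"
 have e: "e > 0" "e <= d" "e <= c - p" "e <= q - c" using d pq by (auto simp: e_def)
 have "kap x <= \<bar>f1 x\<bar> * \<bar>x - c\<bar>" if x: "0 < \<bar>x - c\<bar>" "\<bar>x - c\<bar> < e" for x
 proof (cases "x < c")
  case True
  obtain z where z: "x < z" "z < c" "f c - f x = (c - x) * f1 z" using fn_mvt[of x c 1] True x e pq Df1 by auto
  have "min \<bar>Df 1 p\<bar> \<bar>Df 1 z\<bar> <= \<bar>Df 1 x\<bar>"
   by (rule Df_min_principle[of 0 c 1 p x z]) (use True x e pq z c01 in auto)
  moreover have "\<bar>f1 z\<bar> < \<bar>f1 p\<bar>" using d(2)[of z] z x e pq by (auto simp: \<eta>_def)
  ultimately have "\<bar>f1 z\<bar> <= \<bar>f1 x\<bar>" unfolding Df1 by auto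
  hence "(c - x) * \<bar>f1 z\<bar> <= (c - x) * \<bar>f1 x\<bar>" using True by (intro mult_left_mono) auto
  thus ?thesis using z by (simp add: kap_def abs_mult abs_minus_commute mult.commute)
 next
  case False
  hence xc: "c < x" using x by auto
  obtain z where z: "c < z" "z < x" "f x - f c = (x - c) * f1 z" using fn_mvt[of c x 1] xc x e pq Df1 by auto
  have "min \<bar>Df 1 z\<bar> \<bar>Df 1 q\<bar> <= \<bar>Df 1 x\<bar>"
   by (rule Df_min_principle[of c 1 1 z x q]) (use xc x e pq z c01 in auto)
  moreover have "\<bar>f1 z\<bar> < \<bar>f1 q\<bar>" using d(2)[of z] z x e pq by (auto simp: \<eta>_def)
  ultimately have "\<bar>f1 z\<bar> <= \<bar>f1 x\<bar>" unfolding Df1 by auto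
  hence "(x - c) * \<bar>f1 z\<bar> <= (x - c) * \<bar>f1 x\<bar>" using xc by (intro mult_left_mono) auto
  thus ?thesis using z by (simp add: kap_def abs_mult mult.commute)
 qed
 thus ?thesis using e(1) by blast
qed

lemma preimage_measure:
 assumes S: "S \<in> sets borel" "S \<subseteq> side s" "S \<subseteq> {0<..<1}" and i: "i > 0" "\<And>x. x \<in> S ==> i <= \<bar>f1 x\<bar>"
  and im: "f ` S \<subseteq> Z k"
 shows "measure lborel S <= measure lborel (Z k) / i"
proof -
 have S01: "S \<subseteq> {0..1}" using S side_props(1) by blast
 have Sl: "S \<in> lmeasurable" by (rule lmeasurable_01[OF S(1) S01])
 have fm: "f ` S \<in> sets lebesgue"
 proof (rule differentiable_image_in_sets_lebesgue)
  show "f differentiable_on S" unfolding differentiable_on_def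
  using f_der S01 DERIV_subset has_field_derivative_def differentiable_def by blast
 qed (use S in auto)
 have bd: "f ` S \<in> lmeasurable" using fm bounded_subset[OF compact_imp_bounded[OF compact_Icc], of "f ` S" 0 1] im Z_sub by (intro bounded_set_imp_lmeasurable) blast+
 have one: "(\<lambda>_. 1 :: real) absolutely_integrable_on f ` S" using bd by (simp add: lmeasurable_iff_integrable set_integrable_def)
 have cv: "(\<lambda>x. \<bar>f1 x\<bar> * 1) absolutely_integrable_on S \<and> integral S (\<lambda>x. \<bar>f1 x\<bar> * 1) = integral (f ` S) (\<lambda>_. 1 :: real)
  \<longleftrightarrow> (\<lambda>_. 1 :: real) absolutely_integrable_on f ` S \<and> integral (f ` S) (\<lambda>_. 1 :: real) = integral (f ` S) (\<lambda>_. 1 :: real)"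
 proof (rule has_absolute_integral_change_of_variables_1'[where f = "\<lambda>_. 1 :: real"])
  show "S \<in> sets lebesgue" using S by simp
  show "inj_on f S" using side_props(3) S(2) inj_on_subset by blast
  show "(f has_real_derivative f1 x) (at x within S)" if "x \<in> S" for x using f_der S01 that DERIV_subset by blast
 qed
 hence ai: "(\<lambda>x. \<bar>f1 x\<bar>) absolutely_integrable_on S" and eq: "integral S (\<lambda>x. \<bar>f1 x\<bar>) = integral (f ` S) (\<lambda>_. 1 :: real)" using one by auto
 have "i * measure lebesgue S = integral S (\<lambda>x. i * 1)" unfolding lmeasure_integral[OF Sl] by (rule integral_mult_right[symmetric])
 hence "i * measure lebesgue S = integral S (\<lambda>_. i)" by simp
 also have "... <= integral S (\<lambda>x. \<bar>f1 x\<bar>)"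
 proof (rule integral_le)
  show "(\<lambda>_. i) integrable_on S" using Sl integrable_on_const by blast
  show "(\<lambda>x. \<bar>f1 x\<bar>) integrable_on S" using ai abs_int_imp_int by blast
 qed (use i in auto)
 also have "... = measure lebesgue (f ` S)" unfolding eq using bd by (simp add: lmeasure_integral)
 also have "... <= measure lebesgue (Z k)"
 proof (rule measure_mono_fmeasurable[OF im fm])
  show "Z k \<in> lmeasurable" by (rule lmeasurable_01[OF Z_borel Z_sub])
 qed
 finally have "i * measure lborel S <= measure lborel (Z k)" using S Z_borel by simp
 thus ?thesis using i by (simp add: field_simps)
qed

lemma f1_away: "e > 0 ==> \<exists>m>0. \<forall>x\<in>{0..1}. e <= \<bar>x - c\<bar> --> m <= \<bar>f1 x\<bar>"
proof -
 assume e: "e > 0"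
 define A where "A = {0..1} \<inter> {x. e <= \<bar>x - c\<bar>}"
 have "closed {x. e <= \<bar>x - c\<bar>}" by (intro closed_Collect_le continuous_intros)
 hence cA: "compact A" unfolding A_def by (intro compact_Int_closed compact_Icc)
 show ?thesis
 proof (cases "A = {}")
  case True thus ?thesis by (intro exI[of _ 1]) (auto simp: A_def)
 next
  case False
  have "continuous_on A (\<lambda>x. \<bar>f1 x\<bar>)" using continuous_on_subset[OF f1_cont, of A] by (intro continuous_intros) (auto simp: A_def)
  then obtain x where x: "x \<in> A" "\<forall>y\<in>A. \<bar>f1 x\<bar> <= \<bar>f1 y\<bar>" using continuous_attains_inf[OF cA False] by blast
  have "x ~= c" using x e by (auto simp: A_def)
  hence "f1 x ~= 0" using f1_zero[of x] x by (auto simp: A_def)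
  thus ?thesis using x(2) by (intro exI[of _ "\<bar>f1 x\<bar>"]) (auto simp: A_def)
 qed
qed

text \<open>Points farther than \<open>D\<close> from \<open>c\<close> have derivative at least of
  order \<open>exp (- k * q)\<close>, and those that have not returned are mapped into
  \<open>Z k\<close>, of measure of order \<open>exp (- 2 * k * q)\<close>. They contribute at most
  order \<open>exp (- k * q)\<close>, so the neighbourhood of radius \<open>D\<close>
  dominates.\<close>

lemma TT_upper: "\<exists>C>0. \<forall>\<^sub>F k in sequentially. TT k <= C * Qf ss (real k)"
proof -
 obtain Cz \<gamma> where Cz: "Cz > 0" "0 < \<gamma>" "\<gamma> < 1" "\<And>k. measure lborel (Z k) <= Cz * \<gamma> ^ k" using Z_exp by blast
 define q where "q = - ln \<gamma> / 2"
 have q: "q > 0" using Cz by (simp add: q_def)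
 have gq: "\<gamma> ^ k = exp (- (real k * q)) * exp (- (real k * q))" for k
 proof -
  have "\<gamma> ^ k = exp (real k * ln \<gamma>)" using Cz by (simp add: exp_of_nat_mult)
  also have "real k * ln \<gamma> = - (real k * q) + - (real k * q)" by (simp add: q_def)
  finally show ?thesis by (simp only: exp_add)
 qed
 obtain e where e: "e > 0" "\<And>x. 0 < \<bar>x - c\<bar> ==> \<bar>x - c\<bar> < e ==> kap x <= \<bar>f1 x\<bar> * \<bar>x - c\<bar>" using f1_near_c by blast
 obtain m where m: "m > 0" "\<And>x. x \<in> {0..1} ==> e <= \<bar>x - c\<bar> ==> m <= \<bar>f1 x\<bar>" using f1_away[OF e(1)] by blast
 define m' where "m' = min 1 m"
 have m': "0 < m'" "m' <= 1" "m' <= m" using m by (auto simp: m'_def)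
 define L where "L = max 1 ((C1 / (v0 * q)) powr (1 / v0))"
 have L: "1 <= L" by (simp add: L_def)
 have Lv: "C1 * (L powr (- v0) / v0) <= q"
 proof -
  have "C1 / (v0 * q) = ((C1 / (v0 * q)) powr (1 / v0)) powr v0" using v0 C12 q by (simp add: powr_powr)
  also have "... <= L powr v0" using v0 by (intro powr_mono2) (auto simp: L_def)
  finally have "C1 / (v0 * q) <= L powr v0" .
  hence "C1 <= L powr v0 * (v0 * q)" using v0 q by (simp add: pos_divide_le_eq)
  moreover have "L powr v0 > 0" using L by simp
  ultimately show ?thesis using v0 by (simp add: powr_minus field_simps)
 qed
 define D where "D k = L * Qf ss (real k)" for k :: nat
 have Dlim: "D \<longlonglongrightarrow> 0" unfolding D_def using tendsto_mult_right_zero[OF Qf_lim[OF ss]] by simp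
 define r where "r = Min {e0, c, 1 - c, 1}"
 have r: "r > 0" "r <= e0" "r <= c" "r <= 1 - c" "r <= 1" using e0 c01 by (auto simp: r_def)
 have evD: "\<forall>\<^sub>F k in sequentially. D k < r" using order_tendstoD(2)[OF Dlim r(1)] .
 have "(\<lambda>k. real k powr ss * exp (- (real k * q))) \<longlonglongrightarrow> 0" using q by real_asymp
 hence evE: "\<forall>\<^sub>F k in sequentially. real k powr ss * exp (- (real k * q)) < 1" by (rule order_tendstoD) simp
 have "\<forall>\<^sub>F k in sequentially. TT k <= (2 * L + 2 * Cz / m') * Qf ss (real k)"
  using evD evE eventually_ge_at_top[of 3]
 proof eventually_elim
  case (elim k)
  let ?D = "D k" let ?E = "exp (- (real k * q))"
  have Qp: "Qf ss (real k) > 0" using elim by (intro Qf_pos) auto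
  have Dp: "0 < ?D" unfolding D_def using L Qp by simp
  have EQ: "?E <= Qf ss (real k)"
  proof -
   have "exp 1 <= real k" using e_less_272 elim by simp
   hence "ln (exp 1) <= ln (real k)" using elim by (subst ln_le_cancel_iff) auto
   hence "(1 / real k) powr ss <= Qf ss (real k)" unfolding Qf_def using elim ss by (intro powr_mono2 divide_right_mono) auto
   moreover have "?E <= (1 / real k) powr ss" using elim by (simp add: powr_divide field_simps)
   ultimately show ?thesis by linarith
  qed
  have Ph: "Phi v0 ?D <= L powr (- v0) * (real k / v0)"
   by (rule Phi_at(3)) (use v0 elim L r in \<open>auto simp: D_def ss_def\<close>)
  have big: "?E <= exp (- C1 * Phi v0 ?D)"
  proof -
   have "C1 * Phi v0 ?D <= C1 * (L powr (- v0) * (real k / v0))" using Ph C12 by (intro mult_left_mono) auto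
   also have "... = real k * (C1 * (L powr (- v0) / v0))" by simp
   also have "... <= real k * q" using Lv by (intro mult_left_mono) auto
   finally show ?thesis by simp
  qed
  have lowf1: "m' * ?E <= \<bar>f1 x\<bar>" if x: "x \<in> {0..1}" "?D <= \<bar>x - c\<bar>" for x
  proof (cases "\<bar>x - c\<bar> < e")
   case True
   have "?E <= kap x"
   proof (rule kap_ge_dist[of x ?D])
    have "exp (- C1 * Phi v0 ?D) <= kap (c - ?D)" using flat_lo[of "c - ?D"] Dp elim r by simp
    thus "?E <= kap (c - ?D)" using big by linarith
    have "exp (- C1 * Phi v0 ?D) <= kap (c + ?D)" using flat_lo[of "c + ?D"] Dp elim r by simp
    thus "?E <= kap (c + ?D)" using big by linarith
   qed (use x Dp elim r c01 in auto)
   also have "... <= \<bar>f1 x\<bar> * \<bar>x - c\<bar>" using e(2)[of x] True x Dp by auto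
   also have "... <= \<bar>f1 x\<bar> * 1" using x c01 by (intro mult_left_mono) auto
   finally have "?E <= \<bar>f1 x\<bar>" by simp
   moreover have "m' * ?E <= 1 * ?E" using m' by (intro mult_right_mono) auto
   ultimately show ?thesis by linarith
  next
   case False
   have "m' * ?E <= m * 1" using m' q by (intro mult_mono) auto
   thus ?thesis using m(2)[of x] False x by simp
  qed
  define W where "W s = sR k \<inter> side s \<inter> {x. ?D <= \<bar>x - c\<bar>}" for s
  have cl: "{x. ?D <= \<bar>x - c\<bar>} \<in> sets borel" by (intro borel_closed closed_Collect_le continuous_intros)
  have Wb: "W s \<in> sets borel" for s unfolding W_def using sR_borel cl by (intro sets.Int) (auto simp: side_def)
  have W01: "W s \<subseteq> {0..1}" for s using sR_sub by (auto simp: W_def)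
  have Wm: "measure lborel (W s) <= Cz / m' * Qf ss (real k)" for s
  proof -
   have "measure lborel (W s) <= measure lborel (Z k) / (m' * ?E)"
   proof (rule preimage_measure[OF Wb, of s s])
    show "W s \<subseteq> side s" by (auto simp: W_def)
    show "W s \<subseteq> {0<..<1}" using sR_sub(1)[of k] ab by (auto simp: W_def J_def)
    show "m' * ?E > 0" using m' by simp
    show "m' * ?E <= \<bar>f1 x\<bar>" if "x \<in> W s" for x using lowf1[of x] that sR_sub(2)[of k] by (auto simp: W_def)
    show "f ` W s \<subseteq> Z k"
    proof (rule image_subsetI)
     fix x assume "x \<in> W s"
     hence x: "x \<in> sR k" by (simp add: W_def)
     have "(f ^^ j) (f x) \<notin> J" if "j < k" for j
     proof -
      have "(f ^^ Suc j) x \<notin> J" using x that unfolding sR_def by (metis (mono_tags, lifting) Suc_leI le_add1 mem_Collect_eq plus_1_eq_Suc)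
      thus ?thesis by (simp only: iter_Suc_swap) simp
     qed
     thus "f x \<in> Z k" using f_rng by (auto simp: Z_def)
    qed
   qed
   also have "... <= (Cz * \<gamma> ^ k) / (m' * ?E)" using Cz m' by (intro divide_right_mono) auto
   also have "... = Cz / m' * ?E" unfolding gq by simp
   also have "... <= Cz / m' * Qf ss (real k)" using EQ Cz m' by (intro mult_left_mono) auto
   finally show ?thesis .
  qed
  have sub: "sR k \<subseteq> {c - ?D..c + ?D} \<union> (W True \<union> W False)"
  proof
   fix x assume x: "x \<in> sR k"
   hence "x \<in> {0..1}" using sR_sub by blast
   then obtain s where "x \<in> side s" using side_cover by blast
   thus "x \<in> {c - ?D..c + ?D} \<union> (W True \<union> W False)" using x by (cases s; cases "?D <= \<bar>x - c\<bar>") (auto simp: W_def)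
  qed
  have "TT k <= measure lborel ({c - ?D..c + ?D} \<union> (W True \<union> W False))" unfolding TT_def
   by (rule measure_mono_01[OF sub sR_borel]) (use Wb W01 Dp elim r in auto)
  also have "... <= measure lborel {c - ?D..c + ?D} + measure lborel (W True \<union> W False)" using Wb by (intro measure_Un_le) auto
  also have "... <= measure lborel {c - ?D..c + ?D} + (measure lborel (W True) + measure lborel (W False))"
   using Wb by (intro add_left_mono measure_Un_le) auto
  also have "... <= 2 * ?D + (Cz / m' * Qf ss (real k) + Cz / m' * Qf ss (real k))" using Wm[of True] Wm[of False] Dp by (intro add_mono) auto
  also have "... = (2 * L + 2 * Cz / m') * Qf ss (real k)" by (simp add: D_def algebra_simps)
  finally show ?case .
 qed
 moreover have "2 * L + 2 * Cz / m' > 0" using L Cz m' by (intro add_pos_pos) auto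
 ultimately show ?thesis by blast
qed

text \<open>Shifting time by this threshold makes the estimates for \<open>Qf\<close> and
  \<open>tf\<close> valid from time 0 on.\<close>

abbreviation (input) BB :: real where "BB \<equiv> Bs ss"

lemma TT_upper_all: "\<exists>C>0. \<forall>k. TT k <= C * Qf ss (BB + real k)"
proof -
 obtain C where C: "C > 0" "\<forall>\<^sub>F k in sequentially. TT k <= C * Qf ss (real k)" using TT_upper by blast
 then obtain k0 where k0: "\<And>k. k >= k0 ==> TT k <= C * Qf ss (real k)" by (auto simp: eventually_sequentially)
 have B1: "BB > 1" using Bs_props(1)[OF ss order_refl] .
 define k1 where "k1 = max k0 2"
 define C' where "C' = C * (1 + BB) powr ss"
 have Qp: "Qf ss (BB + real k) > 0" for k using B1 by (intro Qf_pos) auto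
 have big: "TT k <= C' * Qf ss (BB + real k)" if k: "k >= k1" for k
 proof -
  have k2: "k >= 2" "k >= k0" using k by (auto simp: k1_def)
  have l: "ln (real k) > 0" "ln (real k) <= ln (BB + real k)" using k2 B1 by auto
  have "ln (real k) / real k <= (1 + BB) * (ln (BB + real k) / (BB + real k))"
  proof -
   have "BB + real k <= (1 + BB) * real k" using k2 B1 by (simp add: algebra_simps)
   hence "ln (real k) * (BB + real k) <= ln (BB + real k) * ((1 + BB) * real k)" using l k2 B1 by (intro mult_mono) auto
   thus ?thesis using k2 B1 by (simp add: field_simps)
  qed
  hence "Qf ss (real k) <= ((1 + BB) * (ln (BB + real k) / (BB + real k))) powr ss" unfolding Qf_def using l k2 ss by (intro powr_mono2) auto
  also have "... = (1 + BB) powr ss * Qf ss (BB + real k)" unfolding Qf_def by (rule powr_mult)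
  finally have "C * Qf ss (real k) <= C * ((1 + BB) powr ss * Qf ss (BB + real k))" using C by (intro mult_left_mono) auto
  thus ?thesis using k0[OF k2(2)] by (simp add: C'_def mult.assoc)
 qed
 define C2 where "C2 = C' + (\<Sum>k<k1. \<bar>TT k\<bar> / Qf ss (BB + real k))"
 have s0: "0 <= (\<Sum>k<k1. \<bar>TT k\<bar> / Qf ss (BB + real k))" using Qp by (intro sum_nonneg divide_nonneg_nonneg) (auto simp: less_imp_le)
 have C'p: "C' > 0" using C B1 by (simp add: C'_def)
 have "TT k <= C2 * Qf ss (BB + real k)" for k
 proof (cases "k >= k1")
  case True
  have "C' * Qf ss (BB + real k) <= C2 * Qf ss (BB + real k)" using s0 Qp by (intro mult_right_mono) (auto simp: C2_def less_imp_le)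
  thus ?thesis using big[OF True] by simp
 next
  case False
  have "\<bar>TT k\<bar> / Qf ss (BB + real k) <= (\<Sum>k<k1. \<bar>TT k\<bar> / Qf ss (BB + real k))"
   using False Qp by (intro member_le_sum[of k "{..<k1}" "\<lambda>k. \<bar>TT k\<bar> / Qf ss (BB + real k)"] divide_nonneg_nonneg) (auto simp: less_imp_le)
  hence "\<bar>TT k\<bar> / Qf ss (BB + real k) <= C2" using C'p by (simp add: C2_def)
  hence "\<bar>TT k\<bar> <= C2 * Qf ss (BB + real k)" using Qp[of k] by (simp add: pos_divide_le_eq)
  thus ?thesis by simp
 qed
 moreover have "C2 > 0" using C'p s0 by (simp add: C2_def)
 ultimately show ?thesis by blast
qed

lemma TT_lower_BB: "\<exists>d>0. \<exists>k0. \<forall>k\<ge>k0. d * Qf ss (BB + real k) <= TT k"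
proof -
 obtain d where d: "d > 0" "\<forall>\<^sub>F k in sequentially. d * Qf ss (real k) <= TT k" using TT_lower by blast
 then obtain k0 where k0: "\<And>k. k >= k0 ==> d * Qf ss (real k) <= TT k" by (auto simp: eventually_sequentially)
 have B1: "BB > 1" using Bs_props(1)[OF ss order_refl] .
 obtain k1 :: nat where k1: "real k1 >= BB" using real_arch_simple by blast
 have "d * Qf ss (BB + real k) <= TT k" if "k >= max k0 k1" for k
 proof -
  have "Qf ss (BB + real k) <= Qf ss (real k)" using Qf_dec[OF ss, of "real k" "BB + real k"] k1 that B1 by simp
  hence "d * Qf ss (BB + real k) <= d * Qf ss (real k)" using d by (intro mult_left_mono) auto
  thus ?thesis using k0[of k] that by simp
 qed
 thus ?thesis using d(1) by blast
qed

end

text \<open>Let \<open>d\<close> be the least positive difference of two elements. A nonzero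
  remainder modulo \<open>d\<close> would produce a smaller difference, so \<open>d\<close> divides
  every element; and all large multiples of \<open>d\<close> are combinations of \<open>q\<close>
  and \<open>q + d\<close>.\<close>

lemma additive_set_eventually:
 fixes P :: "nat set"
 assumes ne: "p0 \<in> P" and pos: "\<And>n. n \<in> P ==> 1 <= n" and add: "\<And>m n. m \<in> P ==> n \<in> P ==> m + n \<in> P"
 shows "\<exists>d\<ge>1. (\<forall>n\<in>P. d dvd n) \<and> (\<exists>N. \<forall>n\<ge>N. n \<in> P \<longleftrightarrow> d dvd n)"
proof -
 have mult: "k * n \<in> P" if "n \<in> P" "1 <= k" for k n using that(2,1) by (induct k rule: dec_induct) (simp_all add: add)
 define D where "D e \<longleftrightarrow> 1 <= e \<and> (\<exists>q\<in>P. q + e \<in> P)" for e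
 have D0: "D p0" unfolding D_def using ne pos add by blast
 define d where "d = (LEAST e. D e)"
 have Dd: "D d" unfolding d_def by (rule LeastI[of D, OF D0])
 then obtain q where q: "q \<in> P" "q + d \<in> P" and d1: "1 <= d" unfolding D_def by blast
 have dv: "d dvd n" if n: "n \<in> P" for n
 proof (rule ccontr)
  assume nd: "\<not> d dvd n"
  define k r where "k = n div d" and "r = n mod d"
  have r: "1 <= r" "r < d" using nd d1 by (auto simp: r_def dvd_eq_mod_eq_0)
  have n': "n = k * d + r" by (simp add: k_def r_def)
  have "Suc k * (q + d) \<in> P" using mult[OF q(2), of "Suc k"] by simp
  moreover have "Suc k * (q + d) + r = n + (k * q + (q + d))" by (simp add: n' algebra_simps)
  moreover have "k * q + (q + d) \<in> P" using mult[OF q(1), of k] add[OF _ q(2)] q(2) by (cases "k = 0") auto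
  ultimately have "D r" unfolding D_def using add[OF n] r by metis
  thus False using not_less_Least[of r D] r d_def by simp
 qed
 obtain Q where Q: "q = d * Q" using dv[OF q(1)] by blast
 have Q1: "1 <= Q" using pos[OF q(1)] Q by (cases Q) auto
 have "n \<in> P" if n: "n >= d * (Q * Q)" "d dvd n" for n
 proof -
  obtain x where x: "n = d * x" using n by blast
  have xQ: "Q * Q <= x" using n x d1 by simp
  define k j where "k = x div Q" and "j = x mod Q"
  have kj: "j < Q" "Q <= k" "x = Q * k + j" using Q1 xQ by (auto simp: k_def j_def less_eq_div_iff_mult_less_eq)
  have "n = (k - j) * q + j * (q + d)"
  using kj by (simp add: less_imp_le le_trans le_add_diff_inverse2 x kj(3) Q algebra_simps)
  moreover have "(k - j) * q \<in> P" using mult[OF q(1), of "k - j"] kj by simp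
  ultimately show ?thesis using mult[OF q(2), of j] add by (cases "j = 0") auto
 qed
 thus ?thesis using d1 dv by blast
qed

context flat_unimodal
begin

subsection \<open>Log-Lipschitz densities\<close>

text \<open>A multiplicative form of \<open>ln u\<close> being \<open>K\<close>-Lipschitz that also
  admits the zero function and is kept by sums with the same constant.\<close>

definition LIP :: "real => (real => real) => bool" where
 "LIP K u \<longleftrightarrow> (\<forall>x\<in>J. 0 <= u x) \<and> (\<forall>x\<in>J. \<forall>y\<in>J. u x <= u y * exp (K * \<bar>x - y\<bar>))"
definition br :: "bool list => (real => real) => real => real" where "br w u y = u (hw w y) * \<bar>dh w y\<bar>"

lemma GG_br: "GG n u y = (\<Sum>w\<in>RW n. br w u y)" and LL_br: "LL r u y = (\<Sum>w\<in>FR r. br w u y)"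
 by (simp_all add: GG_def LL_def br_def)

lemma LIP_nonneg: "LIP K u ==> x \<in> J ==> 0 <= u x" and LIP_le: "LIP K u ==> x \<in> J ==> y \<in> J ==> u x <= u y * exp (K * \<bar>x - y\<bar>)"
 by (auto simp: LIP_def)

lemma LIP_mono: "LIP K u ==> K <= K' ==> LIP K' u"
 unfolding LIP_def by (intro conjI ballI) (blast, meson exp_le_cancel_iff mult_left_mono mult_right_mono abs_ge_zero order_trans)

lemma LIP_sum: "(\<And>i. i \<in> I ==> LIP K (u i)) ==> LIP K (\<lambda>y. \<Sum>i\<in>I. u i y)"
 unfolding LIP_def by (auto simp: sum_distrib_right intro!: sum_nonneg sum_mono)

lemma LIP_cong: "LIP K u ==> (\<And>y. y \<in> J ==> u y = v y) ==> LIP K v"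
 unfolding LIP_def by metis

lemma LIP_cmult: "LIP K u ==> 0 <= k ==> LIP K (\<lambda>y. k * u y)"
 unfolding LIP_def by (auto simp: mult.assoc intro!: mult_left_mono)

lemma LIP_mult: "LIP K u ==> LIP K' v ==> LIP (K + K') (\<lambda>y. u y * v y)"
proof -
 assume u: "LIP K u" "LIP K' v"
 have "u x * v x <= (u y * exp (K * \<bar>x - y\<bar>)) * (v y * exp (K' * \<bar>x - y\<bar>))" if "x \<in> J" "y \<in> J" for x y
  using LIP_nonneg[OF u(1)] LIP_nonneg[OF u(2)] LIP_le[OF u(1)] LIP_le[OF u(2)] that by (intro mult_mono) auto
 hence "u x * v x <= u y * v y * exp ((K + K') * \<bar>x - y\<bar>)" if "x \<in> J" "y \<in> J" for x y
  using that by (simp add: distrib_right exp_add mult.assoc mult.left_commute)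
 thus ?thesis using LIP_nonneg[OF u(1)] LIP_nonneg[OF u(2)] unfolding LIP_def by simp
qed

definition dl :: real where "dl = b - a"
text \<open>A bound for all branch derivatives over the closure of \<open>J\<close>: branch images
  have length at most 1, and distortion spreads the mean value over the interval.\<close>

definition Th :: real where "Th = exp (K0 * dl) / dl"

lemma dl: "dl > 0" using ab by (simp add: dl_def)
lemma Th: "Th > 0" using dl by (simp add: Th_def)

lemma J_len: "x \<in> J ==> y \<in> J ==> \<bar>x - y\<bar> <= dl" by (auto simp: J_def dl_def)
lemma Icc_J': "{a1..b1} \<subseteq> J'" "{a..b} \<subseteq> {a1..b1}" "J \<subseteq> {a..b}" using a1b1 by (auto simp: J'_def J_def)

lemma hw_mvt:
 assumes w: "ok w" and xy: "x \<in> J'" "y \<in> J'"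
 shows "\<exists>z\<in>{min x y..max x y}. \<bar>hw w x - hw w y\<bar> = \<bar>dh w z\<bar> * \<bar>x - y\<bar>"
proof -
 have *: "\<exists>z\<in>{p..q}. \<bar>hw w q - hw w p\<bar> = \<bar>dh w z\<bar> * \<bar>q - p\<bar>" if "p < q" "p \<in> J'" "q \<in> J'" for p q
 proof -
  have "\<exists>z>p. z < q \<and> hw w q - hw w p = (q - p) * dh w z"
   by (rule MVT2[OF that(1)]) (use that hw_der[OF w] in \<open>auto simp: J'_def\<close>)
  thus ?thesis by (metis abs_mult atLeastAtMost_iff less_imp_le mult.commute)
 qed
 show ?thesis
 proof (cases x y rule: linorder_cases)
  case less thus ?thesis using *[OF less xy] by (simp add: abs_minus_commute)
 next
  case greater thus ?thesis using *[OF greater xy(2,1)] by simp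
 qed auto
qed

lemma koebe_J: "ok w ==> x \<in> {a..b} ==> y \<in> {a..b} ==> \<bar>dh w x\<bar> <= \<bar>dh w y\<bar> * exp (K0 * \<bar>x - y\<bar>)"
 using koebe[of w x y] Icc_J' by blast

lemma koebe_dl: "ok w ==> x \<in> {a..b} ==> y \<in> {a..b} ==> \<bar>dh w x\<bar> <= \<bar>dh w y\<bar> * exp (K0 * dl)"
proof -
 assume *: "ok w" "x \<in> {a..b}" "y \<in> {a..b}"
 have "exp (K0 * \<bar>x - y\<bar>) <= exp (K0 * dl)" using * a1b1 by (auto simp: dl_def)
 hence "\<bar>dh w y\<bar> * exp (K0 * \<bar>x - y\<bar>) <= \<bar>dh w y\<bar> * exp (K0 * dl)" by (intro mult_left_mono) auto
 thus ?thesis using koebe_J[OF *] by linarith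
qed

lemma dh_le_image:
 assumes w: "ok w" and y: "y \<in> {a..b}"
 shows "\<bar>dh w y\<bar> <= \<bar>hw w a - hw w b\<bar> * Th"
proof -
 have ab': "a \<in> J'" "b \<in> J'" using ab by (auto simp: J'_def)
 obtain z where z: "z \<in> {a..b}" "\<bar>hw w a - hw w b\<bar> = \<bar>dh w z\<bar> * dl" using hw_mvt[OF w ab'] ab by (auto simp: dl_def)
 have "\<bar>dh w y\<bar> <= \<bar>dh w z\<bar> * exp (K0 * dl)" using koebe_dl[OF w y z(1)] .
 also have "... = \<bar>hw w a - hw w b\<bar> * Th" using z(2) dl by (simp add: Th_def)
 finally show ?thesis .
qed

lemma dh_le_Th:
 assumes w: "ok w" and y: "y \<in> {a..b}" shows "\<bar>dh w y\<bar> <= Th"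
proof -
 have ab': "a \<in> J'" "b \<in> J'" using ab by (auto simp: J'_def)
 have "\<bar>hw w a - hw w b\<bar> <= 1" using ok_01[OF w ab'(1)] ok_01[OF w ab'(2)] by auto
 hence "\<bar>hw w a - hw w b\<bar> * Th <= 1 * Th" using Th by (intro mult_right_mono) auto
 thus ?thesis using dh_le_image[OF w y] by simp
qed

text \<open>A branch image contains no preimage of \<open>c\<close> of order below the length of the
  word, so \<open>shrink\<close> makes it short for long words.\<close>

lemma dh_small:
 assumes e: "e > 0"
 shows "\<exists>N. \<forall>w y. ok w \<and> N <= length w \<and> y \<in> {a..b} --> \<bar>dh w y\<bar> <= e"
proof -
 have "e / Th > 0" using e Th by simp
 then obtain N where N: "\<And>p q. 0 <= p ==> p < q ==> q <= 1 ==> (\<forall>j<N. c \<notin> (f ^^ j) ` {p<..<q}) ==> q - p <= e / Th" using shrink by meson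
 have "\<bar>dh w y\<bar> <= e" if w: "ok w" "N <= length w" "y \<in> {a..b}" for w y
 proof -
  have ab': "a \<in> J'" "b \<in> J'" using ab by (auto simp: J'_def)
  define p q where "p = min (hw w a) (hw w b)" and "q = max (hw w a) (hw w b)"
  have "q - p <= e / Th"
  proof (cases "p < q")
   case True
   have cv: "\<exists>z\<in>J'. x = hw w z" if x: "x \<in> {p<..<q}" for x
   proof -
    have "\<exists>t\<in>{a..b}. hw w t = x"
    proof (rule between_image)
     show "continuous_on {a..b} (hw w)" using continuous_on_subset[OF ok_cont[OF w(1)]] Icc_J' by blast
    qed (use x ab in \<open>auto simp: p_def q_def\<close>)
    thus ?thesis using Icc_J' by blast
   qed
   show ?thesis
   proof (rule N[OF _ True])
    show "0 <= p" "q <= 1" using ok_01[OF w(1) ab'(1)] ok_01[OF w(1) ab'(2)] by (auto simp: p_def q_def)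
    show "\<forall>j<N. c \<notin> (f ^^ j) ` {p<..<q}"
    proof (intro allI impI notI)
     fix j assume j: "j < N" "c \<in> (f ^^ j) ` {p<..<q}"
     then obtain x where x: "x \<in> {p<..<q}" "(f ^^ j) x = c" by auto
     then obtain z where "z \<in> J'" "x = hw w z" using cv by blast
     thus False using ok_nc[OF w(1), of z j] j w(2) x(2) by simp
    qed
   qed
  qed (use e Th in \<open>auto simp: p_def q_def\<close>)
  hence "\<bar>hw w a - hw w b\<bar> <= e / Th" by (auto simp: p_def q_def)
  hence "\<bar>hw w a - hw w b\<bar> * Th <= e" using Th by (simp add: pos_le_divide_eq)
  thus ?thesis using dh_le_image[OF w(1,3)] by linarith
 qed
 thus ?thesis by (intro exI[of _ N]) simp
qed

text \<open>The old constant is multiplied by the contraction and the Jacobian adds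
  \<open>K0\<close>: the Lasota-Yorke mechanism in this cone.\<close>

lemma br_LIP:
 assumes u: "LIP K u" "0 <= K" and w: "ok w" "inJ w" and th: "\<And>y. y \<in> J ==> \<bar>dh w y\<bar> <= \<theta>"
 shows "LIP (K * \<theta> + K0) (br w u)"
proof -
 have "LIP (K * \<theta>) (\<lambda>y. u (hw w y))" unfolding LIP_def
 proof (intro conjI ballI)
  show "0 <= u (hw w x)" if "x \<in> J" for x using LIP_nonneg[OF u(1) inJ_J[OF w that]] .
  fix x y assume xy: "x \<in> J" "y \<in> J"
  hence xy': "x \<in> J'" "y \<in> J'" using J_sub by auto
  obtain z where z: "z \<in> {min x y..max x y}" "\<bar>hw w x - hw w y\<bar> = \<bar>dh w z\<bar> * \<bar>x - y\<bar>" using hw_mvt[OF w(1) xy'] by blast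
  have "z \<in> J" using z xy by (auto simp: J_def)
  hence "\<bar>hw w x - hw w y\<bar> <= \<theta> * \<bar>x - y\<bar>" unfolding z(2) using th by (intro mult_right_mono) auto
  hence "K * \<bar>hw w x - hw w y\<bar> <= K * \<theta> * \<bar>x - y\<bar>" using u(2) mult_left_mono[of _ _ K] by (simp add: mult.assoc)
  hence "u (hw w y) * exp (K * \<bar>hw w x - hw w y\<bar>) <= u (hw w y) * exp (K * \<theta> * \<bar>x - y\<bar>)"
   using LIP_nonneg[OF u(1) inJ_J[OF w xy(2)]] by (intro mult_left_mono) auto
  thus "u (hw w x) <= u (hw w y) * exp (K * \<theta> * \<bar>x - y\<bar>)" using LIP_le[OF u(1) inJ_J[OF w xy(1)] inJ_J[OF w xy(2)]] by linarith
 qed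
 moreover have "LIP K0 (\<lambda>y. \<bar>dh w y\<bar>)" unfolding LIP_def using koebe_J[OF w(1)] subsetD[OF Icc_J'(3)] by simp
 ultimately show ?thesis unfolding br_def[abs_def] by (rule LIP_mult)
qed

lemma br_append: "ok w ==> ok v ==> inJ v ==> y \<in> J ==> br v (br w u) y = br (w @ v) u y"
 using dh_append[of w v y] J_sub(1) by (auto simp: br_def hw_append abs_mult)

lemma br_sum: "br v (\<lambda>y. \<Sum>i\<in>I. u i y) y = (\<Sum>i\<in>I. br v (u i) y)"
 by (simp add: br_def sum_distrib_right)

section \<open>Mass on \<open>J\<close> and the first return partition\<close>

definition mm :: "(real => real) => real" where "mm u = integral J u"

lemma J_int: "J \<in> sets borel" "J \<in> lmeasurable" "measure lebesgue J = dl"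
 using ab by (auto simp: J_def dl_def)

lemma LIP_mm:
 assumes u: "LIP K u" "u absolutely_integrable_on J" and K: "0 <= K" and y: "y \<in> J"
 shows "u y <= exp (K * dl) / dl * mm u" "mm u <= u y * exp (K * dl) * dl"
proof -
 have ui: "u integrable_on J" using u(2) abs_int_imp_int by blast
 have E: "exp (K * \<bar>x - z\<bar>) <= exp (K * dl)" if "x \<in> J" "z \<in> J" for x z using J_len[OF that] K by (simp add: mult_left_mono)
 have ci: "integral J (\<lambda>x. k) = k * dl" "(\<lambda>x. k) integrable_on J" for k :: real
 proof -
  have "integral J (\<lambda>x. k * 1) = k * integral J (\<lambda>x. 1)" by (rule integral_mult_right)
  thus "integral J (\<lambda>x. k) = k * dl" using lmeasure_integral[OF J_int(2)] J_int(3) by simp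
  show "(\<lambda>x. k) integrable_on J" using J_int(2) integrable_on_const by blast
 qed
 have "u y * dl = integral J (\<lambda>x. u y)" using ci(1) by simp
 also have "... <= integral J (\<lambda>x. u x * exp (K * dl))"
 proof (rule integral_le)
  fix x assume x: "x \<in> J"
  have "u y <= u x * exp (K * \<bar>y - x\<bar>)" using LIP_le[OF u(1) y x] .
  also have "... <= u x * exp (K * dl)" using E[OF y x] LIP_nonneg[OF u(1) x] by (rule mult_left_mono)
  finally show "u y <= u x * exp (K * dl)" .
 qed (use ci ui in \<open>auto intro: integrable_on_mult_left\<close>)
 also have "... = mm u * exp (K * dl)" by (simp add: mm_def)
 finally show "u y <= exp (K * dl) / dl * mm u" using dl by (simp add: field_simps)
 have "mm u <= integral J (\<lambda>x. u y * exp (K * dl))" unfolding mm_def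
 proof (rule integral_le)
  fix x assume x: "x \<in> J"
  have "u x <= u y * exp (K * \<bar>x - y\<bar>)" using LIP_le[OF u(1) x y] .
  also have "... <= u y * exp (K * dl)" using E[OF x y] LIP_nonneg[OF u(1) y] by (rule mult_left_mono)
  finally show "u x <= u y * exp (K * dl)" .
 qed (use ci ui in auto)
 thus "mm u <= u y * exp (K * dl) * dl" using ci(1) by (simp add: mult_ac)
qed

lemma LIP_continuous: "LIP K u ==> continuous_on J u"
proof -
 assume u: "LIP K u"
 show ?thesis unfolding continuous_on_def
 proof
  fix x assume x: "x \<in> J"
  have 1: "((\<lambda>y. u x * exp (K * \<bar>y - x\<bar>)) \<longlongrightarrow> u x * exp (K * \<bar>x - x\<bar>)) (at x within J)"
   by (intro tendsto_intros)
  have 2: "((\<lambda>y. u x / exp (K * \<bar>x - y\<bar>)) \<longlongrightarrow> u x / exp (K * \<bar>x - x\<bar>)) (at x within J)"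
   by (intro tendsto_intros) auto
  have ev: "\<forall>\<^sub>F y in at x within J. y \<in> J" by (simp add: eventually_at_filter)
  have ev1: "\<forall>\<^sub>F y in at x within J. u x / exp (K * \<bar>x - y\<bar>) <= u y"
   using ev by eventually_elim (use LIP_le[OF u x] in \<open>simp add: pos_divide_le_eq\<close>)
  have ev2: "\<forall>\<^sub>F y in at x within J. u y <= u x * exp (K * \<bar>y - x\<bar>)"
   using ev by eventually_elim (use LIP_le[OF u _ x] in simp)
  show "(u \<longlongrightarrow> u x) (at x within J)" by (rule tendsto_sandwich[OF ev1 ev2]) (use 1 2 in auto)
 qed
qed

lemma LIP_integrable: "LIP K u ==> u absolutely_integrable_on J"
proof -
 assume u: "LIP K u"
 have m: "u \<in> borel_measurable (lebesgue_on J)"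
  by (rule continuous_imp_measurable_on_sets_lebesgue[OF LIP_continuous[OF u]]) (use J_int in auto)
 have "norm (u x) <= u c * exp (\<bar>K\<bar> * dl)" if x: "x \<in> J" for x
 proof -
  have "u x <= u c * exp (K * \<bar>x - c\<bar>)" using LIP_le[OF u x J_sub(3)] .
  also have "... <= u c * exp (\<bar>K\<bar> * dl)" using J_len[OF x J_sub(3)] LIP_nonneg[OF u J_sub(3)]
   by (intro mult_left_mono) (auto intro: order_trans[OF mult_right_mono[of K "\<bar>K\<bar>"] mult_left_mono])
  finally show ?thesis using LIP_nonneg[OF u x] by simp
 qed
 thus ?thesis by (intro measurable_bounded_by_integrable_imp_absolutely_integrable[OF m, where g = "\<lambda>_. u c * exp (\<bar>K\<bar> * dl)"])
  (use J_int integrable_on_const in auto)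
qed

lemma frset_props: "frset r \<subseteq> J" "frset r \<in> sets borel" "frset r = (\<Union>w\<in>FR r. hw w ` J)"
proof -
 show "frset r \<subseteq> J" by (auto simp: frset_def)
 have "{x \<in> frset r. (f ^^ r) x \<in> J} = frset r" by (auto simp: frset_def)
 thus e: "frset r = (\<Union>w\<in>FR r. hw w ` J)" using FR_sets[of J r] by simp
 have "hw w ` J \<in> sets borel" if "w \<in> FR r" for w using hw_image_borel[of w J] J_sub J_int that by (auto simp: FR_def RW_def)
 thus "frset r \<in> sets borel" unfolding e using fin_RW by (intro sets.finite_UN) auto
qed

lemma J_decomp: "J = sR k \<union> (\<Union>r\<in>{1..k}. frset r)" "sR k \<inter> (\<Union>r\<in>{1..k}. frset r) = {}"
 "disjoint_family frset" "k < r ==> frset r \<subseteq> sR k"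
proof -
 show "J = sR k \<union> (\<Union>r\<in>{1..k}. frset r)"
 proof (intro equalityI subsetI)
  fix x assume x: "x \<in> J"
  show "x \<in> sR k \<union> (\<Union>r\<in>{1..k}. frset r)"
  proof (cases "x \<in> sR k")
   case False
   define P where "P r \<longleftrightarrow> 1 <= r \<and> (f ^^ r) x \<in> J" for r
   obtain r where r: "P r" "r <= k" using False x by (auto simp: sR_def P_def)
   define r0 where "r0 = (LEAST r. P r)"
   have r0: "P r0" "r0 <= r" unfolding r0_def using r(1) by (auto intro: LeastI Least_le)
   have "(f ^^ j) x \<notin> J" if "0 < j" "j < r0" for j
    using not_less_Least[of j P, folded r0_def, OF that(2)] that(1) unfolding P_def by simp
   hence "x \<in> frset r0" using r0 x by (auto simp: frset_def P_def)
   moreover have "r0 \<in> {1..k}" using r0 r by (auto simp: P_def)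
   ultimately show ?thesis by blast
  qed simp
 qed (use sR_sub frset_props(1) in blast)
 show "sR k \<inter> (\<Union>r\<in>{1..k}. frset r) = {}" by (auto simp: sR_def frset_def)
 show "disjoint_family frset" unfolding disjoint_family_on_def
 proof (intro ballI impI)
  fix m n :: nat assume "m ~= n"
  thus "frset m \<inter> frset n = {}" by (cases "m < n") (auto simp: frset_def)
 qed
 show "k < r ==> frset r \<subseteq> sR k" by (auto simp: sR_def frset_def)
qed

lemma mm_LL:
 assumes u: "u absolutely_integrable_on J"
 shows "LL r u absolutely_integrable_on J" "mm (LL r u) = integral (frset r) u"
proof -
 have "(\<lambda>y. \<Sum>w\<in>FR r. u (hw w y) * \<bar>dh w y\<bar>) absolutely_integrable_on J"
  "integral J (\<lambda>y. \<Sum>w\<in>FR r. u (hw w y) * \<bar>dh w y\<bar>) = integral (\<Union>w\<in>FR r. hw w ` J) u"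
  using words_integral[of "FR r" r J J u, OF fin_RW(2) _ J_sub(1) J_int(1) u frset_props(1)[unfolded frset_props(3)]]
  by (simp_all add: FR_def RW_def)
 thus "LL r u absolutely_integrable_on J" "mm (LL r u) = integral (frset r) u"
  using frset_props(3)[of r] by (auto simp: mm_def LL_def[abs_def])
qed

lemma mm_tail:
 assumes u: "u absolutely_integrable_on J"
 shows "mm u - (\<Sum>r\<in>{1..k}. mm (LL r u)) = integral (sR k) u"
proof -
 have ai: "u absolutely_integrable_on B" if "B \<subseteq> J" "B \<in> sets borel" for B
  by (rule set_integrable_subset[OF u]) (use that in auto)
 have hi: "(u has_integral integral B u) B" if "B \<subseteq> J" "B \<in> sets borel" for B
  using ai[OF that] abs_int_imp_int by blast
 have 1: "(u has_integral (\<Sum>r\<in>{1..k}. integral (frset r) u)) (\<Union>r\<in>{1..k}. frset r)"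
 using hi frset_props J_decomp(3) by (simp add: has_integral_UN pairwise_def disjoint_family_on_def)
 have "(u has_integral (integral (sR k) u + (\<Sum>r\<in>{1..k}. integral (frset r) u))) (sR k \<union> (\<Union>r\<in>{1..k}. frset r))"
  by (rule has_integral_Un[OF hi 1]) (use sR_sub sR_borel J_decomp(2) in auto)
 thus ?thesis using J_decomp(1)[of k] mm_LL(2)[OF u] by (simp add: mm_def has_integral_iff)
qed

lemma mm_GG:
 assumes u: "u absolutely_integrable_on J" and A: "A \<subseteq> J" "A \<in> sets borel"
 shows "GG n u absolutely_integrable_on A" "integral A (GG n u) = integral {x \<in> J. (f ^^ n) x \<in> A} u"
proof -
 have sb: "(\<Union>w\<in>RW n. hw w ` A) \<subseteq> J" unfolding RW_sets[OF A(1), symmetric] by blast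
 have "(\<lambda>y. \<Sum>w\<in>RW n. u (hw w y) * \<bar>dh w y\<bar>) absolutely_integrable_on A"
  "integral A (\<lambda>y. \<Sum>w\<in>RW n. u (hw w y) * \<bar>dh w y\<bar>) = integral (\<Union>w\<in>RW n. hw w ` A) u"
  using words_integral[of "RW n" n A J u, OF fin_RW(1) _ subset_trans[OF A(1) J_sub(1)] A(2) u sb]
  by (simp_all add: RW_def)
 thus "GG n u absolutely_integrable_on A" "integral A (GG n u) = integral {x \<in> J. (f ^^ n) x \<in> A} u"
  using RW_sets[OF A(1)] by (auto simp: GG_def[abs_def])
qed

lemma TT_lim: "TT \<longlonglongrightarrow> 0"
proof -
 obtain C where C: "C > 0" "\<And>k. TT k <= C * Qf ss (BB + real k)" using TT_upper_all by blast
 have B1: "BB > 1" using Bs_props(1)[OF ss order_refl] .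
 have "\<forall>\<^sub>F k in sequentially. TT k <= C * Qf ss (real k)"
 proof -
  obtain k1 :: nat where k1: "real k1 >= BB" using real_arch_simple by blast
  show ?thesis using eventually_ge_at_top[of k1]
  proof eventually_elim
   case (elim k)
   have "Qf ss (BB + real k) <= Qf ss (real k)" using Qf_dec[OF ss, of "real k" "BB + real k"] k1 elim B1 by simp
   hence "C * Qf ss (BB + real k) <= C * Qf ss (real k)" using C by (intro mult_left_mono) auto
   thus ?case using C(2)[of k] by simp
  qed
 qed
 moreover have "(\<lambda>k. C * Qf ss (real k)) \<longlonglongrightarrow> 0" using tendsto_mult_right_zero[OF Qf_lim[OF ss]] by simp
 ultimately show ?thesis by (intro tendsto_sandwich[of "\<lambda>_. 0" TT sequentially "\<lambda>k. C * Qf ss (real k)" 0]) (auto simp: TT_def)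
qed

text \<open>Some return exists, since otherwise \<open>sR k\<close> would be all of \<open>J\<close>
  for every \<open>k\<close>, against \<open>TT\<close> tending to 0.\<close>

lemma exists_period: "\<exists>d\<ge>1. (\<forall>r. FR r ~= {} --> d dvd r) \<and> (\<forall>n. RW n ~= {} --> d dvd n) \<and> (\<exists>N. \<forall>n\<ge>N. d dvd n --> RW n ~= {})"
proof -
 define P where "P = {n. 1 <= n \<and> RW n ~= {}}"
 have "\<exists>p. p \<in> P"
 proof (rule ccontr)
  assume "\<not> ?thesis"
  hence "FR r = {}" for r unfolding P_def FR_def by blast
  hence "frset r = {}" for r using frset_props(3) by simp
  hence "sR k = J" for k using J_decomp(1)[of k] by simp
  hence "TT = (\<lambda>k. measure lborel J)" by (simp add: TT_def fun_eq_iff)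
  hence "measure lborel J = 0" using TT_lim LIMSEQ_const_iff by metis
  thus False using J_int dl by simp
 qed
 then obtain p where p: "p \<in> P" by blast
 have "\<exists>d\<ge>1. (\<forall>n\<in>P. d dvd n) \<and> (\<exists>N. \<forall>n\<ge>N. n \<in> P \<longleftrightarrow> d dvd n)"
 proof (rule additive_set_eventually[OF p])
  show "1 <= n" if "n \<in> P" for n using that by (simp add: P_def)
  show "m + n \<in> P" if "m \<in> P" "n \<in> P" for m n using that RW_append unfolding P_def by fastforce
 qed
 then obtain d N where d: "d >= 1" "\<And>n. n \<in> P ==> d dvd n" "\<And>n. n >= N ==> n \<in> P \<longleftrightarrow> d dvd n" by blast
 have "d dvd n" if "RW n ~= {}" for n using d(2)[of n] that by (cases "n = 0") (auto simp: P_def)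
 moreover have "d dvd r" if "FR r ~= {}" for r using calculation[of r] that by (auto simp: FR_def)
 moreover have "RW n ~= {}" if "n >= N" "d dvd n" for n using d(3)[of n] that by (simp add: P_def)
 ultimately show ?thesis using d(1) by blast
qed

end

lemma sum_multiples:
 fixes g :: "nat => real"
 assumes d: "d >= 1" and z: "\<And>r. \<not> d dvd r ==> g r = 0"
 shows "(\<Sum>r\<in>{1..d * n}. g r) = (\<Sum>r\<in>{1..n}. g (d * r))"
proof -
 have inj: "inj_on (\<lambda>r. d * r) {1..n}" using d by (auto simp: inj_on_def)
 have sub: "(\<lambda>r. d * r) ` {1..n} \<subseteq> {1..d * n}" using d by auto
 have "(\<Sum>r\<in>{1..d * n}. g r) = (\<Sum>r\<in>(\<lambda>r. d * r) ` {1..n}. g r)"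
 proof (rule sum.mono_neutral_right[OF _ sub])
  show "\<forall>i\<in>{1..d * n} - (\<lambda>r. d * r) ` {1..n}. g i = 0"
  proof
   fix i assume i: "i \<in> {1..d * n} - (\<lambda>r. d * r) ` {1..n}"
   have "\<not> d dvd i"
   using i d by auto
   thus "g i = 0" by (rule z)
  qed
 qed simp
 thus ?thesis using sum.reindex[OF inj, of g] by (simp add: o_def)
qed

context flat_unimodal
begin

text \<open>With \<open>t = exp (K * |x - y|)\<close> the claim reduces to
  \<open>t^3 - 1/t <= 2 * (t^3 - t)\<close>, whose difference is a square divided by
  \<open>t\<close>. The factor 2 on the right is the margin in \<open>le\<close>; the cube is why
  the constant triples.\<close>

lemma LIP_diff:
 assumes g: "LIP K g" and r: "LIP K r" and K: "0 <= K" and k: "0 <= k" and le: "\<And>y. y \<in> J ==> 2 * k * r y <= g y"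
 shows "LIP (3 * K) (\<lambda>y. g y - k * r y)"
 unfolding LIP_def
proof (intro conjI ballI)
 show "0 <= g x - k * r x" if "x \<in> J" for x using le[OF that] mult_nonneg_nonneg[OF k LIP_nonneg[OF r that]] by linarith
 fix x y assume xy: "x \<in> J" "y \<in> J"
 define t where "t = exp (K * \<bar>x - y\<bar>)"
 have t1: "t >= 1" using K by (simp add: t_def)
 have t3: "exp (3 * K * \<bar>x - y\<bar>) = t ^ 3" unfolding t_def exp_of_nat_mult[symmetric] by (simp add: mult.assoc)
 have rx: "r y / t <= r x" using LIP_le[OF r xy(2,1)] by (simp add: pos_divide_le_eq t_def abs_minus_commute)
 have ry: "0 <= k * r y" using k LIP_nonneg[OF r xy(2)] by simp
 have id: "2 * (t ^ 3 - t) - (t ^ 3 - 1 / t) = (t\<^sup>2 - 1)\<^sup>2 / t" using t1 by (simp add: field_simps power2_eq_square power3_eq_cube)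
 have "(t\<^sup>2 - 1)\<^sup>2 / t >= 0" using t1 by simp
 hence tt: "t ^ 3 - 1 / t <= 2 * (t ^ 3 - t)" using id by linarith
 have t33: "t ^ 3 - t >= 0" using power_increasing[of 1 3 t] t1 by simp
 have "k * r y * (t ^ 3 - 1 / t) <= k * r y * (2 * (t ^ 3 - t))" using tt ry by (intro mult_left_mono)
 also have "... = (2 * k * r y) * (t ^ 3 - t)" by simp
 also have "... <= g y * (t ^ 3 - t)" using le[OF xy(2)] t33 by (intro mult_right_mono)
 finally have 1: "k * r y * t ^ 3 - k * (r y / t) <= g y * t ^ 3 - g y * t" by (simp add: algebra_simps)
 have "g x - k * r x <= g y * t - k * (r y / t)" using LIP_le[OF g xy] mult_left_mono[OF rx k] by (simp add: t_def)
 also have "... <= (g y - k * r y) * t ^ 3" using 1 by (simp add: algebra_simps)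
 finally show "g x - k * r x <= (g y - k * r y) * exp (3 * K * \<bar>x - y\<bar>)" by (simp add: t3)
qed

text \<open>The distance to the complement of \<open>J\<close>: the bump of the second
  observable.\<close>

definition chi :: "real => real" where "chi x = max 0 (min (x - a) (b - x))"
definition C3 :: real where "C3 = exp (K0 * (b1 - a1)) ^ 2 / min (a - a1) (b1 - b)"

lemma chi_out: "x \<notin> J ==> chi x = 0" and chi_le: "chi x <= dl" "0 <= chi x"
 and chi_lip: "\<bar>chi x - chi y\<bar> <= \<bar>x - y\<bar>"
 using ab by (auto simp: chi_def J_def dl_def min_def max_def)

lemma C3_pos: "C3 > 0" using a1b1 by (simp add: C3_def)

text \<open>A nonempty return branch maps the whole margin from \<open>a1\<close> to
  \<open>b1\<close> into \<open>J\<close>. Hence the distance of \<open>hw w y\<close> from the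
  boundary of \<open>J\<close> is at least comparable to \<open>|dh w y|\<close>, which bounds the
  relative variation of \<open>chi\<close> along the branch.\<close>

lemma chi_LIP:
 assumes w: "ok w" "inJ w" "w ~= []"
 shows "LIP C3 (\<lambda>y. chi (hw w y))"
proof -
 define E where "E = exp (K0 * (b1 - a1))"
 define e1 where "e1 = min (a - a1) (b1 - b)"
 have e1: "e1 > 0" using a1b1 by (simp add: e1_def)
 have E0: "E > 0" by (simp add: E_def)
 have kE: "\<bar>dh w x\<bar> <= \<bar>dh w y\<bar> * E" if "x \<in> {a1..b1}" "y \<in> {a1..b1}" for x y
 proof -
  have "exp (K0 * \<bar>x - y\<bar>) <= E" using that a1b1 by (auto simp: E_def)
  hence "\<bar>dh w y\<bar> * exp (K0 * \<bar>x - y\<bar>) <= \<bar>dh w y\<bar> * E" by (intro mult_left_mono) auto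
  thus ?thesis using koebe[OF w(1) that] by linarith
 qed
 have inJ': "hw w x \<in> J" if "x \<in> {a1..b1}" for x using inJ_iff[OF w(1,3), of x] w(2) that Icc_J'(1) by blast
 have low: "e1 * \<bar>dh w y\<bar> <= E * \<bar>hw w y - hw w p\<bar>" if y: "y \<in> J" and p: "p \<in> {a1, b1}" for y p
 proof -
  have y1: "y \<in> {a1..b1}" and p1: "p \<in> {a1..b1}" using y p Icc_J' by auto
  obtain z where z: "z \<in> {min y p..max y p}" "\<bar>hw w y - hw w p\<bar> = \<bar>dh w z\<bar> * \<bar>y - p\<bar>" using hw_mvt[OF w(1), of y p] y1 p1 Icc_J'(1) by blast
  have z1: "z \<in> {a1..b1}" using z y1 p1 by auto
  have "e1 <= \<bar>y - p\<bar>" using y p by (auto simp: e1_def J_def)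
  hence "\<bar>dh w y\<bar> * e1 <= (\<bar>dh w z\<bar> * E) * \<bar>y - p\<bar>" using kE[OF y1 z1] e1 E0 by (intro mult_mono) auto
  thus ?thesis using z(2) by (simp add: mult_ac)
 qed
 have clow: "e1 * \<bar>dh w y\<bar> <= E * chi (hw w y)" if y: "y \<in> J" for y
 proof -
  let ?x = "hw w y"
  have yy: "a1 < y" "y < b1" using y a1b1 by (auto simp: J_def)
  have con: "continuous_on {a1..b1} (hw w)" using continuous_on_subset[OF ok_cont[OF w(1)] Icc_J'(1)] .
  have inj: "inj_on (hw w) {a1..b1}" using hw_inj[OF w(1)] Icc_J'(1) inj_on_subset by blast
  have mono: "hw w a1 < ?x \<and> ?x < hw w b1 \<or> hw w b1 < ?x \<and> ?x < hw w a1"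
   using continuous_inj_imp_mono[OF yy con inj] by auto
  have ends: "hw w a1 \<in> J" "hw w b1 \<in> J" using inJ' a1b1 ab by auto
  have "min \<bar>?x - hw w a1\<bar> \<bar>?x - hw w b1\<bar> <= chi ?x" using mono ends by (auto simp: chi_def J_def)
  hence "E * min \<bar>?x - hw w a1\<bar> \<bar>?x - hw w b1\<bar> <= E * chi ?x" using E0 by (intro mult_left_mono) auto
  moreover have "e1 * \<bar>dh w y\<bar> <= E * min \<bar>?x - hw w a1\<bar> \<bar>?x - hw w b1\<bar>"
   using low[OF y, of a1] low[OF y, of b1] by (auto simp: min_def)
  ultimately show ?thesis by linarith
 qed
 show ?thesis unfolding LIP_def
 proof (intro conjI ballI)
  show "0 <= chi (hw w x)" for x by (rule chi_le(2))
  fix x y assume xy: "x \<in> J" "y \<in> J"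
  obtain z where z: "z \<in> {min x y..max x y}" "\<bar>hw w x - hw w y\<bar> = \<bar>dh w z\<bar> * \<bar>x - y\<bar>" using hw_mvt[OF w(1), of x y] xy J_sub(1) by blast
  have z1: "z \<in> {a1..b1}" "y \<in> {a1..b1}" using z xy a1b1 by (auto simp: J_def)
  have "chi (hw w x) <= chi (hw w y) + \<bar>hw w x - hw w y\<bar>" using chi_lip[of "hw w x" "hw w y"] by linarith
  also have "... <= chi (hw w y) + (\<bar>dh w y\<bar> * E) * \<bar>x - y\<bar>" unfolding z(2) using kE[OF z1] by (intro add_left_mono mult_right_mono) auto
  also have "... <= chi (hw w y) + ((E * chi (hw w y) / e1) * E) * \<bar>x - y\<bar>"
  proof -
   have "\<bar>dh w y\<bar> <= E * chi (hw w y) / e1" using clow[OF xy(2)] e1 by (simp add: field_simps)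
   thus ?thesis using E0 by (intro add_left_mono mult_right_mono) auto
  qed
  also have "... = chi (hw w y) * (1 + C3 * \<bar>x - y\<bar>)" unfolding C3_def E_def[symmetric] e1_def[symmetric] by (simp add: algebra_simps power2_eq_square)
  also have "... <= chi (hw w y) * exp (C3 * \<bar>x - y\<bar>)" using chi_le(2) exp_ge_add_one_self by (intro mult_left_mono) auto
  finally show "chi (hw w x) <= chi (hw w y) * exp (C3 * \<bar>x - y\<bar>)" .
 qed
qed

end

subsection \<open>Renewal bound for the return operators\<close>

text \<open>The invariant density on \<open>J\<close> seen abstractly: \<open>rho_LL\<close> is
  one-sided invariance under the first return map, and \<open>kac\<close> is Kac's formula.\<close>

locale flat_density = flat_unimodal +
 fixes \<rho> :: "real => real" and Kr :: real
 assumes Kr: "0 <= Kr" and rho_LIP: "LIP Kr \<rho>" and rho_c: "0 < \<rho> c"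
  and rho_LL: "\<And>n y. y \<in> J ==> (\<Sum>r\<in>{1..n}. LL r \<rho> y) <= \<rho> y"
  and kac: "(\<lambda>k. integral (sR k) \<rho>) sums 1"
begin

text \<open>\<open>KK\<close> is the log-Lipschitz constant after a long return and
  \<open>K1\<close> after any return; both start from functions with constant \<open>3 * KK\<close>.
  The summand 1 is what a contraction by \<open>1 / (3 * KK)\<close> leaves of that
  constant.\<close>

definition KK :: real where "KK = K0 + 1 + C3 + Kr"
definition K1 :: real where "K1 = 3 * KK * Th + K0 + C3"
definition b0 :: "real => real" where "b0 x = chi x * \<rho> x"

text \<open>The density \<open>chi \<sqdot> \<rho>\<close> vanishes at the boundary of \<open>J\<close> and is not log-Lipschitz, but its images under
 the return branches are; hence regularity is only required after one return.\<close>

definition SS :: "real => nat => (real => real) set" where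
 "SS A N = {u. (\<forall>y\<in>J. 0 <= u y) \<and> u absolutely_integrable_on J \<and> (\<forall>y\<in>J. u y <= A * mm u) \<and>
  (\<forall>n\<ge>1. \<forall>w\<in>RW n. LIP K1 (br w u)) \<and> (\<forall>n\<ge>N. \<forall>w\<in>RW n. LIP KK (br w u))}"

definition goodAN :: "real => nat => bool" where
 "goodAN A N \<longleftrightarrow> 1 <= A \<and> exp (K1 * dl) / dl <= A \<and> exp (3 * KK * dl) / dl <= A \<and> 1 <= N \<and>
  (\<forall>w y. ok w \<and> N <= length w \<and> y \<in> J --> \<bar>dh w y\<bar> <= 1 / (3 * KK))"

lemma KK: "KK > 0" "KK >= 1" "Kr <= KK" "K1 > 0" "K0 + 1 + C3 <= KK"
 using Kr a1b1(5) C3_pos Th by (auto simp: KK_def K1_def intro!: add_nonneg_pos add_pos_pos mult_nonneg_nonneg)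

lemma SS_D:
 assumes "u \<in> SS A N"
 shows "\<And>y. y \<in> J ==> 0 <= u y" "u absolutely_integrable_on J" "\<And>y. y \<in> J ==> u y <= A * mm u"
  "\<And>n w. n >= 1 ==> w \<in> RW n ==> LIP K1 (br w u)" "\<And>n w. n >= N ==> w \<in> RW n ==> LIP KK (br w u)"
 using assms unfolding SS_def by blast+

lemma mm_nonneg: "(\<And>y. y \<in> J ==> 0 <= u y) ==> u absolutely_integrable_on J ==> 0 <= mm u"
 unfolding mm_def by (intro integral_nonneg) (auto intro: abs_int_imp_int)

lemma SS_LIP:
 assumes g: "goodAN A N" and u: "LIP (3 * KK) u"
 shows "u \<in> SS A N"
proof -
 have ui: "u absolutely_integrable_on J" by (rule LIP_integrable[OF u])
 have "u y <= A * mm u" if y: "y \<in> J" for y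
 proof -
  have "u y <= exp (3 * KK * dl) / dl * mm u" using LIP_mm(1)[OF u ui _ y] KK by simp
  also have "... <= A * mm u" using g mm_nonneg[OF LIP_nonneg[OF u] ui] by (intro mult_right_mono) (auto simp: goodAN_def)
  finally show ?thesis .
 qed
 moreover have "LIP K1 (br w u)" if w: "w \<in> RW n" for n w
 proof -
  have "LIP (3 * KK * Th + K0) (br w u)"
   by (rule br_LIP[OF u]) (use w KK dh_le_Th Icc_J'(3) in \<open>auto simp: RW_def\<close>)
  thus ?thesis by (rule LIP_mono) (use C3_pos in \<open>simp add: K1_def\<close>)
 qed
 moreover have "LIP KK (br w u)" if w: "n >= N" "w \<in> RW n" for n w
 proof -
  have "LIP (3 * KK * (1 / (3 * KK)) + K0) (br w u)"
   by (rule br_LIP[OF u]) (use w KK g in \<open>auto simp: RW_def goodAN_def\<close>)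
  thus ?thesis by (rule LIP_mono) (use KK C3_pos in simp)
 qed
 ultimately show ?thesis using LIP_nonneg[OF u] ui unfolding SS_def by blast
qed

lemma SS_words:
 assumes g: "goodAN A N" and u: "u \<in> SS A N" and Om: "\<Omega> \<subseteq> RW r" and r: "1 <= r"
  and i: "(\<lambda>y. \<Sum>w\<in>\<Omega>. br w u y) absolutely_integrable_on J"
 shows "(\<lambda>y. \<Sum>w\<in>\<Omega>. br w u y) \<in> SS A N"
proof -
 let ?v = "\<lambda>y. \<Sum>w\<in>\<Omega>. br w u y"
 have L1: "LIP K1 ?v" using SS_D(4)[OF u r] Om by (intro LIP_sum) auto
 have "?v y <= A * mm ?v" if y: "y \<in> J" for y
 proof -
  have "?v y <= exp (K1 * dl) / dl * mm ?v" using LIP_mm(1)[OF L1 i _ y] KK by simp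
  also have "... <= A * mm ?v" using g mm_nonneg[OF LIP_nonneg[OF L1] i] by (intro mult_right_mono) (auto simp: goodAN_def)
  finally show ?thesis .
 qed
 moreover have E: "br w ?v y = (\<Sum>x\<in>\<Omega>. br (x @ w) u y)" if "w \<in> RW n" "y \<in> J" for w n y
  unfolding br_sum using that Om by (intro sum.cong refl br_append) (auto simp: RW_def)
 have app: "x @ w \<in> RW (r + n)" if "w \<in> RW n" "x \<in> \<Omega>" for x w n using RW_append[of x r w n] that Om by auto
 have "LIP K1 (br w ?v)" if w: "w \<in> RW n" for n w
 proof (rule LIP_cong)
  show "LIP K1 (\<lambda>y. \<Sum>x\<in>\<Omega>. br (x @ w) u y)" using SS_D(4)[OF u _ app[OF w]] r by (intro LIP_sum) auto
 qed (use E[OF w] in simp)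
 moreover have "LIP KK (br w ?v)" if w: "n >= N" "w \<in> RW n" for n w
 proof (rule LIP_cong)
  show "LIP KK (\<lambda>y. \<Sum>x\<in>\<Omega>. br (x @ w) u y)" using SS_D(5)[OF u _ app[OF w(2)]] w(1) by (intro LIP_sum) auto
 qed (use E[OF w(2)] in simp)
 ultimately show ?thesis using LIP_nonneg[OF L1] i unfolding SS_def by blast
qed

lemma SS_LL: "goodAN A N ==> u \<in> SS A N ==> 1 <= r ==> LL r u \<in> SS A N"
 using SS_words[of A N u "FR r" r] mm_LL(1)[OF SS_D(2), of u A N r] by (auto simp: LL_br[abs_def] FR_def)

lemma GG_0: "GG 0 u = u" by (simp add: fun_eq_iff GG_br RW_0 br_def dh_def Df_def)

lemma SS_GG: "goodAN A N ==> u \<in> SS A N ==> GG n u \<in> SS A N"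
 using SS_words[of A N u "RW n" n] mm_GG(1)[OF SS_D(2), of u A N J n] J_int(1) GG_0 by (cases "n = 0") (auto simp: GG_br[abs_def])

text \<open>At times from \<open>N\<close> on the constant has come down to \<open>KK\<close>;
  subtraction raises it to \<open>3 * KK\<close>, and \<open>SS_LIP\<close> readmits the
  result.\<close>

lemma SS_sub:
 assumes g: "goodAN A N" and u: "u \<in> SS A N" and n: "N <= n" and k: "0 <= k" and le: "\<And>y. y \<in> J ==> 2 * k * \<rho> y <= GG n u y"
 shows "(\<lambda>y. GG n u y - k * \<rho> y) \<in> SS A N"
proof (rule SS_LIP[OF g], rule LIP_diff[OF _ _ _ k le])
 show "LIP KK (GG n u)" unfolding GG_br[abs_def] using SS_D(5)[OF u n] by (rule LIP_sum)
 show "LIP KK \<rho>" using rho_LIP KK(3) by (rule LIP_mono)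
qed (use KK in auto)

lemma rho_pos: "y \<in> J ==> \<rho> y > 0"
 using LIP_le[OF rho_LIP J_sub(3), of y] rho_c by (smt (verit) exp_gt_zero mult_nonpos_nonneg)

definition rmax :: real where "rmax = \<rho> c * exp (Kr * dl)"
definition rmin :: real where "rmin = \<rho> c / exp (Kr * dl)"

lemma rho_bounds: "rmax > 0" "rmin > 0" "y \<in> J ==> \<rho> y <= rmax" "y \<in> J ==> rmin <= \<rho> y"
proof -
 show "rmax > 0" "rmin > 0" using rho_c by (auto simp: rmax_def rmin_def)
 have E: "exp (Kr * \<bar>x - z\<bar>) <= exp (Kr * dl)" if "x \<in> J" "z \<in> J" for x z using J_len[OF that] Kr by (simp add: mult_left_mono)
 show "\<rho> y <= rmax" if y: "y \<in> J"
  unfolding rmax_def by (rule order_trans[OF LIP_le[OF rho_LIP y J_sub(3)] mult_left_mono[OF E[OF y J_sub(3)]]]) (use rho_c in simp)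
 show "rmin <= \<rho> y" if y: "y \<in> J"
  unfolding rmin_def pos_divide_le_eq[OF exp_gt_zero]
  by (rule order_trans[OF LIP_le[OF rho_LIP J_sub(3) y] mult_left_mono[OF E[OF J_sub(3) y]]]) (use rho_pos[OF y] in simp)
qed

lemma b0_props: "b0 absolutely_integrable_on J" "\<And>y. y \<in> J ==> 0 <= b0 y" "\<And>y. y \<in> J ==> b0 y <= dl * rmax" "mm b0 > 0"
proof -
 have con: "continuous_on J b0" unfolding b0_def[abs_def] chi_def[abs_def]
  by (intro continuous_intros LIP_continuous[OF rho_LIP])
 have m: "b0 \<in> borel_measurable (lebesgue_on J)" by (rule continuous_imp_measurable_on_sets_lebesgue[OF con]) (use J_int in auto)
 show nn: "0 <= b0 y" if "y \<in> J" for y using rho_pos[OF that] chi_le(2) by (simp add: b0_def)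
 show le: "b0 y <= dl * rmax" if "y \<in> J" for y unfolding b0_def using rho_bounds(1,3) rho_pos chi_le that dl by (intro mult_mono) (auto intro: less_imp_le)
 show ai: "b0 absolutely_integrable_on J"
  by (rule measurable_bounded_by_integrable_imp_absolutely_integrable[OF m, where g = "\<lambda>_. dl * rmax"])
   (use J_int integrable_on_const le nn in auto)
 have "mm b0 ~= 0"
 proof
  assume 0: "mm b0 = 0"
  define p q where "p = (a + c) / 2" and "q = (c + b) / 2"
  have pq: "a < p" "p < q" "q < b" using ab by (auto simp: p_def q_def)
  have sub: "{p..q} \<subseteq> J" using pq by (auto simp: J_def)
  define k where "k = min (p - a) (b - q) * rmin"
  have k: "k > 0" using pq rho_bounds by (simp add: k_def)
  have bi: "b0 integrable_on {p..q}" using continuous_on_subset[OF con sub] by (rule integrable_continuous_real)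
  have "k * (q - p) = integral {p..q} (\<lambda>_. k)" using pq by simp
  also have "... <= integral {p..q} b0"
  proof (rule integral_le[OF _ bi])
   fix x assume x: "x \<in> {p..q}"
   hence "x \<in> J" using sub by auto
   thus "k <= b0 x" unfolding k_def b0_def using rho_bounds(2,4) x pq by (intro mult_mono) (auto simp: chi_def)
  qed auto
  also have "... <= mm b0" unfolding mm_def using nn ai bi sub by (intro integral_subset_le) (auto intro: abs_int_imp_int)
  finally show False using 0 k pq by (simp add: mult_le_0_iff)
 qed
 thus "mm b0 > 0" using mm_nonneg[OF nn ai] by simp
qed

lemma b0_SS:
 assumes g: "goodAN A N" and A: "dl * rmax <= A * mm b0"
 shows "b0 \<in> SS A N"
proof -
 have E: "LIP (C3 + (Kr * \<theta> + K0)) (br w b0)" if w: "w \<in> RW n" "n >= 1" and th: "\<And>y. y \<in> J ==> \<bar>dh w y\<bar> <= \<theta>" for n w \<theta>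
 proof -
  have "LIP (C3 + (Kr * \<theta> + K0)) (\<lambda>y. chi (hw w y) * br w \<rho> y)"
   by (rule LIP_mult[OF chi_LIP br_LIP[OF rho_LIP Kr _ _ th]]) (use w in \<open>auto simp: RW_def\<close>)
  thus ?thesis by (simp add: br_def[abs_def] b0_def mult.assoc)
 qed
 have "LIP K1 (br w b0)" if w: "n >= 1" "w \<in> RW n" for n w
 proof (rule LIP_mono[OF E[OF w(2,1), of Th]])
  show "\<bar>dh w y\<bar> <= Th" if "y \<in> J" for y using dh_le_Th[of w y] Icc_J'(3) w that by (auto simp: RW_def)
  have "Kr * Th <= 3 * KK * Th" using KK Th Kr by (intro mult_right_mono) auto
  thus "C3 + (Kr * Th + K0) <= K1" by (simp add: K1_def)
 qed
 moreover have "LIP KK (br w b0)" if w: "n >= N" "w \<in> RW n" for n w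
 proof (rule LIP_mono[OF E[OF w(2), of "1 / (3 * KK)"]])
  show "n >= 1" using w(1) g by (auto simp: goodAN_def)
  show "\<bar>dh w y\<bar> <= 1 / (3 * KK)" if "y \<in> J" for y using g w that by (auto simp: goodAN_def RW_def)
  have "Kr * (1 / (3 * KK)) <= 1" using KK by (simp add: field_simps)
  thus "C3 + (Kr * (1 / (3 * KK)) + K0) <= KK" using KK(5) by linarith
 qed
 moreover have "b0 y <= A * mm b0" if "y \<in> J" for y using b0_props(3)[OF that] A by linarith
 ultimately show ?thesis using b0_props(1,2) unfolding SS_def by blast
qed

text \<open>The gcd of the return times; a transitive map that is not mixing has \<open>dd > 1\<close>.\<close>

definition dd :: nat where "dd = (SOME d. d >= 1 \<and> (\<forall>r. FR r ~= {} --> d dvd r) \<and> (\<forall>n. RW n ~= {} --> d dvd n) \<and> (\<exists>N. \<forall>n\<ge>N. d dvd n --> RW n ~= {}))"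

lemma dd: "dd >= 1" "FR r ~= {} ==> dd dvd r" "RW n ~= {} ==> dd dvd n" "\<exists>N. \<forall>n\<ge>N. dd dvd n --> RW n ~= {}"
 using someI_ex[OF exists_period] unfolding dd_def[symmetric] by blast+

lemma LL_0: "\<not> dd dvd r ==> LL r u y = 0" using dd(2)[of r] by (cases "FR r = {}") (auto simp: LL_def)

lemma mm_LL0: "\<not> dd dvd r ==> mm (LL r u) = 0"
proof -
 assume "\<not> dd dvd r"
 hence "LL r u = (\<lambda>_. 0)" using LL_0 by blast
 thus ?thesis by (simp add: mm_def)
qed

lemma GG_zero: "\<not> dd dvd n ==> GG n u y = 0" using dd(3)[of n] by (cases "RW n = {}") (auto simp: GG_def)

text \<open>First returns occur only at multiples of \<open>dd\<close>, so staying away up to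
  \<open>dd * k\<close> already means staying away until the next multiple.\<close>

lemma sR_period: "i < dd ==> sR (dd * k + i) = sR (dd * k)"
proof (intro equalityI subsetI)
 fix x assume i: "i < dd" and x: "x \<in> sR (dd * k)"
 show "x \<in> sR (dd * k + i)"
 proof (rule ccontr)
  assume "x \<notin> sR (dd * k + i)"
  then obtain r where r: "r \<in> {1..dd * k + i}" "x \<in> frset r" using J_decomp(1)[of "dd * k + i"] x sR_sub(1) by blast
  hence "FR r ~= {}" using frset_props(3)[of r] by auto
  then obtain j where j: "r = dd * j" using dd(2) by blast
  have "dd * j < dd * (k + 1)" using r(1) i j by (simp add: algebra_simps)
  hence "j <= k" unfolding mult_less_cancel1 by simp
  hence "r \<in> {1..dd * k}" using r(1) j by simp
  thus False using J_decomp(2)[of "dd * k"] r(2) x by blast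
 qed
next
 fix x assume "x \<in> sR (dd * k + i)" thus "x \<in> sR (dd * k)" by (auto simp: sR_def)
qed

lemma int_sR:
 assumes u: "u absolutely_integrable_on J" "\<And>y. y \<in> J ==> 0 <= u y" "\<And>y. y \<in> J ==> u y <= k" and B: "B \<subseteq> J" "B \<in> sets borel"
 shows "integral B u <= k * measure lborel B" "0 <= integral B u"
proof -
 have ai: "u absolutely_integrable_on B" by (rule set_integrable_subset[OF u(1)]) (use B in auto)
 have ii: "u integrable_on B" using ai abs_int_imp_int by blast
 have Bl: "B \<in> lmeasurable" using B J_sub by (intro lmeasurable_01) force+
 have "integral B u <= integral B (\<lambda>_. k * 1)" using u B ii Bl integrable_on_const by (intro integral_le) auto
 also have "... = k * integral B (\<lambda>_. 1)" by (rule integral_mult_right)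
 also have "... = k * measure lborel B" using lmeasure_integral[OF Bl] B by simp
 finally show "integral B u <= k * measure lborel B" .
 show "0 <= integral B u" using ii u B by (intro integral_nonneg) auto
qed

lemma rho_sR_sum: "(\<Sum>k<n. real dd * integral (sR (dd * k)) \<rho>) = (\<Sum>j<dd * n. integral (sR j) \<rho>)"
proof -
 have "(\<Sum>j<n * dd. integral (sR j) \<rho>) = (\<Sum>k<n. sum (\<lambda>j. integral (sR j) \<rho>) {k * dd..<k * dd + dd})"
  by (rule sum.nat_group[symmetric])
 also have "... = (\<Sum>k<n. real dd * integral (sR (dd * k)) \<rho>)"
 proof (rule sum.cong[OF refl])
  fix k
  have "sum (\<lambda>j. integral (sR j) \<rho>) {k * dd..<k * dd + dd} = sum (\<lambda>j. integral (sR (dd * k)) \<rho>) {k * dd..<k * dd + dd}"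
  proof (rule sum.cong[OF refl])
   fix j assume "j \<in> {k * dd..<k * dd + dd}"
   hence "j - k * dd < dd" "dd * k + (j - k * dd) = j" by (auto simp: mult.commute)
   hence "sR j = sR (dd * k)" using sR_period[of "j - k * dd" k] by simp
   thus "integral (sR j) \<rho> = integral (sR (dd * k)) \<rho>" by simp
  qed
  thus "sum (\<lambda>j. integral (sR j) \<rho>) {k * dd..<k * dd + dd} = real dd * integral (sR (dd * k)) \<rho>" by simp
 qed
 finally show ?thesis by (simp add: mult.commute)
qed

lemma rho_ai: "\<rho> absolutely_integrable_on J" by (rule LIP_integrable[OF rho_LIP])

lemma rho_sR: "0 <= integral (sR k) \<rho>" "integral (sR k) \<rho> <= rmax * TT k" "rmin * TT k <= integral (sR k) \<rho>"
proof -
 show "0 <= integral (sR k) \<rho>" "integral (sR k) \<rho> <= rmax * TT k"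
  using int_sR[of \<rho> rmax "sR k"] rho_ai rho_bounds(3) rho_pos sR_sub(1) sR_borel by (auto simp: TT_def less_imp_le)
 have Bl: "sR k \<in> lmeasurable" by (rule lmeasurable_01[OF sR_borel sR_sub(2)])
 have ai: "\<rho> absolutely_integrable_on sR k" by (rule set_integrable_subset[OF rho_ai]) (use sR_sub sR_borel in auto)
 have "rmin * TT k = rmin * integral (sR k) (\<lambda>_. 1)" unfolding TT_def using lmeasure_integral[OF Bl] sR_borel by simp
 also have "... = integral (sR k) (\<lambda>_. rmin * 1)" by (rule integral_mult_right[symmetric])
 also have "... <= integral (sR k) \<rho>"
 proof (rule integral_le)
  show "\<rho> integrable_on sR k" using ai abs_int_imp_int by blast
  show "rmin * 1 <= \<rho> x" if "x \<in> sR k" for x using rho_bounds(4)[of x] that sR_sub(1) by auto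
 qed (use Bl integrable_on_const in auto)
 finally show "rmin * TT k <= integral (sR k) \<rho>" .
qed

lemma GG_semi:
 assumes b: "\<And>y. y \<in> J ==> 0 <= u y" and y: "y \<in> J"
 shows "GG s (GG j u) y <= GG (j + s) u y"
proof -
 have "GG s (GG j u) y = (\<Sum>v\<in>RW s. \<Sum>w\<in>RW j. br (w @ v) u y)"
  unfolding GG_br[abs_def] br_sum using y by (intro sum.cong refl br_append) (auto simp: RW_def)
 also have "... = (\<Sum>x\<in>RW s \<times> RW j. br (snd x @ fst x) u y)" by (simp add: sum.cartesian_product split_def)
 also have "... = (\<Sum>z\<in>(\<lambda>x. snd x @ fst x) ` (RW s \<times> RW j). br z u y)"
 by (simp add: sum.reindex inj_on_def RW_def)
 also have "... <= (\<Sum>z\<in>RW (j + s). br z u y)"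
 proof (rule sum_mono2[OF fin_RW(1)])
  show "(\<lambda>x. snd x @ fst x) ` (RW s \<times> RW j) \<subseteq> RW (j + s)" using RW_append by auto
  show "0 <= br z u y" if "z \<in> RW (j + s) - (\<lambda>x. snd x @ fst x) ` (RW s \<times> RW j)" for z
   using that b inJ_J[of z y] y by (auto simp: br_def RW_def)
 qed
 finally show ?thesis unfolding GG_br .
qed

lemma LL_le_GG: "(\<And>y. y \<in> J ==> 0 <= u y) ==> y \<in> J ==> LL r u y <= GG r u y"
 unfolding LL_br GG_br by (rule sum_mono2[OF fin_RW(1)]) (auto simp: FR_def br_def RW_def intro!: mult_nonneg_nonneg inJ_J)

text \<open>Half of the mass returns by time \<open>R0\<close>, so some return time
  \<open>r <= R0\<close>, necessarily a multiple of \<open>dd\<close>, carries a fixed fraction.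
  After it the density is log-Lipschitz, hence bounded below on \<open>J\<close>, and the remaining
  time is bridged by return words, which exist for every large multiple of
  \<open>dd\<close>.\<close>

lemma aperiodicity:
 assumes g: "goodAN A N"
 shows "\<exists>s0. \<forall>s\<ge>s0. \<exists>k>0. \<forall>u\<in>SS A N. \<forall>y\<in>J. k * mm u <= GG (dd * s) u y"
proof -
 have A1: "A >= 1" using g by (simp add: goodAN_def)
 have "\<forall>\<^sub>F k in sequentially. TT k < 1 / (2 * A)" using order_tendstoD(2)[OF TT_lim, of "1 / (2 * A)"] A1 by simp
 then obtain R where R: "\<And>k. k >= R ==> TT k < 1 / (2 * A)" by (auto simp: eventually_sequentially)
 define R0 where "R0 = max R 1"
 have R0: "R0 >= 1" "A * TT R0 <= 1 / 2" using R[of R0] A1 by (auto simp: R0_def field_simps)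
 obtain N1 where N1: "\<And>n. n >= N1 ==> dd dvd n ==> RW n ~= {}" using dd(4) by blast
 define gg where "gg s r = (\<Sum>w\<in>RW (dd * s - r). \<bar>dh w c\<bar> * exp (- K0 * dl))" for s r
 have main: "\<exists>k>0. \<forall>u\<in>SS A N. \<forall>y\<in>J. k * mm u <= GG (dd * s) u y" if s: "s >= R0 + N1" for s
 proof -
  define I where "I = {r \<in> {1..R0}. dd dvd r}"
  have ds: "R0 + N1 <= dd * s" using s dd(1) by (metis le_trans mult.commute mult_le_mono2 nat_mult_1_right)
  have gp: "gg s r > 0" if r: "r \<in> I" for r
  proof -
   have "N1 <= dd * s - r" "dd dvd dd * s - r" using ds r by (auto simp: I_def dvd_diff_nat)
   hence "RW (dd * s - r) ~= {}" by (rule N1)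
   thus ?thesis unfolding gg_def using dh_nz cJ' fin_RW by (intro sum_pos) (auto simp: RW_def)
  qed
  define gm where "gm = Min (insert 1 (gg s ` I))"
  have finI: "finite I" by (simp add: I_def)
  have gm: "gm > 0" "\<And>r. r \<in> I ==> gm <= gg s r" using gp finI by (auto simp: gm_def)
  define h where "h = exp (K1 * dl) * dl"
  have h: "h > 0" using dl by (simp add: h_def)
  define k where "k = gm / (h * (2 * real R0))"
  have k: "k > 0" using gm h R0 by (simp add: k_def)
  have "k * mm u <= GG (dd * s) u y" if u: "u \<in> SS A N" and y: "y \<in> J" for u y
  proof (cases "mm u = 0")
   case True
   thus ?thesis using SS_D(1)[OF SS_GG[OF g u] y] by simp
  next
   case False
   hence mp: "mm u > 0" using mm_nonneg[OF SS_D(1,2)[OF u]] by simp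
   have "integral (sR R0) u <= A * mm u * TT R0" unfolding TT_def
    using int_sR(1)[OF SS_D(2)[OF u] SS_D(1)[OF u] SS_D(3)[OF u] sR_sub(1) sR_borel] .
   also have "... <= 1 / 2 * mm u" using mult_right_mono[OF R0(2), of "mm u"] mp by (simp add: mult_ac)
   finally have sum: "mm u / 2 <= (\<Sum>r\<in>{1..R0}. mm (LL r u))" using mm_tail[OF SS_D(2)[OF u], of R0] by simp
   have "\<exists>r\<in>{1..R0}. mm u / (2 * real R0) <= mm (LL r u)"
   proof (rule ccontr)
    assume "\<not> ?thesis"
    hence "\<And>r. r \<in> {1..R0} ==> mm (LL r u) < mm u / (2 * real R0)" by (meson linorder_not_le)
    hence "(\<Sum>r\<in>{1..R0}. mm (LL r u)) < (\<Sum>r\<in>{1..R0}. mm u / (2 * real R0))" using R0(1) by (intro sum_strict_mono) auto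
    thus False using sum R0 by simp
   qed
   then obtain r where r: "r \<in> {1..R0}" "mm u / (2 * real R0) <= mm (LL r u)" by blast
   have "mm (LL r u) > 0" using r(2) mp R0 by (smt (verit) divide_pos_pos of_nat_0_less_iff less_eq_Suc_le One_nat_def)
   hence "dd dvd r" using mm_LL0[of r u] by force
   hence rI: "r \<in> I" using r by (simp add: I_def)
   have rs: "r <= dd * s" using r ds by simp
   have LS: "LL r u \<in> SS A N" using SS_LL[OF g u] r by simp
   have LLip: "LIP K1 (LL r u)" unfolding LL_br[abs_def] using SS_D(4)[OF u] r by (intro LIP_sum) (auto simp: FR_def)
   have low: "mm (LL r u) / h <= GG r u x" if x: "x \<in> J" for x
   proof -
    have "mm (LL r u) <= LL r u x * h" using LIP_mm(2)[OF LLip SS_D(2)[OF LS] _ x] KK by (simp add: h_def mult.assoc)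
    hence "mm (LL r u) / h <= LL r u x" using h by (simp add: pos_divide_le_eq)
    moreover have "LL r u x <= GG r u x" by (rule LL_le_GG[OF _ x]) (rule SS_D(1)[OF u])
    ultimately show ?thesis by linarith
   qed
   have "k * mm u = gm * ((mm u / (2 * real R0)) / h)" by (simp add: k_def)
   also have "... <= gg s r * (mm (LL r u) / h)"
    using gm rI r h mp R0 by (intro mult_mono divide_right_mono) (auto intro: less_imp_le[OF gp])
   also have "... = (\<Sum>w\<in>RW (dd * s - r). (mm (LL r u) / h) * (\<bar>dh w c\<bar> * exp (- K0 * dl)))" by (simp add: gg_def sum_distrib_left mult.commute)
   also have "... <= (\<Sum>w\<in>RW (dd * s - r). GG r u (hw w y) * \<bar>dh w y\<bar>)"
   proof (intro sum_mono mult_mono)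
    fix w assume "w \<in> RW (dd * s - r)"
    hence w: "ok w" "inJ w" by (auto simp: RW_def)
    show "mm (LL r u) / h <= GG r u (hw w y)" using low inJ_J[OF w y] by blast
    show "0 <= GG r u (hw w y)" using SS_D(1)[OF SS_GG[OF g u] inJ_J[OF w y]] .
    have "\<bar>dh w c\<bar> <= \<bar>dh w y\<bar> * exp (K0 * dl)" using koebe_dl[OF w(1)] Icc_J'(3) J_sub(3) y by blast
    thus "\<bar>dh w c\<bar> * exp (- K0 * dl) <= \<bar>dh w y\<bar>" by (simp add: exp_minus field_simps)
   qed auto
   also have "... = GG (dd * s - r) (GG r u) y" by (simp add: GG_def)
   also have "... <= GG (r + (dd * s - r)) u y" by (rule GG_semi[OF SS_D(1)[OF u] y])
   finally show ?thesis using rs by simp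
  qed
  thus ?thesis using k by blast
 qed
 thus ?thesis by blast
qed

text \<open>The renewal setting in the time unit \<open>dd\<close>. The density carries the factor
  \<open>dd\<close> because Kac's sum now runs over multiples of \<open>dd\<close> only and must
  still be 1.\<close>

theorem renewal_bound:
 "\<exists>K>0. \<forall>n. \<forall>y\<in>J. GG (dd * n) b0 y <= mm b0 * (real dd * \<rho> y + K * tf ss (BB + real n))"
proof -
 obtain CT where CT: "CT > 0" "\<And>k. TT k <= CT * Qf ss (BB + real k)" using TT_upper_all by blast
 obtain N' where N': "\<And>w y. ok w ==> N' <= length w ==> y \<in> {a..b} ==> \<bar>dh w y\<bar> <= 1 / (3 * KK)"
  using dh_small[of "1 / (3 * KK)"] KK by auto
 define N where "N = max N' 1"
 define Ct where "Ct = rmax * CT * (1 + 2 / (ss - 1))"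
 \<comment> \<open>One constant for the class \<open>SS\<close>, for the membership of
   \<open>b0\<close> in it, and for the tail of Kac's sum.\<close>
 define A where "A = Max {1, exp (K1 * dl) / dl, exp (3 * KK * dl) / dl, dl * rmax / mm b0, Ct}"
 have A: "1 <= A" "exp (K1 * dl) / dl <= A" "exp (3 * KK * dl) / dl <= A" "dl * rmax / mm b0 <= A" "Ct <= A" by (auto simp: A_def)
 have g: "goodAN A N" unfolding goodAN_def using A N' Icc_J'(3) by (auto simp: N_def)
 have bS: "b0 \<in> SS A N" by (rule b0_SS[OF g]) (use A(4) b0_props(4) in \<open>simp add: pos_divide_le_eq\<close>)
 have B1: "BB > 1" using Bs_props(1)[OF ss order_refl] .
 have tl: "mm u - (\<Sum>r\<in>{1..k}. mm (LL (dd * r) u)) = integral (sR (dd * k)) u" if "u absolutely_integrable_on J" for u k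
 proof -
  have "(\<Sum>r\<in>{1..dd * k}. mm (LL r u)) = (\<Sum>r\<in>{1..k}. mm (LL (dd * r) u))"
   by (rule sum_multiples[OF dd(1) mm_LL0])
  thus ?thesis using mm_tail[OF that, of "dd * k"] by simp
 qed
 have int1: "u integrable_on J" if "u absolutely_integrable_on J" for u :: "real => real" using that abs_int_imp_int by blast
 have Qle: "Qf ss (BB + real (dd * k)) <= Qf ss (BB + real k)" for k
 proof (rule Qf_dec[OF ss])
  have "k <= dd * k" using dd(1) by simp
  thus "BB + real k <= BB + real (dd * k)" by (simp only: of_nat_le_iff add_le_cancel_left)
 qed simp
 have rS: "(\<lambda>y. real dd * \<rho> y) \<in> SS A N"
  by (rule SS_LIP[OF g LIP_cmult[OF LIP_mono[OF rho_LIP]]]) (use KK in auto)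
 have mrho: "mm (\<lambda>y. real dd * u y) = real dd * mm u" "LL r (\<lambda>y. real dd * \<rho> y) = (\<lambda>y. real dd * LL r \<rho> y)"  for r u
  by (simp_all add: mm_def LL_def[abs_def] sum_distrib_left mult.assoc)
 have tausum: "(\<Sum>k<n. mm (\<lambda>y. real dd * \<rho> y) - (\<Sum>r\<in>{1..k}. mm (LL (dd * r) (\<lambda>y. real dd * \<rho> y)))) = (\<Sum>j<dd * n. integral (sR j) \<rho>)" for n
 proof -
  have "mm (\<lambda>y. real dd * \<rho> y) - (\<Sum>r\<in>{1..k}. mm (LL (dd * r) (\<lambda>y. real dd * \<rho> y))) = real dd * integral (sR (dd * k)) \<rho>" for k
   unfolding mrho tl[OF rho_ai, symmetric] by (simp add: sum_distrib_left right_diff_distrib)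
  thus ?thesis by (simp add: rho_sR_sum[symmetric])
 qed
 interpret operator_renewal J "\<lambda>r. LL (dd * r)" "\<lambda>n. GG (dd * n)" "SS A N" mm "\<lambda>y. real dd * \<rho> y"
  "\<lambda>r. measure lborel (frset (dd * r))" "\<lambda>k. CT * Qf ss (BB + real k)" "\<lambda>n. tf ss (BB + real n)" A N
 proof unfold_locales
  show "1 <= A" by (rule A(1))
  show "LL (dd * r) (\<lambda>y. u y - k * v y) y = LL (dd * r) u y - k * LL (dd * r) v y" for r u v k y
   by (simp add: LL_def sum_distrib_left sum_subtractf left_diff_distrib mult.assoc)
  show "LL (dd * r) (\<lambda>y. \<Sum>i\<in>I. u i y) y = (\<Sum>i\<in>I. LL (dd * r) (u i) y)" for r and I :: "nat set" and u y
   unfolding LL_br br_sum by (rule sum.swap)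
  show "LL (dd * r) u y <= LL (dd * r) v y" if "\<And>y. y \<in> J ==> u y <= v y" "y \<in> J" for r u v y
   unfolding LL_def using that inJ_J by (intro sum_mono mult_right_mono) (auto simp: FR_def RW_def)
  show "GG (dd * 0) u y = u y" for u y by (simp add: GG_0)
  show "GG (dd * n) u y = (\<Sum>r\<in>{1..n}. LL (dd * r) (GG (dd * (n - r)) u) y)" if n: "1 <= n" and y: "y \<in> J" for n u y
  proof -
   have dn: "dd * n >= 1" using n dd(1) by simp
   have "GG (dd * n) u y = (\<Sum>r\<in>{1..dd * n}. LL r (GG (dd * n - r) u) y)" by (rule renewal_identity[OF dn y])
   also have "... = (\<Sum>r\<in>{1..n}. LL (dd * r) (GG (dd * n - dd * r) u) y)" by (rule sum_multiples[OF dd(1) LL_0])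
   finally show ?thesis by (simp add: diff_mult_distrib2)
  qed
  show "GG (dd * s) (GG (dd * j) b) y <= GG (dd * (j + s)) b y" if "b \<in> SS A N" "y \<in> J" for b s j y
   using GG_semi[where s = "dd * s" and j = "dd * j", OF SS_D(1)[OF that(1)] that(2)] by (simp add: distrib_left)
  show "0 <= b y" if "b \<in> SS A N" "y \<in> J" for b y using SS_D(1) that by blast
  show "LL (dd * r) b \<in> SS A N" if "b \<in> SS A N" "1 <= r" for b r using SS_LL[OF g that(1), of "dd * r"] that dd(1) by simp
  show "GG (dd * n) b \<in> SS A N" if "b \<in> SS A N" for b n using SS_GG[OF g that] .
  show "(\<lambda>y. GG (dd * n) b y - k * (real dd * \<rho> y)) \<in> SS A N"
   if "b \<in> SS A N" "N <= n" "0 <= k" "\<And>y. y \<in> J ==> 2 * k * (real dd * \<rho> y) <= GG (dd * n) b y" for b n k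
  proof -
   have "n <= dd * n" using dd(1) by simp
   hence "(\<lambda>y. GG (dd * n) b y - (k * real dd) * \<rho> y) \<in> SS A N" using that order_trans[OF that(2)] by (intro SS_sub[OF g]) (auto simp: mult.assoc)
   thus ?thesis by (simp add: mult.assoc)
  qed
  show "0 <= mm b" if "b \<in> SS A N" for b using mm_nonneg[OF SS_D(1,2)[OF that]] .
  show "mm u = mm v" if "\<And>y. y \<in> J ==> u y = v y" for u v unfolding mm_def by (rule integral_cong) (rule that)
  show "mm (\<lambda>y. u y - k * v y) = mm u - k * mm v" if "u \<in> SS A N" "v \<in> SS A N" for u v k
   unfolding mm_def using integral_diff[OF int1[OF SS_D(2)[OF that(1)]] integrable_on_mult_right[OF int1[OF SS_D(2)[OF that(2)]], of k]] by simp
  show "mm (\<lambda>y. \<Sum>i\<in>I. u i y) = (\<Sum>i\<in>I. mm (u i))" if "finite I" "\<And>i. i \<in> I ==> u i \<in> SS A N" for I :: "nat set" and u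
   unfolding mm_def using that int1[OF SS_D(2)] by (intro integral_sum) auto
  show "(\<lambda>r. mm (LL (dd * Suc r) b)) sums mm b" if b: "b \<in> SS A N" for b
  proof -
   have "integral (sR (dd * k)) b <= A * mm b * TT (dd * k)" for k unfolding TT_def
    using int_sR(1)[OF SS_D(2)[OF b] SS_D(1)[OF b] SS_D(3)[OF b] sR_sub(1) sR_borel] .
   moreover have "0 <= integral (sR k) b" for k using int_sR(2)[OF SS_D(2)[OF b] SS_D(1)[OF b] SS_D(3)[OF b] sR_sub(1) sR_borel] .
   moreover have "strict_mono (\<lambda>k. dd * k)" using dd(1) by (simp add: strict_mono_def)
   hence "(\<lambda>k. A * mm b * TT (dd * k)) \<longlonglongrightarrow> 0" using LIMSEQ_subseq_LIMSEQ[OF TT_lim] by (intro tendsto_mult_right_zero) (auto simp: o_def)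
   ultimately have "(\<lambda>k. integral (sR (dd * k)) b) \<longlonglongrightarrow> 0"
    by (intro tendsto_sandwich[of "\<lambda>_. 0" "\<lambda>k. integral (sR (dd * k)) b" sequentially "\<lambda>k. A * mm b * TT (dd * k)" 0]) auto
   hence "(\<lambda>k. mm b - integral (sR (dd * k)) b) \<longlonglongrightarrow> mm b - 0" by (intro tendsto_intros)
   moreover have "mm b - integral (sR (dd * k)) b = (\<Sum>r<k. mm (LL (dd * Suc r) b))" for k
    using tl[OF SS_D(2)[OF b], of k] sum.atLeast1_atMost_eq[of "\<lambda>r. mm (LL (dd * r) b)" k] by simp
   ultimately show ?thesis by (simp add: sums_def)
  qed
  show "0 <= measure lborel (frset (dd * r))" for r by simp
  show "mm (LL (dd * r) b) <= A * measure lborel (frset (dd * r)) * mm b" if b: "b \<in> SS A N" for b r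
   unfolding mm_LL(2)[OF SS_D(2)[OF b]] using int_sR(1)[OF SS_D(2)[OF b] SS_D(1)[OF b] SS_D(3)[OF b] frset_props(1,2), of "dd * r"] by (simp add: mult_ac)
  show "b y <= A * mm b" if "b \<in> SS A N" "y \<in> J" for b y using SS_D(3) that by blast
  show "\<exists>s0. \<forall>s\<ge>s0. \<exists>c>0. \<forall>b\<in>SS A N. \<forall>y\<in>J. c * mm b <= GG (dd * s) b y" by (rule aperiodicity[OF g])
  show "(\<lambda>y. real dd * \<rho> y) \<in> SS A N" by (rule rS)
  show "(\<Sum>r\<in>{1..n}. LL (dd * r) (\<lambda>y. real dd * \<rho> y) y) <= real dd * \<rho> y" if "y \<in> J" for n y
  proof -
   have "(\<Sum>r\<in>{1..n}. LL (dd * r) \<rho> y) = (\<Sum>r\<in>{1..dd * n}. LL r \<rho> y)" by (rule sum_multiples[OF dd(1) LL_0, symmetric])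
   also have "... <= \<rho> y" by (rule rho_LL[OF that])
   finally show ?thesis unfolding mrho sum_distrib_left[symmetric] by (intro mult_left_mono) auto
  qed
  have fr01: "frset r \<subseteq> {0..1}" for r using frset_props(1)[of r] J_sub by force
  show "(\<Sum>r\<in>{k<..n}. measure lborel (frset (dd * r))) <= CT * Qf ss (BB + real k)" for k n
  proof -
   have dj: "disjoint_family_on (\<lambda>r. frset (dd * r)) {k<..n}" unfolding disjoint_family_on_def
   using dd(1) J_decomp(3) by (auto simp: disjoint_family_on_def)
   have "(\<Sum>r\<in>{k<..n}. measure lborel (frset (dd * r))) = measure lborel (\<Union>r\<in>{k<..n}. frset (dd * r))"
    by (rule measure_finite_UN_lborel[symmetric]) (use frset_props(2) dj fr01 in simp_all)
   also have "... <= TT (dd * k)" unfolding TT_def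
   proof (rule measure_mono_01[OF _ _ sR_borel sR_sub(2)])
    show "(\<Union>r\<in>{k<..n}. frset (dd * r)) \<subseteq> sR (dd * k)" using J_decomp(4) dd(1) by (intro UN_least) simp
    show "(\<Union>r\<in>{k<..n}. frset (dd * r)) \<in> sets borel" using frset_props(2) by (intro sets.finite_UN) auto
   qed
   also have "... <= CT * Qf ss (BB + real (dd * k))" by (rule CT(2))
   also have "... <= CT * Qf ss (BB + real k)" using Qle CT by (intro mult_left_mono) auto
   finally show ?thesis .
  qed
  show "CT * Qf ss (BB + real l) <= CT * Qf ss (BB + real k)" if "k <= l" for k l
   using CT that by (intro mult_left_mono Qf_dec[OF ss]) auto
  show "summable (\<lambda>k. CT * Qf ss (BB + real k))"
  proof (rule summable_mult, rule bounded_imp_summable)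
   show "0 <= Qf ss (BB + real k)" for k by (simp add: Qf_def)
   show "(\<Sum>k\<le>n. Qf ss (BB + real k)) <= (1 + 2 / (ss - 1)) * tf ss BB" for n
    using Qf_sum_upper[OF ss order_refl, of "Suc n"] by (simp only: lessThan_Suc_atMost)
  qed
  show "1 - (\<Sum>k<n. mm (\<lambda>y. real dd * \<rho> y) - (\<Sum>r\<in>{1..k}. mm (LL (dd * r) (\<lambda>y. real dd * \<rho> y)))) <= A * tf ss (BB + real n)" for n
  proof -
   have sm: "summable (\<lambda>k. integral (sR k) \<rho>)" "(\<Sum>k. integral (sR k) \<rho>) = 1" using kac by (auto simp: sums_iff)
   have "1 - (\<Sum>j<dd * n. integral (sR j) \<rho>) = (\<Sum>j. integral (sR (j + dd * n)) \<rho>)"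
    using suminf_split_initial_segment[OF sm(1), of "dd * n"] sm(2) by simp
   also have "... <= Ct * tf ss (BB + real (dd * n))"
   proof (rule suminf_le_const)
    show "summable (\<lambda>j. integral (sR (j + dd * n)) \<rho>)" using sm(1) by (rule summable_ignore_initial_segment)
    fix q
    have "(\<Sum>j<q. integral (sR (j + dd * n)) \<rho>) <= (\<Sum>j<q. rmax * CT * Qf ss ((BB + real (dd * n)) + real j))"
    proof (rule sum_mono)
     fix j
     have "integral (sR (j + dd * n)) \<rho> <= rmax * TT (j + dd * n)" by (rule rho_sR(2))
     also have "... <= rmax * (CT * Qf ss (BB + real (j + dd * n)))" using CT(2)[of "j + dd * n"] rho_bounds(1) by (intro mult_left_mono) (simp_all only: less_imp_le)
     finally show "integral (sR (j + dd * n)) \<rho> <= rmax * CT * Qf ss ((BB + real (dd * n)) + real j)" by (simp add: algebra_simps)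
    qed
    also have "... = rmax * CT * (\<Sum>j<q. Qf ss ((BB + real (dd * n)) + real j))" by (simp add: sum_distrib_left)
    also have "... <= rmax * CT * ((1 + 2 / (ss - 1)) * tf ss (BB + real (dd * n)))"
     using rho_bounds(1) CT(1) by (intro mult_left_mono Qf_sum_upper[OF ss]) auto
    finally show "(\<Sum>j<q. integral (sR (j + dd * n)) \<rho>) <= Ct * tf ss (BB + real (dd * n))" by (simp add: Ct_def mult.assoc)
   qed
   also have "... <= A * tf ss (BB + real n)"
   proof (rule mult_mono[OF A(5)])
    have "n <= dd * n" using dd(1) by simp
    hence "real n <= real (dd * n)" by (simp only: of_nat_le_iff)
    thus "tf ss (BB + real (dd * n)) <= tf ss (BB + real n)" by (intro tf_dec[OF ss]) auto
    show "0 <= A" using A(1) by simp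
    show "0 <= tf ss (BB + real (dd * n))" using tf_pos[of "BB + real (dd * n)" ss] B1 by linarith
   qed
   finally show ?thesis unfolding tausum .
  qed
  show "(\<Sum>k<n. mm (\<lambda>y. real dd * \<rho> y) - (\<Sum>r\<in>{1..k}. mm (LL (dd * r) (\<lambda>y. real dd * \<rho> y)))) <= 1" for n
   unfolding tausum using kac rho_sR(1) sum_le_suminf[of "\<lambda>k. integral (sR k) \<rho>" "{..<dd * n}"] by (simp add: sums_iff)
  show "0 < tf ss (BB + real n)" for n using B1 by (intro tf_pos) auto
  show "tf ss (BB + real l) <= tf ss (BB + real k)" if "k <= l" for k l using that by (intro tf_dec[OF ss]) auto
  show "(\<lambda>n. tf ss (BB + real n)) \<longlonglongrightarrow> 0"
  proof (rule filterlim_compose[OF tf_lim[OF ss]])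
   show "filterlim (\<lambda>n. BB + real n) at_top sequentially" by (rule filterlim_tendsto_add_at_top[OF tendsto_const filterlim_real_sequentially])
  qed
  show "\<exists>\<epsilon>>0. \<epsilon> < 1/4 \<and> (\<forall>\<^sub>F n in sequentially. \<forall>k. real k <= 3 * \<epsilon> * real n --> tf ss (BB + real (n - k)) <= (1 + \<eta>) * tf ss (BB + real n))" if eta: "\<eta> > 0" for \<eta>
  using tf_slow[OF ss eta order_refl] by auto
  show "\<exists>C>0. \<forall>\<^sub>F n in sequentially. \<forall>k. \<epsilon> * real n <= real k + 1 --> CT * Qf ss (BB + real k) * real n <= C * tf ss (BB + real n) \<and> tf ss (BB + real k) <= C * tf ss (BB + real n)" if eps: "\<epsilon> > 0" for \<epsilon>
  proof -
   obtain C where C: "C > 0" "\<And>n k. \<epsilon> * real n <= real k + 1 ==> Qf ss (BB + real k) * real n <= C * tf ss (BB + real n)"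
    "\<And>n k. \<epsilon> * real n <= real k + 1 ==> tf ss (BB + real k) <= C * tf ss (BB + real n)" using tf_doub[OF ss eps order_refl] by blast
   have tp: "tf ss (BB + real n) > 0" for n using B1 by (intro tf_pos) auto
   have "CT * Qf ss (BB + real k) * real n <= (C * (CT + 1)) * tf ss (BB + real n) \<and> tf ss (BB + real k) <= (C * (CT + 1)) * tf ss (BB + real n)"
    if "\<epsilon> * real n <= real k + 1" for n k
   proof -
    have "CT * (Qf ss (BB + real k) * real n) <= CT * (C * tf ss (BB + real n))" using C(2)[OF that] CT by (intro mult_left_mono) auto
    moreover have "0 < C * tf ss (BB + real n)" "0 < C * tf ss (BB + real n) * CT" using C(1) tp CT by auto
    ultimately show ?thesis using C(3)[OF that] by (simp add: algebra_simps)
   qed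
   thus ?thesis using C(1) CT by (intro exI[of _ "C * (CT + 1)"] conjI always_eventually allI) auto
  qed
 qed
 show ?thesis using renewal_upper bS by blast
qed

end

lemma average_tendsto_0:
 fixes t :: "nat => real"
 assumes lim: "t \<longlonglongrightarrow> 0" and dec: "\<And>k l. k <= l ==> t l <= t k" and pos: "\<And>k. 0 <= t k" and e: "e > 0"
 shows "\<exists>q0. \<forall>q\<ge>q0. (\<Sum>i\<le>q. t i) <= e * real q"
proof -
 obtain i0 where i0: "\<And>i. i >= i0 ==> t i < e / 2" using order_tendstoD(2)[OF lim, of "e / 2"] e by (auto simp: eventually_sequentially)
 obtain q1 :: nat where q1: "real i0 * t 0 + e <= (e / 2) * real q1"
  using real_arch_simple[of "(real i0 * t 0 + e) / (e / 2)"] e by (auto simp: field_simps)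
 have "(\<Sum>i\<le>q. t i) <= e * real q" if q: "q >= max i0 q1" for q
 proof -
  have "(\<Sum>i\<le>q. t i) = (\<Sum>i<i0. t i) + (\<Sum>i\<in>{i0..q}. t i)"
   using q by (subst sum.union_disjoint[symmetric]) (auto intro!: sum.cong)
  also have "(\<Sum>i<i0. t i) <= real i0 * t 0" using sum_bounded_above[of "{..<i0}" t "t 0"] dec by simp
  also have "(\<Sum>i\<in>{i0..q}. t i) <= real (card {i0..q}) * (e / 2)" using sum_bounded_above[of "{i0..q}" t "e / 2"] i0 by (simp add: less_imp_le)
  also have "real (card {i0..q}) * (e / 2) <= (real q + 1) * (e / 2)" using e by (intro mult_right_mono) auto
  finally have "(\<Sum>i\<le>q. t i) <= real i0 * t 0 + e / 2 + real q * (e / 2)" by (simp add: algebra_simps add_divide_distrib)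
  also have "... <= (e / 2) * real q1 + real q * (e / 2)" using q1 e by simp
  also have "... <= (e / 2) * real q + real q * (e / 2)" using q e by (intro add_right_mono mult_left_mono) auto
  finally show ?thesis by simp
 qed
 thus ?thesis by blast
qed

context flat_density
begin

subsection \<open>The main term and the error term\<close>

definition tau :: "nat => real" where "tau k = integral (sR k) \<rho>"

lemma tau_sum: "summable tau" "suminf tau = 1" using kac by (auto simp: sums_iff tau_def[abs_def])

lemma tau_tail_lower: "\<exists>c1>0. \<exists>k0. \<forall>p\<ge>k0. c1 * tf ss (BB + real p) <= (\<Sum>j. tau (j + p))"
proof -
 obtain d k0 where d: "d > 0" "\<And>k. k >= k0 ==> d * Qf ss (BB + real k) <= TT k" using TT_lower_BB by blast
 define c1 where "c1 = rmin * d / (ss - 1)"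
 have s: "ss - 1 > 0" using ss by simp
 have c1: "c1 > 0" using d rho_bounds(2) s by (simp add: c1_def)
 have "c1 * tf ss (BB + real p) <= (\<Sum>j. tau (j + p))" if p: "p >= k0" for p
 proof -
  have low: "c1 * (tf ss (BB + real p) - tf ss (BB + real p + real N)) <= (\<Sum>j. tau (j + p))" for N
  proof -
   have "c1 * (tf ss (BB + real p) - tf ss (BB + real p + real N)) = rmin * d * ((tf ss (BB + real p) - tf ss (BB + real p + real N)) / (ss - 1))"
    by (simp add: c1_def)
   also have "... <= rmin * d * (\<Sum>k<N. Qf ss (BB + real p + real k))"
    using rho_bounds(2) d by (intro mult_left_mono Qf_sum_lower[OF ss]) auto
   also have "... = (\<Sum>j<N. rmin * (d * Qf ss (BB + real (j + p))))" by (simp add: sum_distrib_left mult.assoc add_ac)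
   also have "... <= (\<Sum>j<N. tau (j + p))"
   proof (rule sum_mono)
    fix j
    have "rmin * (d * Qf ss (BB + real (j + p))) <= rmin * TT (j + p)" using rho_bounds(2) d(2)[of "j + p"] p by (intro mult_left_mono) auto
    thus "rmin * (d * Qf ss (BB + real (j + p))) <= tau (j + p)" using rho_sR(3)[of "j + p"] by (simp add: tau_def)
   qed
   also have "... <= (\<Sum>j. tau (j + p))"
    using summable_ignore_initial_segment[OF tau_sum(1)] rho_sR(1) by (intro sum_le_suminf) (auto simp: tau_def)
   finally show ?thesis .
  qed
  have "filterlim (\<lambda>N. BB + real p + real N) at_top sequentially" by (rule filterlim_tendsto_add_at_top[OF tendsto_const filterlim_real_sequentially])
  hence "(\<lambda>N. tf ss (BB + real p + real N)) \<longlonglongrightarrow> 0" by (rule filterlim_compose[OF tf_lim[OF ss]])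
  hence "(\<lambda>N. c1 * (tf ss (BB + real p) - tf ss (BB + real p + real N))) \<longlonglongrightarrow> c1 * (tf ss (BB + real p) - 0)" by (intro tendsto_intros)
  thus ?thesis using tendsto_upperbound[of _ "c1 * (tf ss (BB + real p) - 0)" sequentially "(\<Sum>j. tau (j + p))"] low by simp
 qed
 thus ?thesis using c1 by blast
qed

text \<open>The terms form a block of Kac's sum, from \<open>dd * M\<close> up to
  \<open>dd * (M + q + 1)\<close>. What lies beyond the block is the gain in the
  correlation.\<close>

lemma last_visit_sum:
 "(\<Sum>i\<le>q. real dd * tau (dd * (M + (q - i)))) = (\<Sum>k. tau (k + dd * M)) - (\<Sum>k. tau (k + dd * (M + q + 1)))"
proof -
 have "(\<Sum>i\<le>q. real dd * tau (dd * (M + (q - i)))) = (\<Sum>l\<le>q. real dd * tau (dd * (M + l)))"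
  by (rule sum.reindex_bij_witness[of _ "\<lambda>l. q - l" "\<lambda>i. q - i"]) auto
 also have "... = (\<Sum>l\<in>{M..<M + q + 1}. real dd * tau (dd * l))"
  by (rule sum.reindex_bij_witness[of _ "\<lambda>l. l - M" "\<lambda>l. M + l"]) auto
 also have "... = (\<Sum>l<M + q + 1. real dd * tau (dd * l)) - (\<Sum>l<M. real dd * tau (dd * l))"
  using sum_diff_nat_ivl[of 0 M "M + q + 1" "\<lambda>l. real dd * tau (dd * l)"] by (simp add: atLeast0LessThan)
 also have "... = (\<Sum>j<dd * (M + q + 1). tau j) - (\<Sum>j<dd * M. tau j)" unfolding tau_def rho_sR_sum ..
 also have "... = (\<Sum>k. tau (k + dd * M)) - (\<Sum>k. tau (k + dd * (M + q + 1)))"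
  using suminf_split_initial_segment[OF tau_sum(1), of "dd * M"] suminf_split_initial_segment[OF tau_sum(1), of "dd * (M + q + 1)"] by simp
 finally show ?thesis .
qed

text \<open>The part of the renewal bound with \<open>\<rho>\<close> leaves Kac's tail beyond
  \<open>x\<close>, at least \<open>c1 * t x\<close>. The error is a convolution of \<open>t\<close>
  with the tail \<open>Q\<close>, kept below half of this. For \<open>i\<close> up to
  \<open>q/2\<close>, \<open>Q\<close> is of order \<open>t q / q\<close> and the mean of
  \<open>t\<close> is small as \<open>q\<close> is large; for the other \<open>i\<close>,
  \<open>t i\<close> is of order \<open>t q\<close> and the sum of \<open>Q\<close> from
  \<open>M\<close> on is small as \<open>M\<close> is large.\<close>

theorem correlation_lower:
 "\<exists>M n0 C. C > 0 \<and> (\<forall>n\<ge>n0. C * real n powr (1 - ss) <=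
   mm b0 * (\<Sum>k. tau (k + M)) - (\<Sum>j\<le>n. integral (sR (n + M - j)) (GG j b0)))"
proof -
 obtain K where K: "K > 0" "\<And>n y. y \<in> J ==> GG (dd * n) b0 y <= mm b0 * (real dd * \<rho> y + K * tf ss (BB + real n))"
  using renewal_bound by blast
 obtain CT where CT: "CT > 0" "\<And>k. TT k <= CT * Qf ss (BB + real k)" using TT_upper_all by blast
 obtain c1 k0 where c1: "c1 > 0" "\<And>p. p >= k0 ==> c1 * tf ss (BB + real p) <= (\<Sum>j. tau (j + p))" using tau_tail_lower by blast
 obtain C4 where C4: "C4 > 0" "\<And>n k. 1 / 2 * real n <= real k + 1 ==> Qf ss (BB + real k) * real n <= C4 * tf ss (BB + real n)"
  "\<And>n k. 1 / 2 * real n <= real k + 1 ==> tf ss (BB + real k) <= C4 * tf ss (BB + real n)"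
  using tf_doub[OF ss, of "1 / 2" BB] by auto
 have B1: "BB > 1" using Bs_props(1)[OF ss order_refl] .
 have s1: "ss - 1 > 0" using ss by simp
 define t where "t n = tf ss (BB + real n)" for n :: nat
 define Q where "Q n = Qf ss (BB + real n)" for n :: nat
 have tp: "t n > 0" and Qp: "Q n > 0" for n using B1 by (auto simp: t_def Q_def intro!: tf_pos Qf_pos)
 have td: "t l <= t k" and Qd: "Q l <= Q k" if "k <= l" for k l using that by (auto simp: t_def Q_def intro!: tf_dec[OF ss] Qf_dec[OF ss])
 have tl: "t \<longlonglongrightarrow> 0" unfolding t_def
 proof (rule filterlim_compose[OF tf_lim[OF ss]])
  show "filterlim (\<lambda>n. BB + real n) at_top sequentially" by (rule filterlim_tendsto_add_at_top[OF tendsto_const filterlim_real_sequentially])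
 qed
 define C5 where "C5 = 1 + 2 / (ss - 1)"
 have C5: "C5 > 0" using s1 by (simp add: C5_def add_pos_pos)
 \<comment> \<open>The cost of replacing \<open>t q\<close> by \<open>t x\<close>: \<open>x\<close>
   is at most \<open>2 * dd * q\<close> once \<open>q > M\<close>.\<close>
 define H where "H = (1 / (2 * real dd)) powr (1 - ss)"
 have H: "H > 0" using dd(1) by (simp add: H_def)
 define G where "G = K * CT * C4 * H"
 have G: "G > 0" using K CT C4 H by (simp add: G_def)
 \<comment> \<open>Both halves of the convolution contribute \<open>G * \<eta> * t x\<close>,
   together half of the gain \<open>c1 * t x\<close>.\<close>
 define \<eta> where "\<eta> = c1 / (4 * G)"
 have eta: "\<eta> > 0" using c1 G by (simp add: \<eta>_def)
 have "\<forall>\<^sub>F n in sequentially. t n < \<eta> / C5" using order_tendstoD(2)[OF tl, of "\<eta> / C5"] eta C5 by simp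
 then obtain M where M: "t M < \<eta> / C5" by (auto simp: eventually_sequentially)
 hence M: "C5 * t M <= \<eta>" using C5 by (simp add: field_simps)
 obtain q0 where q0: "\<And>q. q >= q0 ==> (\<Sum>i\<le>q. t i) <= \<eta> * real q"
  using average_tendsto_0[OF tl td less_imp_le[OF tp] eta] by blast
 define n0 where "n0 = dd * Max {q0, M + 1, k0}"
 define H2 where "H2 = BB + real (dd * (M + 1)) + 1"
 have H2: "H2 > 0" using B1 by (simp add: H2_def add_pos_nonneg)
 define C where "C = mm b0 * (c1 / 2) * H2 powr (1 - ss)"
 have C: "C > 0" using b0_props(4) c1 H2 by (simp add: C_def)
 have main: "C * real n powr (1 - ss) <= mm b0 * (\<Sum>k. tau (k + dd * M)) - (\<Sum>j\<le>n. integral (sR (n + dd * M - j)) (GG j b0))"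
  if n: "n >= n0" for n
 proof -
  define q r where "q = n div dd" and "r = n mod dd"
  have nqr: "n = dd * q + r" "r < dd" using dd(1) by (auto simp: q_def r_def)
  have "Max {q0, M + 1, k0} <= q" using n dd(1) unfolding q_def n0_def by (metis div_le_mono nonzero_mult_div_cancel_left not_one_le_zero)
  hence q: "q >= q0" "q >= M + 1" "q >= k0" by auto
  have q1: "real q > 0" using q by simp
  define x where "x = dd * (M + q + 1)"
  define \<beta> where "\<beta> j = integral (sR (n + dd * M - j)) (GG j b0)" for j
  have b_i: "\<beta> (dd * i) <= mm b0 * (real dd * tau (dd * (M + (q - i))) + K * t i * TT (dd * (M + (q - i))))" if i: "i <= q" for i
  proof -
   let ?B = "sR (dd * (M + (q - i)))"
   obtain e where e: "q = i + e" using i le_Suc_ex by blast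
   have "n + dd * M - dd * i = dd * (M + (q - i)) + r" unfolding nqr e by (simp add: algebra_simps)
   hence sRe: "sR (n + dd * M - dd * i) = ?B" using sR_period[OF nqr(2)] by simp
   have Bl: "?B \<in> lmeasurable" by (rule lmeasurable_01[OF sR_borel sR_sub(2)])
   have Gi: "GG (dd * i) b0 integrable_on ?B" using mm_GG(1)[OF b0_props(1) sR_sub(1) sR_borel] abs_int_imp_int by blast
   have "\<rho> absolutely_integrable_on ?B" by (rule set_integrable_subset[OF rho_ai]) (use sR_sub sR_borel in auto)
   hence ri: "\<rho> integrable_on ?B" using abs_int_imp_int by blast
   have ci: "(\<lambda>y. K * t i * 1) integrable_on ?B" using Bl integrable_on_const by blast
   have "\<beta> (dd * i) <= integral ?B (\<lambda>y. mm b0 * (real dd * \<rho> y + K * t i * 1))" unfolding \<beta>_def sRe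
   proof (rule integral_le[OF Gi])
    show "(\<lambda>y. mm b0 * (real dd * \<rho> y + K * t i * 1)) integrable_on ?B" using integrable_on_mult_right[OF integrable_add[OF integrable_on_mult_right[OF ri] ci]] by simp
    show "GG (dd * i) b0 y <= mm b0 * (real dd * \<rho> y + K * t i * 1)" if "y \<in> ?B" for y using K(2)[of y i] that sR_sub(1) by (auto simp: t_def)
   qed
   also have "... = mm b0 * (real dd * tau (dd * (M + (q - i))) + K * t i * integral ?B (\<lambda>y. 1))"
    unfolding integral_mult_right integral_add[OF integrable_on_mult_right[OF ri] ci] tau_def ..
   also have "integral ?B (\<lambda>y. 1) = TT (dd * (M + (q - i)))" unfolding TT_def using lmeasure_integral[OF Bl] sR_borel by simp
   finally show ?thesis .
  qed
  have "(\<Sum>j\<le>n. \<beta> j) = \<beta> 0 + (\<Sum>j\<in>{1..n}. \<beta> j)" by (simp add: atMost_atLeast0 sum.atLeast_Suc_atMost)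
  also have "(\<Sum>j\<in>{1..n}. \<beta> j) = (\<Sum>j\<in>{1..dd * q}. \<beta> j)"
  proof (rule sum.mono_neutral_right)
   show "\<forall>j\<in>{1..n} - {1..dd * q}. \<beta> j = 0"
   proof
    fix j assume j: "j \<in> {1..n} - {1..dd * q}"
    have "\<not> dd dvd j"
    proof
     assume "dd dvd j"
     then obtain i where i: "j = dd * i" by blast
     have "dd * q < dd * i" "dd * i < dd * (q + 1)" using j nqr i by auto
     thus False unfolding mult_less_cancel1 by simp
    qed
    hence "GG j b0 = (\<lambda>_. 0)" using GG_zero by blast
    thus "\<beta> j = 0" by (simp add: \<beta>_def)
   qed
  qed (use nqr in auto)
  also have "... = (\<Sum>i\<in>{1..q}. \<beta> (dd * i))"
  proof (rule sum_multiples[OF dd(1)])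
   fix j assume "\<not> dd dvd j"
   hence "GG j b0 = (\<lambda>_. 0)" using GG_zero by blast
   thus "\<beta> j = 0" by (simp add: \<beta>_def)
  qed
  also have "\<beta> 0 + ... = (\<Sum>i\<le>q. \<beta> (dd * i))" by (simp add: atMost_atLeast0 sum.atLeast_Suc_atMost)
  also have "... <= (\<Sum>i\<le>q. mm b0 * (real dd * tau (dd * (M + (q - i))) + K * t i * TT (dd * (M + (q - i)))))"
   using b_i by (intro sum_mono) auto
  also have "... = mm b0 * ((\<Sum>i\<le>q. real dd * tau (dd * (M + (q - i)))) + (\<Sum>i\<le>q. K * t i * TT (dd * (M + (q - i)))))"
   by (simp only: sum_distrib_left[symmetric] sum.distrib)
  also have "... <= mm b0 * (((\<Sum>k. tau (k + dd * M)) - c1 * t x) + c1 / 2 * t x)"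
  proof (intro mult_left_mono add_mono)
   have "k0 <= x" using q(3) dd(1) unfolding x_def by (metis add_leD2 le_add1 le_trans mult_le_mono1 nat_mult_1)
   thus "(\<Sum>i\<le>q. real dd * tau (dd * (M + (q - i)))) <= (\<Sum>k. tau (k + dd * M)) - c1 * t x"
    unfolding last_visit_sum using c1(2)[of x] by (simp add: x_def t_def)
   have "t q <= H * t x" unfolding t_def H_def
   proof (rule tf_ratio[OF ss])
    have "dd * (M + 1) <= dd * q" using q(2) by (rule mult_le_mono2)
    hence "x <= 2 * dd * q" by (simp add: x_def algebra_simps)
    hence "real x <= 2 * real dd * real q" by (metis of_nat_le_iff of_nat_mult of_nat_numeral)
    moreover have "BB <= 2 * real dd * BB" using dd(1) B1 by simp
    ultimately have "BB + real x <= (BB + real q) * (2 * real dd)" by (simp add: algebra_simps)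
    thus "1 / (2 * real dd) * (BB + real x) <= BB + real q" using dd(1) by (simp add: pos_divide_le_eq)
   qed (use dd(1) in auto)
   have each: "t i * Q (M + (q - i)) <= C4 * t q * (t i / real q + Q (M + (q - i)))" if i: "i <= q" for i
   proof (cases "2 * i <= q")
    case True
    have "Q (q - i) * real q <= C4 * t q" unfolding Q_def t_def using True by (intro C4(2)) auto
    hence "Q (q - i) <= C4 * t q / real q" using q1 by (simp add: field_simps)
    moreover have "Q (M + (q - i)) <= Q (q - i)" by (rule Qd) simp
    ultimately have "t i * Q (M + (q - i)) <= t i * (C4 * t q / real q)" using tp[of i] by (intro mult_left_mono) auto
    moreover have "0 <= C4 * t q * Q (M + (q - i))" using C4(1) tp Qp by (simp add: less_imp_le)
    ultimately show ?thesis by (simp add: algebra_simps)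
   next
    case False
    have "t i <= C4 * t q" unfolding t_def using False by (intro C4(3)) auto
    hence "t i * Q (M + (q - i)) <= C4 * t q * Q (M + (q - i))" using Qp by (intro mult_right_mono) (auto simp: less_imp_le)
    moreover have "0 <= C4 * t q * (t i / real q)" using C4(1) tp by (simp add: less_imp_le)
    ultimately show ?thesis by (simp add: algebra_simps)
   qed
   have sQ: "(\<Sum>i\<le>q. Q (M + (q - i))) <= C5 * t M"
   proof -
    have "(\<Sum>i\<le>q. Q (M + (q - i))) = (\<Sum>l\<le>q. Q (M + l))" by (rule sum.reindex_bij_witness[of _ "\<lambda>l. q - l" "\<lambda>i. q - i"]) auto
    also have "... = (\<Sum>l<Suc q. Qf ss ((BB + real M) + real l))" by (simp add: Q_def lessThan_Suc_atMost add_ac)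
    also have "... <= C5 * t M" unfolding C5_def t_def by (rule Qf_sum_upper[OF ss]) simp
    finally show ?thesis .
   qed
   have "(\<Sum>i\<le>q. K * t i * TT (dd * (M + (q - i)))) <= (\<Sum>i\<le>q. K * CT * (t i * Q (M + (q - i))))"
   proof (rule sum_mono)
    fix i
    let ?k = "M + (q - i)"
    have "?k <= dd * ?k" using dd(1) by simp
    hence "Q (dd * ?k) <= Q ?k" by (rule Qd)
    hence "CT * Q (dd * ?k) <= CT * Q ?k" using CT(1) by simp
    hence "TT (dd * ?k) <= CT * Q ?k" using CT(2)[of "dd * ?k"] unfolding Q_def by linarith
    hence "K * t i * TT (dd * ?k) <= K * t i * (CT * Q ?k)" using K(1) tp[of i] by (intro mult_left_mono) auto
    thus "K * t i * TT (dd * ?k) <= K * CT * (t i * Q ?k)" by (simp add: mult_ac)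
   qed
   also have "... <= (\<Sum>i\<le>q. K * CT * (C4 * t q * (t i / real q + Q (M + (q - i)))))"
    using each K(1) CT(1) by (intro sum_mono mult_left_mono) auto
   also have "... = K * CT * C4 * t q * ((\<Sum>i\<le>q. t i) / real q + (\<Sum>i\<le>q. Q (M + (q - i))))"
    by (simp only: sum_distrib_left[symmetric] sum.distrib sum_divide_distrib[symmetric] mult.assoc)
   also have "... <= K * CT * C4 * t q * (\<eta> + \<eta>)"
   proof (intro mult_left_mono add_mono)
    show "(\<Sum>i\<le>q. t i) / real q <= \<eta>" using q0[OF q(1)] q1 by (simp add: pos_divide_le_eq)
    show "(\<Sum>i\<le>q. Q (M + (q - i))) <= \<eta>" using sQ M by linarith
    show "0 <= K * CT * C4 * t q" using K(1) CT(1) C4(1) tp[of q] by simp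
   qed
   also have "... <= K * CT * C4 * (H * t x) * (\<eta> + \<eta>)"
    using \<open>t q \<le> H * t x\<close> K(1) CT(1) C4(1) eta by (intro mult_right_mono mult_left_mono) auto
   also have "... = G * (\<eta> + \<eta>) * t x" by (simp add: G_def mult_ac)
   also have "... = c1 / 2 * t x" using G by (simp add: \<eta>_def)
   finally show "(\<Sum>i\<le>q. K * t i * TT (dd * (M + (q - i)))) <= c1 / 2 * t x" .
  qed (use b0_props(4) in simp)
  finally have "mm b0 * (c1 / 2 * t x) <= mm b0 * (\<Sum>k. tau (k + dd * M)) - (\<Sum>j\<le>n. \<beta> j)" by (simp add: algebra_simps)
  moreover have "C * real n powr (1 - ss) <= mm b0 * (c1 / 2 * t x)"
  proof -
   define z where "z = BB + real x"
   have z: "z >= BB" "z > 1" using B1 by (auto simp: z_def)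
   have lz: "ln z > 1" using Bs_props(3)[OF ss z(1)] .
   have "dd * q ~= 0" using q(2) dd(1) by simp
   hence "n >= 1" using nqr(1) by linarith
   hence n1: "real n >= 1" by (simp only: real_of_nat_ge_one_iff)
   have "x <= n + dd * (M + 1)" unfolding x_def nqr(1) by (simp add: algebra_simps)
   hence "real x <= real n + real (dd * (M + 1))" by (metis of_nat_le_iff of_nat_add)
   hence "z <= real n * 1 + (H2 - 1)" unfolding z_def H2_def by simp
   also have "... <= real n * H2"
   proof -
    have "1 * (H2 - 1) <= real n * (H2 - 1)" using n1 B1 by (intro mult_right_mono) (auto simp: H2_def)
    thus ?thesis by (simp add: algebra_simps)
   qed
   finally have zn: "z <= H2 * real n" by (simp add: mult.commute)
   \<comment> \<open>Dropping the factor \<open>(ln z) powr ss\<close>, which exceeds 1, leaves the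
     pure power of the conclusion.\<close>
   have "(H2 * real n) powr (1 - ss) <= z powr (1 - ss)" using zn z s1 by (intro powr_mono2') auto
   also have "... = z * (1 / z) powr ss" using z by (simp add: powr_diff powr_divide)
   also have "... <= z * (ln z / z) powr ss" using z lz ss by (intro mult_left_mono powr_mono2 divide_right_mono) auto
   also have "... = t x" by (simp add: t_def tf_def Qf_def z_def)
   finally have "H2 powr (1 - ss) * real n powr (1 - ss) <= t x" by (simp add: powr_mult)
   hence "(mm b0 * (c1 / 2)) * (H2 powr (1 - ss) * real n powr (1 - ss)) <= (mm b0 * (c1 / 2)) * t x"
    using b0_props(4) c1(1) by (intro mult_left_mono) auto
   thus ?thesis by (simp add: C_def mult.assoc)
  qed
  ultimately show ?thesis unfolding \<beta>_def by linarith
 qed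
 show ?thesis by (intro exI[of _ "dd * M"] exI[of _ n0] exI[of _ C] conjI allI impI C main)
qed

end

subsection \<open>The invariant density\<close>

lemma abs_diff_integrable:
 fixes p q :: "real => real"
 assumes "p absolutely_integrable_on S" "q absolutely_integrable_on S"
 shows "(\<lambda>x. \<bar>p x - q x\<bar>) integrable_on S"
proof -
 have "(\<lambda>x. p x - q x) absolutely_integrable_on S" using assms by (rule set_integral_diff(1))
 thus ?thesis by (simp add: absolutely_integrable_on_def)
qed

text \<open>Truncation at a high level \<open>m\<close> costs little. The truncated function is an
  almost everywhere limit of continuous ones, and clipping these to values between 0 and
  \<open>m\<close> allows dominated convergence.\<close>

lemma L1_continuous_approx:
 fixes r :: "real => real"
 assumes r: "r absolutely_integrable_on {0..1}" and nn: "\<And>x. 0 <= r x" and e: "e > 0"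
 shows "\<exists>g. continuous_on UNIV g \<and> (\<forall>x. 0 <= g x) \<and> (\<lambda>x. \<bar>r x - g x\<bar>) integrable_on {0..1} \<and> integral {0..1} (\<lambda>x. \<bar>r x - g x\<bar>) <= e"
proof -
 have ri: "r integrable_on {0..1}" using r abs_int_imp_int by blast
 have ca: "g absolutely_integrable_on {0..1}" if "continuous_on UNIV g" for g :: "real => real"
  using absolutely_integrable_continuous_real continuous_on_subset[OF that] by blast
 have mina: "(\<lambda>x. min (r x) m) absolutely_integrable_on {0..1}" for m
  by (rule absolutely_integrable_min_1[OF r ca[OF continuous_on_const]])
 have ab: "(\<lambda>x. \<bar>p x - q x\<bar>) integrable_on {0..1}" if "p absolutely_integrable_on {0..1}" "q absolutely_integrable_on {0..1}" for p q :: "real => real"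
  using that by (rule abs_diff_integrable)
 have "(\<lambda>m. integral {0..1} (\<lambda>x. \<bar>r x - min (r x) (real m)\<bar>)) \<longlonglongrightarrow> integral {0..1} (\<lambda>x::real. 0::real)"
 proof (rule dominated_convergence(2)[where h = r and f = "\<lambda>m x. \<bar>r x - min (r x) (real m)\<bar>" and g = "\<lambda>_. 0"])
  show "(\<lambda>x. \<bar>r x - min (r x) (real m)\<bar>) integrable_on {0..1}" for m by (rule ab[OF r mina])
  show "norm \<bar>r x - min (r x) (real m)\<bar> <= r x" for m x using nn[of x] by (auto simp: min_def)
  show "(\<lambda>m. \<bar>r x - min (r x) (real m)\<bar>) \<longlonglongrightarrow> 0" for x
  proof (rule tendsto_eventually)
   obtain m0 :: nat where "r x <= real m0" using real_arch_simple by blast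
   thus "\<forall>\<^sub>F m in sequentially. \<bar>r x - min (r x) (real m)\<bar> = 0" by (intro eventually_sequentiallyI[of m0]) (auto simp: min_def)
  qed
 qed (rule ri)
 hence "\<forall>\<^sub>F m in sequentially. integral {0..1} (\<lambda>x. \<bar>r x - min (r x) (real m)\<bar>) < e / 2" using e by (intro order_tendstoD(2)) auto
 then obtain m :: nat where m: "integral {0..1} (\<lambda>x. \<bar>r x - min (r x) (real m)\<bar>) < e / 2" by (auto simp: eventually_sequentially)
 define s where "s x = min (r x) (real m)" for x
 have sa: "s absolutely_integrable_on {0..1}" unfolding s_def[abs_def] by (rule mina)
 have sm: "0 <= s x" "s x <= real m" for x using nn[of x] by (auto simp: s_def)
 have "s measurable_on {0..1}"
  using absolutely_integrable_measurable[of "{0..1}" s] sa by (subst measurable_on_iff_borel_measurable) auto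
 then obtain N g where N: "negligible N" and g: "\<And>n. continuous_on UNIV (g n)"
  and lim: "\<And>x. x \<notin> N ==> (\<lambda>n. g n x) \<longlonglongrightarrow> (if x \<in> {0..1} then s x else 0)" unfolding measurable_on_def by blast
 define h where "h n x = max 0 (min (real m) (g n x))" for n x
 have hc: "continuous_on UNIV (h n)" for n unfolding h_def[abs_def] by (intro continuous_intros g)
 have hb: "0 <= h n x" "h n x <= real m" for n x by (auto simp: h_def)
 define k where "k n x = (if x \<in> N then 0 else \<bar>s x - h n x\<bar>)" for n x
 have shi: "(\<lambda>x. \<bar>s x - h n x\<bar>) integrable_on {0..1}" for n by (rule ab[OF sa ca[OF hc]])
 have "(\<lambda>n. integral {0..1} (k n)) \<longlonglongrightarrow> integral {0..1} (\<lambda>x::real. 0::real)"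
 proof (rule dominated_convergence(2)[where h = "\<lambda>_. real m" and f = k and g = "\<lambda>_. 0"])
  show "k n integrable_on {0..1}" for n by (rule integrable_spike[OF shi[of n] N]) (simp add: k_def)
  show "norm (k n x) <= real m" for n x using sm[of x] hb[of n x] by (auto simp: k_def)
  show "(\<lambda>n. k n x) \<longlonglongrightarrow> 0" if x: "x \<in> {0..1}" for x
  proof (cases "x \<in> N")
   case False
   have "(\<lambda>n. max 0 (min (real m) (g n x))) \<longlonglongrightarrow> max 0 (min (real m) (s x))" using lim[OF False] x by (intro tendsto_intros) auto
   hence "(\<lambda>n. \<bar>s x - h n x\<bar>) \<longlonglongrightarrow> \<bar>s x - max 0 (min (real m) (s x))\<bar>" unfolding h_def by (intro tendsto_rabs tendsto_diff tendsto_const)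
   moreover have "max 0 (min (real m) (s x)) = s x" using sm[of x] by auto
   ultimately show ?thesis using False by (simp add: k_def)
  qed (simp add: k_def)
 qed auto
 hence "\<forall>\<^sub>F n in sequentially. integral {0..1} (k n) < e / 2" using e by (intro order_tendstoD(2)) auto
 then obtain n where n: "integral {0..1} (k n) < e / 2" by (auto simp: eventually_sequentially)
 have "integral {0..1} (k n) = integral {0..1} (\<lambda>x. \<bar>s x - h n x\<bar>)" by (rule integral_spike[OF N]) (simp add: k_def)
 hence n: "integral {0..1} (\<lambda>x. \<bar>s x - h n x\<bar>) < e / 2" using n by simp
 have rhi: "(\<lambda>x. \<bar>r x - h n x\<bar>) integrable_on {0..1}" by (rule ab[OF r ca[OF hc]])
 have rsi: "(\<lambda>x. \<bar>r x - s x\<bar>) integrable_on {0..1}" by (rule ab[OF r sa])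
 have "integral {0..1} (\<lambda>x. \<bar>r x - h n x\<bar>) <= integral {0..1} (\<lambda>x. \<bar>r x - s x\<bar> + \<bar>s x - h n x\<bar>)"
  by (rule integral_le[OF rhi integrable_add[OF rsi shi]]) auto
 also have "... = integral {0..1} (\<lambda>x. \<bar>r x - s x\<bar>) + integral {0..1} (\<lambda>x. \<bar>s x - h n x\<bar>)" by (rule integral_add[OF rsi shi])
 also have "... <= e" using m n by (simp add: s_def)
 finally show ?thesis using hc hb(1) rhi by blast
qed

locale acip_unimodal = flat_unimodal + fixes \<mu> :: "real measure" assumes acip: "is_acip f \<mu>"
begin

sublocale M: prob_space \<mu> using acip by (simp add: is_acip_def)

lemma mu_sets: "B \<subseteq> {0..1} ==> B \<in> sets \<mu> \<longleftrightarrow> B \<in> sets borel" and mu_space: "space \<mu> = {0..1}"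
proof -
 have "sets \<mu> = sets (restrict_space borel {0..1})" "space \<mu> = {0..1}" using acip by (auto simp: is_acip_def)
 thus "space \<mu> = {0..1}" "B \<subseteq> {0..1} ==> B \<in> sets \<mu> \<longleftrightarrow> B \<in> sets borel" by (auto simp: sets_restrict_space_iff)
qed

lemma mu_01: "measure \<mu> {0..1} = 1" using M.prob_space mu_space by simp

lemma pre_borel: "B \<in> sets borel ==> {x \<in> {0..1}. (f ^^ n) x \<in> B} \<in> sets borel"
proof -
 assume "B \<in> sets borel"
 hence "(f ^^ n) -` B \<in> sets borel" using measurable_sets[OF fn_meas] by simp
 hence "{0..1} \<inter> (f ^^ n) -` B \<in> sets borel" by (intro sets.Int) auto
 moreover have "{0..1} \<inter> (f ^^ n) -` B = {x \<in> {0..1}. (f ^^ n) x \<in> B}" by auto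
 ultimately show ?thesis by simp
qed

lemma mu_inv:
 assumes B: "B \<subseteq> {0..1}" "B \<in> sets borel"
 shows "measure \<mu> {x \<in> {0..1}. (f ^^ n) x \<in> B} = measure \<mu> B"
proof (induct n)
 case 0
 have "{x \<in> {0..1}. (f ^^ 0) x \<in> B} = B" using B by auto
 thus ?case by simp
next
 case (Suc n)
 let ?A = "{x \<in> {0..1}. (f ^^ n) x \<in> B}"
 have A: "?A \<in> sets \<mu>" using mu_sets[of ?A] pre_borel[OF B(2)] by blast
 have fm: "f \<in> measurable \<mu> \<mu>" "distr \<mu> \<mu> f = \<mu>" using acip by (auto simp: is_acip_def)
 have "measure \<mu> ?A = measure (distr \<mu> \<mu> f) ?A" using fm(2) by simp
 also have "... = measure \<mu> (f -` ?A \<inter> space \<mu>)" by (rule measure_distr[OF fm(1) A])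
 also have "f -` ?A \<inter> space \<mu> = {x \<in> {0..1}. (f ^^ Suc n) x \<in> B}" unfolding mu_space using f_rng by (auto simp: funpow_swap1)
 finally show ?case using Suc by simp
qed

lemma mu_density:
 "\<exists>r. r \<in> borel_measurable borel \<and> (\<forall>x. 0 <= r x) \<and> r absolutely_integrable_on {0..1} \<and> (\<forall>B. B \<subseteq> {0..1} --> B \<in> sets borel --> measure \<mu> B = integral B r)"
proof -
 let ?M = "restrict_space lborel {0..1::real}"
 have ac: "absolutely_continuous ?M \<mu>" and se: "sets \<mu> = sets ?M"
  using acip by (auto simp: is_acip_def sets_restrict_space)
 have em: "emeasure ?M (space ?M) = 1" by (simp add: emeasure_restrict_space space_restrict_space)
 interpret R: finite_measure ?M by (rule finite_measureI) (simp only: em, simp)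
 obtain D where D: "D \<in> borel_measurable ?M" "AE x in ?M. RN_deriv ?M \<mu> x = ennreal (D x)" "\<And>x. 0 <= D x"
  using R.real_RN_deriv[OF M.finite_measure_axioms ac se] by blast
 have dens: "density ?M (\<lambda>x. ennreal (D x)) = \<mu>"
 proof -
  have "density ?M (RN_deriv ?M \<mu>) = density ?M (\<lambda>x. ennreal (D x))" by (rule density_cong) (use D in auto)
  thus ?thesis using R.density_RN_deriv[OF ac se] by simp
 qed
 define r where "r x = indicator {0..1} x * D x" for x
 have rm: "r \<in> borel_measurable borel"
 proof -
  have "(\<lambda>x. indicator {0..1} x *\<^sub>R D x) \<in> borel_measurable lborel"
   using D(1) borel_measurable_restrict_space_iff[of "{0..1}" lborel D] by simp
  thus ?thesis by (simp add: r_def[abs_def])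
 qed
 have r0: "0 <= r x" for x using D(3)[of x] by (simp add: r_def)
 have eq: "emeasure \<mu> B = (\<integral>\<^sup>+x. ennreal (indicator B x * r x) \<partial>lborel)" if B: "B \<subseteq> {0..1}" "B \<in> sets borel" for B
 proof -
  have Bs: "B \<in> sets ?M" using mu_sets[OF B(1)] B(2) se by simp
  have "emeasure \<mu> B = (\<integral>\<^sup>+x. ennreal (D x) * indicator B x \<partial>?M)"
   by (subst dens[symmetric], rule emeasure_density) (use D(1) Bs in auto)
  also have "... = (\<integral>\<^sup>+x. ennreal (D x) * indicator B x * indicator {0..1} x \<partial>lborel)"
   by (rule nn_integral_restrict_space) simp
  also have "... = (\<integral>\<^sup>+x. ennreal (indicator B x * r x) \<partial>lborel)"
   by (intro nn_integral_cong) (use B in \<open>auto simp: r_def indicator_def\<close>)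
  finally show ?thesis .
 qed
 have int: "integrable lborel (\<lambda>x. indicator B x * r x)" "measure \<mu> B = (\<integral>x. indicator B x * r x \<partial>lborel)" if B: "B \<subseteq> {0..1}" "B \<in> sets borel" for B
 proof -
  have m: "(\<lambda>x. indicator B x * r x) \<in> borel_measurable lborel" using rm B by auto
  have fin: "(\<integral>\<^sup>+x. ennreal (indicator B x * r x) \<partial>lborel) < \<infinity>" unfolding eq[OF B, symmetric] by (simp add: less_top[symmetric])
  show "integrable lborel (\<lambda>x. indicator B x * r x)" by (rule integrableI_nonneg[OF m _ fin]) (use r0 in auto)
  show "measure \<mu> B = (\<integral>x. indicator B x * r x \<partial>lborel)"
   unfolding measure_def eq[OF B] by (rule integral_eq_nn_integral[symmetric, OF m]) (use r0 in auto)
 qed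
 have si: "set_integrable lborel B r" if B: "B \<subseteq> {0..1}" "B \<in> sets borel" for B using int(1)[OF B] by (simp add: set_integrable_def)
 have "measure \<mu> B = integral B r" if B: "B \<subseteq> {0..1}" "B \<in> sets borel" for B
  using int(2)[OF B] set_borel_integral_eq_integral(2)[OF si[OF B]] by (simp add: set_lebesgue_integral_def)
 moreover have "r absolutely_integrable_on {0..1}" using si[of "{0..1}"]
  unfolding set_integrable_def by (intro integrable_completion[THEN iffD2]) auto
 ultimately show ?thesis using rm r0 by blast
qed

text \<open>Unlike in \<open>RW\<close>, branches may start anywhere in the unit interval, as is
  needed to pull the measure of subsets of \<open>J\<close> back.\<close>

definition OW :: "nat => bool list set" where "OW n = {w. length w = n \<and> ok w}"

lemma fin_OW: "finite (OW n)"
using finite_lists_length_eq[of "UNIV :: bool set" n] by (auto simp: OW_def)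

lemma OW_sets:
 assumes "B \<subseteq> J'"
 shows "{x \<in> {0..1}. (f ^^ n) x \<in> B} = (\<Union>w\<in>OW n. hw w ` B)"
proof (intro equalityI subsetI)
 fix x assume x: "x \<in> {x \<in> {0..1}. (f ^^ n) x \<in> B}"
 then obtain w where w: "length w = n" "ok w" "x = hw w ((f ^^ n) x)" using branch_cover[of x n] assms by auto
 hence "w \<in> OW n" by (simp add: OW_def)
 thus "x \<in> (\<Union>w\<in>OW n. hw w ` B)" using w(3) x by blast
next
 fix x assume "x \<in> (\<Union>w\<in>OW n. hw w ` B)"
 then obtain w y where w: "w \<in> OW n" "y \<in> B" "x = hw w y" by blast
 hence y: "y \<in> J'" "ok w" "length w = n" using assms by (auto simp: OW_def)
 thus "x \<in> {x \<in> {0..1}. (f ^^ n) x \<in> B}" using ok_fn[OF y(2,1)] ok_01[OF y(2,1)] w by auto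
qed

text \<open>Pull a subset of \<open>J\<close> back by \<open>f ^^ n\<close>; by invariance its
  measure is the integral of the raw density over branch images. Replace that density by a
  continuous \<open>g\<close> and freeze \<open>g\<close> at one point of each short branch image.
  What remains is a combination of branch Jacobians with nonnegative coefficients, so its constant
  is \<open>K0\<close> whatever \<open>g\<close> is.\<close>

lemma density_approx:
 assumes e: "e > 0"
 shows "\<exists>G. LIP K0 G \<and> (\<forall>B. B \<subseteq> J --> B \<in> sets borel --> \<bar>measure \<mu> B - integral B G\<bar> <= e)"
proof -
 obtain r where r: "\<And>x. 0 <= r x" "r absolutely_integrable_on {0..1}"
  and rmu: "\<And>B. B \<subseteq> {0..1} ==> B \<in> sets borel ==> measure \<mu> B = integral B r" using mu_density by blast
 obtain g where g: "continuous_on UNIV g" "\<And>x. 0 <= g x" "(\<lambda>x. \<bar>r x - g x\<bar>) integrable_on {0..1}" "integral {0..1} (\<lambda>x. \<bar>r x - g x\<bar>) <= e / 2"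
  using L1_continuous_approx[OF r(2,1), of "e / 2"] e by auto
 have "uniformly_continuous_on {0..1} g" using continuous_on_subset[OF g(1)] by (intro compact_uniformly_continuous) auto
 then obtain d where d: "d > 0" "\<And>x y. x \<in> {0..1} ==> y \<in> {0..1} ==> \<bar>y - x\<bar> < d ==> \<bar>g y - g x\<bar> < e / 2"
  unfolding uniformly_continuous_on_def dist_real_def using e half_gt_zero by metis
 obtain n where n: "\<And>w y. ok w ==> n <= length w ==> y \<in> {a..b} ==> \<bar>dh w y\<bar> <= d / (2 * dl)" using dh_small[OF divide_pos_pos[OF d(1), of "2 * dl"]] dl by (meson mult_pos_pos zero_less_numeral)
 define G where "G y = (\<Sum>w\<in>OW n. g (hw w c) * \<bar>dh w y\<bar>)" for y
 have GL: "LIP K0 G" unfolding G_def[abs_def]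
 proof (rule LIP_sum, rule LIP_cmult)
  fix w assume "w \<in> OW n"
  hence "ok w" by (simp add: OW_def)
  thus "LIP K0 (\<lambda>y. \<bar>dh w y\<bar>)" unfolding LIP_def using koebe_J subsetD[OF Icc_J'(3)] by simp
 qed (rule g)
 have near: "\<bar>g (hw w y) - g (hw w c)\<bar> <= e / 2" if w: "w \<in> OW n" and y: "y \<in> J" for w y
 proof -
  have o: "ok w" "n <= length w" using w by (auto simp: OW_def)
  have yc: "y \<in> J'" "c \<in> J'" using y J_sub by auto
  obtain z where z: "z \<in> {min y c..max y c}" "\<bar>hw w y - hw w c\<bar> = \<bar>dh w z\<bar> * \<bar>y - c\<bar>" using hw_mvt[OF o(1) yc] by blast
  have "z \<in> {a..b}" using z y ab by (auto simp: J_def)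
  hence "\<bar>hw w y - hw w c\<bar> <= d / (2 * dl) * dl" unfolding z(2) using n[OF o] J_len[OF y J_sub(3)] d dl by (intro mult_mono) auto
  also have "... < d" using d by simp
  finally show ?thesis using d(2)[of "hw w c" "hw w y"] ok_01[OF o(1) yc(1)] ok_01[OF o(1) yc(2)] by force
 qed
 have "\<bar>measure \<mu> B - integral B G\<bar> <= e" if B: "B \<subseteq> J" "B \<in> sets borel" for B
 proof -
  have BJ': "B \<subseteq> J'" using B J_sub by blast
  define U where "U = (\<Union>w\<in>OW n. hw w ` B)"
  have Ue: "U = {x \<in> {0..1}. (f ^^ n) x \<in> B}" unfolding U_def by (rule OW_sets[OF BJ', symmetric])
  have U: "U \<subseteq> {0..1}" "U \<in> sets borel" unfolding Ue using pre_borel[OF B(2)] by auto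
  have B01: "B \<subseteq> {0..1}" using B(1) J_sub by force
  have mU: "measure \<mu> B = integral U r" using mu_inv[OF B01 B(2), of n] rmu[OF U] by (simp add: Ue)
  have Ul: "U \<in> lmeasurable" by (rule lmeasurable_01[OF U(2,1)])
  have aiU: "u absolutely_integrable_on U" if "u absolutely_integrable_on {0..1}" for u :: "real => real" by (rule set_integrable_subset[OF that]) (use U in auto)
  have ga: "g absolutely_integrable_on {0..1}" using absolutely_integrable_continuous_real continuous_on_subset[OF g(1)] by blast
  have onea: "(\<lambda>x :: real. 1 :: real) absolutely_integrable_on {0..1}" by (rule absolutely_integrable_continuous_real[OF continuous_on_const])
  note ii = abs_int_imp_int
  have rg: "\<bar>integral U r - integral U g\<bar> <= e / 2"
  proof -
   have eq: "integral U r - integral U g = integral U (\<lambda>x. r x - g x)" using integral_diff[OF ii[OF aiU[OF r(2)]] ii[OF aiU[OF ga]]] by simp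
   have "\<bar>integral U (\<lambda>x. r x - g x)\<bar> <= integral U (\<lambda>x. \<bar>r x - g x\<bar>)"
    using integral_norm_bound_integral[OF integrable_diff[OF ii[OF aiU[OF r(2)]] ii[OF aiU[OF ga]]], of "\<lambda>x. \<bar>r x - g x\<bar>"]
     abs_diff_integrable[OF aiU[OF r(2)] aiU[OF ga]] by simp
   also have "... <= integral {0..1} (\<lambda>x. \<bar>r x - g x\<bar>)"
    by (rule integral_subset_le[OF U(1) abs_diff_integrable[OF aiU[OF r(2)] aiU[OF ga]] g(3)]) auto
   finally show ?thesis unfolding eq using g(4) by linarith
  qed
  have OWp: "w \<in> OW n ==> ok w \<and> length w = n" for w by (simp add: OW_def)
  note wi = words_integral[of "OW n" n B "{0..1}", OF fin_OW OWp BJ' B(2) _ U(1)[unfolded U_def]]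
  have g1: "(\<lambda>y. \<Sum>w\<in>OW n. g (hw w y) * \<bar>dh w y\<bar>) integrable_on B" "integral B (\<lambda>y. \<Sum>w\<in>OW n. g (hw w y) * \<bar>dh w y\<bar>) = integral U g"
   using ii[OF wi(1)[OF _ ga]] wi(2)[OF _ ga] unfolding U_def by blast+
  have one1: "(\<lambda>y. \<Sum>w\<in>OW n. 1 * \<bar>dh w y\<bar>) integrable_on B" "integral B (\<lambda>y. \<Sum>w\<in>OW n. 1 * \<bar>dh w y\<bar>) = integral U (\<lambda>_. 1)"
   using ii[OF wi(1)[OF _ onea]] wi(2)[OF _ onea] unfolding U_def by blast+
  have Gi: "G integrable_on B" by (rule ii, rule set_integrable_subset[OF LIP_integrable[OF GL]]) (use B in auto)
  have "\<bar>integral U g - integral B G\<bar> = \<bar>integral B (\<lambda>y. (\<Sum>w\<in>OW n. g (hw w y) * \<bar>dh w y\<bar>) - G y)\<bar>"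
   using integral_diff[OF g1(1) Gi] g1(2) by simp
  also have "... <= integral B (\<lambda>y. e / 2 * (\<Sum>w\<in>OW n. 1 * \<bar>dh w y\<bar>))"
  proof -
   have "norm (integral B (\<lambda>y. (\<Sum>w\<in>OW n. g (hw w y) * \<bar>dh w y\<bar>) - G y)) <= integral B (\<lambda>y. e / 2 * (\<Sum>w\<in>OW n. 1 * \<bar>dh w y\<bar>))"
   proof (rule integral_norm_bound_integral[OF integrable_diff[OF g1(1) Gi] integrable_on_mult_right[OF one1(1)]])
    fix y assume y: "y \<in> B"
    have eq: "(\<Sum>w\<in>OW n. g (hw w y) * \<bar>dh w y\<bar>) - G y = (\<Sum>w\<in>OW n. (g (hw w y) - g (hw w c)) * \<bar>dh w y\<bar>)"
     by (simp add: G_def sum_subtractf left_diff_distrib)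
    have "norm (\<Sum>w\<in>OW n. (g (hw w y) - g (hw w c)) * \<bar>dh w y\<bar>) <= (\<Sum>w\<in>OW n. e / 2 * \<bar>dh w y\<bar>)"
    proof (rule sum_norm_le)
     fix w assume "w \<in> OW n"
     hence "\<bar>g (hw w y) - g (hw w c)\<bar> <= e / 2" using near y B(1) by blast
     thus "norm ((g (hw w y) - g (hw w c)) * \<bar>dh w y\<bar>) <= e / 2 * \<bar>dh w y\<bar>"
      unfolding real_norm_def abs_mult abs_abs by (rule mult_right_mono) simp
    qed
    also have "... = e / 2 * (\<Sum>w\<in>OW n. 1 * \<bar>dh w y\<bar>)" by (simp add: sum_distrib_left)
    finally show "norm ((\<Sum>w\<in>OW n. g (hw w y) * \<bar>dh w y\<bar>) - G y) <= e / 2 * (\<Sum>w\<in>OW n. 1 * \<bar>dh w y\<bar>)" unfolding eq .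
   qed
   thus ?thesis unfolding real_norm_def .
  qed
  also have "... = e / 2 * integral U (\<lambda>_. 1)" using one1(2) by simp
  also have "... <= e / 2 * 1"
  proof (rule mult_left_mono)
   have "integral U (\<lambda>_. 1 :: real) = measure lborel U" using lmeasure_integral[OF Ul] U by simp
   also have "... <= measure lborel {0..1::real}" by (rule measure_mono_01) (use U in auto)
   finally show "integral U (\<lambda>_. 1 :: real) <= 1" by simp
  qed (use e in simp)
  finally show ?thesis using rg mU by linarith
 qed
 thus ?thesis using GL by blast
qed

lemma LIP_interval_average:
 assumes u: "LIP K u" and K: "0 <= K" and h: "h > 0" and y: "y \<in> J" "y + h < b" and Cm: "\<And>x. x \<in> J ==> u x <= Cm"
 shows "\<bar>integral {y..y + h} u / h - u y\<bar> <= Cm * (exp (K * h) - 1)"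
proof -
 have sub: "{y..y + h} \<subseteq> J" using y by (auto simp: J_def)
 have con: "continuous_on {y..y + h} u" using continuous_on_subset[OF LIP_continuous[OF u] sub] .
 have near: "\<bar>u x - u y\<bar> <= Cm * (exp (K * h) - 1)" if x: "x \<in> {y..y + h}" for x
 proof -
  have xJ: "x \<in> J" using sub x by blast
  have E: "exp (K * \<bar>x - y\<bar>) <= exp (K * h)" "exp (K * \<bar>y - x\<bar>) <= exp (K * h)" using x K by (auto intro: mult_left_mono)
  have "u x - u y <= u y * (exp (K * h) - 1)"
   using LIP_le[OF u xJ y(1)] mult_left_mono[OF E(1) LIP_nonneg[OF u y(1)]] by (simp add: algebra_simps)
  moreover have "u y - u x <= u x * (exp (K * h) - 1)"
   using LIP_le[OF u y(1) xJ] mult_left_mono[OF E(2) LIP_nonneg[OF u xJ]] by (simp add: algebra_simps)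
  moreover have "exp (K * h) - 1 >= 0" using K h by simp
  hence "u y * (exp (K * h) - 1) <= Cm * (exp (K * h) - 1)" "u x * (exp (K * h) - 1) <= Cm * (exp (K * h) - 1)"
   using Cm[OF y(1)] Cm[OF xJ] by (auto intro: mult_right_mono)
  ultimately show ?thesis by linarith
 qed
 have ui: "u integrable_on {y..y + h}" by (rule integrable_continuous_real[OF con])
 have eq: "integral {y..y + h} u - u y * h = integral {y..y + h} (\<lambda>x. u x - u y)" using integral_diff[OF ui integrable_continuous_real[OF continuous_on_const]] h by (simp add: mult.commute)
 have "norm (integral {y..y + h} (\<lambda>x. u x - u y)) <= integral {y..y + h} (\<lambda>_. Cm * (exp (K * h) - 1))"
  by (rule integral_norm_bound_integral) (use near ui in \<open>auto intro: integrable_diff\<close>)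
 hence "\<bar>integral {y..y + h} u - u y * h\<bar> <= Cm * (exp (K * h) - 1) * h" unfolding eq using h by (simp add: mult_ac)
 moreover have "integral {y..y + h} u / h - u y = (integral {y..y + h} u - u y * h) / h" using h by (simp add: field_simps)
 ultimately show ?thesis using h by (simp add: pos_divide_le_eq)
qed

text \<open>The approximations converge at every point: their averages over a short interval are
  determined by \<open>\<mu>\<close> up to a vanishing error, and the common constant
  \<open>K0\<close> ties the value at \<open>y\<close> to the average near \<open>y\<close>.\<close>

lemma density_exists: "\<exists>\<rho>. LIP K0 \<rho> \<and> (\<forall>B. B \<subseteq> J --> B \<in> sets borel --> measure \<mu> B = integral B \<rho>)"
proof -
 have "\<forall>i. \<exists>G. LIP K0 G \<and> (\<forall>B. B \<subseteq> J --> B \<in> sets borel --> \<bar>measure \<mu> B - integral B G\<bar> <= 1 / real (Suc i))"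
  using density_approx by simp
 from choice[OF this] obtain G where "\<forall>i. LIP K0 (G i) \<and> (\<forall>B. B \<subseteq> J --> B \<in> sets borel --> \<bar>measure \<mu> B - integral B (G i)\<bar> <= 1 / real (Suc i))"
  by (elim exE)
 hence G: "LIP K0 (G i)" and GB: "B \<subseteq> J ==> B \<in> sets borel ==> \<bar>measure \<mu> B - integral B (G i)\<bar> <= 1 / real (Suc i)" for i B by blast+
 define Cm where "Cm = exp (K0 * dl) / dl * 2"
 have K0: "0 <= K0" using a1b1(5) by simp
 have Cm: "G i x <= Cm" if x: "x \<in> J" for i x
 proof -
  have "\<bar>measure \<mu> J - mm (G i)\<bar> <= 1 / real (Suc i)" using GB[of J i] J_int(1) by (simp add: mm_def)
  moreover have "1 / real (Suc i) <= 1" by simp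
  moreover have "measure \<mu> J <= 1" by simp
  ultimately have "mm (G i) <= 2" by linarith
  hence "exp (K0 * dl) / dl * mm (G i) <= Cm" unfolding Cm_def using dl by (intro mult_left_mono) auto
  thus ?thesis using LIP_mm(1)[OF G LIP_integrable[OF G] K0 x, of i] by linarith
 qed
 have conv: "convergent (\<lambda>i. G i y)" if y: "y \<in> J" for y
 proof (rule Cauchy_convergent, rule metric_CauchyI)
  fix e :: real assume e: "e > 0"
  have "((\<lambda>h. Cm * (exp (K0 * h) - 1)) \<longlongrightarrow> Cm * (exp (K0 * 0) - 1)) (at_right 0)" by (intro tendsto_intros)
  hence "\<forall>\<^sub>F h in at_right 0. Cm * (exp (K0 * h) - 1) < e / 4" using e by (intro order_tendstoD(2)) auto
  moreover have "\<forall>\<^sub>F h in at_right 0. h < b - y" using y by (intro eventually_at_right_less[THEN eventually_mono] eventually_at_rightI[of 0 "b - y"]) (auto simp: J_def)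
  moreover have "\<forall>\<^sub>F h in at_right 0. (0::real) < h" by (rule eventually_at_right_less)
  ultimately have "\<forall>\<^sub>F h in at_right 0. Cm * (exp (K0 * h) - 1) < e / 4 \<and> h < b - y \<and> 0 < h" by eventually_elim simp
  then obtain h where h: "Cm * (exp (K0 * h) - 1) < e / 4" "y + h < b" "0 < h"
   using eventually_happens'[OF trivial_limit_at_right_real] by force
  obtain N :: nat where N: "8 / (e * h) < real N" using reals_Archimedean2 by blast
  have each: "\<bar>G i y - measure \<mu> {y..y + h} / h\<bar> < e / 2" if i: "i >= N" for i
  proof -
   have "{y..y + h} \<subseteq> J" using y h by (auto simp: J_def)
   hence "\<bar>measure \<mu> {y..y + h} - integral {y..y + h} (G i)\<bar> <= 1 / real (Suc i)" by (intro GB) auto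
   also have "... <= e * h / 8"
   proof -
    have "8 / (e * h) <= real (Suc i)" using N i by simp
    thus ?thesis using e h by (simp add: field_simps)
   qed
   finally have 0: "\<bar>measure \<mu> {y..y + h} - integral {y..y + h} (G i)\<bar> <= e * h / 8" .
   have "\<bar>measure \<mu> {y..y + h} / h - integral {y..y + h} (G i) / h\<bar> = \<bar>measure \<mu> {y..y + h} - integral {y..y + h} (G i)\<bar> / h"
    using h by (simp add: diff_divide_distrib[symmetric])
   also have "... <= (e * h / 8) / h" using 0 h by (intro divide_right_mono) auto
   finally have 1: "\<bar>measure \<mu> {y..y + h} / h - integral {y..y + h} (G i) / h\<bar> <= e / 8" using h by simp
   have "\<bar>integral {y..y + h} (G i) / h - G i y\<bar> <= Cm * (exp (K0 * h) - 1)" by (rule LIP_interval_average[OF G K0 h(3) y h(2) Cm])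
   thus ?thesis using 1 h(1) by linarith
  qed
  have "dist (G i y) (G j y) < e" if "i >= N" "j >= N" for i j using each[OF that(1)] each[OF that(2)] unfolding dist_real_def by linarith
  thus "\<exists>N. \<forall>i\<ge>N. \<forall>j\<ge>N. dist (G i y) (G j y) < e" by blast
 qed
 define \<rho> where "\<rho> y = lim (\<lambda>i. G i y)" for y
 have lim: "(\<lambda>i. G i y) \<longlonglongrightarrow> \<rho> y" if "y \<in> J" for y using conv[OF that] by (simp add: \<rho>_def convergent_LIMSEQ_iff)
 have "LIP K0 \<rho>" unfolding LIP_def
 proof (intro conjI ballI)
  show "0 <= \<rho> x" if "x \<in> J" for x using LIMSEQ_le_const[OF lim[OF that]] LIP_nonneg[OF G that] by blast
  fix x y assume xy: "x \<in> J" "y \<in> J"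
  have "(\<lambda>i. G i y * exp (K0 * \<bar>x - y\<bar>)) \<longlonglongrightarrow> \<rho> y * exp (K0 * \<bar>x - y\<bar>)" by (intro tendsto_intros lim xy)
  thus "\<rho> x <= \<rho> y * exp (K0 * \<bar>x - y\<bar>)" using LIMSEQ_le[OF lim[OF xy(1)]] LIP_le[OF G xy] by blast
 qed
 moreover have "measure \<mu> B = integral B \<rho>" if B: "B \<subseteq> J" "B \<in> sets borel" for B
 proof -
  have Bl: "B \<in> lmeasurable" using B J_sub by (intro lmeasurable_01) force+
  have Gi: "G i integrable_on B" for i by (rule abs_int_imp_int, rule set_integrable_subset[OF LIP_integrable[OF G]]) (use B in auto)
  have "(\<lambda>i. integral B (G i)) \<longlonglongrightarrow> integral B \<rho>"
  proof (rule dominated_convergence(2)[OF Gi, of "\<lambda>_. Cm"])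
   show "(\<lambda>_. Cm) integrable_on B" using Bl integrable_on_const by blast
   show "norm (G i x) <= Cm" if "x \<in> B" for i x using Cm[of x i] LIP_nonneg[OF G, of x i] that B by auto
   show "(\<lambda>i. G i x) \<longlonglongrightarrow> \<rho> x" if "x \<in> B" for x using lim that B by blast
  qed
  moreover have "(\<lambda>i. integral B (G i)) \<longlonglongrightarrow> measure \<mu> B"
  proof (rule LIM_zero_cancel, rule Lim_null_comparison[OF always_eventually])
   show "\<forall>i. norm (integral B (G i) - measure \<mu> B) <= 1 / real (Suc i)" using GB[OF B] by (simp add: abs_minus_commute)
   show "(\<lambda>i. 1 / real (Suc i)) \<longlonglongrightarrow> 0" by (rule LIMSEQ_Suc[OF lim_1_over_n])
  qed
  ultimately show ?thesis using LIMSEQ_unique by blast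
 qed
 ultimately show ?thesis by blast
qed

text \<open>The exponential decay concerns Lebesgue measure. Absolute continuity transfers the fact
  that the intersection of all \<open>Z n\<close> is null, and continuity from above does the
  rest.\<close>

lemma Z_lim: "(\<lambda>n. measure \<mu> (Z n)) \<longlonglongrightarrow> 0"
proof -
 obtain C \<gamma> where C: "C > 0" "0 < \<gamma>" "\<gamma> < 1" "\<And>k. measure lborel (Z k) <= C * \<gamma> ^ k" using Z_exp by blast
 define N where "N = (\<Inter>n. Z n)"
 have Zm: "Z n \<in> sets \<mu>" for n using mu_sets[OF Z_sub] Z_borel by blast
 have "decseq Z" unfolding decseq_def Z_def by auto
 hence lim: "(\<lambda>n. measure \<mu> (Z n)) \<longlonglongrightarrow> measure \<mu> N" unfolding N_def using Zm by (intro M.finite_Lim_measure_decseq) auto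
 have Nb: "N \<in> sets borel" "N \<subseteq> {0..1}" unfolding N_def using Z_borel Z_sub[of 0] by auto
 have "measure lborel N <= C * \<gamma> ^ k" for k
 proof -
  have "measure lborel N <= measure lborel (Z k)" by (rule measure_mono_01[OF _ Nb(1) Z_borel Z_sub]) (auto simp: N_def)
  thus ?thesis using C(4)[of k] by linarith
 qed
 moreover have "(\<lambda>k. C * \<gamma> ^ k) \<longlonglongrightarrow> 0" using C by (intro tendsto_mult_right_zero LIMSEQ_power_zero) auto
 ultimately have "measure lborel N <= 0" using LIMSEQ_le_const by blast
 hence "measure lborel N = 0" using measure_nonneg[of lborel N] by linarith
 moreover have "emeasure lborel N <= emeasure lborel {0..1::real}" using Nb by (intro emeasure_mono) auto
 hence "emeasure lborel N ~= \<top>" by (auto simp: top_unique)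
 ultimately have n0: "emeasure lborel N = 0" by (simp add: emeasure_eq_ennreal_measure)
 have "N \<in> null_sets (restrict_space lborel {0..1})" using n0 Nb by (auto simp: null_sets_def sets_restrict_space_iff emeasure_restrict_space)
 moreover have "absolutely_continuous (restrict_space lborel {0..1}) \<mu>" using acip by (simp add: is_acip_def)
 ultimately have "N \<in> null_sets \<mu>" unfolding absolutely_continuous_def by blast
 hence "measure \<mu> N = 0" by (simp add: measure_def null_sets_def)
 thus ?thesis using lim by simp
qed

text \<open>The preimage of \<open>Z n\<close> splits according to whether the starting point lies
  in \<open>J\<close>; with invariance, iterating this telescopes to Kac's formula.\<close>

lemma Z_step: "measure \<mu> (Z n) = measure \<mu> (Z (Suc n)) + measure \<mu> (sR n)"
proof -
 have "{x \<in> {0..1}. (f ^^ 1) x \<in> Z n} = Z (Suc n) \<union> sR n"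
 proof (intro equalityI subsetI)
  fix x assume "x \<in> {x \<in> {0..1}. (f ^^ 1) x \<in> Z n}"
  hence x: "x \<in> {0..1}" "\<And>j. j < n ==> (f ^^ j) (f x) \<notin> J" by (auto simp: Z_def)
  have s: "(f ^^ j) x \<notin> J" if "1 <= j" "j <= n" for j using x(2)[of "j - 1"] that by (cases j) (auto simp: funpow_swap1)
  show "x \<in> Z (Suc n) \<union> sR n"
  proof (cases "x \<in> J")
   case True thus ?thesis using s by (auto simp: sR_def)
  next
   case False
   have "(f ^^ j) x \<notin> J" if "j < Suc n" for j using s[of j] False that by (cases "j = 0") auto
   thus ?thesis using x by (auto simp: Z_def)
  qed
 next
  fix x assume x: "x \<in> Z (Suc n) \<union> sR n"
  have "(f ^^ j) (f x) \<notin> J" if "j < n" for j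
  proof -
   have "(f ^^ Suc j) x \<notin> J" using x that unfolding Z_def sR_def by force
   thus ?thesis by (simp add: funpow_swap1)
  qed
  moreover have "x \<in> {0..1}" using x Z_sub sR_sub by blast
  ultimately show "x \<in> {x \<in> {0..1}. (f ^^ 1) x \<in> Z n}" using f_rng by (auto simp: Z_def)
 qed
 hence "measure \<mu> (Z n) = measure \<mu> (Z (Suc n) \<union> sR n)" using mu_inv[OF Z_sub Z_borel, where n = 1] by (metis (no_types, lifting))
 also have "... = measure \<mu> (Z (Suc n)) + measure \<mu> (sR n)"
 proof (rule M.finite_measure_Union)
  show "Z (Suc n) \<in> sets \<mu>" "sR n \<in> sets \<mu>" using mu_sets Z_sub Z_borel sR_sub(2) sR_borel by blast+
  show "Z (Suc n) \<inter> sR n = {}" unfolding Z_def sR_def by force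
 qed
 finally show ?thesis .
qed

lemma Z_sum: "measure \<mu> (Z n) = 1 - (\<Sum>k<n. measure \<mu> (sR k))"
proof (induct n)
 case 0
 have "Z 0 = {0..1}" by (auto simp: Z_def)
 thus ?case using mu_01 by simp
next
 case (Suc n) thus ?case using Z_step[of n] by simp
qed

lemma kac_mu: "(\<lambda>k. measure \<mu> (sR k)) sums 1"
proof -
 have "(\<lambda>n. 1 - measure \<mu> (Z n)) \<longlonglongrightarrow> 1 - 0" by (intro tendsto_intros Z_lim)
 thus ?thesis unfolding sums_def by (simp add: Z_sum)
qed

text \<open>Integrated over a small \<open>B\<close>, the sum measures the points that are in
  \<open>B\<close> at time \<open>n\<close> and whose last earlier visit to \<open>J\<close> was at
  time \<open>n - r\<close>. These events are disjoint and lie in the preimage of \<open>B\<close>,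
  of the same measure as \<open>B\<close>. Continuity turns a violation at a point into one on an
  interval.\<close>

lemma induced_sub:
 assumes rho: "\<And>B. B \<subseteq> J ==> B \<in> sets borel ==> measure \<mu> B = integral B \<rho>" and L: "LIP K0 \<rho>" and y: "y \<in> J"
 shows "(\<Sum>r\<in>{1..n}. LL r \<rho> y) <= \<rho> y"
proof (rule ccontr)
 assume neg: "\<not> ?thesis"
 have K0: "0 <= K0" using a1b1(5) by simp
 define F where "F x = (\<Sum>r\<in>{1..n}. LL r \<rho> x)" for x
 have LLL: "LIP (K0 * Th + K0) (LL r \<rho>)" for r unfolding LL_br[abs_def]
 proof (rule LIP_sum, rule br_LIP[OF L K0])
  fix w assume "w \<in> FR r"
  thus "ok w" "inJ w" by (auto simp: FR_def RW_def)
  thus "\<bar>dh w x\<bar> <= Th" if "x \<in> J" for x using dh_le_Th that Icc_J'(3) by blast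
 qed
 have FL: "LIP (K0 * Th + K0) F" unfolding F_def[abs_def] by (rule LIP_sum[OF LLL])
 have con: "continuous_on J (\<lambda>x. F x - \<rho> x)" using LIP_continuous[OF FL] LIP_continuous[OF L] by (intro continuous_intros)
 have "F y - \<rho> y > 0" using neg by (simp add: F_def)
 then obtain d where d: "d > 0" "\<And>x. x \<in> J ==> \<bar>x - y\<bar> < d ==> \<bar>(F x - \<rho> x) - (F y - \<rho> y)\<bar> < F y - \<rho> y"
  using con y unfolding continuous_on_iff dist_real_def by metis
 define h where "h = min (d / 2) ((b - y) / 2)"
 have "h <= d / 2" "h <= (b - y) / 2" unfolding h_def by (rule min.cobounded1, rule min.cobounded2)
 moreover have "h > 0" using d(1) y by (simp add: h_def J_def)
 ultimately have h: "h > 0" "h < d" "y + h < b" by (auto simp: J_def field_simps)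
 define B where "B = {y..y + h}"
 have BJ: "B \<subseteq> J" "B \<in> sets borel" "B \<subseteq> {0..1}" using y h ab by (auto simp: B_def J_def)
 have "integral {y..y + h} \<rho> < integral {y..y + h} F"
 proof (rule integral_less_real)
  show "continuous_on {y..y + h} \<rho>" "continuous_on {y..y + h} F"
   using continuous_on_subset[OF LIP_continuous[OF L] BJ(1)] continuous_on_subset[OF LIP_continuous[OF FL] BJ(1)] by (auto simp: B_def)
  show "{y<..<y + h} ~= {}" using h by auto
  fix x assume x: "x \<in> {y<..<y + h}"
  hence "x \<in> J" "\<bar>x - y\<bar> < d" using BJ(1) h by (auto simp: B_def)
  thus "\<rho> x < F x" using d(2)[of x] by linarith
 qed
 hence lt: "measure \<mu> B < integral B F" using rho[OF BJ(1,2)] by (simp add: B_def)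
 define E0 where "E0 r = {x \<in> frset r. (f ^^ r) x \<in> B}" for r
 have E0e: "E0 r = (\<Union>w\<in>FR r. hw w ` B)" for r unfolding E0_def by (rule FR_sets[OF BJ(1)])
 have E0b: "E0 r \<in> sets borel" "E0 r \<subseteq> J" for r
 proof -
  have "hw w ` B \<in> sets borel" if "w \<in> FR r" for w using hw_image_borel[of w B] BJ J_sub(1) that by (auto simp: FR_def RW_def)
  thus "E0 r \<in> sets borel" unfolding E0e using fin_RW by (intro sets.finite_UN) auto
  show "E0 r \<subseteq> J" using frset_props(1) by (auto simp: E0_def)
 qed
 have iLL: "LL r \<rho> integrable_on B" "integral B (LL r \<rho>) = measure \<mu> (E0 r)" for r
 proof -
  have "FR r \<subseteq> RW r" by (auto simp: FR_def)
  hence ok: "w \<in> FR r ==> ok w \<and> length w = r" for w by (auto simp: RW_def)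
  note wi = words_integral[of "FR r" r B J \<rho>, OF fin_RW(2) ok subset_trans[OF BJ(1) J_sub(1)] BJ(2) LIP_integrable[OF L] E0b(2)[of r, unfolded E0e]]
  show "LL r \<rho> integrable_on B" unfolding LL_def[abs_def] using wi(1) abs_int_imp_int by blast
  have "integral B (LL r \<rho>) = integral (E0 r) \<rho>" unfolding LL_def[abs_def] E0e using wi(2) by blast
  thus "integral B (LL r \<rho>) = measure \<mu> (E0 r)" using rho[OF E0b(2,1)] by simp
 qed
 define E where "E r = {x \<in> {0..1}. (f ^^ (n - r)) x \<in> E0 r}" for r
 have E01: "E0 r \<subseteq> {0..1}" for r using E0b(2)[of r] J_sub by force
 have Em: "E r \<in> sets \<mu>" for r
 proof -
  have "E r \<subseteq> {0..1}" by (auto simp: E_def)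
  thus ?thesis using mu_sets pre_borel[OF E0b(1)] unfolding E_def by blast
 qed
 have "integral B F = (\<Sum>r\<in>{1..n}. integral B (LL r \<rho>))" unfolding F_def[abs_def] using iLL(1) by (intro integral_sum) auto
 also have "... = (\<Sum>r\<in>{1..n}. measure \<mu> (E r))" unfolding E_def using mu_inv[OF E01 E0b(1)] iLL(2) by simp
 also have "... = measure \<mu> (\<Union>r\<in>{1..n}. E r)"
 proof (rule M.finite_measure_finite_Union[symmetric])
  have dj: "E r \<inter> E s = {}" if "r < s" "s <= n" for r s
  proof (rule ccontr)
   assume "E r \<inter> E s ~= {}"
   then obtain x where x: "(f ^^ (n - r)) x \<in> frset r" "(f ^^ (n - s)) x \<in> frset s" by (auto simp: E_def E0_def)
   have "\<And>j. 0 < j \<and> j < s ==> (f ^^ j) ((f ^^ (n - s)) x) \<notin> J" using x(2) by (simp add: frset_def)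
   moreover have "1 <= r" using x(1) by (simp add: frset_def)
   ultimately have "(f ^^ (s - r)) ((f ^^ (n - s)) x) \<notin> J" using that by simp
   moreover have "(f ^^ (s - r)) ((f ^^ (n - s)) x) = (f ^^ (n - r)) x" using iter_add[of "s - r" "n - s" f x] that by simp
   ultimately show False using x(1) by (simp add: frset_def)
  qed
  show "disjoint_family_on E {1..n}" unfolding disjoint_family_on_def
  proof (intro ballI impI)
   fix r s assume "r \<in> {1..n}" "s \<in> {1..n}" "r ~= s"
   thus "E r \<inter> E s = {}" using dj[of r s] dj[of s r] by (cases "r < s") auto
  qed
 qed (use Em in auto)
 also have "... <= measure \<mu> {x \<in> {0..1}. (f ^^ n) x \<in> B}"
 proof (rule M.finite_measure_mono)
  show "(\<Union>r\<in>{1..n}. E r) \<subseteq> {x \<in> {0..1}. (f ^^ n) x \<in> B}"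
  proof (rule UN_least)
   fix r assume r: "r \<in> {1..n}"
   show "E r \<subseteq> {x \<in> {0..1}. (f ^^ n) x \<in> B}"
   proof
    fix x assume x: "x \<in> E r"
    have "(f ^^ r) ((f ^^ (n - r)) x) = (f ^^ n) x" using iter_add[of r "n - r" f x] r by simp
    thus "x \<in> {x \<in> {0..1}. (f ^^ n) x \<in> B}" using x by (auto simp: E_def E0_def)
   qed
  qed
  have "{x \<in> {0..1}. (f ^^ n) x \<in> B} \<subseteq> {0..1}" by auto
  thus "{x \<in> {0..1}. (f ^^ n) x \<in> B} \<in> sets \<mu>" using mu_sets pre_borel[OF BJ(2)] by blast
 qed
 also have "... = measure \<mu> B" by (rule mu_inv[OF BJ(3,2)])
 finally show False using lt by simp
qed

lemma flat_density_mu: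
 "\<exists>\<rho>. flat_density f f1 c f2 f3 a' a b b' v0 C1 C2 e0 \<rho> K0 \<and> LIP K0 \<rho> \<and> (\<forall>B. B \<subseteq> J --> B \<in> sets borel --> measure \<mu> B = integral B \<rho>)"
proof -
 obtain \<rho> where L: "LIP K0 \<rho>" and rho: "\<And>B. B \<subseteq> J ==> B \<in> sets borel ==> measure \<mu> B = integral B \<rho>" using density_exists by blast
 have kac: "(\<lambda>k. integral (sR k) \<rho>) sums 1" using kac_mu rho[OF sR_sub(1) sR_borel] by simp
 \<comment> \<open>A zero of a log-Lipschitz function makes it vanish on all of \<open>J\<close>,
   and then Kac's sum would be 0.\<close>
 have "\<rho> c ~= 0"
 proof
  assume "\<rho> c = 0"
  hence z: "\<rho> y = 0" if "y \<in> J" for y using LIP_le[OF L that J_sub(3)] LIP_nonneg[OF L that] by simp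
  have "integral (sR k) \<rho> = integral (sR k) (\<lambda>_. 0)" for k using z sR_sub(1) by (intro integral_cong) auto
  hence "(\<lambda>k. integral (sR k) \<rho>) = (\<lambda>_. 0)" by simp
  hence "(0::real) = 1" using kac sums_unique2[OF sums_zero] by metis
  thus False by simp
 qed
 hence "\<rho> c > 0" using LIP_nonneg[OF L J_sub(3)] by simp
 hence rc: "0 < \<rho> c" .
 have "flat_density f f1 c f2 f3 a' a b b' v0 C1 C2 e0 \<rho> K0"
 proof (unfold_locales)
  show "0 <= K0" using a1b1(5) by simp
  show "(\<Sum>r\<in>{1..n}. LL r \<rho> y) <= \<rho> y" if "y \<in> J" for n y by (rule induced_sub[OF _ L that]) (rule rho)
 qed (fact L rc kac)+
 thus ?thesis using rho L by blast
qed

subsection \<open>Correlations\<close>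

text \<open>The bridge between integrals with respect to \<open>\<mu>\<close>, as in
  \<open>Cor\<close>, and the gauge integrals against \<open>\<rho>\<close> on which the operators
  act: \<open>\<mu>\<close> restricted to \<open>J\<close> is identified with a density
  measure.\<close>

lemma chi_integral:
 assumes L: "LIP K0 \<rho>" and rho: "\<And>B. B \<subseteq> J ==> B \<in> sets borel ==> measure \<mu> B = integral B \<rho>" and B: "B \<subseteq> J" "B \<in> sets borel"
 shows "(\<integral>x. indicator B x * chi x \<partial>\<mu>) = integral B (\<lambda>x. chi x * \<rho> x)"
proof -
 let ?R = "restrict_space lborel J" let ?\<rho> = "\<lambda>x. ennreal (\<rho> x)"
 have J01: "J \<subseteq> {0..1}" using J_sub by force
 have Jm: "J \<in> sets \<mu>" "J \<inter> space \<mu> = J" "J \<inter> space \<mu> \<in> sets \<mu>" using mu_sets[OF J01] J_int(1) Int_absorb2[OF J01] by simp_all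
 have rm: "\<rho> \<in> borel_measurable ?R"
  using borel_measurable_continuous_on_restrict[OF LIP_continuous[OF L]] by (simp add: measurable_def sets_restrict_space space_restrict_space)
 have meq: "restrict_space \<mu> J = density ?R ?\<rho>"
 proof (rule measure_eqI)
  show "sets (restrict_space \<mu> J) = sets (density ?R ?\<rho>)"
  proof -
   have "sets \<mu> = sets (restrict_space borel {0..1})" using acip by (simp add: is_acip_def)
   hence "sets (restrict_space \<mu> J) = sets (restrict_space (restrict_space borel {0..1}) J)" by (rule sets_restrict_space_cong)
   also have "... = sets (restrict_space borel J)" using J01 by (simp add: restrict_restrict_space Int_absorb1 J_int)
   finally show ?thesis by (simp add: sets_restrict_space)
  qed
  fix A assume "A \<in> sets (restrict_space \<mu> J)"
  hence A': "A \<subseteq> J" "A \<in> sets \<mu>" using sets_restrict_space_iff[OF Jm(3)] by auto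
  hence A: "A \<subseteq> J" "A \<in> sets borel" using mu_sets[of A] J01 by auto
  have "emeasure (restrict_space \<mu> J) A = emeasure \<mu> A" using emeasure_restrict_space[OF Jm(3)] A' by simp
  also have "... = ennreal (integral A \<rho>)" using rho[OF A] M.emeasure_eq_measure by simp
  also have "... = (\<integral>\<^sup>+x. ?\<rho> x * indicator A x \<partial>lborel)"
  proof -
   have m: "(\<lambda>x. \<rho> x * indicator A x) \<in> borel_measurable borel"
   proof -
    have "(\<lambda>x. indicator J x *\<^sub>R \<rho> x) \<in> borel_measurable borel"
     using rm borel_measurable_restrict_space_iff[of J lborel \<rho>] J_int(1) by simp
    hence "(\<lambda>x. indicator A x * (indicator J x *\<^sub>R \<rho> x)) \<in> borel_measurable borel" using A(2) by (intro borel_measurable_times) auto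
    moreover have "(\<lambda>x. indicator A x * (indicator J x *\<^sub>R \<rho> x)) = (\<lambda>x. \<rho> x * indicator A x)" using A(1) by (auto simp: fun_eq_iff indicator_def)
    ultimately show ?thesis by simp
   qed
   have ai: "\<rho> absolutely_integrable_on A" by (rule set_integrable_subset[OF LIP_integrable[OF L]]) (use A in auto)
   have nn: "0 <= \<rho> x * indicator A x" for x using LIP_nonneg[OF L, of x] A(1) by (auto simp: indicator_def)
   have "(\<rho> has_integral integral A \<rho>) A" using ai abs_int_imp_int by blast
   moreover have "(\<lambda>x. \<rho> x * indicator A x) = (\<lambda>x. if x \<in> A then \<rho> x else 0)" by (auto simp: fun_eq_iff)
   ultimately have "((\<lambda>x. \<rho> x * indicator A x) has_integral integral A \<rho>) UNIV"
    by simp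
   hence "(\<integral>\<^sup>+x. ennreal (\<rho> x * indicator A x) \<partial>lborel) = ennreal (integral A \<rho>)" by (rule nn_integral_has_integral_lborel[OF m nn])
   moreover have "ennreal (\<rho> x * indicator A x) = ?\<rho> x * indicator A x" for x by (simp add: indicator_def)
   ultimately show ?thesis by simp
  qed
  also have "... = (\<integral>\<^sup>+x. (?\<rho> x * indicator A x) * indicator J x \<partial>lborel)" using A(1) by (intro nn_integral_cong) (auto simp: indicator_def)
  also have "... = (\<integral>\<^sup>+x. ?\<rho> x * indicator A x \<partial>?R)" by (rule nn_integral_restrict_space[symmetric]) (simp add: J_int)
  also have "... = emeasure (density ?R ?\<rho>) A"
   by (rule emeasure_density[symmetric]) (use rm A in \<open>auto simp: sets_restrict_space_iff J_int\<close>)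
  finally show "emeasure (restrict_space \<mu> J) A = emeasure (density ?R ?\<rho>) A" .
 qed
 let ?h = "\<lambda>x. indicator B x * chi x"
 have hm: "?h \<in> borel_measurable borel" using B(2) unfolding chi_def[abs_def] by measurable
 have hR: "?h \<in> borel_measurable ?R" by (rule measurable_restrict_space1) (use hm in \<open>simp only: measurable_lborel2\<close>)
 have "(\<integral>x. ?h x \<partial>\<mu>) = (\<integral>x. indicator J x *\<^sub>R ?h x \<partial>\<mu>)" using B(1) by (intro Bochner_Integration.integral_cong) (auto simp: indicator_def)
 also have "... = (\<integral>x. ?h x \<partial>restrict_space \<mu> J)" by (rule integral_restrict_space[symmetric, OF Jm(3)])
 also have "... = (\<integral>x. \<rho> x *\<^sub>R ?h x \<partial>?R)" unfolding meq
  by (rule integral_density[OF hR rm]) (auto simp: space_restrict_space LIP_nonneg[OF L])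
 also have "... = (\<integral>x. indicator J x *\<^sub>R (\<rho> x *\<^sub>R ?h x) \<partial>lborel)" by (rule integral_restrict_space) (simp add: J_int)
 also have "... = (LINT x:B|lborel. chi x * \<rho> x)" unfolding set_lebesgue_integral_def
  using B(1) by (intro Bochner_Integration.integral_cong) (auto simp: indicator_def)
 also have "... = integral B (\<lambda>x. chi x * \<rho> x)"
 proof (rule set_borel_integral_eq_integral(2))
  have fin: "emeasure lborel B < \<infinity>"
  proof -
   have "emeasure lborel B <= emeasure lborel {0..1::real}" using B J01 by (intro emeasure_mono) auto
   thus ?thesis by (auto simp: less_top[symmetric] top_unique)
  qed
  obtain k where k: "\<And>x. x \<in> J ==> \<bar>chi x * \<rho> x\<bar> <= k"
  proof -
   have "\<bar>chi x * \<rho> x\<bar> <= dl * (\<rho> c * exp (K0 * dl))" if x: "x \<in> J" for x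
   proof -
    have "\<rho> x <= \<rho> c * exp (K0 * \<bar>x - c\<bar>)" by (rule LIP_le[OF L x J_sub(3)])
    also have "... <= \<rho> c * exp (K0 * dl)" using LIP_nonneg[OF L J_sub(3)] J_len[OF x J_sub(3)] a1b1(5) by (intro mult_left_mono) auto
    finally show ?thesis using chi_le[of x] LIP_nonneg[OF L x] by (auto simp: abs_mult intro!: mult_mono)
   qed
   thus ?thesis by (rule that)
  qed
  have m: "(\<lambda>x. indicator B x *\<^sub>R (chi x * \<rho> x)) \<in> borel_measurable borel"
  proof -
   have "(\<lambda>x. indicator J x *\<^sub>R \<rho> x) \<in> borel_measurable borel"
    using rm borel_measurable_restrict_space_iff[of J lborel \<rho>] J_int(1) by simp
   hence "(\<lambda>x. ?h x * (indicator J x *\<^sub>R \<rho> x)) \<in> borel_measurable borel" by (rule borel_measurable_times[OF hm])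
   moreover have "(\<lambda>x. ?h x * (indicator J x *\<^sub>R \<rho> x)) = (\<lambda>x. indicator B x *\<^sub>R (chi x * \<rho> x))" using B(1) by (auto simp: fun_eq_iff indicator_def)
   ultimately show ?thesis by simp
  qed
  show "set_integrable lborel B (\<lambda>x. chi x * \<rho> x)" unfolding set_integrable_def
  proof (rule integrableI_bounded_set[where A = B and B = k])
   show "AE x in lborel. x \<in> B --> norm (indicator B x *\<^sub>R (chi x * \<rho> x)) <= k" using k B(1) by (auto simp: indicator_def)
  qed (use m B fin in auto)
 qed
 finally show ?thesis .
qed

theorem slow_correlations:
 "\<exists>\<phi> \<psi> C. Linfty_01 \<phi> \<and> holder_on {0..1} \<psi> \<and> C > 0 \<and> (\<forall>n\<ge>1. Cor \<mu> f \<phi> \<psi> n >= C * real n powr (1 - 1 / v0))"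
proof -
 obtain \<rho> where fd: "flat_density f f1 c f2 f3 a' a b b' v0 C1 C2 e0 \<rho> K0" and L: "LIP K0 \<rho>"
  and rho: "\<And>B. B \<subseteq> J ==> B \<in> sets borel ==> measure \<mu> B = integral B \<rho>" using flat_density_mu by blast
 interpret F: flat_density f f1 c f2 f3 a' a b b' v0 C1 C2 e0 \<rho> K0 by (rule fd)
 obtain M n0 C where C: "C > 0" and main: "\<And>n. n >= n0 ==> C * real n powr (1 - ss) <=
   mm F.b0 * (\<Sum>k. F.tau (k + M)) - (\<Sum>j\<le>n. integral (sR (n + M - j)) (GG j F.b0))" using F.correlation_lower by blast
 have b0e: "F.b0 = (\<lambda>x. chi x * \<rho> x)" by (rule ext) (rule F.b0_def)
 define \<Theta> where "\<Theta> = {x \<in> {0..1}. (f ^^ 1) x \<in> Z M}"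
 have Th_iff: "x \<in> \<Theta> \<longleftrightarrow> (\<forall>j. 1 <= j \<and> j <= M --> (f ^^ j) x \<notin> J)" if x: "x \<in> {0..1}" for x
 proof
  assume "x \<in> \<Theta>"
  hence *: "\<And>j. j < M ==> (f ^^ j) (f x) \<notin> J" by (auto simp: \<Theta>_def Z_def)
  show "\<forall>j. 1 <= j \<and> j <= M --> (f ^^ j) x \<notin> J"
  proof (intro allI impI)
   fix j assume "1 <= j \<and> j <= M" thus "(f ^^ j) x \<notin> J" using *[of "j - 1"] by (cases j) (auto simp: funpow_swap1)
  qed
 next
  assume *: "\<forall>j. 1 <= j \<and> j <= M --> (f ^^ j) x \<notin> J"
  have "(f ^^ j) (f x) \<notin> J" if "j < M" for j using *[rule_format, of "Suc j"] that by (simp add: funpow_swap1)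
  thus "x \<in> \<Theta>" using x f_rng by (auto simp: \<Theta>_def Z_def)
 qed
 have Tb: "\<Theta> \<in> sets borel" "\<Theta> \<subseteq> {0..1}" unfolding \<Theta>_def by (rule pre_borel[OF Z_borel]) auto
 have tau: "F.tau k = measure \<mu> (sR k)" for k unfolding F.tau_def using rho[OF sR_sub(1) sR_borel] by simp
 have muT: "measure \<mu> \<Theta> = (\<Sum>k. F.tau (k + M))"
 proof -
  have "measure \<mu> \<Theta> = measure \<mu> (Z M)" unfolding \<Theta>_def by (rule mu_inv[OF Z_sub Z_borel])
  also have "... = 1 - (\<Sum>k<M. F.tau k)" by (simp add: Z_sum tau)
  also have "... = (\<Sum>k. F.tau (k + M))" using suminf_split_initial_segment[OF F.tau_sum(1), of M] F.tau_sum(2) by simp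
  finally show ?thesis .
 qed
 have fnn: "(f ^^ n) x \<in> {0..1}" if "x \<in> {0..1}" for n x using fn_rng[OF that, of n] by auto
 define \<phi> :: "real => real" where "\<phi> = indicator {x \<in> {0..1}. (f ^^ n0) x \<in> \<Theta>}"
 define \<psi> :: "real => real" where "\<psi> x = - chi x" for x
 have 1: "Linfty_01 \<phi>" unfolding Linfty_01_def \<phi>_def using pre_borel[OF Tb(1)] by (auto intro!: exI[of _ 1] simp: indicator_def)
 have 2: "holder_on {0..1} \<psi>" unfolding holder_on_def \<psi>_def
 proof (intro exI conjI ballI)
  show "\<bar>- chi x - - chi y\<bar> <= 1 * \<bar>x - y\<bar> powr 1" for x y using chi_lip[of x y] by simp
 qed auto
 \<comment> \<open>Since \<open>chi\<close> vanishes off \<open>J\<close>, time 0 counts as a visit,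
   so there is a last visit \<open>j <= n\<close>. Lying in \<open>\<Theta>\<close> at time
   \<open>n\<close> excludes visits at times \<open>n + 1\<close> to \<open>n + M\<close>, so after
   time \<open>j\<close> the orbit stays away for \<open>n + M - j\<close> steps.\<close>
 have visit: "(\<integral>x. indicator \<Theta> ((f ^^ n) x) * chi x \<partial>\<mu>) = (\<Sum>j\<le>n. integral (sR (n + M - j)) (GG j F.b0))" for n
 proof -
  define E where "E j = {x \<in> J. (f ^^ j) x \<in> sR (n + M - j)}" for j
  define U where "U = (\<Union>j\<le>n. E j)"
  have Eb: "E j \<in> sets borel" "E j \<subseteq> J" for j
  proof -
   have "E j = J \<inter> {x \<in> {0..1}. (f ^^ j) x \<in> sR (n + M - j)}" using J_sub by (force simp: E_def)
   thus "E j \<in> sets borel" using pre_borel[OF sR_borel] J_int(1) by auto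
   show "E j \<subseteq> J" by (auto simp: E_def)
  qed
  have Ub: "U \<in> sets borel" "U \<subseteq> J" unfolding U_def using Eb by auto
  have EI: "x \<in> E j \<longleftrightarrow> x \<in> J \<and> (f ^^ j) x \<in> J \<and> (\<forall>i. j < i \<and> i <= n + M --> (f ^^ i) x \<notin> J)" if j: "j <= n" for x j
  proof -
   have "(\<forall>i. 1 <= i \<and> i <= n + M - j --> (f ^^ i) ((f ^^ j) x) \<notin> J) \<longleftrightarrow> (\<forall>i. j < i \<and> i <= n + M --> (f ^^ i) x \<notin> J)"
   proof (intro iffI allI impI)
    fix i assume *: "\<forall>i. 1 <= i \<and> i <= n + M - j --> (f ^^ i) ((f ^^ j) x) \<notin> J" and i: "j < i \<and> i <= n + M"
    hence "(f ^^ (i - j)) ((f ^^ j) x) \<notin> J" using *[rule_format, of "i - j"] by linarith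
    thus "(f ^^ i) x \<notin> J" using iter_add[of "i - j" j f x] i by simp
   next
    fix i assume *: "\<forall>i. j < i \<and> i <= n + M --> (f ^^ i) x \<notin> J" and i: "1 <= i \<and> i <= n + M - j"
    hence "(f ^^ (i + j)) x \<notin> J" by auto
    thus "(f ^^ i) ((f ^^ j) x) \<notin> J" using iter_add[of i j f x] by simp
   qed
   thus ?thesis unfolding E_def sR_def by blast
  qed
  have UI: "x \<in> U \<longleftrightarrow> (f ^^ n) x \<in> \<Theta>" if x: "x \<in> J" for x
  proof -
   have x01: "x \<in> {0..1}" using x J_sub by force
   have T: "(f ^^ n) x \<in> \<Theta> \<longleftrightarrow> (\<forall>i. n < i \<and> i <= n + M --> (f ^^ i) x \<notin> J)"
    unfolding Th_iff[OF fnn[OF x01]]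
   proof (intro iffI allI impI)
    fix i assume *: "\<forall>j. 1 <= j \<and> j <= M --> (f ^^ j) ((f ^^ n) x) \<notin> J" and i: "n < i \<and> i <= n + M"
    hence "(f ^^ (i - n)) ((f ^^ n) x) \<notin> J" using *[rule_format, of "i - n"] by linarith
    thus "(f ^^ i) x \<notin> J" using iter_add[of "i - n" n f x] i by simp
   next
    fix j assume *: "\<forall>i. n < i \<and> i <= n + M --> (f ^^ i) x \<notin> J" and j: "1 <= j \<and> j <= M"
    hence "(f ^^ (j + n)) x \<notin> J" by auto
    thus "(f ^^ j) ((f ^^ n) x) \<notin> J" using iter_add[of j n f x] by simp
   qed
   show ?thesis
   proof
    assume "x \<in> U"
    then obtain j where j: "j <= n" "x \<in> E j" by (auto simp: U_def)
    hence "\<forall>i. j < i \<and> i <= n + M --> (f ^^ i) x \<notin> J" using EI[OF j(1)] by blast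
    thus "(f ^^ n) x \<in> \<Theta>" unfolding T using j(1) by auto
   next
    assume t: "(f ^^ n) x \<in> \<Theta>"
    define S where "S = {j. j <= n \<and> (f ^^ j) x \<in> J}"
    have S: "finite S" "0 \<in> S" using x by (auto simp: S_def)
    define j where "j = Max S"
    have j: "j \<in> S" "\<And>i. i \<in> S ==> i <= j" using Max_in[OF S(1)] S(2) Max_ge[OF S(1)] unfolding j_def by blast+
    have "(f ^^ i) x \<notin> J" if "j < i" "i <= n + M" for i
    proof (cases "i <= n")
     case True
     thus ?thesis using j(2)[of i] that by (auto simp: S_def)
    next
     case False
     thus ?thesis using t that unfolding T by auto
    qed
    hence "x \<in> E j" using EI[of j x] j(1) x by (auto simp: S_def)
    thus "x \<in> U" using j(1) by (auto simp: U_def S_def)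
   qed
  qed
  have "(\<integral>x. indicator \<Theta> ((f ^^ n) x) * chi x \<partial>\<mu>) = (\<integral>x. indicator U x * chi x \<partial>\<mu>)"
  proof (rule Bochner_Integration.integral_cong[OF refl])
   fix x
   show "indicator \<Theta> ((f ^^ n) x) * chi x = indicator U x * chi x"
    using UI[of x] chi_out[of x] by (cases "x \<in> J") (auto simp: indicator_def)
  qed
  also have "... = integral U F.b0" unfolding b0e by (rule chi_integral[OF L _ Ub(2,1)]) (rule rho)
  also have "... = (\<Sum>j\<le>n. integral (E j) F.b0)" unfolding U_def
  proof (rule integral_unique, rule has_integral_UN)
   have ai: "F.b0 absolutely_integrable_on E j" for j by (rule set_integrable_subset[OF F.b0_props(1)]) (use Eb in auto)
   show "(F.b0 has_integral integral (E j) F.b0) (E j)" for j using ai abs_int_imp_int by blast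
   have "E i \<inter> E j = {}" if "i < j" "j <= n" for i j
   proof (rule ccontr)
    assume "E i \<inter> E j ~= {}"
    then obtain x where x: "x \<in> E i" "x \<in> E j" by blast
    hence "(f ^^ j) x \<in> J" "\<forall>k. i < k \<and> k <= n + M --> (f ^^ k) x \<notin> J" using EI[of i x] EI[of j x] that by auto
    thus False using that by auto
   qed
   thus "pairwise (\<lambda>i i'. negligible (E i \<inter> E i')) {..n}"
    unfolding pairwise_def by (metis Int_commute atMost_iff linorder_neqE_nat negligible_empty)
  qed simp
  also have "... = (\<Sum>j\<le>n. integral (sR (n + M - j)) (GG j F.b0))"
   unfolding E_def using mm_GG(2)[OF F.b0_props(1) sR_sub(1) sR_borel] by simp
  finally show ?thesis .
 qed
 have int_chi: "(\<integral>x. chi x \<partial>\<mu>) = mm F.b0"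
 proof -
  have "(\<integral>x. chi x \<partial>\<mu>) = (\<integral>x. indicator J x * chi x \<partial>\<mu>)"
   using chi_out by (intro Bochner_Integration.integral_cong) (auto simp: indicator_def)
  also have "... = mm F.b0" unfolding b0e mm_def by (rule chi_integral[OF L _ order_refl J_int(1)]) (rule rho)
  finally show ?thesis .
 qed
 have cor: "Cor \<mu> f \<phi> \<psi> n = mm F.b0 * (\<Sum>k. F.tau (k + M)) - (\<Sum>j\<le>n + n0. integral (sR (n + n0 + M - j)) (GG j F.b0))" for n
 proof -
  have "(\<integral>x. \<phi> ((f ^^ n) x) * \<psi> x \<partial>\<mu>) = (\<integral>x. - (indicator \<Theta> ((f ^^ (n + n0)) x) * chi x) \<partial>\<mu>)"
  proof (rule Bochner_Integration.integral_cong[OF refl])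
   fix x assume "x \<in> space \<mu>"
   hence "(f ^^ n) x \<in> {0..1}" using fnn mu_space by auto
   moreover have "(f ^^ n0) ((f ^^ n) x) = (f ^^ (n + n0)) x" using iter_add[of n0 n f x] by (simp add: add.commute)
   ultimately show "\<phi> ((f ^^ n) x) * \<psi> x = - (indicator \<Theta> ((f ^^ (n + n0)) x) * chi x)" by (auto simp: \<phi>_def \<psi>_def indicator_def)
  qed
  also have "... = - (\<Sum>j\<le>n + n0. integral (sR (n + n0 + M - j)) (GG j F.b0))" using visit[of "n + n0"] by simp
  finally have A: "(\<integral>x. \<phi> ((f ^^ n) x) * \<psi> x \<partial>\<mu>) = - (\<Sum>j\<le>n + n0. integral (sR (n + n0 + M - j)) (GG j F.b0))" .
  have "(\<integral>x. \<phi> x \<partial>\<mu>) = measure \<mu> ({x \<in> {0..1}. (f ^^ n0) x \<in> \<Theta>} \<inter> space \<mu>)" unfolding \<phi>_def by (rule Bochner_Integration.integral_indicator)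
  also have "{x \<in> {0..1}. (f ^^ n0) x \<in> \<Theta>} \<inter> space \<mu> = {x \<in> {0..1}. (f ^^ n0) x \<in> \<Theta>}" unfolding mu_space by blast
  also have "measure \<mu> ... = measure \<mu> \<Theta>" by (rule mu_inv[OF Tb(2,1)])
  finally have B: "(\<integral>x. \<phi> x \<partial>\<mu>) = (\<Sum>k. F.tau (k + M))" using muT by simp
  have "(\<integral>x. \<psi> x \<partial>\<mu>) = - mm F.b0" using int_chi by (simp add: \<psi>_def[abs_def])
  thus ?thesis unfolding Cor_def A B by simp
 qed
 \<comment> \<open>The time shift costs only this factor, because
   \<open>n + n0 <= (1 + n0) * n\<close> for \<open>n >= 1\<close>.\<close>
 define C' where "C' = C * (1 + real n0) powr (1 - ss)"
 have C': "C' > 0" using C by (simp add: C'_def)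
 have "C' * real n powr (1 - 1 / v0) <= Cor \<mu> f \<phi> \<psi> n" if n: "n >= 1" for n
 proof -
  have "real n0 * 1 <= real n0 * real n" using n by (intro mult_left_mono) auto
  hence le: "real (n + n0) <= (1 + real n0) * real n" by (simp add: algebra_simps)
  have "C' * real n powr (1 - 1 / v0) = C * ((1 + real n0) * real n) powr (1 - ss)" by (simp add: C'_def ss_def powr_mult)
  also have "... <= C * real (n + n0) powr (1 - ss)"
   using le n ss C by (intro mult_left_mono powr_mono2') auto
  also have "... <= Cor \<mu> f \<phi> \<psi> n" unfolding cor by (rule main) simp
  finally show ?thesis .
 qed
 thus ?thesis using 1 2 C' by blast
qed

end

subsection \<open>From the hypotheses to the renewal setting\<close>

lemma islimpt_01: "x \<in> {0..1} ==> at x within {0..1::real} - {c} ~= bot"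
proof -
 assume x: "x \<in> {0..1}"
 have i1: "x islimpt {0..1::real}" using x by simp
 have "{0..1::real} = ({0..1} - {c}) \<union> ({0..1} \<inter> {c})" by auto
 hence "x islimpt ({0..1} - {c}) \<union> ({0..1} \<inter> {c})" using i1 by simp
 hence "x islimpt {0..1} - {c}" unfolding islimpt_Un using islimpt_finite[of "{0..1} \<inter> {c}" x] by auto
 thus ?thesis by (simp add: trivial_limit_within)
qed

lemma at_01: "x \<in> {0..1} ==> at x within {0..1::real} ~= bot"
 by (simp add: trivial_limit_within)

lemma C1_lipschitz:
 fixes g g1 :: "real => real"
 assumes "\<And>x. x \<in> {p..q} ==> (g has_real_derivative g1 x) (at x within {p..q})" "continuous_on {p..q} g1"
 shows "\<exists>M>0. \<forall>x\<in>{p..q}. \<forall>y\<in>{p..q}. \<bar>g x - g y\<bar> <= M * \<bar>x - y\<bar>"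
proof -
 have "compact (g1 ` {p..q})" using assms(2) by (intro compact_continuous_image) auto
 then obtain B where B: "\<forall>x\<in>g1 ` {p..q}. norm x <= B" using compact_imp_bounded bounded_iff by blast
 have "\<bar>g x - g y\<bar> <= max 1 B * \<bar>x - y\<bar>" if "x \<in> {p..q}" "y \<in> {p..q}" for x y
  using field_differentiable_bound[of "{p..q}" g g1 "max 1 B" x y] assms(1) B that by (auto simp: le_max_iff_disj)
 thus ?thesis by (intro exI[of _ "max 1 B"]) auto
qed

lemma C1_on_UNIV_lipschitz:
 assumes "C1_on UNIV g"
 shows "\<exists>M>0. \<forall>x\<in>{p..q}. \<forall>y\<in>{p..q}. \<bar>g x - g y\<bar> <= M * \<bar>x - y\<bar>"
proof -
 obtain g1 where g1: "\<And>x. (g has_real_derivative g1 x) (at x)" "continuous_on UNIV g1"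
  using assms unfolding C1_on_def has_deriv_on_def by auto
 show ?thesis by (rule C1_lipschitz[of p q g g1]) (use g1 continuous_on_subset has_field_derivative_at_within in blast)+
qed

lemma C1_diffeo_bilipschitz:
 assumes g: "C1_diffeo g" and p: "p \<in> {0..1}" "g p = 0"
 shows "\<exists>m>0. \<exists>M>0. \<forall>x\<in>{0..1}. m * \<bar>x - p\<bar> <= \<bar>g x\<bar> \<and> \<bar>g x\<bar> <= M * \<bar>x - p\<bar>"
proof -
 have bj: "bij g" and C: "C1_on UNIV g" "C1_on UNIV (inv g)" using g by (auto simp: C1_diffeo_def)
 obtain M where M: "M > 0" "\<And>x y. x \<in> {0..1} ==> y \<in> {0..1} ==> \<bar>g x - g y\<bar> <= M * \<bar>x - y\<bar>" using C1_on_UNIV_lipschitz[OF C(1), of 0 1] by blast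
 obtain L where L: "L > 0" "\<And>x y. x \<in> {- M..M} ==> y \<in> {- M..M} ==> \<bar>inv g x - inv g y\<bar> <= L * \<bar>x - y\<bar>" using C1_on_UNIV_lipschitz[OF C(2), of "- M" M] by blast
 have up: "\<bar>g x\<bar> <= M * \<bar>x - p\<bar>" if "x \<in> {0..1}" for x using M(2)[OF that p(1)] p(2) by simp
 have "1 / L * \<bar>x - p\<bar> <= \<bar>g x\<bar>" if x: "x \<in> {0..1}" for x
 proof -
  have "\<bar>x - p\<bar> <= 1" using x p by auto
  hence "M * \<bar>x - p\<bar> <= M * 1" using M(1) by (intro mult_left_mono) auto
  hence "\<bar>g x\<bar> <= M" using up[OF x] by linarith
  hence "g x \<in> {- M..M}" "0 \<in> {- M..M}" by auto
  hence "\<bar>inv g (g x) - inv g 0\<bar> <= L * \<bar>g x - 0\<bar>" by (rule L(2))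
  moreover have "inv g (g x) = x" "inv g 0 = p" using bj p(2) by (auto simp: bij_def inv_f_eq)
  ultimately show ?thesis using L(1) by (simp add: field_simps)
 qed
 thus ?thesis using up M(1) L(1) by (intro exI[of _ "1 / L"] exI[of _ M] conjI ballI) auto
qed

text \<open>Take logarithms in the flatness relation. As \<open>\<xi>\<close> is bi-Lipschitz,
  \<open>-ln |\<xi> x|\<close> is comparable to \<open>ln (1 / d)\<close>. As \<open>v\<close> is
  Lipschitz and \<open>d * ln (1 / d)\<close> tends to 0, \<open>d powr (- v x)\<close> equals
  \<open>d powr (- v c)\<close> up to the factor \<open>exp 1\<close>. The constants coming from
  \<open>\<eta>\<close> are absorbed because \<open>Phi\<close> tends to infinity.\<close>

lemma flat_bounds:
 assumes fl: "flat_critical f c l" and im: "f ` {0..1} \<subseteq> {0..1}" and c: "c \<in> {0<..<1}" and v: "C3_on {0..1} v" and vc: "v c \<in> {0<..<1}"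
  and l: "\<forall>\<^sub>F x in at c within {0..1}. l x = \<bar>x - c\<bar> powr (- v x)"
 shows "\<exists>C1 C2 e. C1 > 0 \<and> C2 > 0 \<and> e > 0 \<and> (\<forall>x\<in>{0..1}. 0 < \<bar>x - c\<bar> \<and> \<bar>x - c\<bar> < e -->
  exp (- C1 * Phi (v c) \<bar>x - c\<bar>) <= \<bar>f x - f c\<bar> \<and> \<bar>f x - f c\<bar> <= exp (- C2 * Phi (v c) \<bar>x - c\<bar>))"
proof -
 obtain \<xi> \<eta> where xe: "C1_diffeo \<xi>" "C1_diffeo \<eta>" "\<xi> c = 0" "\<eta> (f c) = 0"
  and fe: "\<forall>\<^sub>F x in at c within {0..1}. \<bar>\<eta> (f x)\<bar> = \<bar>\<xi> x\<bar> powr l x" using fl by (auto simp: flat_critical_def)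
 have c01: "c \<in> {0..1}" using c by auto
 have fc01: "f c \<in> {0..1}" using subsetD[OF im imageI[OF c01]] .
 obtain m M where m: "m > 0" "M > 0" and mM: "\<And>x. x \<in> {0..1} ==> m * \<bar>x - c\<bar> <= \<bar>\<xi> x\<bar>" "\<And>x. x \<in> {0..1} ==> \<bar>\<xi> x\<bar> <= M * \<bar>x - c\<bar>"
  using C1_diffeo_bilipschitz[OF xe(1) c01 xe(3)] by blast
 obtain p P where p: "p > 0" "P > 0" and pP: "\<And>y. y \<in> {0..1} ==> p * \<bar>y - f c\<bar> <= \<bar>\<eta> y\<bar>" "\<And>y. y \<in> {0..1} ==> \<bar>\<eta> y\<bar> <= P * \<bar>y - f c\<bar>"
  using C1_diffeo_bilipschitz[OF xe(2) fc01 xe(4)] by blast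
 obtain v1 v2 where v1: "has_deriv_on v v1 {0..1}" "has_deriv_on v1 v2 {0..1}" using v by (auto simp: C3_on_def)
 have "continuous_on {0..1} v1" using v1(2) by (auto simp: has_deriv_on_def intro!: DERIV_continuous_on)
 then obtain Lv where Lv: "Lv > 0" "\<And>x y. x \<in> {0..1} ==> y \<in> {0..1} ==> \<bar>v x - v y\<bar> <= Lv * \<bar>x - y\<bar>"
  using C1_lipschitz[of 0 1 v v1] v1(1) unfolding has_deriv_on_def by blast
 define w where "w = v c"
 have w: "w > 0" using vc by (simp add: w_def)
 define E where "E = exp (1::real)"
 have E: "E > 0" by (simp add: E_def)
 obtain d1 where d1: "d1 > 0" "\<And>x. x \<in> {0..1} ==> x ~= c ==> dist x c < d1 ==> \<bar>\<eta> (f x)\<bar> = \<bar>\<xi> x\<bar> powr (\<bar>x - c\<bar> powr (- v x))"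
 by (smt (verit) fe l eventually_at)
 define k1 where "k1 = \<bar>ln m\<bar> + \<bar>ln M\<bar>"
 define k2 where "k2 = \<bar>ln p\<bar> + \<bar>ln P\<bar>"
 have "filterlim (\<lambda>d::real. ln (1 / d)) at_top (at_right 0)" by real_asymp
 hence ev1: "\<forall>\<^sub>F d in at_right 0. 2 * k1 + 1 <= ln (1 / d)" by (simp add: filterlim_at_top)
 have "((\<lambda>d. Lv * d * ln (1 / d)) \<longlongrightarrow> 0) (at_right 0)" by real_asymp
 hence ev2: "\<forall>\<^sub>F d in at_right 0. Lv * d * ln (1 / d) < 1" by (rule order_tendstoD) simp
 have "filterlim (\<lambda>d. Phi w d) at_top (at_right 0)" unfolding Phi_def using w by real_asymp
 hence ev3: "\<forall>\<^sub>F d in at_right 0. 4 * E * k2 <= Phi w d" by (simp add: filterlim_at_top)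
 have "\<forall>\<^sub>F d in at_right 0. 2 * k1 + 1 <= ln (1 / d) \<and> Lv * d * ln (1 / d) < 1 \<and> 4 * E * k2 <= Phi w d"
  using ev1 ev2 ev3 by eventually_elim simp
 then obtain d2 where d2: "d2 > 0" "\<And>d. 0 < d ==> d < d2 ==> 2 * k1 + 1 <= ln (1 / d) \<and> Lv * d * ln (1 / d) < 1 \<and> 4 * E * k2 <= Phi w d"
  unfolding eventually_at_right_field by blast
 have main: "exp (- (2 * E + 1 / (4 * E)) * Phi w \<bar>x - c\<bar>) <= \<bar>f x - f c\<bar> \<and> \<bar>f x - f c\<bar> <= exp (- (1 / (4 * E)) * Phi w \<bar>x - c\<bar>)"
  if x: "x \<in> {0..1}" "0 < \<bar>x - c\<bar>" "\<bar>x - c\<bar> < min d1 d2" for x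
 proof -
  define d where "d = \<bar>x - c\<bar>"
  have d: "0 < d" "d < d1" "d < d2" using x by (auto simp: d_def)
  note D = d2(2)[OF d(1,3)]
  define \<Lambda> where "\<Lambda> = ln (1 / d)"
  have k10: "k1 >= 0" by (simp add: k1_def)
  have La: "2 * k1 + 1 <= \<Lambda>" "\<Lambda> > 0" using D k10 by (auto simp: \<Lambda>_def)
  have lnd: "ln d = - \<Lambda>" by (simp add: \<Lambda>_def ln_div)
  have xi0: "\<bar>\<xi> x\<bar> > 0" using mM(1)[OF x(1)] m(1) x(2) by (smt (verit) mult_pos_pos)
  have "ln (m * d) <= ln \<bar>\<xi> x\<bar>" "ln \<bar>\<xi> x\<bar> <= ln (M * d)" using mM[OF x(1)] xi0 m d by (auto simp: d_def)
  hence "ln m - \<Lambda> <= ln \<bar>\<xi> x\<bar>" "ln \<bar>\<xi> x\<bar> <= ln M - \<Lambda>" using m d lnd by (auto simp: ln_mult)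
  moreover have "\<bar>ln m\<bar> <= k1" "\<bar>ln M\<bar> <= k1" by (auto simp: k1_def)
  ultimately have X: "\<Lambda> / 2 <= - ln \<bar>\<xi> x\<bar>" "- ln \<bar>\<xi> x\<bar> <= 2 * \<Lambda>" using La by linarith+
  define L where "L = d powr (- v x)"
  have Le: "L = d powr (- w) * exp ((v x - w) * \<Lambda>)" using lnd by (simp add: L_def powr_def exp_add[symmetric] algebra_simps)
  have vx: "\<bar>(v x - w) * \<Lambda>\<bar> <= 1"
  proof -
   have "\<bar>v x - w\<bar> * \<Lambda> <= (Lv * d) * \<Lambda>" using Lv(2)[OF x(1) c01] La by (intro mult_right_mono) (auto simp: d_def w_def)
   moreover have "Lv * d * \<Lambda> < 1" using D by (simp add: \<Lambda>_def)
   moreover have "\<bar>(v x - w) * \<Lambda>\<bar> = \<bar>v x - w\<bar> * \<Lambda>" using La(2) by (simp add: abs_mult)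
   ultimately show ?thesis by linarith
  qed
  have eb: "1 / E <= exp ((v x - w) * \<Lambda>)" "exp ((v x - w) * \<Lambda>) <= E"
  proof -
   have "exp (- 1) <= exp ((v x - w) * \<Lambda>)" using vx by (simp only: exp_le_cancel_iff)
   thus "1 / E <= exp ((v x - w) * \<Lambda>)" by (simp add: E_def exp_minus inverse_eq_divide)
   show "exp ((v x - w) * \<Lambda>) <= E" unfolding E_def using vx by (simp only: exp_le_cancel_iff)
  qed
  define D0 where "D0 = d powr (- w)"
  have D0: "D0 > 0" using d by (simp add: D0_def)
  have Lb: "D0 / E <= L" "L <= D0 * E"
   using mult_left_mono[OF eb(1), of D0] mult_left_mono[OF eb(2), of D0] by (auto simp: Le D0_def)
  have L0: "L > 0" using d by (simp add: L_def)
  define h where "h = ln \<bar>\<eta> (f x)\<bar>"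
  have "\<bar>\<eta> (f x)\<bar> = \<bar>\<xi> x\<bar> powr L" using d1(2)[OF x(1)] d by (auto simp: L_def d_def dist_real_def)
  hence hL: "h = L * ln \<bar>\<xi> x\<bar>" and eta0: "\<bar>\<eta> (f x)\<bar> > 0" using xi0 by (auto simp: h_def ln_powr)
  have Ph: "Phi w d = D0 * \<Lambda>" by (simp add: Phi_def D0_def \<Lambda>_def)
  have h1: "Phi w d / (2 * E) <= - h"
  proof -
   have "(D0 / E) * (\<Lambda> / 2) <= L * (- ln \<bar>\<xi> x\<bar>)" using Lb X D0 E La L0 by (intro mult_mono) auto
   thus ?thesis by (simp add: hL Ph)
  qed
  have h2: "- h <= 2 * E * Phi w d"
  proof -
   have "L * (- ln \<bar>\<xi> x\<bar>) <= (D0 * E) * (2 * \<Lambda>)" using Lb X D0 E La L0 by (intro mult_mono) auto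
   thus ?thesis by (simp add: hL Ph mult_ac)
  qed
  define \<kappa> where "\<kappa> = \<bar>f x - f c\<bar>"
  have fx: "f x \<in> {0..1}" using subsetD[OF im imageI[OF x(1)]] .
  have kp: "p * \<kappa> <= \<bar>\<eta> (f x)\<bar>" "\<bar>\<eta> (f x)\<bar> <= P * \<kappa>" using pP[OF fx] by (auto simp: \<kappa>_def)
  have k0: "\<kappa> > 0" using kp(2) eta0 p by (smt (verit) mult_nonneg_nonpos zero_less_mult_iff)
  have "ln (p * \<kappa>) <= h" "h <= ln (P * \<kappa>)" unfolding h_def using kp eta0 k0 p by auto
  hence "ln p + ln \<kappa> <= h" "h <= ln P + ln \<kappa>" using p k0 by (auto simp: ln_mult)
  moreover have "\<bar>ln p\<bar> <= k2" "\<bar>ln P\<bar> <= k2" by (auto simp: k2_def)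
  ultimately have K: "ln \<kappa> <= h + k2" "h - k2 <= ln \<kappa>" by linarith+
  have k2b: "k2 <= Phi w d / (4 * E)" using D E by (simp add: field_simps)
  have "Phi w d / (2 * E) = Phi w d / (4 * E) + Phi w d / (4 * E)" by (simp add: field_simps)
  hence "ln \<kappa> <= - (1 / (4 * E)) * Phi w d" using K h1 k2b by simp
  hence up: "\<kappa> <= exp (- (1 / (4 * E)) * Phi w d)" using k0 by (metis exp_le_cancel_iff exp_ln)
  have "- (2 * E + 1 / (4 * E)) * Phi w d <= ln \<kappa>" using K h2 k2b by (simp add: algebra_simps)
  hence "exp (- (2 * E + 1 / (4 * E)) * Phi w d) <= \<kappa>" using k0 by (metis exp_le_cancel_iff exp_ln)
  thus ?thesis using up by (simp add: \<kappa>_def d_def)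
 qed
 show ?thesis
  by (rule exI[of _ "2 * E + 1 / (4 * E)"], rule exI[of _ "1 / (4 * E)"], rule exI[of _ "min d1 d2"])
   (use main E d1(1) d2(1) in \<open>auto simp: w_def intro: add_pos_pos\<close>)
qed

theorem theoremC:
  fixes f :: "real \<Rightarrow> real" and c :: real and l v :: "real \<Rightarrow> real" and \<mu> :: "real measure"
  assumes "top_transitive f"
    and "S_unimodal f c"
    and "flat_critical f c l"
    and "misiurewicz f c"
    and "C3_on {0..1} v" and "\<forall>x\<in>{0..1}. v x > 0" and "v c \<in> {0<..<1}"
    and "\<forall>\<^sub>F x in at c within {0..1}. l x = \<bar>x - c\<bar> powr (- v x)"
    and "is_acip f \<mu>"
  shows "\<exists>\<phi> \<psi> C. Linfty_01 \<phi> \<and> holder_on {0..1} \<psi> \<and> C > 0 \<and>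
           (\<forall>n\<ge>1. Cor \<mu> f \<phi> \<psi> n \<ge> C * real n powr (1 - 1 / v c))"
proof -
  have uni: "unimodal f c" using assms(2) by (simp add: S_unimodal_def)
  hence c01: "0 < c" "c < 1" and im: "f ` {0..1} \<subseteq> {0..1}" by (auto simp: unimodal_def)
  obtain g1 where g1: "has_deriv_on f g1 {0..1}" "continuous_on {0..1} g1" "{x \<in> {0..1}. g1 x = 0} = {c}"
    using uni by (auto simp: unimodal_def)
  obtain e where e: "e > 0" "(\<forall>x\<in>{0..1}. \<bar>x - c\<bar> < e --> f x <= f c) \<or> (\<forall>x\<in>{0..1}. \<bar>x - c\<bar> < e --> f x >= f c)"
    using uni by (auto simp: unimodal_def)
  obtain h1 h2 h3 where h: "has_deriv_on f h1 ({0..1} - {c})" "has_deriv_on h1 h2 ({0..1} - {c})" "has_deriv_on h2 h3 ({0..1} - {c})"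
    "\<And>x. x \<in> {0..1} - {c} ==> h3 x / h1 x - 3 / 2 * (h2 x / h1 x)\<^sup>2 < 0" using assms(2) by (auto simp: S_unimodal_def)
  have gz: "g1 x = 0 \<longleftrightarrow> x = c" if "x \<in> {0..1}" for x using g1(3) that by auto
  have der: "(f has_real_derivative g1 x) (at x within {0..1})" if "x \<in> {0..1}" for x using g1(1) that by (simp add: has_deriv_on_def)
  have fc: "continuous_on {0..1} f" using der by (rule DERIV_continuous_on)
  \<comment> \<open>The derivative witnessing smoothness on the whole interval and the one
    witnessing the Schwarzian condition off \<open>c\<close> come from separate existential
    statements and have to be identified.\<close>
  have gh: "g1 x = h1 x" if x: "x \<in> {0..1} - {c}" for x
  proof (rule has_field_derivative_unique)
    show "(f has_real_derivative g1 x) (at x within {0..1} - {c})" using der[of x] x by (auto intro: DERIV_subset)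
    show "(f has_real_derivative h1 x) (at x within {0..1} - {c})" using h(1) x by (simp add: has_deriv_on_def)
    show "at x within {0..1} - {c} ~= bot" using islimpt_01 x by blast
  qed
  \<comment> \<open>Clamping the argument gives a continuous map of the whole line with the same
    iterates, derivatives and correlations on the unit interval.\<close>
  define F where "F x = f (max 0 (min 1 x))" for x
  have FI: "F x = f x" if "x \<in> {0..1}" for x using that by (simp add: F_def)
  have F01: "F x \<in> {0..1}" for x unfolding F_def by (rule subsetD[OF im imageI]) auto
  have fn01: "(f ^^ n) x \<in> {0..1}" if "x \<in> {0..1}" for x n by (rule iterate_in_01[OF im that])
  have Fn: "(F ^^ n) x = (f ^^ n) x" if x: "x \<in> {0..1}" for x n
    by (induct n) (use FI fn01[OF x] in auto)
  have Fder: "(F has_real_derivative g1 x) (at x within {0..1})" if "x \<in> {0..1}" for x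
    by (rule has_field_derivative_transform_within[OF der[OF that] zero_less_one that]) (simp add: FI)
  have ne: "f x ~= f c" if x: "x \<in> {0..1}" "x ~= c" for x
  proof
    assume eq: "f x = f c"
    define p q where "p = min x c" and "q = max x c"
    have pq: "p < q" "0 <= p" "q <= 1" using x c01 by (auto simp: p_def q_def)
    have fpq: "f p = f q" using eq by (auto simp: p_def q_def min_def max_def)
    have "\<exists>z. p < z \<and> z < q \<and> (f has_real_derivative 0) (at z)"
    proof (rule Rolle[OF pq(1) fpq])
      show "continuous_on {p..q} f" using continuous_on_subset[OF fc] pq by auto
      show "f differentiable (at z)" if "p < z" "z < q" for z
      proof -
        have "(f has_real_derivative g1 z) (at z)" using der[of z] at_within_Icc_at[of 0 z 1] that pq by auto
        thus ?thesis using real_differentiable_def by blast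
      qed
    qed
    then obtain z where z: "p < z" "z < q" "(f has_real_derivative 0) (at z)" by blast
    have "(f has_real_derivative g1 z) (at z)" using der[of z] at_within_Icc_at[of 0 z 1] z pq by auto
    hence "g1 z = 0" using z(3) DERIV_unique by blast
    hence "z = c" using gz[of z] z pq by auto
    thus False using z by (auto simp: p_def q_def)
  qed
  have same: "f x < f c \<longleftrightarrow> f y < f c" if xy: "x \<in> {0..1}" "y \<in> {0..1}" "x < c \<and> y < c \<or> c < x \<and> c < y" for x y
  proof (rule ccontr)
    assume n: "\<not> ?thesis"
    define p q where "p = min x y" and "q = max x y"
    have "\<exists>z\<in>{p..q}. f z = f c"
    proof -
      have "connected (f ` {p..q})" using continuous_on_subset[OF fc] xy by (intro connected_continuous_image) (auto simp: p_def q_def)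
      moreover have "f x \<in> f ` {p..q}" "f y \<in> f ` {p..q}" by (auto simp: p_def q_def)
      ultimately have "f c \<in> f ` {p..q}" using n unfolding is_interval_connected_1[symmetric] is_interval_1 by (meson linorder_not_less less_imp_le)
      thus ?thesis by force
    qed
    then obtain z where z: "z \<in> {p..q}" "f z = f c" by blast
    moreover have "z \<in> {0..1}" "z ~= c" using z xy by (auto simp: p_def q_def)
    ultimately show False using ne by blast
  qed
  \<comment> \<open>The local extremum is global: \<open>f\<close> takes the value
    \<open>f c\<close> only at \<open>c\<close>, so by connectedness it stays on one side of
    \<open>f c\<close> on each side of \<open>c\<close>, and nearby points \<open>y1\<close> and
    \<open>y2\<close> decide which.\<close>
  have ext: "(\<forall>x\<in>{0..1}. f x <= f c) \<or> (\<forall>x\<in>{0..1}. f c <= f x)"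
  proof -
    define y1 y2 where "y1 = c - min e c / 2" and "y2 = c + min e (1 - c) / 2"
    have y: "y1 \<in> {0..1}" "y1 < c" "\<bar>y1 - c\<bar> < e" "y2 \<in> {0..1}" "c < y2" "\<bar>y2 - c\<bar> < e"
      using e(1) c01 by (auto simp: y1_def y2_def min_def field_simps)
    have sgn: "f x < f c \<longleftrightarrow> f (if x < c then y1 else y2) < f c" if "x \<in> {0..1}" "x ~= c" for x
      using same[of x y1] same[of x y2] that y by auto
    from e(2) show ?thesis
    proof
      assume "\<forall>x\<in>{0..1}. \<bar>x - c\<bar> < e --> f x <= f c"
      hence "f y1 < f c" "f y2 < f c" using y ne[of y1] ne[of y2] by (auto simp: less_le)
      hence "f x <= f c" if "x \<in> {0..1}" for x using sgn[OF that] by (cases "x = c") (auto split: if_splits)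
      thus ?thesis by blast
    next
      assume "\<forall>x\<in>{0..1}. \<bar>x - c\<bar> < e --> f x >= f c"
      hence "\<not> f y1 < f c" "\<not> f y2 < f c" using y by (auto simp: not_less)
      hence "f c <= f x" if "x \<in> {0..1}" for x using sgn[OF that] by (cases "x = c") (auto split: if_splits)
      thus ?thesis by blast
    qed
  qed
  have D01: "D01 (f ^^ n) x = (\<Prod>j<n. g1 ((f ^^ j) x))" if x: "x \<in> {0..1}" for n x
  proof -
    have "((f ^^ n) has_real_derivative (\<Prod>j<n. g1 ((f ^^ j) x))) (at x within {0..1})" by (rule iterate_has_derivative[OF der im x])
    thus ?thesis unfolding D01_def using has_field_derivative_unique[OF _ _ at_01[OF x]] by (intro the_equality) blast+
  qed
  have rep: "\<bar>\<Prod>j<n. g1 ((f ^^ j) x)\<bar> > 1" if "x \<in> {0..1}" "1 <= n" "(f ^^ n) x = x" for x n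
  proof -
    have "\<bar>D01 (f ^^ n) x\<bar> > 1" using assms(4) that unfolding misiurewicz_def by blast
    thus ?thesis using D01[OF that(1), of n] by simp
  qed
  have cc: "c \<in> {0..1}" using c01 by auto
  \<comment> \<open>A periodic \<open>c\<close> would have multiplier 0, against expansion at
    periodic points. This handles the finitely many times about which the limit set says
    nothing.\<close>
  have nonper: "(f ^^ k) c ~= c" if k: "k >= 1" for k
  proof
    assume "(f ^^ k) c = c"
    hence "\<bar>\<Prod>j<k. g1 ((f ^^ j) c)\<bar> > 1" using rep[OF cc k] by simp
    moreover have "(\<Prod>j<k. g1 ((f ^^ j) c)) = 0" using k gz[OF cc] by (auto intro!: bexI[of _ 0])
    ultimately show False by simp
  qed
  have nonrec: "\<exists>d>0. \<forall>k\<ge>1. d <= \<bar>(f ^^ k) c - c\<bar>"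
  proof -
    have "c \<notin> omega_limit f c" using assms(4) by (simp add: misiurewicz_def)
    then obtain e N where e: "e > 0" "\<And>n. n >= N ==> e <= \<bar>(f ^^ n) c - c\<bar>" unfolding omega_limit_def dist_real_def by (auto simp: not_less)
    define d where "d = Min (insert e ((\<lambda>k. \<bar>(f ^^ k) c - c\<bar>) ` {1..N}))"
    have "d > 0" unfolding d_def using e(1) nonper by auto
    moreover have "d <= \<bar>(f ^^ k) c - c\<bar>" if k: "k >= 1" for k
    proof (cases "k <= N")
      case True thus ?thesis unfolding d_def using k by (intro Min_le) auto
    next
      case False
      have "d <= e" unfolding d_def by (intro Min_le) auto
      thus ?thesis using e(2)[of k] False by simp
    qed
    ultimately show ?thesis by blast
  qed
  interpret T: transitive_unimodal F g1 c
  proof unfold_locales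
    show "continuous_on UNIV F" unfolding F_def
      by (rule continuous_on_compose2[OF fc]) (auto intro!: continuous_intros)
    show "0 <= F x" "F x <= 1" for x using F01[of x] by auto
    show "(\<forall>x\<in>{0..1}. F x <= F c) \<or> (\<forall>x\<in>{0..1}. F c <= F x)" using ext FI cc by auto
    show "\<bar>\<Prod>j<n. g1 ((F ^^ j) x)\<bar> > 1" if "x \<in> {0..1}" "1 <= n" "(F ^^ n) x = x" for x n
      using rep[of x n] that Fn[OF that(1)] by simp
    show "\<exists>d>0. \<forall>k\<ge>1. d <= \<bar>(F ^^ k) c - c\<bar>" using nonrec Fn[OF cc] by simp
    show "\<exists>n\<ge>1. \<exists>x\<in>{a<..<b}. (F ^^ n) x \<in> {a'<..<b'}" if ab: "0 <= a" "a < b" "b <= 1" "0 <= a'" "a' < b'" "b' <= 1" for a b a' b' :: real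
    proof -
      have o: "openin (top_of_set {0..1}) {p<..<q}" if "0 <= p" "q <= 1" for p q :: real
        using that by (intro open_subset) auto
      have "{a<..<b} ~= {}" "{a'<..<b'} ~= {}" using ab by auto
      then obtain n where n: "n >= 1" "(f ^^ n) ` {a<..<b} \<inter> {a'<..<b'} ~= {}"
        using assms(1) o[of a b] o[of a' b'] ab unfolding top_transitive_def by metis
      then obtain x where x: "x \<in> {a<..<b}" "(f ^^ n) x \<in> {a'<..<b'}" by blast
      hence "x \<in> {0..1}" using ab by auto
      hence "(F ^^ n) x \<in> {a'<..<b'}" using Fn[of x n] x(2) by simp
      thus ?thesis using n(1) x(1) by blast
    qed
  qed (use c01 Fder g1(2) gz in auto)
  obtain a' a b b' where ab: "0 < a' \<and> a' < a \<and> a < c \<and> c < b \<and> b < b' \<and> b' < 1" "\<forall>k\<ge>1. (F ^^ k) c \<notin> {a'..b'}"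
    "\<forall>k\<ge>1. (F ^^ k) a \<notin> {a'<..<b'} \<and> (F ^^ k) b \<notin> {a'<..<b'}" using T.nice_pair by blast
  interpret N: nice_unimodal F g1 c h2 h3 a' a b b'
  proof unfold_locales
    show "(g1 has_real_derivative h2 x) (at x within {0..1} - {c})" if x: "x \<in> {0..1} - {c}" for x
    proof (rule has_field_derivative_transform_within[OF _ zero_less_one x])
      show "(h1 has_real_derivative h2 x) (at x within {0..1} - {c})" using h(2) x by (simp add: has_deriv_on_def)
    qed (simp add: gh)
    show "(h2 has_real_derivative h3 x) (at x within {0..1} - {c})" if x: "x \<in> {0..1} - {c}" for x using h(3) x by (simp add: has_deriv_on_def)
    show "h3 x / g1 x - 3 / 2 * (h2 x / g1 x)\<^sup>2 < 0" if x: "x \<in> {0..1} - {c}" for x using h(4)[OF x] gh[OF x] by simp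
  qed (use ab in auto)
  obtain C1 C2 e0 where C: "C1 > 0" "C2 > 0" "e0 > 0" and fl: "\<And>x. x \<in> {0..1} ==> 0 < \<bar>x - c\<bar> ==> \<bar>x - c\<bar> < e0 ==>
     exp (- C1 * Phi (v c) \<bar>x - c\<bar>) <= \<bar>f x - f c\<bar> \<and> \<bar>f x - f c\<bar> <= exp (- C2 * Phi (v c) \<bar>x - c\<bar>)"
    using flat_bounds[OF assms(3) im _ assms(5,7,8)] c01 by auto
  have kap: "T.kap x = \<bar>f x - f c\<bar>" if "x \<in> {0..1}" for x using FI[OF that] FI[OF cc] by (simp add: T.kap_def)
  interpret P: flat_unimodal F g1 c h2 h3 a' a b b' "v c" C1 C2 e0
    by unfold_locales (use assms(7) C fl kap in auto)
  have acF: "is_acip F \<mu>"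
  proof -
    have ac: "space \<mu> = {0..1}" "f \<in> measurable \<mu> \<mu>" "distr \<mu> \<mu> f = \<mu>" using assms(9) by (auto simp: is_acip_def)
    have eq: "\<And>x. x \<in> space \<mu> ==> F x = f x" using FI ac(1) by auto
    have "F \<in> measurable \<mu> \<mu>" using ac(2) measurable_cong[of \<mu> F f \<mu>] eq by blast
    moreover have "distr \<mu> \<mu> F = \<mu>" using distr_cong[of \<mu> \<mu> \<mu> \<mu> F f] eq ac(3) by simp
    ultimately show ?thesis using assms(9) by (simp add: is_acip_def)
  qed
  interpret A: acip_unimodal F g1 c h2 h3 a' a b b' "v c" C1 C2 e0 \<mu> by unfold_locales (rule acF)
  have "Cor \<mu> F \<phi> \<psi> n = Cor \<mu> f \<phi> \<psi> n" for \<phi> \<psi> n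
  by (smt (verit) Bochner_Integration.integral_cong Fn A.mu_space Cor_def)
  thus ?thesis using A.slow_correlations by simp
qed

end
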